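(* Let $\mu$ be a weight function for which there is $C_1>0$ such that for a.e. $y\in(0,1)$ and all $0<\tau<y/2$ the quantities $\inf_{s\in(y-3\tau/2,\,y+3\tau/2)}\mu(s)$ and $\sup_{s\in(y-3\tau/2,\,y+3\tau/2)}\mu(s)$ both exist (are finite), $\inf_{s\in(y-3\tau/2,\,y+3\tau/2)}\mu(s)>0$, and $$\sup_{y\in(0,1),\ \tau<y/2}\ \frac{\sup_{s\in(y-3\tau/2,\,y+3\tau/2)}\mu(s)}{\inf_{s\in(y-3\tau/2,\,y+3\tau/2)}\mu(s)}\le C_1 .$$ Let $\tilde{\mathbb{A}}_0:(0,2)\to\mathbb{R}^{(n+1)\times(n+1)}$ be a symmetric measurable matrix of the form $$\tilde{\mathbb{A}}_0(y)=\mu(y)\begin{bmatrix}\tilde{\mathbb{B}}_0&0\\0&1\end{bmatrix},$$ where $\begin{bmatrix}\tilde{\mathbb{B}}_0&0\\0&1\end{bmatrix}$ is an elliptic constant $(n+1)\times(n+1)$ matrix. Assume also that there exists $\Lambda>0$ such that $$\Lambda^{-1}\mu(y)|\xi|^2\le\langle\tilde{\mathbb{A}}_0(y)\xi,\xi\rangle\le\Lambda\mu(y)|\xi|^2,\quad\forall\,\xi\in\mathbb{R}^{n+1},\ \text{for a.e. }y\in(0,2).$$ Then for every $\theta\in(0,1)$ there is $C=C(\Lambda,\theta,C_1,n)$ such that the following holds: for every $x_0=(x_0',0)\in\overline{T}_1$, $X_0=(x_0,y_0)\in\overline{T}_1\times(0,1)$ and $\tau\in(0,1)$ with $y_0-2\tau>0$,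 if $v\in W^{1,2}(D^+_{3\tau/2}(X_0),\mu)$ is a weak solution of $$\begin{cases}\operatorname{div}[\tilde{\mathbb{A}}_0(y)\nabla v]=0, & \text{in }D^+_{3\tau/2}(X_0),\\ v=0, & \text{on }T_{3\tau/2}(x_0)\times(y_0-3\tau/2,\,y_0+3\tau/2),\end{cases}$$ then $$\|\nabla v\|_{L^\infty(D^+_{3\theta\tau/2}(X_0))}\le C\left[\frac1{\hat\mu(D_{3\tau/2}(X_0))}\int_{D^+_{3\tau/2}(X_0)}|\nabla v(x,y)|^2\mu(y)\,dx\,dy\right]^{1/2}.$$
   Context: $X=(x,y)\in\mathbb{R}^n\times\mathbb{R}$, $x=(x',x_n)$, $\nabla=(\nabla_x,\partial_y)$. $B_r(x_0)\subset\mathbb{R}^n$ is the ball; for $x_0=(x_0',x_n^0)$, $B_r^+(x_0)=\{x\in B_r(x_0):x_n>x_n^0\}$, $T_r(x_0)=\{x\in B_r(x_0):x_n=x_n^0\}$, $T_r=T_r(0)$; $D_r(x_0,y_0)=B_r(x_0)\times(y_0-r,y_0+r)$, $D_r^+(x_0,y_0)=B_r^+(x_0)\times(y_0-r,y_0+r)$. A weight function is a non-negative function $\mu:\mathbb{R}\to[0,\infty)$ (not assumed to be in $A_2$; it may be degenerate or singular at $y=0$); $\hat\mu(E)=\int_E\mu(y)\,dX$. $W^{1,2}(E,\mu)$: functions which together with their weak gradients are square integrable on $E$ with respect to $\mu(y)\,dx\,dy$. Weak solution on $D_R^+(X_0)$ with zero data on $T_R(x_0)\times(y_0-R,y_0+R)$: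 $v$ lies in the closure in $W^{1,2}(D_R^+(X_0),\mu)$ of smooth functions on the closed cylinder vanishing on $T_R(x_0)\times(y_0-R,y_0+R)$, and $\int_{D_R^+(X_0)}\langle\tilde{\mathbb{A}}_0(y)\nabla v,\nabla\phi\rangle dX=0$ for all $\phi\in C_0^\infty(D_R^+(X_0))$. *)

theory Defs
  imports "HOL-Analysis.Analysis" "HOL-Probability.Essential_Supremum"
begin

text \<open>
  \<open>\<real>\<^sup>n\<close> is \<open>real ^ 'n\<close>, and the coordinate called \<open>x\<^sub>n\<close> is \<open>x $ k\<close> for a distinguished
  index \<open>k\<close>, so that \<open>n = 1\<close> is included. A point \<open>X = (x, y)\<close> has type \<open>(real ^ 'n) \<times> real\<close>,
  which carries the Euclidean structure of \<open>\<real>\<^sup>n\<^sup>+\<^sup>1\<close>.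
\<close>

definition half_ball :: "'n::finite \<Rightarrow> real ^ 'n \<Rightarrow> real \<Rightarrow> (real ^ 'n) set"
  where "half_ball k x0 r = {x \<in> ball x0 r. x $ k > x0 $ k}"

definition flat_ball :: "'n::finite \<Rightarrow> real ^ 'n \<Rightarrow> real \<Rightarrow> (real ^ 'n) set"
  where "flat_ball k x0 r = {x \<in> ball x0 r. x $ k = x0 $ k}"

definition cyl :: "(real ^ 'n::finite) \<times> real \<Rightarrow> real \<Rightarrow> ((real ^ 'n) \<times> real) set"
  where "cyl X0 r = ball (fst X0) r \<times> {snd X0 - r <..< snd X0 + r}"

definition half_cyl :: "'n::finite \<Rightarrow> (real ^ 'n) \<times> real \<Rightarrow> real \<Rightarrow> ((real ^ 'n) \<times> real) set"
  where "half_cyl k X0 r = half_ball k (fst X0) r \<times> {snd X0 - r <..< snd X0 + r}"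

definition flat_cyl :: "'n::finite \<Rightarrow> (real ^ 'n) \<times> real \<Rightarrow> real \<Rightarrow> ((real ^ 'n) \<times> real) set"
  where "flat_cyl k X0 r = flat_ball k (fst X0) r \<times> {snd X0 - r <..< snd X0 + r}"


section \<open>Matrices of size \<open>n + 1\<close>\<close>

text \<open>Rows and columns are indexed by \<open>'n option\<close>, with \<open>None\<close> standing for the index of \<open>y\<close>.\<close>

definition join :: "(real ^ 'n) \<times> real \<Rightarrow> real ^ 'n::finite option"
  where "join X = (\<chi> i. case i of Some j \<Rightarrow> fst X $ j | None \<Rightarrow> snd X)"

definition block_matrix :: "real ^ 'n ^ 'n \<Rightarrow> real ^ 'n::finite option ^ 'n option"
  where "block_matrix B =
    (\<chi> i j. case i of
        Some i' \<Rightarrow> (case j of Some j' \<Rightarrow> B $ i' $ j' | None \<Rightarrow> 0)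
      | None \<Rightarrow> (case j of Some _ \<Rightarrow> 0 | None \<Rightarrow> 1))"

definition elliptic_matrix :: "real ^ 'm ^ 'm::finite \<Rightarrow> bool"
  where "elliptic_matrix M \<longleftrightarrow>
    (\<exists>\<kappa>>0. \<forall>\<xi>. \<kappa> * (norm \<xi>)\<^sup>2 \<le> (M *v \<xi>) \<bullet> \<xi> \<and> (M *v \<xi>) \<bullet> \<xi> \<le> inverse \<kappa> * (norm \<xi>)\<^sup>2)"


section \<open>Smooth functions\<close>

primrec C_diff :: "nat \<Rightarrow> ('a::euclidean_space \<Rightarrow> real) \<Rightarrow> bool"
  where
    "C_diff 0 f \<longleftrightarrow> continuous_on UNIV f"
  | "C_diff (Suc m) f \<longleftrightarrow>
      (\<forall>x. f differentiable (at x)) \<and>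
      (\<forall>b\<in>Basis. C_diff m (\<lambda>x. frechet_derivative f (at x) b))"

definition smooth :: "('a::euclidean_space \<Rightarrow> real) \<Rightarrow> bool"
  where "smooth f \<longleftrightarrow> (\<forall>m. C_diff m f)"

definition test_function :: "'a::euclidean_space set \<Rightarrow> ('a \<Rightarrow> real) \<Rightarrow> bool"
  where "test_function E \<phi> \<longleftrightarrow>
    smooth \<phi> \<and> compact (closure {X. \<phi> X \<noteq> 0}) \<and> closure {X. \<phi> X \<noteq> 0} \<subseteq> E"

definition grad :: "('a::euclidean_space \<Rightarrow> real) \<Rightarrow> 'a \<Rightarrow> 'a"
  where "grad f X = (\<Sum>b\<in>Basis. frechet_derivative f (at X) b *\<^sub>R b)"


section \<open>Weighted Sobolev spaces\<close>

definition weak_gradient ::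
    "'a::euclidean_space set \<Rightarrow> ('a \<Rightarrow> real) \<Rightarrow> ('a \<Rightarrow> 'a) \<Rightarrow> bool"
  where "weak_gradient E v G \<longleftrightarrow>
    (\<forall>K. compact K \<and> K \<subseteq> E \<longrightarrow> set_integrable lebesgue K v \<and> set_integrable lebesgue K G) \<and>
    (\<forall>\<phi>. test_function E \<phi> \<longrightarrow>
      (\<forall>b\<in>Basis. (LINT X:E|lebesgue. v X * (grad \<phi> X \<bullet> b)) =
                 - (LINT X:E|lebesgue. (G X \<bullet> b) * \<phi> X)))"

text \<open>
  A weight is merely non-negative here. Wherever it is integrated below its measurability
  follows from that of the coefficient matrix, one of whose entries is the weight itself.
\<close>

definition weight_function :: "(real \<Rightarrow> real) \<Rightarrow> bool"
  where "weight_function \<mu> \<longleftrightarrow> (\<forall>y. 0 \<le> \<mu> y)"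

definition weighted_measure :: "(real \<Rightarrow> real) \<Rightarrow> ((real ^ 'n::finite) \<times> real) set \<Rightarrow> real"
  where "weighted_measure \<mu> E = (LINT X:E|lebesgue. \<mu> (snd X))"

text \<open>
  \<open>W12 \<mu> E v G\<close>: the function \<open>v\<close> belongs to \<open>W\<^sup>1\<^sup>,\<^sup>2(E, \<mu>)\<close> and \<open>G\<close> is (a representative of) its
  weak gradient. Only the values on \<open>E\<close> matter.
\<close>

definition W12 ::
    "(real \<Rightarrow> real) \<Rightarrow> ((real ^ 'n::finite) \<times> real) set \<Rightarrow>
     ((real ^ 'n) \<times> real \<Rightarrow> real) \<Rightarrow> ((real ^ 'n) \<times> real \<Rightarrow> (real ^ 'n) \<times> real) \<Rightarrow> bool"
  where "W12 \<mu> E v G \<longleftrightarrow>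
    weak_gradient E v G \<and>
    set_integrable lebesgue E (\<lambda>X. (v X)\<^sup>2 * \<mu> (snd X)) \<and>
    set_integrable lebesgue E (\<lambda>X. (norm (G X))\<^sup>2 * \<mu> (snd X))"

text \<open>
  The closure, in the norm of \<open>W\<^sup>1\<^sup>,\<^sup>2(D\<^sub>R\<^sup>+(X\<^sub>0), \<mu>)\<close>, of the smooth functions on the closed cylinder
  that vanish on the flat part of its boundary. Smooth functions on the closed cylinder are
  understood as restrictions of smooth functions on the whole space.
\<close>

definition W12_zero_flat ::
    "'n::finite \<Rightarrow> (real \<Rightarrow> real) \<Rightarrow> (real ^ 'n) \<times> real \<Rightarrow> real \<Rightarrow>
     ((real ^ 'n) \<times> real \<Rightarrow> real) \<Rightarrow> ((real ^ 'n) \<times> real \<Rightarrow> (real ^ 'n) \<times> real) \<Rightarrow> bool"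
  where "W12_zero_flat k \<mu> X0 R v G \<longleftrightarrow>
    W12 \<mu> (half_cyl k X0 R) v G \<and>
    (\<forall>\<epsilon>>0. \<exists>f. smooth f \<and> (\<forall>X\<in>flat_cyl k X0 R. f X = 0) \<and>
       W12 \<mu> (half_cyl k X0 R) f (grad f) \<and>
       sqrt (LINT X:half_cyl k X0 R|lebesgue.
         ((v X - f X)\<^sup>2 + (norm (G X - grad f X))\<^sup>2) * \<mu> (snd X)) < \<epsilon>)"

text \<open>
  \<open>v\<close>, with weak gradient \<open>G\<close>, is a weak solution of \<open>div (A(y) \<nabla>v) = 0\<close> in \<open>D\<^sub>R\<^sup>+(X\<^sub>0)\<close> with zero
  data on the flat part of the boundary.
\<close>

definition weak_solution ::
    "'n::finite \<Rightarrow> (real \<Rightarrow> real) \<Rightarrow> (real \<Rightarrow> real ^ 'n option ^ 'n option) \<Rightarrow>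
     (real ^ 'n) \<times> real \<Rightarrow> real \<Rightarrow>
     ((real ^ 'n) \<times> real \<Rightarrow> real) \<Rightarrow> ((real ^ 'n) \<times> real \<Rightarrow> (real ^ 'n) \<times> real) \<Rightarrow> bool"
  where "weak_solution k \<mu> A X0 R v G \<longleftrightarrow>
    W12_zero_flat k \<mu> X0 R v G \<and>
    (\<forall>\<phi>. test_function (half_cyl k X0 R) \<phi> \<longrightarrow>
      (LINT X:half_cyl k X0 R|lebesgue.
         (A (snd X) *v join (G X)) \<bullet> join (grad \<phi> X)) = 0)"

definition Linfty_norm ::
    "'a::euclidean_space set \<Rightarrow> ('a \<Rightarrow> 'b::real_normed_vector) \<Rightarrow> ereal"
  where "Linfty_norm E F = esssup (lebesgue_on E) (\<lambda>X. ereal (norm (F X)))"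


section \<open>Hypotheses on the weight and on the coefficients\<close>

definition osc_interval :: "real \<Rightarrow> real \<Rightarrow> real set"
  where "osc_interval y \<tau> = {y - 3 * \<tau> / 2 <..< y + 3 * \<tau> / 2}"

text \<open>
  The bound on the supremum of the ratios is spelled out for every \<open>y\<close> and \<open>\<tau>\<close>, since \<open>Sup\<close> of a
  set of reals is meaningless when the set is unbounded.
\<close>

definition weight_osc_bound :: "(real \<Rightarrow> real) \<Rightarrow> real \<Rightarrow> bool"
  where "weight_osc_bound \<mu> C1 \<longleftrightarrow>
    (AE y in lebesgue. y \<in> {0<..<1} \<longrightarrow>
      (\<forall>\<tau>. 0 < \<tau> \<and> \<tau> < y / 2 \<longrightarrow>
        bdd_below (\<mu> ` osc_interval y \<tau>) \<and> bdd_above (\<mu> ` osc_interval y \<tau>) \<and>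
        Inf (\<mu> ` osc_interval y \<tau>) > 0)) \<and>
    (\<forall>y\<in>{0<..<1}. \<forall>\<tau>. 0 < \<tau> \<and> \<tau> < y / 2 \<longrightarrow>
      Sup (\<mu> ` osc_interval y \<tau>) / Inf (\<mu> ` osc_interval y \<tau>) \<le> C1)"

text \<open>
  The coefficient matrix is a function on \<open>(0, 2)\<close>; its values elsewhere are irrelevant.
\<close>

definition admissible_matrix ::
    "(real \<Rightarrow> real) \<Rightarrow> real \<Rightarrow> (real \<Rightarrow> real ^ 'n::finite option ^ 'n option) \<Rightarrow> bool"
  where "admissible_matrix \<mu> \<Lambda> A \<longleftrightarrow>
    A \<in> borel_measurable (lebesgue_on {0<..<2}) \<and>
    (\<forall>y\<in>{0<..<2}. transpose (A y) = A y) \<and>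
    (\<exists>B :: real ^ 'n ^ 'n. elliptic_matrix (block_matrix B) \<and>
       (\<forall>y\<in>{0<..<2}. A y = \<mu> y *\<^sub>R block_matrix B)) \<and>
    (AE y in lebesgue. y \<in> {0<..<2} \<longrightarrow>
      (\<forall>\<xi>. inverse \<Lambda> * \<mu> y * (norm \<xi>)\<^sup>2 \<le> (A y *v \<xi>) \<bullet> \<xi> \<and>
           (A y *v \<xi>) \<bullet> \<xi> \<le> \<Lambda> * \<mu> y * (norm \<xi>)\<^sup>2))"

end

theory Submission
  imports Defs
begin

text \<open>
  Dividing the weight by a positive lower bound \<open>m\<close> does not change the equation,
  and the oscillation condition provides an \<open>m\<close> that makes the quotient a function
  of \<open>y\<close> with values in \<open>[1, c]\<close>. The problem thus becomes a uniformly
  elliptic equation \<open>div (\<mu>(y) (B \<nabla>\<^sub>x v, \<partial>\<^sub>y v)) =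
  0\<close> whose only rough coefficient depends on the single variable \<open>y\<close>; no
  regularity in \<open>y\<close> is available, and none is needed because the coefficients are
  constant in \<open>x\<close>.

  In the interior the argument has three steps. First, convolution in \<open>x\<close> alone
  commutes with the equation, so every horizontal derivative of a solution is a solution, and
  the Caccioppoli inequality can be iterated: all horizontal derivatives of the gradient are
  bounded in \<open>L\<^sup>2\<close> by the gradient itself
  (\<open>iterated_caccioppoli\<close>). Second, a Sobolev inequality in \<open>x\<close>, for
  functions with values in \<open>L\<^sup>1(dy)\<close>, bounds the integral of the gradient and
  of its first horizontal derivatives over every vertical segment, uniformly in \<open>x\<close>
  (\<open>slice_norm_bound\<close>). Third, the segments are used to integrate in
  \<open>y\<close>. For a horizontal component, \<open>\<partial>\<^sub>y \<partial>\<^sub>b v =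
  \<partial>\<^sub>b \<partial>\<^sub>y v\<close> is integrable over segments because the field
  is a gradient (\<open>curl_free\<close>); for the vertical component the equation itself says
  that \<open>\<partial>\<^sub>y (\<mu> \<partial>\<^sub>y v) = - div\<^sub>x (\<mu> B
  \<nabla>\<^sub>x v)\<close> is integrable over segments, so it is the flux \<open>\<mu>
  \<partial>\<^sub>y v\<close>, and not \<open>\<partial>\<^sub>y v\<close>, that is absolutely
  continuous in \<open>y\<close>. One-dimensional integration bounds both, and \<open>\<mu>
  \<ge> 1\<close> gives back \<open>\<partial>\<^sub>y v\<close>
  (\<open>unit_gradient_bound\<close>).

  At the flat boundary the solution is extended oddly by the conormal reflection, the linear map
  that fixes the hyperplane \<open>x\<^sub>n = 0\<close>, reverses the conormal \<open>B
  e\<^sub>n\<close> and leaves \<open>B\<close> invariant. The extended field solves the same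
  equation in a full cylinder (\<open>solution_on_odd_reflection\<close>), where the interior
  bound applies. Translations and dilations, which preserve the class of equations, and a
  countable cover of the smaller half cylinder give the estimate on half cylinders of arbitrary
  position and size (\<open>half_cylinder_gradient_bound\<close>).

  Throughout, a solution is represented by its gradient field \<open>G\<close> alone: the
  predicate \<open>solution_on\<close> asks that \<open>G\<close> be a limit in
  \<open>L\<^sup>2\<close> of gradients of \<open>C\<^sup>1\<close> functions vanishing on the
  flat part and that \<open>G\<close> satisfy the weak equation. Fields in the weighted space
  are brought to this form in \<open>weak_solution_imp_solution_on\<close>, where smooth test
  functions are replaced by \<open>C\<^sup>1\<close> ones.
\<close>

section \<open>Continuously differentiable functions and their gradients\<close>

text \<open>
  The gradient is kept as an explicit function, so that it can be evaluated, integrated and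
  transformed without choosing derivatives.
\<close>

definition C1 :: "('a::euclidean_space \<Rightarrow> real) \<Rightarrow> ('a \<Rightarrow> 'a) \<Rightarrow> bool"
  where "C1 f g \<longleftrightarrow> (\<forall>X. (f has_derivative (\<lambda>v. g X \<bullet> v)) (at X)) \<and> continuous_on UNIV g"

lemma C1_D: "C1 f g \<Longrightarrow> (f has_derivative (\<lambda>v. g X \<bullet> v)) (at X within S)"
  unfolding C1_def using has_derivative_at_withinI by blast

lemma C1_continuous_gradient: "C1 f g \<Longrightarrow> continuous_on S g"
  unfolding C1_def using continuous_on_subset by blast

lemma C1_continuous: "C1 f g \<Longrightarrow> continuous_on S f"
  using C1_D[of f g] has_derivative_continuous[of f]
  unfolding continuous_on_eq_continuous_within by metis

lemma C1_measurable:
  assumes "C1 f g"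
  shows "f \<in> borel_measurable borel" "g \<in> borel_measurable borel"
  using C1_continuous[OF assms] C1_continuous_gradient[OF assms]
  by (auto intro: borel_measurable_continuous_onI)

lemma C1_const: "C1 (\<lambda>X. c) (\<lambda>X. 0)"
  unfolding C1_def by (auto intro!: has_derivative_eq_rhs[OF has_derivative_const])

lemma C1_mult:
  assumes "C1 f g" "C1 f' g'"
  shows "C1 (\<lambda>X. f X * f' X) (\<lambda>X. f X *\<^sub>R g' X + f' X *\<^sub>R g X)"
  unfolding C1_def
proof (intro conjI allI)
  fix X
  show "((\<lambda>X. f X * f' X) has_derivative (\<lambda>v. (f X *\<^sub>R g' X + f' X *\<^sub>R g X) \<bullet> v)) (at X)"
    by (rule has_derivative_eq_rhs[OF has_derivative_mult[OF C1_D[OF assms(1)] C1_D[OF assms(2)]]])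
      (auto simp: inner_simps algebra_simps)
  show "continuous_on UNIV (\<lambda>X. f X *\<^sub>R g' X + f' X *\<^sub>R g X)"
    by (rule continuous_on_add[OF continuous_on_scaleR continuous_on_scaleR])
      (rule C1_continuous[OF assms(1)] C1_continuous[OF assms(2)]
        C1_continuous_gradient[OF assms(1)] C1_continuous_gradient[OF assms(2)])+
qed

lemma C1_diff:
  assumes "C1 f g" "C1 f' g'"
  shows "C1 (\<lambda>X. f X - f' X) (\<lambda>X. g X - g' X)"
  unfolding C1_def
proof (intro conjI allI)
  fix X
  show "((\<lambda>X. f X - f' X) has_derivative (\<lambda>v. (g X - g' X) \<bullet> v)) (at X)"
    by (rule has_derivative_eq_rhs[OF has_derivative_diff[OF C1_D[OF assms(1)] C1_D[OF assms(2)]]])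
      (auto simp: inner_simps algebra_simps)
  show "continuous_on UNIV (\<lambda>X. g X - g' X)"
    by (rule continuous_on_diff[OF C1_continuous_gradient[OF assms(1)] C1_continuous_gradient[OF assms(2)]])
qed

lemma C1_compose_real:
  assumes "C1 f g" and s: "\<And>t. (s has_field_derivative s' t) (at t)" and "continuous_on UNIV s'"
  shows "C1 (\<lambda>X. s (f X)) (\<lambda>X. s' (f X) *\<^sub>R g X)"
  unfolding C1_def
proof (intro conjI allI)
  fix X
  have "(s has_derivative (\<lambda>h. s' (f X) * h)) (at (f X))"
    using s[of "f X"] by (simp add: has_field_derivative_def)
  from has_derivative_compose[OF C1_D[OF assms(1), of X UNIV] this]
  show "((\<lambda>X. s (f X)) has_derivative (\<lambda>v. (s' (f X) *\<^sub>R g X) \<bullet> v)) (at X)"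
    by (simp add: inner_simps)
  have "continuous_on UNIV (\<lambda>X. s' (f X))"
    by (rule continuous_on_compose2[OF assms(3) C1_continuous[OF assms(1), of UNIV]]) simp
  moreover have "continuous_on UNIV g"
    by (rule C1_continuous_gradient[OF assms(1)])
  ultimately show "continuous_on UNIV (\<lambda>X. s' (f X) *\<^sub>R g X)"
    by (rule continuous_on_scaleR)
qed

lemma C1_compose_affine:
  fixes L :: "'b::euclidean_space \<Rightarrow> 'a::euclidean_space"
  assumes "C1 f g" and L: "linear L" and L': "\<And>v w. L' w \<bullet> v = w \<bullet> L v" and "linear L'"
  shows "C1 (\<lambda>X. f (c + L X)) (\<lambda>X. L' (g (c + L X)))"
  unfolding C1_def
proof (intro conjI allI)
  fix X
  have "((\<lambda>X. c + L X) has_derivative L) (at X)"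
    using L by (auto intro!: derivative_eq_intros linear_imp_has_derivative)
  from has_derivative_compose[OF this C1_D[OF assms(1)]]
  show "((\<lambda>X. f (c + L X)) has_derivative (\<lambda>v. L' (g (c + L X)) \<bullet> v)) (at X)"
    by (simp add: L')
  have "continuous_on UNIV (\<lambda>X. g (c + L X))"
    by (rule continuous_on_compose2[OF C1_continuous_gradient[OF assms(1), of UNIV]])
      (auto intro!: continuous_intros linear_continuous_on_compose[OF _ L])
  then show "continuous_on UNIV (\<lambda>X. L' (g (c + L X)))"
    by (rule linear_continuous_on_compose[OF _ \<open>linear L'\<close>])
qed

lemma C1_line:
  assumes "C1 f g"
  shows "((\<lambda>t. f (X + t *\<^sub>R b)) has_field_derivative g (X + t *\<^sub>R b) \<bullet> b) (at t)"
proof -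
  have "((\<lambda>t. X + t *\<^sub>R b) has_derivative (\<lambda>h. h *\<^sub>R b)) (at t)"
    by (auto intro!: derivative_eq_intros)
  from has_derivative_compose[OF this C1_D[OF assms, of _ UNIV]]
  show ?thesis
    by (simp add: has_field_derivative_def mult.commute[of _ "_ \<bullet> b"])
qed

lemma C1_gradient_zero:
  assumes "C1 f g" "open U" "X \<in> U" "\<And>Y. Y \<in> U \<Longrightarrow> f Y = 0"
  shows "g X = 0"
proof -
  have "((\<lambda>_. 0) has_derivative (\<lambda>v. g X \<bullet> v)) (at X)"
    by (rule has_derivative_transform_within_open[OF C1_D[OF assms(1)] assms(2,3)])
      (use assms(4) in auto)
  moreover have "((\<lambda>_. 0::real) has_derivative (\<lambda>v. 0)) (at X)" by simp
  ultimately have "(\<lambda>v. g X \<bullet> v) = (\<lambda>v. 0)"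
    by (rule has_derivative_unique)
  then have "g X \<bullet> g X = 0" by metis
  then show ?thesis by simp
qed

lemma C1_gradient_zero_outside:
  assumes "C1 f g" "closed K" "\<And>Y. Y \<notin> K \<Longrightarrow> f Y = 0" "X \<notin> K"
  shows "g X = 0"
  using C1_gradient_zero[OF assms(1), of "-K" X] assms by auto

lemma continuous_cpt_bounded:
  fixes f :: "'a::euclidean_space \<Rightarrow> 'b::real_normed_vector"
  assumes "continuous_on UNIV f" "compact K" "\<And>X. X \<notin> K \<Longrightarrow> f X = 0"
  obtains b where "b > 0" "\<And>X. norm (f X) \<le> b"
proof -
  have "compact (f ` K)"
    using assms by (auto intro: compact_continuous_image continuous_on_subset)
  then obtain b where b: "b > 0" "\<forall>y\<in>f ` K. norm y \<le> b"
    using bounded_pos compact_imp_bounded by metis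
  have "norm (f X) \<le> b" for X
    using assms(3)[of X] b by (cases "X \<in> K") auto
  with b show ?thesis using that by blast
qed

lemma continuous_cpt_integrable:
  fixes f :: "'a::euclidean_space \<Rightarrow> 'b::{banach,second_countable_topology}"
  assumes "continuous_on UNIV f" "compact K" "\<And>X. X \<notin> K \<Longrightarrow> f X = 0"
  shows "integrable lborel f"
proof -
  have "integrable lborel (\<lambda>x. indicator K x *\<^sub>R f x)"
    using borel_integrable_compact[OF assms(2), of f] assms(1) continuous_on_subset by blast
  moreover have "(\<lambda>x. indicator K x *\<^sub>R f x) = f"
    using assms(3) by (auto simp: indicator_def fun_eq_iff)
  ultimately show ?thesis by simp
qed

lemma integrable_translate:
  fixes f :: "'a::euclidean_space \<Rightarrow> 'b::{banach,second_countable_topology}"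
  assumes "f \<in> borel_measurable borel"
  shows "integrable lborel (\<lambda>x. f (c + x)) \<longleftrightarrow> integrable lborel f"
  by (subst (2) lborel_distr_plus[of c, symmetric])
     (simp add: integrable_distr_eq assms)

lemma integral_translate:
  fixes f :: "'a::euclidean_space \<Rightarrow> 'b::{banach,second_countable_topology}"
  assumes "f \<in> borel_measurable borel"
  shows "(LINT x|lborel. f (c + x)) = (LINT x|lborel. f x)"
  by (subst (2) lborel_distr_plus[of c, symmetric])
     (simp add: integral_distr assms)

lemma nn_integral_translate:
  fixes f :: "'a::euclidean_space \<Rightarrow> ennreal"
  assumes "f \<in> borel_measurable borel"
  shows "(\<integral>\<^sup>+x. f (c + x) \<partial>lborel) = (\<integral>\<^sup>+x. f x \<partial>lborel)"
  by (subst (2) lborel_distr_plus[of c, symmetric])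
     (simp add: nn_integral_distr assms)

text \<open>
  The integral of \<open>f\<close> is invariant under the translation by \<open>t b\<close>;
  differentiating at \<open>t = 0\<close> gives the claim. All integrations by parts below are
  instances.
\<close>

lemma integral_of_derivative_eq_0:
  assumes f: "C1 f g" and K: "compact K" "\<And>X. X \<notin> K \<Longrightarrow> f X = 0"
  shows "(LINT X|lborel. g X \<bullet> b) = 0"
proof -
  have g0: "g X = 0" if "X \<notin> K" for X
    using C1_gradient_zero_outside[OF f compact_imp_closed[OF K(1)] K(2) that] .
  obtain L where L: "L > 0" "\<And>X. norm (g X) \<le> L"
    using continuous_cpt_bounded[OF C1_continuous_gradient[OF f] K(1) g0] by metis
  obtain r where r: "r > 0" "K \<subseteq> cball 0 r"
    using bounded_subset_ballD[OF compact_imp_bounded[OF K(1)], of 0] ball_subset_cball by (metis order_trans)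
  define q where "q n X = Suc n * (f (b /\<^sub>R Suc n + X) - f X)" for n X
  have fm[measurable]: "f \<in> borel_measurable borel" and gm[measurable]: "g \<in> borel_measurable borel"
    using C1_measurable[OF f] by auto
  have fi: "integrable lborel f"
    using continuous_cpt_integrable[OF C1_continuous[OF f] K] .
  have "(LINT X|lborel. q n X) = 0" for n
    unfolding q_def using fi integrable_translate[OF fm] integral_translate[OF fm]
    by (simp add: Bochner_Integration.integral_diff)
  moreover have "(\<lambda>n. LINT X|lborel. q n X) \<longlonglongrightarrow> (LINT X|lborel. g X \<bullet> b)"
  proof (rule integral_dominated_convergence[where w="\<lambda>X. indicator (cball 0 (r + norm b)) X * (L * norm b)"])
    show "q n \<in> borel_measurable lborel" for n unfolding q_def by measurable
    show "integrable lborel (\<lambda>X. indicator (cball 0 (r + norm b)) X * (L * norm b) :: real)"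
      by (auto intro!: integrable_mult_left integrable_real_indicator emeasure_bounded_finite)
    show "AE X in lborel. (\<lambda>n. q n X) \<longlonglongrightarrow> g X \<bullet> b"
    proof (rule AE_I2)
      fix X
      have "((\<lambda>t. f (X + t *\<^sub>R b)) has_field_derivative g X \<bullet> b) (at 0)"
        using C1_line[OF f, of X b 0] by simp
      then have "((\<lambda>h. (f (X + h *\<^sub>R b) - f X) / h) \<longlongrightarrow> g X \<bullet> b) (at 0)"
        by (simp add: DERIV_def)
      from tendsto_compose_at[OF LIMSEQ_inverse_real_of_nat this]
      have "(\<lambda>n. (f (X + inverse (real (Suc n)) *\<^sub>R b) - f X) / inverse (real (Suc n))) \<longlonglongrightarrow> g X \<bullet> b"
        by (simp add: o_def del: of_nat_Suc)
      then show "(\<lambda>n. q n X) \<longlonglongrightarrow> g X \<bullet> b"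
        by (simp add: q_def field_simps add.commute del: of_nat_Suc)
    qed
    show "AE X in lborel. norm (q n X) \<le> indicator (cball 0 (r + norm b)) X * (L * norm b)" for n
    proof (rule AE_I2)
      fix X
      have b1: "norm (b /\<^sub>R Suc n) \<le> norm b"
        by (simp add: divide_simps mult_left_le_one_le) (simp add: distrib_left)
      show "norm (q n X) \<le> indicator (cball 0 (r + norm b)) X * (L * norm b)"
      proof (cases "X \<in> cball 0 (r + norm b)")
        case True
        have "norm (f (b /\<^sub>R Suc n + X) - f X) \<le> L * norm (b /\<^sub>R Suc n + X - X)"
        proof (rule differentiable_bound[where S=UNIV and f'="\<lambda>X v. g X \<bullet> v"])
          show "onorm (\<lambda>v. g x \<bullet> v) \<le> L" for x
            using order_trans[OF Cauchy_Schwarz_ineq2 mult_right_mono[OF L(2) norm_ge_zero]]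
            by (intro onorm_le) (simp add: real_norm_def)
        qed (auto intro!: C1_D[OF f])
        then have "\<bar>f (b /\<^sub>R Suc n + X) - f X\<bar> * Suc n \<le> L * norm b"
          by (simp add: divide_simps mult.commute del: of_nat_Suc)
        then show ?thesis using True by (simp add: q_def abs_mult mult.commute del: of_nat_Suc)
      next
        case False
        then have n1: "norm X > r + norm b" by simp
        then have "\<not> norm X \<le> r" using norm_ge_zero[of b] by linarith
        then have "X \<notin> K" using r(2) by (meson mem_cball_0 subsetD)
        moreover have "norm X \<le> norm (b /\<^sub>R Suc n + X) + norm (b /\<^sub>R Suc n)"
          by (metis add.commute add_diff_cancel_right' norm_triangle_ineq4)
        then have "norm (b /\<^sub>R Suc n + X) > r"
          using n1 b1 by linarith
        then have "b /\<^sub>R Suc n + X \<notin> K"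
          using r(2) by (metis mem_cball_0 not_le subsetD)
        ultimately show ?thesis using K(2) False by (simp add: q_def)
      qed
    qed
  qed (measurable)
  ultimately show ?thesis
    by (simp add: LIMSEQ_const_iff)
qed

section \<open>Smooth functions\<close>

lemma C_diff_continuous: "C_diff m f \<Longrightarrow> continuous_on UNIV f"
  by (cases m) (auto simp: continuous_on_eq_continuous_within differentiable_imp_continuous_within)

lemma C_diff_Suc_imp: "C_diff (Suc m) f \<Longrightarrow> C_diff m f"
proof (induction m arbitrary: f)
  case 0
  then show ?case by (auto simp: continuous_on_eq_continuous_within differentiable_imp_continuous_within)
next
  case (Suc m)
  then show ?case by (metis C_diff.simps(2))
qed

lemma C_diff_SucI:
  assumes "\<And>x. (f has_derivative f' x) (at x)" "\<And>b. b \<in> Basis \<Longrightarrow> C_diff m (\<lambda>x. f' x b)"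
  shows "C_diff (Suc m) f"
proof -
  have "frechet_derivative f (at x) = f' x" for x
    using assms(1) frechet_derivative_at by metis
  then show ?thesis using assms by (auto simp: differentiable_def)
qed

lemma C_diff_D: "C_diff (Suc m) f \<Longrightarrow> (f has_derivative frechet_derivative f (at x)) (at x)"
  by (simp add: frechet_derivative_works)

lemma C_diff_add: "C_diff m f \<Longrightarrow> C_diff m g \<Longrightarrow> C_diff m (\<lambda>x. f x + g x)"
proof (induction m arbitrary: f g)
  case 0
  then show ?case by (auto intro: continuous_intros)
next
  case (Suc m)
  show ?case
    by (rule C_diff_SucI[OF has_derivative_add[OF C_diff_D[OF Suc.prems(1)] C_diff_D[OF Suc.prems(2)]]])
      (use Suc in auto)
qed

lemma C_diff_mult: "C_diff m f \<Longrightarrow> C_diff m g \<Longrightarrow> C_diff m (\<lambda>x. f x * g x)"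
proof (induction m arbitrary: f g)
  case 0
  then show ?case by (auto intro: continuous_intros)
next
  case (Suc m)
  show ?case
    by (rule C_diff_SucI[OF has_derivative_mult[OF C_diff_D[OF Suc.prems(1)] C_diff_D[OF Suc.prems(2)]]])
      (use Suc C_diff_Suc_imp[OF Suc.prems(1)] C_diff_Suc_imp[OF Suc.prems(2)] in \<open>auto intro!: C_diff_add\<close>)
qed

lemma C_diff_const: "C_diff m (\<lambda>x. c)"
proof (induction m arbitrary: c)
  case (Suc m)
  show ?case by (rule C_diff_SucI[OF has_derivative_const]) (use Suc in auto)
qed auto

lemma C_diff_linear:
  assumes "bounded_linear f"
  shows "C_diff m f"
proof (cases m)
  case 0
  then show ?thesis using assms by (simp add: linear_continuous_on)
next
  case (Suc m')
  show ?thesis unfolding Suc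
    by (rule C_diff_SucI[OF bounded_linear_imp_has_derivative[OF assms]]) (rule C_diff_const)
qed

lemma C_diff_norm_squared: "C_diff m (\<lambda>x::'a::euclidean_space. x \<bullet> x)"
proof (cases m)
  case (Suc m')
  have "((\<lambda>x::'a. x \<bullet> x) has_derivative (\<lambda>v. x \<bullet> v + v \<bullet> x)) (at x)" for x
    by (auto intro!: derivative_eq_intros)
  then show ?thesis unfolding Suc
    by (rule C_diff_SucI) (auto intro!: C_diff_linear bounded_linear_add bounded_linear_inner_left bounded_linear_inner_right)
qed (auto intro!: continuous_intros)

text \<open>
  The outer function is given with all its derivatives \<open>H j\<close>, because then one
  induction on \<open>m\<close>, for all \<open>j\<close> at once, needs only the product rule.
\<close>

lemma C_diff_compose:
  assumes H: "\<And>j t. (H j has_field_derivative H (Suc j) t) (at t)" and f: "\<And>m. C_diff m f"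
  shows "C_diff m (\<lambda>x. H j (f x))"
proof (induction m arbitrary: j)
  case 0
  have "continuous_on UNIV (H j)"
    using DERIV_continuous_on[of UNIV "H j" "H (Suc j)"] H has_field_derivative_at_within by blast
  then show ?case using continuous_on_compose2[OF _ C_diff_continuous[OF f[of 0]]] by auto
next
  case (Suc m)
  have *: "((\<lambda>x. H j (f x)) has_derivative (\<lambda>v. H (Suc j) (f x) * frechet_derivative f (at x) v)) (at x)" for x
    using has_derivative_compose[OF C_diff_D[OF f[of "Suc 0"]], of "H j" "(*) (H (Suc j) (f x))" x] H
    by (auto simp: has_field_derivative_def)
  show ?case
    by (rule C_diff_SucI[OF *]) (use f[of "Suc m"] Suc in \<open>auto intro!: C_diff_mult\<close>)
qed

text \<open>
  The \<open>j\<close>-th derivative of \<open>exp (- 1 / t)\<close> is a polynomial in \<open>1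
  / t\<close> times \<open>exp (- 1 / t)\<close>; with \<open>s = 1 / t\<close> the recursion is
  \<open>p \<mapsto> s\<^sup>2 (p - p')\<close>.
\<close>

primrec flat_poly :: "nat \<Rightarrow> real poly"
  where "flat_poly 0 = 1"
  | "flat_poly (Suc j) = monom 1 2 * (flat_poly j - pderiv (flat_poly j))"

definition flat_exp :: "nat \<Rightarrow> real \<Rightarrow> real"
  where "flat_exp j t = (if t > 0 then poly (flat_poly j) (1 / t) * exp (- 1 / t) else 0)"

lemma poly_times_exp_tendsto_0: "((\<lambda>s::real. poly p s * exp (- s)) \<longlongrightarrow> 0) at_top"
proof -
  have "((\<lambda>s. (\<Sum>i\<le>degree p. coeff p i * (s ^ i / exp s))) \<longlongrightarrow> (\<Sum>i\<le>degree p. coeff p i * 0)) at_top"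
    by (intro tendsto_sum tendsto_mult tendsto_const tendsto_power_div_exp_0)
  then show ?thesis
    by (simp add: poly_altdef sum_distrib_right exp_minus divide_inverse mult.assoc)
qed

lemma flat_exp_derivative: "(flat_exp j has_field_derivative flat_exp (Suc j) t) (at t)"
proof -
  consider "t > 0" | "t < 0" | "t = 0" by linarith
  then show ?thesis
  proof cases
    case 1
    have "((\<lambda>t. poly (flat_poly j) (1 / t) * exp (- 1 / t)) has_field_derivative flat_exp (Suc j) t) (at t)"
      using 1 by (auto intro!: derivative_eq_intros simp: flat_exp_def poly_monom field_simps power2_eq_square)
    then show ?thesis
      by (rule has_field_derivative_transform_within_open[of _ _ _ "{0<..}"]) (use 1 in \<open>auto simp: flat_exp_def\<close>)
  next
    case 2
    have "((\<lambda>t. 0) has_field_derivative flat_exp (Suc j) t) (at t)"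
      using 2 by (auto simp: flat_exp_def)
    then show ?thesis
      by (rule has_field_derivative_transform_within_open[of _ _ _ "{..<0}"]) (use 2 in \<open>auto simp: flat_exp_def\<close>)
  next
    case 3
    have "((\<lambda>h. flat_exp j h / h) \<longlongrightarrow> 0) (at_left 0)"
      by (rule tendsto_eventually) (auto simp: eventually_at_filter flat_exp_def)
    moreover have "((\<lambda>h. flat_exp j h / h) \<longlongrightarrow> 0) (at_right 0)"
    proof -
      have "((\<lambda>s::real. poly (pCons 0 (flat_poly j)) s * exp (- s)) \<longlongrightarrow> 0) at_top"
        by (rule poly_times_exp_tendsto_0)
      then have "((\<lambda>h::real. poly (pCons 0 (flat_poly j)) (inverse h) * exp (- inverse h)) \<longlongrightarrow> 0) (at_right 0)"
        by (rule filterlim_compose) (rule filterlim_inverse_at_top_right)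
      then show ?thesis
        by (rule Lim_transform_eventually) (auto simp: eventually_at_filter flat_exp_def field_simps)
    qed
    ultimately have "((\<lambda>h. flat_exp j h / h) \<longlongrightarrow> 0) (at 0)"
      using filterlim_split_at by blast
    then show ?thesis using 3 by (simp add: DERIV_def flat_exp_def)
  qed
qed

text \<open>
  The function \<open>exp (- 1 / (\<epsilon>\<^sup>2 - |x|\<^sup>2))\<close>, continued by zero
  and divided by its integral.
\<close>

lemma smooth_bump:
  assumes "\<epsilon> > 0"
  obtains \<rho> :: "'a::euclidean_space \<Rightarrow> real"
  where "smooth \<rho>" "\<And>x. 0 \<le> \<rho> x" "\<And>x. x \<notin> cball 0 \<epsilon> \<Longrightarrow> \<rho> x = 0" "(LINT x|lborel. \<rho> x) = 1"
proof -
  define h where "h x = flat_exp 0 (\<epsilon>\<^sup>2 + (-1) * (x \<bullet> x))" for x :: 'a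
  have sm: "C_diff m h" for m
    unfolding h_def
    by (rule C_diff_compose[where H=flat_exp and j=0, OF flat_exp_derivative])
      (rule C_diff_add[OF C_diff_const C_diff_mult[OF C_diff_const C_diff_norm_squared]])
  have nn: "h x \<ge> 0" for x by (simp add: h_def flat_exp_def)
  have supp: "h x = 0" if "x \<notin> cball 0 \<epsilon>" for x
  proof -
    have "\<epsilon>\<^sup>2 \<le> (norm x)\<^sup>2" using that assms by (intro power_mono) auto
    then show ?thesis by (simp add: h_def flat_exp_def dot_square_norm)
  qed
  have cont: "continuous_on UNIV h" using C_diff_continuous[OF sm] .
  have int: "integrable lborel h"
    by (rule continuous_cpt_integrable[OF cont compact_cball supp])
  have "(LINT x|lborel. h x) \<noteq> 0"
  proof
    assume "(LINT x|lborel. h x) = 0"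
    then have "AE x in lborel. h x = 0"
      using integral_nonneg_eq_0_iff_AE[OF int] nn by auto
    then have "AE x in lborel. x \<notin> ball (0::'a) \<epsilon>"
    proof eventually_elim
      case (elim x)
      show ?case
      proof
        assume "x \<in> ball 0 \<epsilon>"
        then have "(norm x)\<^sup>2 < \<epsilon>\<^sup>2" by (intro power_strict_mono) auto
        then show False using elim by (simp add: h_def flat_exp_def dot_square_norm)
      qed
    qed
    then have "emeasure lborel (ball (0::'a) \<epsilon>) = 0"
      by (subst (asm) AE_iff_measurable[of "ball (0::'a) \<epsilon>"]) (auto simp: set_eq_iff)
    moreover have "emeasure lborel (ball (0::'a) \<epsilon>) > 0"
      using assms by (simp add: emeasure_ball unit_ball_vol_pos)
    ultimately show False by simp
  qed
  moreover have "(LINT x|lborel. h x) \<ge> 0" using nn by simp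
  ultimately have pos: "(LINT x|lborel. h x) > 0" by simp
  show ?thesis
  proof (rule that[of "\<lambda>x. inverse (LINT x|lborel. h x) * h x"])
    show "smooth (\<lambda>x. inverse (LINT x|lborel. h x) * h x)"
      unfolding smooth_def by (rule allI, rule C_diff_mult[OF C_diff_const sm])
  qed (use nn supp pos in auto)
qed

lemma smooth_partial:
  assumes "smooth f" "b \<in> Basis"
  shows "smooth (\<lambda>x. grad f x \<bullet> b)"
proof -
  have "C_diff m (\<lambda>x. frechet_derivative f (at x) b)" for m
    using assms C_diff.simps(2)[of m f] unfolding smooth_def by blast
  moreover have "grad f x \<bullet> b = frechet_derivative f (at x) b" for x
    using assms(2) by (simp add: grad_def inner_sum_left inner_Basis if_distrib sum.delta cong: if_cong)
  ultimately show ?thesis by (simp add: smooth_def)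
qed

lemma smooth_C1:
  assumes "smooth f"
  shows "C1 f (grad f)"
  unfolding C1_def
proof (intro conjI allI)
  fix X
  have *: "C_diff (Suc 0) f" using assms by (simp add: smooth_def del: C_diff.simps)
  have d: "(f has_derivative frechet_derivative f (at X)) (at X)"
    using C_diff_D[OF *] .
  have "frechet_derivative f (at X) v = grad f X \<bullet> v" for v
  proof -
    interpret bounded_linear "frechet_derivative f (at X)" using d by (rule has_derivative_bounded_linear)
    have "frechet_derivative f (at X) v = frechet_derivative f (at X) (\<Sum>b\<in>Basis. (v \<bullet> b) *\<^sub>R b)"
      by (simp add: euclidean_representation)
    also have "\<dots> = (\<Sum>b\<in>Basis. (v \<bullet> b) * frechet_derivative f (at X) b)"
      by (simp add: sum scaleR)
    also have "\<dots> = grad f X \<bullet> v"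
      by (simp add: grad_def inner_sum_left inner_commute[of v] mult.commute)
    finally show ?thesis .
  qed
  then have "frechet_derivative f (at X) = (\<lambda>v. grad f X \<bullet> v)" by auto
  with d show "(f has_derivative (\<lambda>v. grad f X \<bullet> v)) (at X)" by simp
  show "continuous_on UNIV (grad f)"
    unfolding grad_def using * by (auto intro!: continuous_intros)
qed

section \<open>Convolution with a kernel\<close>

text \<open>
  The kernel lives on the space \<open>'b\<close>, which \<open>\<iota>\<close> maps into the
  space of the variable. With the inclusion of the horizontal directions for
  \<open>\<iota>\<close> this is convolution in the horizontal variables only, with the identity
  it is convolution in all variables.
\<close>

definition conv :: "('b::euclidean_space \<Rightarrow> 'a::euclidean_space) \<Rightarrow> ('a \<Rightarrow> 'c) \<Rightarrow> ('b \<Rightarrow> real) \<Rightarrow> 'a \<Rightarrow> 'c::{banach,second_countable_topology}"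
  where "conv \<iota> F \<kappa> X = (LINT w|lborel. \<kappa> w *\<^sub>R F (X - \<iota> w))"

definition kernel :: "real \<Rightarrow> ('b::euclidean_space \<Rightarrow> real) \<Rightarrow> bool"
  where "kernel \<epsilon> \<kappa> \<longleftrightarrow> continuous_on UNIV \<kappa> \<and> (\<forall>w. w \<notin> cball 0 \<epsilon> \<longrightarrow> \<kappa> w = 0)"

lemma kernel_continuous: "kernel \<epsilon> \<kappa> \<Longrightarrow> continuous_on UNIV \<kappa>"
  and kernel_zero: "kernel \<epsilon> \<kappa> \<Longrightarrow> w \<notin> cball 0 \<epsilon> \<Longrightarrow> \<kappa> w = 0"
  unfolding kernel_def by auto

lemma kernel_measurable: "kernel \<epsilon> \<kappa> \<Longrightarrow> \<kappa> \<in> borel_measurable borel"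
  by (simp add: kernel_def borel_measurable_continuous_onI)

lemma kernel_integrable: "kernel \<epsilon> \<kappa> \<Longrightarrow> integrable lborel \<kappa>"
  using continuous_cpt_integrable[of \<kappa> "cball 0 \<epsilon>"] by (simp add: kernel_def)

lemma kernel_partial:
  assumes "C1 \<kappa> \<kappa>'" "kernel \<epsilon> \<kappa>"
  shows "kernel \<epsilon> (\<lambda>w. \<kappa>' w \<bullet> b)"
proof -
  have "\<kappa>' w = 0" if "w \<notin> cball 0 \<epsilon>" for w
    using C1_gradient_zero_outside[OF assms(1) closed_cball _ that] assms(2) by (auto simp: kernel_def)
  moreover have "continuous_on UNIV (\<lambda>w. \<kappa>' w \<bullet> b)"
    using C1_continuous_gradient[OF assms(1), of UNIV] by (intro continuous_on_inner continuous_on_const)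
  ultimately show ?thesis by (simp add: kernel_def)
qed

lemma linear_measurable: "linear \<iota> \<Longrightarrow> \<iota> \<in> borel_measurable borel" for \<iota> :: "'b::euclidean_space \<Rightarrow> 'a::euclidean_space"
  by (simp add: borel_measurable_continuous_onI linear_continuous_on linear_conv_bounded_linear)

lemma conv_measurable_pair:
  fixes \<iota> :: "'b::euclidean_space \<Rightarrow> 'a::euclidean_space" and F :: "'a \<Rightarrow> 'c::{banach,second_countable_topology}"
  assumes "linear \<iota>" "F \<in> borel_measurable borel" "\<kappa> \<in> borel_measurable borel"
  shows "(\<lambda>(X, w). \<kappa> w *\<^sub>R F (X - \<iota> w)) \<in> borel_measurable (borel \<Otimes>\<^sub>M borel)"
proof -
  note [measurable] = assms(2,3) linear_measurable[OF assms(1)]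
  show ?thesis by measurable
qed

lemma conv_measurable:
  assumes "linear \<iota>" "F \<in> borel_measurable borel" "\<kappa> \<in> borel_measurable borel"
  shows "conv \<iota> F \<kappa> \<in> borel_measurable borel"
proof -
  have "(\<lambda>(X, w). \<kappa> w *\<^sub>R F (X - \<iota> w)) \<in> borel_measurable (borel \<Otimes>\<^sub>M lborel)"
    using conv_measurable_pair[OF assms] measurable_cong_sets[OF sets_pair_measure_cong[OF refl sets_lborel] refl] by blast
  from lborel.borel_measurable_lebesgue_integral[OF this]
  show ?thesis unfolding conv_def by simp
qed

lemma conv_norm_le:
  assumes "linear \<iota>" "F \<in> borel_measurable borel" "\<kappa> \<in> borel_measurable borel"
  shows "ennreal (norm (conv \<iota> F \<kappa> X)) \<le> (\<integral>\<^sup>+w. ennreal (\<bar>\<kappa> w\<bar> * norm (F (X - \<iota> w))) \<partial>lborel)"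
proof (cases "integrable lborel (\<lambda>w. \<kappa> w *\<^sub>R F (X - \<iota> w))")
  case True
  from integral_norm_bound_ennreal[OF this] show ?thesis by (simp add: conv_def)
qed (simp add: conv_def not_integrable_integral_eq)

text \<open>
  Young's inequality, localised: by Cauchy--Schwarz the square of the convolution is at most the
  mass of \<open>|\<kappa>|\<close> times the convolution of the square with
  \<open>|\<kappa>|\<close>, and the latter is integrated by Tonelli's theorem.
\<close>

lemma conv_L2_bound:
  assumes \<iota>: "linear \<iota>" and F: "F \<in> borel_measurable borel" and \<kappa>: "kernel \<epsilon> \<kappa>"
    and S: "S \<in> sets borel" "S' \<in> sets borel" and SS': "\<And>X w. X \<in> S \<Longrightarrow> norm w \<le> \<epsilon> \<Longrightarrow> X - \<iota> w \<in> S'"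
  shows "(\<integral>\<^sup>+X\<in>S. ennreal ((norm (conv \<iota> F \<kappa> X))\<^sup>2) \<partial>lborel) \<le>
    ennreal ((LINT w|lborel. \<bar>\<kappa> w\<bar>)\<^sup>2) * (\<integral>\<^sup>+X\<in>S'. ennreal ((norm (F X))\<^sup>2) \<partial>lborel)"
proof -
  note [measurable] = F S linear_measurable[OF \<iota>] kernel_measurable[OF \<kappa>]
  define k where "k = (LINT w|lborel. \<bar>\<kappa> w\<bar>)"
  define A where "A = (\<integral>\<^sup>+X\<in>S'. ennreal ((norm (F X))\<^sup>2) \<partial>lborel)"
  have k: "(\<integral>\<^sup>+w. ennreal \<bar>\<kappa> w\<bar> \<partial>lborel) = ennreal k"
    unfolding k_def using kernel_integrable[OF \<kappa>] by (intro nn_integral_eq_integral) auto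
  have kpos: "k \<ge> 0" by (simp add: k_def)
  have pt: "ennreal ((norm (conv \<iota> F \<kappa> X))\<^sup>2) \<le> ennreal k * (\<integral>\<^sup>+w. ennreal (\<bar>\<kappa> w\<bar> * (norm (F (X - \<iota> w)))\<^sup>2) \<partial>lborel)" for X
  proof -
    have "ennreal ((norm (conv \<iota> F \<kappa> X))\<^sup>2) = (ennreal (norm (conv \<iota> F \<kappa> X)))\<^sup>2"
      by (simp add: ennreal_power)
    also have "\<dots> \<le> (\<integral>\<^sup>+w. ennreal (\<bar>\<kappa> w\<bar> * norm (F (X - \<iota> w))) \<partial>lborel)\<^sup>2"
      using conv_norm_le[OF \<iota> F kernel_measurable[OF \<kappa>]] by (rule power_mono) simp
    also have "\<dots> = (\<integral>\<^sup>+w. ennreal (sqrt \<bar>\<kappa> w\<bar>) * ennreal (sqrt \<bar>\<kappa> w\<bar> * norm (F (X - \<iota> w))) \<partial>lborel)\<^sup>2"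
      by (simp add: ennreal_mult[symmetric] mult.assoc[symmetric])
    also have "\<dots> \<le> (\<integral>\<^sup>+w. (ennreal (sqrt \<bar>\<kappa> w\<bar>))\<^sup>2 \<partial>lborel) * (\<integral>\<^sup>+w. (ennreal (sqrt \<bar>\<kappa> w\<bar> * norm (F (X - \<iota> w))))\<^sup>2 \<partial>lborel)"
      by (rule Cauchy_Schwarz_nn_integral) measurable
    also have "\<dots> = ennreal k * (\<integral>\<^sup>+w. ennreal (\<bar>\<kappa> w\<bar> * (norm (F (X - \<iota> w)))\<^sup>2) \<partial>lborel)"
      by (simp add: ennreal_power power_mult_distrib k)
    finally show ?thesis .
  qed
  have "(\<integral>\<^sup>+X\<in>S. ennreal ((norm (conv \<iota> F \<kappa> X))\<^sup>2) \<partial>lborel)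
      \<le> (\<integral>\<^sup>+X. ennreal k * (\<integral>\<^sup>+w. ennreal (\<bar>\<kappa> w\<bar> * (norm (F (X - \<iota> w)))\<^sup>2) * indicator S X \<partial>lborel) \<partial>lborel)"
  proof (rule nn_integral_mono)
    fix X
    show "ennreal ((norm (conv \<iota> F \<kappa> X))\<^sup>2) * indicator S X
      \<le> ennreal k * (\<integral>\<^sup>+w. ennreal (\<bar>\<kappa> w\<bar> * (norm (F (X - \<iota> w)))\<^sup>2) * indicator S X \<partial>lborel)"
      using pt[of X] by (cases "X \<in> S") auto
  qed
  also have "\<dots> = ennreal k * (\<integral>\<^sup>+X. (\<integral>\<^sup>+w. ennreal (\<bar>\<kappa> w\<bar> * (norm (F (X - \<iota> w)))\<^sup>2) * indicator S X \<partial>lborel) \<partial>lborel)"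
    by (rule nn_integral_cmult) measurable
  also have "(\<integral>\<^sup>+X. (\<integral>\<^sup>+w. ennreal (\<bar>\<kappa> w\<bar> * (norm (F (X - \<iota> w)))\<^sup>2) * indicator S X \<partial>lborel) \<partial>lborel)
     = (\<integral>\<^sup>+w. (\<integral>\<^sup>+X. ennreal (\<bar>\<kappa> w\<bar> * (norm (F (X - \<iota> w)))\<^sup>2) * indicator S X \<partial>lborel) \<partial>lborel)"
    by (rule lborel_pair.Fubini') measurable
  also have "\<dots> \<le> (\<integral>\<^sup>+w. ennreal \<bar>\<kappa> w\<bar> * A \<partial>lborel)"
  proof (rule nn_integral_mono)
    fix w
    show "(\<integral>\<^sup>+X. ennreal (\<bar>\<kappa> w\<bar> * (norm (F (X - \<iota> w)))\<^sup>2) * indicator S X \<partial>lborel) \<le> ennreal \<bar>\<kappa> w\<bar> * A"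
    proof (cases "norm w \<le> \<epsilon>")
      case True
      have "(\<integral>\<^sup>+X. ennreal (\<bar>\<kappa> w\<bar> * (norm (F (X - \<iota> w)))\<^sup>2) * indicator S X \<partial>lborel)
        \<le> (\<integral>\<^sup>+X. ennreal \<bar>\<kappa> w\<bar> * (ennreal ((norm (F (- \<iota> w + X)))\<^sup>2) * indicator S' (- \<iota> w + X)) \<partial>lborel)"
        using SS'[OF _ True] by (intro nn_integral_mono) (auto simp: ennreal_mult indicator_def)
      also have "\<dots> = ennreal \<bar>\<kappa> w\<bar> * (\<integral>\<^sup>+X. (ennreal ((norm (F (- \<iota> w + X)))\<^sup>2) * indicator S' (- \<iota> w + X)) \<partial>lborel)"
        by (rule nn_integral_cmult) measurable
      also have "\<dots> = ennreal \<bar>\<kappa> w\<bar> * A"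
        unfolding A_def by (subst nn_integral_translate[where f="\<lambda>X. ennreal ((norm (F X))\<^sup>2) * indicator S' X"]) auto
      finally show ?thesis .
    qed (use kernel_zero[OF \<kappa>, of w] in auto)
  qed
  also have "\<dots> = ennreal k * A"
    by (subst nn_integral_multc) (auto simp: k)
  also have "ennreal k * (ennreal k * A) = ennreal (k\<^sup>2) * A"
    using kpos by (simp add: power2_eq_square ennreal_mult mult.assoc)
  finally show ?thesis
    by (simp add: k_def A_def mult_left_mono)
qed

lemma conv_pair_integrable:
  fixes F :: "'a::euclidean_space \<Rightarrow> 'c::euclidean_space"
  assumes \<iota>: "linear \<iota>" and F: "integrable lborel F" and \<kappa>: "integrable lborel \<kappa>"
  shows "integrable (lborel \<Otimes>\<^sub>M lborel) (\<lambda>(X, w). \<kappa> w *\<^sub>R F (X - \<iota> w))"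
proof -
  note [measurable] = borel_measurable_integrable[OF F, simplified] linear_measurable[OF \<iota>] borel_measurable_integrable[OF \<kappa>, simplified]
  have m: "(\<lambda>(X, w). \<kappa> w *\<^sub>R F (X - \<iota> w)) \<in> borel_measurable (lborel \<Otimes>\<^sub>M lborel)"
    by measurable
  have "(\<integral>\<^sup>+z. ennreal (norm (case z of (X, w) \<Rightarrow> \<kappa> w *\<^sub>R F (X - \<iota> w))) \<partial>(lborel \<Otimes>\<^sub>M lborel))
    = (\<integral>\<^sup>+w. (\<integral>\<^sup>+X. ennreal (norm (\<kappa> w *\<^sub>R F (X - \<iota> w))) \<partial>lborel) \<partial>lborel)"
    using lborel_pair.nn_integral_snd[of "\<lambda>z. ennreal (norm (case z of (X, w) \<Rightarrow> \<kappa> w *\<^sub>R F (X - \<iota> w)))"] m by simp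
  also have "\<dots> = (\<integral>\<^sup>+w. ennreal \<bar>\<kappa> w\<bar> * (\<integral>\<^sup>+X. ennreal (norm (F X)) \<partial>lborel) \<partial>lborel)"
  proof (rule nn_integral_cong)
    fix w
    have "(\<integral>\<^sup>+X. ennreal (norm (\<kappa> w *\<^sub>R F (X - \<iota> w))) \<partial>lborel) = ennreal \<bar>\<kappa> w\<bar> * (\<integral>\<^sup>+X. ennreal (norm (F (- \<iota> w + X))) \<partial>lborel)"
      by (subst nn_integral_cmult[symmetric]) (auto simp: ennreal_mult)
    then show "(\<integral>\<^sup>+X. ennreal (norm (\<kappa> w *\<^sub>R F (X - \<iota> w))) \<partial>lborel) = ennreal \<bar>\<kappa> w\<bar> * (\<integral>\<^sup>+X. ennreal (norm (F X)) \<partial>lborel)"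
      by (subst (asm) nn_integral_translate[where f="\<lambda>X. ennreal (norm (F X))"]) auto
  qed
  also have "\<dots> = (\<integral>\<^sup>+w. ennreal \<bar>\<kappa> w\<bar> \<partial>lborel) * (\<integral>\<^sup>+X. ennreal (norm (F X)) \<partial>lborel)"
    by (rule nn_integral_multc) measurable
  also have "\<dots> < \<infinity>"
    using F \<kappa> by (auto simp: integrable_iff_bounded ennreal_mult_less_top)
  finally show ?thesis using m by (auto simp: integrable_iff_bounded)
qed

lemma conv_AE_integrable:
  fixes F :: "'a::euclidean_space \<Rightarrow> 'c::euclidean_space"
  assumes "linear \<iota>" "integrable lborel F" "integrable lborel \<kappa>"
  shows "AE X in lborel. integrable lborel (\<lambda>w. \<kappa> w *\<^sub>R F (X - \<iota> w))"
  using lborel_pair.AE_integrable_fst[OF conv_pair_integrable[OF assms]] by simp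

lemma conv_integrable:
  fixes F :: "'a::euclidean_space \<Rightarrow> 'c::euclidean_space"
  assumes "linear \<iota>" "integrable lborel F" "integrable lborel \<kappa>"
  shows "integrable lborel (conv \<iota> F \<kappa>)"
  using lborel_pair.integrable_fst[OF conv_pair_integrable[OF assms]] by (simp add: conv_def[abs_def])

text \<open>
  Convolution is moved to the other factor by Fubini's theorem; the kernel is reflected.
\<close>

lemma conv_duality:
  fixes F \<psi> :: "'a::euclidean_space \<Rightarrow> 'c::euclidean_space"
  assumes \<iota>: "linear \<iota>" and F: "integrable lborel F" and \<kappa>: "kernel \<epsilon> \<kappa>"
    and \<psi>: "\<psi> \<in> borel_measurable borel" "\<And>X. norm (\<psi> X) \<le> b"
  shows "(LINT X|lborel. conv \<iota> F \<kappa> X \<bullet> \<psi> X) = (LINT X|lborel. F X \<bullet> conv (\<lambda>w. - \<iota> w) \<psi> \<kappa> X)"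
proof -
  note [measurable] = borel_measurable_integrable[OF F, simplified] linear_measurable[OF \<iota>] kernel_measurable[OF \<kappa>] \<psi>(1)
  note \<kappa>i = kernel_integrable[OF \<kappa>]
  have pi: "integrable (lborel \<Otimes>\<^sub>M lborel) (\<lambda>(X, w). \<kappa> w * (F (X - \<iota> w) \<bullet> \<psi> X))"
  proof (rule Bochner_Integration.integrable_bound[OF integrable_mult_right[OF integrable_norm[OF conv_pair_integrable[OF \<iota> F \<kappa>i]], of "b"]])
    show "AE z in lborel \<Otimes>\<^sub>M lborel. norm (case z of (X, w) \<Rightarrow> \<kappa> w * (F (X - \<iota> w) \<bullet> \<psi> X)) \<le> norm (b * norm (case z of (X, w) \<Rightarrow> \<kappa> w *\<^sub>R F (X - \<iota> w)))"
    proof (rule AE_I2, clarify)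
      fix X w
      have "\<bar>F (X - \<iota> w) \<bullet> \<psi> X\<bar> \<le> norm (F (X - \<iota> w)) * b"
        using order_trans[OF Cauchy_Schwarz_ineq2 mult_left_mono[OF \<psi>(2) norm_ge_zero]] .
      moreover have "b \<ge> 0" using order_trans[OF norm_ge_zero \<psi>(2)] .
      ultimately show "norm (\<kappa> w * (F (X - \<iota> w) \<bullet> \<psi> X)) \<le> norm (b * norm (\<kappa> w *\<^sub>R F (X - \<iota> w)))"
        by (simp add: abs_mult mult_left_mono mult.left_commute[of b] mult.commute[of b] mult.assoc)
    qed
  qed measurable
  have "(LINT X|lborel. conv \<iota> F \<kappa> X \<bullet> \<psi> X) = (LINT X|lborel. LINT w|lborel. \<kappa> w * (F (X - \<iota> w) \<bullet> \<psi> X))"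
  proof (rule integral_cong_AE)
    show "AE X in lborel. conv \<iota> F \<kappa> X \<bullet> \<psi> X = (LINT w|lborel. \<kappa> w * (F (X - \<iota> w) \<bullet> \<psi> X))"
      using conv_AE_integrable[OF \<iota> F \<kappa>i]
    proof eventually_elim
      case (elim X)
      have "(LINT w|lborel. (\<kappa> w *\<^sub>R F (X - \<iota> w)) \<bullet> \<psi> X) = conv \<iota> F \<kappa> X \<bullet> \<psi> X"
        unfolding conv_def using elim by (rule integral_inner_left) 
      then show ?case by simp
    qed
    show "(\<lambda>X. conv \<iota> F \<kappa> X \<bullet> \<psi> X) \<in> borel_measurable lborel"
      using borel_measurable_integrable[OF conv_integrable[OF \<iota> F \<kappa>i]] \<psi>(1) by simp
  qed measurable
  also have "\<dots> = (LINT w|lborel. LINT X|lborel. \<kappa> w * (F (X - \<iota> w) \<bullet> \<psi> X))"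
    using lborel_pair.Fubini_integral[OF pi] by simp
  also have "\<dots> = (LINT w|lborel. LINT X|lborel. \<kappa> w * (F X \<bullet> \<psi> (X + \<iota> w)))"
  proof (rule Bochner_Integration.integral_cong[OF refl])
    fix w
    show "(LINT X|lborel. \<kappa> w * (F (X - \<iota> w) \<bullet> \<psi> X)) = (LINT X|lborel. \<kappa> w * (F X \<bullet> \<psi> (X + \<iota> w)))"
      by (subst (2) integral_translate[where c="- \<iota> w", symmetric]) auto
  qed
  also have "\<dots> = (LINT X|lborel. LINT w|lborel. \<kappa> w * (F X \<bullet> \<psi> (X + \<iota> w)))"
  proof (rule lborel_pair.Fubini_integral)
    have p1: "integrable (lborel \<Otimes>\<^sub>M lborel) (\<lambda>(X, w). \<kappa> w *\<^sub>R F X)"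
      using conv_pair_integrable[of "\<lambda>w. 0", OF _ F \<kappa>i] by (simp add: linear_0 linear_zero)
    show "integrable (lborel \<Otimes>\<^sub>M lborel) (\<lambda>(X, w). \<kappa> w * (F X \<bullet> \<psi> (X + \<iota> w)))"
    proof (rule Bochner_Integration.integrable_bound[OF integrable_mult_right[OF integrable_norm[OF p1], of "b"]])
      show "AE z in lborel \<Otimes>\<^sub>M lborel. norm (case z of (X, w) \<Rightarrow> \<kappa> w * (F X \<bullet> \<psi> (X + \<iota> w))) \<le> norm (b * norm (case z of (X, w) \<Rightarrow> \<kappa> w *\<^sub>R F X))"
      proof (rule AE_I2, clarify)
        fix X w
        have "\<bar>F X \<bullet> \<psi> (X + \<iota> w)\<bar> \<le> norm (F X) * b"
          using order_trans[OF Cauchy_Schwarz_ineq2 mult_left_mono[OF \<psi>(2) norm_ge_zero]] .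
        moreover have "b \<ge> 0" using order_trans[OF norm_ge_zero \<psi>(2)] .
        ultimately show "norm (\<kappa> w * (F X \<bullet> \<psi> (X + \<iota> w))) \<le> norm (b * norm (\<kappa> w *\<^sub>R F X))"
          by (simp add: abs_mult mult_left_mono mult.left_commute[of b] mult.commute[of b] mult.assoc)
      qed
    qed measurable
  qed
  also have "\<dots> = (LINT X|lborel. F X \<bullet> conv (\<lambda>w. - \<iota> w) \<psi> \<kappa> X)"
  proof (rule Bochner_Integration.integral_cong[OF refl])
    fix X
    have "integrable lborel (\<lambda>w. \<kappa> w *\<^sub>R \<psi> (X + \<iota> w))"
    proof (rule Bochner_Integration.integrable_bound[OF integrable_mult_right[OF \<kappa>i, of "b"]])
      have "b \<ge> 0" using order_trans[OF norm_ge_zero \<psi>(2)] .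
      then show "AE w in lborel. norm (\<kappa> w *\<^sub>R \<psi> (X + \<iota> w)) \<le> norm (b * \<kappa> w)"
        using \<psi>(2) by (intro AE_I2) (simp add: abs_mult mult.commute[of b] mult_left_mono)
    qed measurable
    from integral_inner_right[OF this, of "F X"]
    show "(LINT w|lborel. \<kappa> w * (F X \<bullet> \<psi> (X + \<iota> w))) = F X \<bullet> conv (\<lambda>w. - \<iota> w) \<psi> \<kappa> X"
      by (simp add: conv_def)
  qed
  finally show ?thesis .
qed

lemma conv_as_integral_cbox:
  fixes F :: "'a::euclidean_space \<Rightarrow> 'c::euclidean_space" and \<iota> :: "'b::euclidean_space \<Rightarrow> 'a"
  assumes "linear \<iota>" "kernel \<epsilon> \<kappa>" "continuous_on UNIV F" "cball 0 \<epsilon> \<subseteq> cbox a b"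
  shows "conv \<iota> F \<kappa> X = integral (cbox a b) (\<lambda>w. \<kappa> w *\<^sub>R F (X - \<iota> w))"
proof -
  have c: "continuous_on UNIV (\<lambda>w. \<kappa> w *\<^sub>R F (X - \<iota> w))"
  proof (rule continuous_on_scaleR[OF kernel_continuous[OF assms(2)]])
    have "continuous_on UNIV (\<lambda>w. X - \<iota> w)"
      using assms(1) by (intro continuous_on_diff continuous_on_const) (simp add: linear_continuous_on linear_conv_bounded_linear)
    then show "continuous_on UNIV (\<lambda>w. F (X - \<iota> w))"
      by (rule continuous_on_compose2[OF assms(3)]) simp
  qed
  then have "set_integrable lborel (cbox a b) (\<lambda>w. \<kappa> w *\<^sub>R F (X - \<iota> w))"
    unfolding set_integrable_def by (intro borel_integrable_compact compact_cbox) (rule continuous_on_subset, auto)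
  from set_borel_integral_eq_integral(2)[OF this]
  have "integral (cbox a b) (\<lambda>w. \<kappa> w *\<^sub>R F (X - \<iota> w)) = (LINT w:cbox a b|lborel. \<kappa> w *\<^sub>R F (X - \<iota> w))" by simp
  also have "\<dots> = conv \<iota> F \<kappa> X"
    unfolding conv_def set_lebesgue_integral_def
    by (rule Bochner_Integration.integral_cong[OF refl])
      (use kernel_zero[OF assms(2)] assms(4) in \<open>auto simp: indicator_def subset_iff\<close>)
  finally show ?thesis by simp
qed

lemma C1_integral_cbox:
  fixes \<iota> :: "'b::euclidean_space \<Rightarrow> 'a::euclidean_space"
  assumes f: "C1 f g" and \<iota>: "linear \<iota>" and \<kappa>: "continuous_on UNIV \<kappa>"
  shows "C1 (\<lambda>X. integral (cbox a b) (\<lambda>w. \<kappa> w *\<^sub>R f (X - \<iota> w))) (\<lambda>X. integral (cbox a b) (\<lambda>w. \<kappa> w *\<^sub>R g (X - \<iota> w)))"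
  unfolding C1_def
proof (intro conjI allI)
  note cg = C1_continuous_gradient[OF f, of UNIV] and cf = C1_continuous[OF f, of UNIV]
  have c\<iota>: "continuous_on UNIV \<iota>"
    using \<iota> by (simp add: linear_continuous_on linear_conv_bounded_linear)
  fix X
  define D where "D X w = \<kappa> w *\<^sub>R blinfun_inner_right (g (X - \<iota> w))" for X w
  have "((\<lambda>X. integral (cbox a b) (\<lambda>w. \<kappa> w *\<^sub>R f (X - \<iota> w))) has_derivative integral (cbox a b) (D X)) (at X within UNIV)"
  proof (rule leibniz_rule)
    fix X w
    have "((\<lambda>X. X - \<iota> w) has_derivative (\<lambda>h. h)) (at X)"
      by (auto intro!: derivative_eq_intros)
    from has_derivative_scaleR_right[OF has_derivative_compose[OF this C1_D[OF f, of _ UNIV]], of "\<kappa> w"]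
    show "((\<lambda>X. \<kappa> w *\<^sub>R f (X - \<iota> w)) has_derivative blinfun_apply (D X w)) (at X within UNIV)"
      by (simp add: D_def scaleR_blinfun.rep_eq)
  next
    fix X
    show "(\<lambda>w. \<kappa> w *\<^sub>R f (X - \<iota> w)) integrable_on cbox a b"
      by (intro integrable_continuous continuous_on_scaleR continuous_on_compose2[OF \<kappa>]
          continuous_on_compose2[OF cf] continuous_on_compose2[OF c\<iota>] continuous_on_diff
          continuous_on_const continuous_on_id) auto
  next
    have "continuous_on (UNIV \<times> cbox a b) (\<lambda>z. \<kappa> (snd z) *\<^sub>R blinfun_inner_right (g (fst z - \<iota> (snd z))))"
      by (intro continuous_on_scaleR continuous_on_compose2[OF \<kappa>]
          bounded_linear.continuous_on[OF bounded_linear_blinfun_inner_right]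
          continuous_on_compose2[OF cg] continuous_on_compose2[OF c\<iota>] continuous_on_diff
          continuous_on_fst continuous_on_snd continuous_on_id) auto
    then show "continuous_on (UNIV \<times> cbox a b) (\<lambda>(X, w). D X w)"
      by (simp add: case_prod_beta D_def)
  qed auto
  moreover have "blinfun_apply (integral (cbox a b) (D X)) = (\<lambda>v. integral (cbox a b) (\<lambda>w. \<kappa> w *\<^sub>R g (X - \<iota> w)) \<bullet> v)"
  proof -
    have "(\<lambda>w. \<kappa> w *\<^sub>R g (X - \<iota> w)) integrable_on cbox a b"
      by (intro integrable_continuous continuous_on_scaleR continuous_on_compose2[OF \<kappa>]
          continuous_on_compose2[OF cg] continuous_on_compose2[OF c\<iota>] continuous_on_diff
          continuous_on_const continuous_on_id) auto
    from integral_linear[OF this bounded_linear_blinfun_inner_right]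
    have "integral (cbox a b) (D X) = blinfun_inner_right (integral (cbox a b) (\<lambda>w. \<kappa> w *\<^sub>R g (X - \<iota> w)))"
      by (simp add: D_def[abs_def] o_def linear_scale bounded_linear.linear[OF bounded_linear_blinfun_inner_right])
    then show ?thesis by auto
  qed
  ultimately show "((\<lambda>X. integral (cbox a b) (\<lambda>w. \<kappa> w *\<^sub>R f (X - \<iota> w))) has_derivative
      (\<lambda>v. integral (cbox a b) (\<lambda>w. \<kappa> w *\<^sub>R g (X - \<iota> w)) \<bullet> v)) (at X)"
    by simp
next
  have c\<iota>: "continuous_on UNIV \<iota>"
    using \<iota> by (simp add: linear_continuous_on linear_conv_bounded_linear)
  show "continuous_on UNIV (\<lambda>X. integral (cbox a b) (\<lambda>w. \<kappa> w *\<^sub>R g (X - \<iota> w)))"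
  proof (rule integral_continuous_on_param)
    have "continuous_on (UNIV \<times> cbox a b) (\<lambda>z. \<kappa> (snd z) *\<^sub>R g (fst z - \<iota> (snd z)))"
      by (intro continuous_on_scaleR continuous_on_compose2[OF \<kappa>]
          continuous_on_compose2[OF C1_continuous_gradient[OF f, of UNIV]] continuous_on_compose2[OF c\<iota>] continuous_on_diff
          continuous_on_fst continuous_on_snd continuous_on_id) auto
    then show "continuous_on (UNIV \<times> cbox a b) (\<lambda>(X, w). \<kappa> w *\<^sub>R g (X - \<iota> w))"
      by (simp add: case_prod_beta)
  qed
qed

lemma C1_conv:
  fixes \<iota> :: "'b::euclidean_space \<Rightarrow> 'a::euclidean_space"
  assumes "C1 f g" "linear \<iota>" "kernel \<epsilon> \<kappa>"
  shows "C1 (conv \<iota> f \<kappa>) (conv \<iota> g \<kappa>)"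
proof -
  obtain a b :: 'b where ab: "cball 0 \<epsilon> \<subseteq> cbox a b"
    using bounded_subset_cbox_symmetric[OF bounded_cball] by metis
  have "conv \<iota> f \<kappa> = (\<lambda>X. integral (cbox a b) (\<lambda>w. \<kappa> w *\<^sub>R f (X - \<iota> w)))"
    by (rule ext) (rule conv_as_integral_cbox[OF assms(2,3) C1_continuous[OF assms(1)] ab])
  moreover have "conv \<iota> g \<kappa> = (\<lambda>X. integral (cbox a b) (\<lambda>w. \<kappa> w *\<^sub>R g (X - \<iota> w)))"
    by (rule ext) (rule conv_as_integral_cbox[OF assms(2,3) C1_continuous_gradient[OF assms(1)] ab])
  ultimately show ?thesis
    using C1_integral_cbox[OF assms(1,2) kernel_continuous[OF assms(3)]] by simp
qed

text \<open>
  Integration by parts: a derivative of the function may be put on the kernel. This is how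
  derivatives of a merely integrable field acquire a meaning.
\<close>

lemma conv_gradient_kernel:
  assumes f: "C1 f g" and \<kappa>: "C1 \<kappa> \<kappa>'" "kernel \<epsilon> \<kappa>" and \<iota>: "linear \<iota>"
  shows "conv \<iota> (\<lambda>X. g X \<bullet> \<iota> b) \<kappa> X = conv \<iota> f (\<lambda>w. \<kappa>' w \<bullet> b) X"
proof -
  have ln: "linear (\<lambda>w. - \<iota> w)" and la: "linear (\<lambda>w. - adjoint \<iota> w)"
    using \<iota> adjoint_linear[OF \<iota>] by (auto intro: linear_compose_neg)
  have "C1 (\<lambda>w. f (X + - \<iota> w)) (\<lambda>w. - adjoint \<iota> (g (X + - \<iota> w)))"
    by (rule C1_compose_affine[OF f ln _ la]) (metis adjoint_works[OF \<iota>] inner_commute inner_minus_left)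
  from C1_mult[OF \<kappa>(1) this]
  have C: "C1 (\<lambda>w. \<kappa> w * f (X - \<iota> w)) (\<lambda>w. \<kappa> w *\<^sub>R (- adjoint \<iota> (g (X - \<iota> w))) + f (X - \<iota> w) *\<^sub>R \<kappa>' w)"
    by simp
  have "(LINT w|lborel. (\<kappa> w *\<^sub>R (- adjoint \<iota> (g (X - \<iota> w))) + f (X - \<iota> w) *\<^sub>R \<kappa>' w) \<bullet> b) = 0"
    by (rule integral_of_derivative_eq_0[OF C, of "cball 0 \<epsilon>"]) (use kernel_zero[OF \<kappa>(2)] in auto)
  moreover have "(\<kappa> w *\<^sub>R (- adjoint \<iota> (g (X - \<iota> w))) + f (X - \<iota> w) *\<^sub>R \<kappa>' w) \<bullet> b
     = (\<kappa>' w \<bullet> b) * f (X - \<iota> w) - \<kappa> w * (g (X - \<iota> w) \<bullet> \<iota> b)" for w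
  proof -
    have "adjoint \<iota> (g (X - \<iota> w)) \<bullet> b = g (X - \<iota> w) \<bullet> \<iota> b"
      by (metis adjoint_works[OF \<iota>] inner_commute)
    then show ?thesis by (simp add: inner_simps algebra_simps)
  qed
  ultimately have 0: "(LINT w|lborel. (\<kappa>' w \<bullet> b) * f (X - \<iota> w) - \<kappa> w * (g (X - \<iota> w) \<bullet> \<iota> b)) = 0" by simp
  have c\<iota>: "continuous_on UNIV \<iota>"
    using \<iota> by (simp add: linear_continuous_on linear_conv_bounded_linear)
  have int: "integrable lborel (\<lambda>w. k w * F (X - \<iota> w))" if "kernel \<epsilon> k" "continuous_on UNIV F" for k and F :: "'a \<Rightarrow> real"
    by (rule continuous_cpt_integrable[of _ "cball 0 \<epsilon>"])
      (use kernel_zero[OF that(1)] in \<open>auto intro!: continuous_on_mult kernel_continuous[OF that(1)]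
        continuous_on_compose2[OF that(2)] continuous_on_diff continuous_on_const c\<iota>\<close>)
  have "continuous_on UNIV (\<lambda>X. g X \<bullet> \<iota> b)"
    by (intro continuous_on_inner C1_continuous_gradient[OF f] continuous_on_const)
  from 0 Bochner_Integration.integral_diff[OF int[OF kernel_partial[OF \<kappa>] C1_continuous[OF f]] int[OF \<kappa>(2) this]]
  show ?thesis by (simp add: conv_def)
qed

lemma conv_support:
  assumes "linear \<iota>" "kernel \<epsilon> \<kappa>" "compact K" "\<And>X. X \<notin> K \<Longrightarrow> F X = 0"
  shows "compact ((\<lambda>(Z, w). Z + \<iota> w) ` (K \<times> cball 0 \<epsilon>))"
    and "X \<notin> (\<lambda>(Z, w). Z + \<iota> w) ` (K \<times> cball 0 \<epsilon>) \<Longrightarrow> conv \<iota> F \<kappa> X = 0"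
proof -
  have c\<iota>: "continuous_on UNIV \<iota>"
    using assms(1) by (simp add: linear_continuous_on linear_conv_bounded_linear)
  have "continuous_on (K \<times> cball 0 \<epsilon>) (\<lambda>z. fst z + \<iota> (snd z))"
    by (intro continuous_on_add continuous_on_compose2[OF c\<iota>] continuous_on_fst continuous_on_snd continuous_on_id) auto
  then show "compact ((\<lambda>(Z, w). Z + \<iota> w) ` (K \<times> cball 0 \<epsilon>))"
    by (intro compact_continuous_image compact_Times assms(3) compact_cball) (simp add: case_prod_beta)
  assume X: "X \<notin> (\<lambda>(Z, w). Z + \<iota> w) ` (K \<times> cball 0 \<epsilon>)"
  have 0: "\<kappa> w *\<^sub>R F (X - \<iota> w) = 0" for w
  proof (cases "w \<in> cball 0 \<epsilon> \<and> X - \<iota> w \<in> K")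
    case True
    then have "X \<in> (\<lambda>(Z, w). Z + \<iota> w) ` (K \<times> cball 0 \<epsilon>)"
      by (intro image_eqI[of _ _ "(X - \<iota> w, w)"]) auto
    with X show ?thesis by simp
  qed (use kernel_zero[OF assms(2)] assms(4) in auto)
  show "conv \<iota> F \<kappa> X = 0" unfolding conv_def 0 by simp
qed

text \<open>
  Uniform continuity of \<open>F\<close>. The quality of the approximation depends on the size
  of the support of the kernel only, not on the kernel.
\<close>

lemma conv_approximates:
  fixes F :: "'a::euclidean_space \<Rightarrow> 'c::euclidean_space"
  assumes \<iota>: "linear \<iota>" and F: "continuous_on UNIV F" "compact K" "\<And>X. X \<notin> K \<Longrightarrow> F X = 0" and "e > 0"
  obtains d where "d > 0"
    "\<And>\<kappa> X. kernel d \<kappa> \<Longrightarrow> (\<And>w. \<kappa> w \<ge> 0) \<Longrightarrow> (LINT w|lborel. \<kappa> w) = 1 \<Longrightarrow> norm (conv \<iota> F \<kappa> X - F X) \<le> e"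
proof -
  obtain B where B: "B > 0" "\<And>w. norm (\<iota> w) \<le> B * norm w"
    using linear_bounded_pos[OF \<iota>] by metis
  obtain r where r: "r > 0" "K \<subseteq> ball 0 r"
    using bounded_subset_ballD[OF compact_imp_bounded[OF F(2)]] by metis
  have "uniformly_continuous_on (cball 0 (r + 1)) F"
    using continuous_on_subset[OF F(1)] by (intro compact_uniformly_continuous) auto
  then obtain d' where d': "d' > 0" "\<And>X Y. X \<in> cball 0 (r + 1) \<Longrightarrow> Y \<in> cball 0 (r + 1) \<Longrightarrow> dist X Y < d' \<Longrightarrow> dist (F X) (F Y) < e"
    using \<open>e > 0\<close> unfolding uniformly_continuous_on_def by metis
  define d where "d = min d' 1"
  have d: "d > 0" "\<And>X Y. dist X Y < d \<Longrightarrow> dist (F X) (F Y) < e"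
  proof -
    show "d > 0" using d' by (simp add: d_def)
    fix X Y :: 'a assume XY: "dist X Y < d"
    show "dist (F X) (F Y) < e"
    proof (cases "X \<in> cball 0 (r + 1) \<and> Y \<in> cball 0 (r + 1)")
      case True
      then show ?thesis using d'(2) XY by (simp add: d_def)
    next
      case False
      have "norm X \<le> norm Y + dist X Y" "norm Y \<le> norm X + dist X Y"
        using norm_triangle_sub[of X Y] norm_triangle_sub[of Y X] by (simp_all add: dist_norm norm_minus_commute)
      then have "norm X > r \<and> norm Y > r" using False XY by (auto simp: d_def)
      then have "X \<notin> K" "Y \<notin> K" using r(2) by (auto simp: subset_iff)
      then show ?thesis using F(3) \<open>e > 0\<close> by simp
    qed
  qed
  show ?thesis
  proof (rule that[of "d / (2 * B)"])
    show "d / (2 * B) > 0" using d B by simp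
    fix \<kappa> :: "'b \<Rightarrow> real" and X
    assume \<kappa>: "kernel (d / (2 * B)) \<kappa>" "\<And>w. \<kappa> w \<ge> 0" "(LINT w|lborel. \<kappa> w) = 1"
    have c\<iota>: "continuous_on UNIV \<iota>"
      using \<iota> by (simp add: linear_continuous_on linear_conv_bounded_linear)
    have i1: "integrable lborel (\<lambda>w. \<kappa> w *\<^sub>R F (X - \<iota> w))"
      by (rule continuous_cpt_integrable[of _ "cball 0 (d / (2 * B))"])
        (use kernel_zero[OF \<kappa>(1)] in \<open>auto intro!: continuous_on_scaleR kernel_continuous[OF \<kappa>(1)]
          continuous_on_compose2[OF F(1)] continuous_on_diff continuous_on_const c\<iota>\<close>)
    have i2: "integrable lborel (\<lambda>w. \<kappa> w *\<^sub>R F X)"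
      using kernel_integrable[OF \<kappa>(1)] by simp
    have "conv \<iota> F \<kappa> X - F X = (LINT w|lborel. \<kappa> w *\<^sub>R F (X - \<iota> w) - \<kappa> w *\<^sub>R F X)"
      using i1 i2 \<kappa>(3) kernel_integrable[OF \<kappa>(1)] by (simp add: conv_def)
    also have "norm \<dots> \<le> (LINT w|lborel. norm (\<kappa> w *\<^sub>R F (X - \<iota> w) - \<kappa> w *\<^sub>R F X))"
      by (rule integral_norm_bound)
    also have "\<dots> \<le> (LINT w|lborel. \<kappa> w * e)"
    proof (rule integral_mono)
      fix w
      show "norm (\<kappa> w *\<^sub>R F (X - \<iota> w) - \<kappa> w *\<^sub>R F X) \<le> \<kappa> w * e"
      proof (cases "w \<in> cball 0 (d / (2 * B))")
        case True
        then have "B * norm w < d" using B d by (simp add: field_simps)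
        then have "norm (F (X - \<iota> w) - F X) \<le> e"
          using d(2)[of "X - \<iota> w" X] B(2)[of w] by (simp add: dist_norm)
        then show ?thesis
          using \<kappa>(2)[of w] by (simp add: scaleR_diff_right[symmetric] mult_left_mono)
      qed (use kernel_zero[OF \<kappa>(1)] in auto)
    qed (use i1 i2 kernel_integrable[OF \<kappa>(1)] in auto)
    also have "\<dots> = e" using \<kappa>(3) by simp
    finally show "norm (conv \<iota> F \<kappa> X - F X) \<le> e" .
  qed
qed

lemma integral_reflect:
  fixes f :: "'a::euclidean_space \<Rightarrow> 'b::{banach,second_countable_topology}"
  assumes "f \<in> borel_measurable borel"
  shows "(LINT x|lborel. f (c - x)) = (LINT x|lborel. f x)"
  by (subst (2) lborel_affine[of "-1" c]) (simp_all add: density_1 integral_distr assms)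

lemma conv_commute:
  fixes F :: "'a::euclidean_space \<Rightarrow> real"
  assumes "F \<in> borel_measurable borel" "\<rho> \<in> borel_measurable borel"
  shows "conv (\<lambda>w. w) F \<rho> X = conv (\<lambda>w. w) \<rho> F X"
  using integral_reflect[of "\<lambda>w. \<rho> w *\<^sub>R F (X - w)" X] assms by (simp add: conv_def mult.commute)

text \<open>
  Regularity of a convolution comes from the smoother factor, the kernel being merely
  continuous.
\<close>

lemma smooth_conv:
  assumes "smooth \<rho>" "kernel \<epsilon> F"
  shows "smooth (conv (\<lambda>w. w) \<rho> F)"
proof -
  have "C_diff m (conv (\<lambda>w. w) \<rho> F)" for m
    using assms(1)
  proof (induction m arbitrary: \<rho>)
    case 0
    from C1_continuous[OF C1_conv[OF smooth_C1[OF 0] linear_id assms(2)], of UNIV]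
    show ?case by (simp add: id_def)
  next
    case (Suc m)
    have c: "C1 (conv (\<lambda>w. w) \<rho> F) (conv (\<lambda>w. w) (grad \<rho>) F)"
      using C1_conv[OF smooth_C1[OF Suc.prems] linear_id assms(2)] by (simp add: id_def)
    show ?case
    proof (rule C_diff_SucI)
      show "(conv (\<lambda>w. w) \<rho> F has_derivative (\<lambda>v. conv (\<lambda>w. w) (grad \<rho>) F x \<bullet> v)) (at x)" for x
        by (rule C1_D[OF c])
      fix b :: 'a assume b: "b \<in> Basis"
      have "integrable lborel (\<lambda>w. F w *\<^sub>R grad \<rho> (X - w))" for X
        by (rule continuous_cpt_integrable[of _ "cball 0 \<epsilon>"])
          (use kernel_zero[OF assms(2)] in \<open>auto intro!: continuous_on_scaleR kernel_continuous[OF assms(2)]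
            continuous_on_compose2[OF C1_continuous_gradient[OF smooth_C1[OF Suc.prems], of UNIV]] continuous_on_diff continuous_on_const continuous_on_id\<close>)
      then have "conv (\<lambda>w. w) (grad \<rho>) F X \<bullet> b = conv (\<lambda>w. w) (\<lambda>x. grad \<rho> x \<bullet> b) F X" for X
        unfolding conv_def by (subst integral_inner_left[symmetric]) auto
      then show "C_diff m (\<lambda>x. conv (\<lambda>w. w) (grad \<rho>) F x \<bullet> b)"
        using Suc.IH[OF smooth_partial[OF Suc.prems b]] by simp
    qed
  qed
  then show ?thesis by (simp add: smooth_def)
qed

section \<open>Cut-off functions on cylinders\<close>

text \<open>
  A transition from 0 to 1 on the unit interval that is only \<open>C\<^sup>1\<close>: the
  energy estimates use first derivatives only.
\<close>

definition transition :: "real \<Rightarrow> real"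
  where "transition t = (max 0 t)\<^sup>2 / ((max 0 t)\<^sup>2 + (max 0 (1 - t))\<^sup>2)"

lemma max0_squared_derivative: "((\<lambda>t. (max 0 t)\<^sup>2) has_field_derivative 2 * max 0 t) (at (t::real))"
proof -
  consider "t > 0" | "t < 0" | "t = 0" by linarith
  then show ?thesis
  proof cases
    case 1
    have "((\<lambda>t. t\<^sup>2) has_field_derivative 2 * max 0 t) (at t)"
      using 1 by (auto intro!: derivative_eq_intros)
    then show ?thesis
      by (rule has_field_derivative_transform_within_open[of _ _ _ "{0<..}"]) (use 1 in auto)
  next
    case 2
    have "((\<lambda>t. 0) has_field_derivative 2 * max 0 t) (at t)"
      using 2 by auto
    then show ?thesis
      by (rule has_field_derivative_transform_within_open[of _ _ _ "{..<0}"]) (use 2 in auto)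
  next
    case 3
    have "((\<lambda>h. max 0 (h::real)) \<longlongrightarrow> 0) (at 0)"
      using tendsto_max[OF tendsto_const[of "0::real"] tendsto_ident_at[of 0 UNIV]] by simp
    then have "((\<lambda>h. (max 0 (h::real))\<^sup>2 / h) \<longlongrightarrow> 0) (at 0)"
      by (rule Lim_transform_eventually) (auto simp: eventually_at_filter max_def power2_eq_square)
    then show ?thesis using 3 by (simp add: DERIV_def)
  qed
qed

lemma transition_denominator: "(max 0 t)\<^sup>2 + (max 0 (1 - t))\<^sup>2 > (0::real)"
proof (cases "t > 0")
  case True
  then have "(max 0 t)\<^sup>2 > 0" by simp
  then show ?thesis by (simp add: add_pos_nonneg)
next
  case False
  then have "(max 0 (1 - t))\<^sup>2 > 0" by simp
  then show ?thesis by (simp add: add_nonneg_pos)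
qed

lemma transition_C1: "\<exists>s'. (\<forall>t. (transition has_field_derivative s' t) (at t)) \<and> continuous_on UNIV s'"
proof -
  define s' where "s' t = (2 * max 0 t * ((max 0 t)\<^sup>2 + (max 0 (1 - t))\<^sup>2) - (max 0 t)\<^sup>2 * (2 * max 0 t + - (2 * max 0 (1 - t))))
    / (((max 0 t)\<^sup>2 + (max 0 (1 - t))\<^sup>2) * ((max 0 t)\<^sup>2 + (max 0 (1 - t))\<^sup>2))" for t :: real
  have d: "(max 0 t)\<^sup>2 + (max 0 (1 - t))\<^sup>2 \<noteq> 0" for t :: real using transition_denominator[of t] by linarith
  have m: "((\<lambda>t. (max 0 (1 - t))\<^sup>2) has_field_derivative - (2 * max 0 (1 - t))) (at (t::real))" for t
  proof -
    have "((\<lambda>t::real. 1 - t) has_field_derivative -1) (at t)"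
      by (auto intro!: derivative_eq_intros)
    from DERIV_chain2[where f="\<lambda>t. (max 0 t)\<^sup>2", OF max0_squared_derivative[of "1 - t"] this]
    show ?thesis by simp
  qed
  have "(transition has_field_derivative s' t) (at t)" for t
    unfolding transition_def[abs_def] s'_def
    by (rule DERIV_divide[OF max0_squared_derivative[of t] DERIV_add[OF max0_squared_derivative[of t] m[of t]] d])
  moreover have "continuous_on UNIV s'"
    unfolding s'_def using d by (intro continuous_intros) (auto simp del: sum_power2_eq_zero_iff)
  ultimately show ?thesis by blast
qed

lemma transition_range: "0 \<le> transition t" "transition t \<le> 1"
  using transition_denominator[of t] by (auto simp: transition_def divide_simps)

lemma transition_eq: "t \<le> 0 \<Longrightarrow> transition t = 0" "t \<ge> 1 \<Longrightarrow> transition t = 1"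
  by (auto simp: transition_def max_def)

lemma C1_transition:
  assumes "C1 f g"
  shows "\<exists>h. C1 (\<lambda>X. transition (f X)) h"
  using transition_C1 C1_compose_real[OF assms, of transition] by metis

lemma C1_inner_fst: "C1 (\<lambda>X::(real^'n) \<times> real. fst X \<bullet> fst X) (\<lambda>X. (2 *\<^sub>R fst X, 0))"
  unfolding C1_def
proof (intro conjI allI)
  show "((\<lambda>X::(real^'n) \<times> real. fst X \<bullet> fst X) has_derivative (\<lambda>v. (2 *\<^sub>R fst X, 0) \<bullet> v)) (at X)" for X
    by (auto intro!: derivative_eq_intros simp: inner_prod_def inner_commute)
qed (auto intro!: continuous_intros)

lemma C1_snd_squared: "C1 (\<lambda>X::(real^'n) \<times> real. snd X * snd X) (\<lambda>X. (0, 2 * snd X))"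
  unfolding C1_def
proof (intro conjI allI)
  show "((\<lambda>X::(real^'n) \<times> real. snd X * snd X) has_derivative (\<lambda>v. (0, 2 * snd X) \<bullet> v)) (at X)" for X
    by (auto intro!: derivative_eq_intros simp: inner_prod_def)
qed (auto intro!: continuous_intros)

lemma mem_cyl: "X \<in> cyl X0 r \<longleftrightarrow> norm (fst X - fst X0) < r \<and> \<bar>snd X - snd X0\<bar> < r"
  by (cases X) (auto simp: cyl_def dist_norm norm_minus_commute)

lemma mem_cyl_0: "X \<in> cyl 0 r \<longleftrightarrow> norm (fst X) < r \<and> \<bar>snd X\<bar> < r"
  by (simp add: mem_cyl)

lemma open_cyl: "open (cyl X0 r)"
  unfolding cyl_def by (intro open_Times) auto

lemma borel_cyl[measurable]: "cyl X0 r \<in> sets borel"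
  by (rule borel_open[OF open_cyl])

lemma bounded_cyl: "bounded (cyl X0 r)"
  unfolding cyl_def by (intro bounded_Times) auto

lemma compact_closed_cyl: "compact {X::(real^'n) \<times> real. norm (fst X) \<le> r \<and> \<bar>snd X\<bar> \<le> r}"
proof -
  have "{X::(real^'n) \<times> real. norm (fst X) \<le> r \<and> \<bar>snd X\<bar> \<le> r} = cball 0 r \<times> cball 0 r"
    by auto
  then show ?thesis by (simp add: compact_Times)
qed

text \<open>
  The squares \<open>|x|\<^sup>2\<close> and \<open>y\<^sup>2\<close> are cut off separately,
  because a cylinder is a product of balls.
\<close>

lemma cutoff:
  assumes "0 < r" "r < r'"
  obtains \<zeta> :: "(real^'n) \<times> real \<Rightarrow> real" and z K L where "C1 \<zeta> z" "\<And>X. 0 \<le> \<zeta> X" "\<And>X. \<zeta> X \<le> 1"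
    "\<And>X. X \<in> cyl 0 r \<Longrightarrow> \<zeta> X = 1" "compact K" "K \<subseteq> cyl 0 r'" "\<And>X. X \<notin> K \<Longrightarrow> \<zeta> X = 0"
    "L > 0" "\<And>X. norm (z X) \<le> L"
proof -
  define \<rho> where "\<rho> = (r + r') / 2"
  have \<rho>: "r < \<rho>" "\<rho> < r'" using assms by (auto simp: \<rho>_def)
  define q where "q = \<rho>\<^sup>2 - r\<^sup>2"
  have q: "q > 0" using \<rho> assms by (simp add: q_def power_strict_mono)
  define a b where "a X = (\<rho>\<^sup>2 - fst X \<bullet> fst X) * (1 / q)" and "b X = (\<rho>\<^sup>2 - snd X * snd X) * (1 / q)" for X :: "(real^'n) \<times> real"
  obtain ga gb where "C1 (\<lambda>X. transition (a X)) ga" "C1 (\<lambda>X. transition (b X)) gb"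
    using C1_transition[OF C1_mult[OF C1_diff[OF C1_const C1_inner_fst] C1_const]]
      C1_transition[OF C1_mult[OF C1_diff[OF C1_const C1_snd_squared] C1_const]]
    unfolding a_def b_def by blast
  from C1_mult[OF this] obtain z where z: "C1 (\<lambda>X. transition (a X) * transition (b X)) z" by blast
  define K where "K = {X::(real^'n) \<times> real. norm (fst X) \<le> \<rho> \<and> \<bar>snd X\<bar> \<le> \<rho>}"
  have K: "compact K" unfolding K_def by (rule compact_closed_cyl)
  have 0: "transition (a X) * transition (b X) = 0" if "X \<notin> K" for X
  proof -
    have "norm (fst X) > \<rho> \<or> \<bar>snd X\<bar> > \<rho>" using that by (simp add: K_def del: split_paired_All) linarith
    then consider "norm (fst X) > \<rho>" | "\<bar>snd X\<bar> > \<rho>" by blast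
    then show ?thesis
    proof cases
      case 1
      then have "\<rho>\<^sup>2 \<le> (norm (fst X))\<^sup>2" using \<rho> assms by (intro power_mono) auto
      then have "a X \<le> 0" using q by (simp add: a_def dot_square_norm divide_simps)
      then show ?thesis by (simp add: transition_eq)
    next
      case 2
      then have "\<rho>\<^sup>2 \<le> \<bar>snd X\<bar>\<^sup>2" using \<rho> assms by (intro power_mono) auto
      then have "b X \<le> 0" using q by (simp add: b_def power2_eq_square[symmetric] divide_simps)
      then show ?thesis by (simp add: transition_eq)
    qed
  qed
  have 1: "transition (a X) * transition (b X) = 1" if "X \<in> cyl 0 r" for X
  proof -
    have X: "norm (fst X) < r" "\<bar>snd X\<bar> < r" using that by (auto simp: mem_cyl_0)
    have "(norm (fst X))\<^sup>2 \<le> r\<^sup>2" "\<bar>snd X\<bar>\<^sup>2 \<le> r\<^sup>2" using X by (intro power_mono; linarith | simp)+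
    then have "a X \<ge> 1" "b X \<ge> 1" using q by (auto simp: a_def b_def q_def dot_square_norm power2_eq_square[of "snd X", symmetric] divide_simps)
    then show ?thesis by (simp add: transition_eq)
  qed
  have z0: "z X = 0" if "X \<notin> K" for X
    by (rule C1_gradient_zero_outside[OF z compact_imp_closed[OF K] 0 that])
  obtain L where L: "L > 0" "\<And>X. norm (z X) \<le> L"
    using continuous_cpt_bounded[OF C1_continuous_gradient[OF z] K z0] by metis
  show ?thesis
  proof (rule that[OF z _ _ 1 K _ 0 L])
    show "0 \<le> transition (a X) * transition (b X)" for X
      by (simp add: transition_range)
    show "transition (a X) * transition (b X) \<le> 1" for X
      by (simp add: transition_range mult_le_one)
    show "K \<subseteq> cyl 0 r'" using \<rho> by (auto simp: mem_cyl_0 K_def)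
  qed
qed

section \<open>Equations whose coefficients depend on the vertical variable\<close>

definition flux :: "real^'n^'n \<Rightarrow> (real^'n) \<times> real \<Rightarrow> (real^'n::finite) \<times> real"
  where "flux B X = (B *v fst X, snd X)"

lemma linear_flux: "linear (flux B)"
  by (rule linearI) (auto simp: flux_def matrix_vector_right_distrib matrix_vector_mult_scaleR plus_prod_def scaleR_prod_def)

definition horizontal :: "real^'n \<Rightarrow> (real^'n::finite) \<times> real"
  where "horizontal w = (w, 0)"

lemma linear_horizontal: "linear horizontal"
  by (rule linearI) (auto simp: horizontal_def)

lemma linear_minus_horizontal: "linear (\<lambda>w. - horizontal w)"
  by (rule linear_compose_neg[OF linear_horizontal])

text \<open>
  The field \<open>G\<close> plays the part of the gradient of a solution. It is the limit of
  gradients of functions vanishing on \<open>F\<close>, which is the flat part of the boundary,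
  or empty in the interior.
\<close>

definition solution_on ::
  "real^'n^'n \<Rightarrow> (real \<Rightarrow> real) \<Rightarrow> ((real^'n) \<times> real) set \<Rightarrow> ((real^'n) \<times> real) set \<Rightarrow>
    ((real^'n) \<times> real \<Rightarrow> (real^'n::finite) \<times> real) \<Rightarrow> bool"
  where "solution_on B \<mu> E F G \<longleftrightarrow>
    G \<in> borel_measurable borel \<and>
    (\<integral>\<^sup>+X\<in>E. ennreal ((norm (G X))\<^sup>2) \<partial>lborel) < \<infinity> \<and>
    (\<forall>e>0. \<exists>f g. C1 f g \<and> (\<forall>X\<in>F. f X = 0) \<and>
       (\<integral>\<^sup>+X\<in>E. ennreal ((norm (G X - g X))\<^sup>2) \<partial>lborel) < ennreal e) \<and>
    (\<forall>\<phi> h K. C1 \<phi> h \<longrightarrow> compact K \<longrightarrow> K \<subseteq> E \<longrightarrow> (\<forall>X. X \<notin> K \<longrightarrow> \<phi> X = 0) \<longrightarrow>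
       (LINT X:E|lborel. \<mu> (snd X) * (flux B (G X) \<bullet> h X)) = 0)"

text \<open>
  The normalised situation. The field is zero outside the cylinder so that it can be integrated
  and convolved over the whole space.
\<close>

definition unit_solution ::
  "real \<Rightarrow> real \<Rightarrow> real^'n^'n \<Rightarrow> (real \<Rightarrow> real) \<Rightarrow> ((real^'n) \<times> real \<Rightarrow> (real^'n::finite) \<times> real) \<Rightarrow> bool"
  where "unit_solution \<Lambda> c B \<mu> G \<longleftrightarrow>
    (\<forall>\<xi>. (norm \<xi>)\<^sup>2 / \<Lambda> \<le> flux B \<xi> \<bullet> \<xi>) \<and> (\<forall>\<xi>. norm (flux B \<xi>) \<le> \<Lambda> * norm \<xi>) \<and>
    \<mu> \<in> borel_measurable borel \<and> (\<forall>y. 1 \<le> \<mu> y \<and> \<mu> y \<le> c) \<and>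
    solution_on B \<mu> (cyl 0 1) {} G \<and> (\<forall>X. X \<notin> cyl 0 1 \<longrightarrow> G X = 0)"

lemma unit_solutionD:
  assumes "unit_solution \<Lambda> c B \<mu> G"
  shows "(norm \<xi>)\<^sup>2 / \<Lambda> \<le> flux B \<xi> \<bullet> \<xi>" "norm (flux B \<xi>) \<le> \<Lambda> * norm \<xi>"
    "\<mu> \<in> borel_measurable borel" "1 \<le> \<mu> y" "\<mu> y \<le> c" "G \<in> borel_measurable borel"
    "X \<notin> cyl 0 1 \<Longrightarrow> G X = 0"
    "e > 0 \<Longrightarrow> \<exists>f g. C1 f g \<and> (\<integral>\<^sup>+X\<in>cyl 0 1. ennreal ((norm (G X - g X))\<^sup>2) \<partial>lborel) < ennreal e"
  using assms unfolding unit_solution_def solution_on_def by (simp_all del: split_paired_All)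

lemma unit_solution_weak:
  assumes "unit_solution \<Lambda> c B \<mu> G" "C1 \<phi> h" "compact K" "K \<subseteq> cyl 0 1" "\<And>X. X \<notin> K \<Longrightarrow> \<phi> X = 0"
  shows "(LINT X|lborel. (\<mu> (snd X) *\<^sub>R flux B (G X)) \<bullet> h X) = 0"
proof -
  have "(LINT X:cyl 0 1|lborel. \<mu> (snd X) * (flux B (G X) \<bullet> h X)) = 0"
    using assms unfolding unit_solution_def solution_on_def by blast
  moreover have eq: "indicator (cyl 0 1) X *\<^sub>R (\<mu> (snd X) * (flux B (G X) \<bullet> h X)) = (\<mu> (snd X) *\<^sub>R flux B (G X)) \<bullet> h X" for X
    using unit_solutionD(7)[OF assms(1), of X] by (auto simp: indicator_def linear_0[OF linear_flux])
  ultimately show ?thesis by (simp only: set_lebesgue_integral_def eq)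
qed

lemma unit_solution_integrable:
  assumes "unit_solution \<Lambda> c B \<mu> G"
  shows "integrable lborel (\<lambda>X. (norm (G X))\<^sup>2)" "integrable lborel G"
proof -
  note [measurable] = unit_solutionD(6)[OF assms]
  have "(\<integral>\<^sup>+X\<in>cyl 0 1. ennreal ((norm (G X))\<^sup>2) \<partial>lborel) < \<infinity>"
    using assms unfolding unit_solution_def solution_on_def by blast
  moreover have "(\<integral>\<^sup>+X\<in>cyl 0 1. ennreal ((norm (G X))\<^sup>2) \<partial>lborel) = (\<integral>\<^sup>+X. ennreal ((norm (G X))\<^sup>2) \<partial>lborel)"
    using unit_solutionD(7)[OF assms] by (intro nn_integral_cong) (auto simp: indicator_def)
  ultimately show 1: "integrable lborel (\<lambda>X. (norm (G X))\<^sup>2)"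
    by (simp add: integrable_iff_bounded)
  have i: "integrable lborel (\<lambda>X. indicator (cyl 0 1) X + (norm (G X))\<^sup>2)"
    by (intro Bochner_Integration.integrable_add 1 integrable_real_indicator emeasure_bounded_finite[OF bounded_cyl]) auto
  show "integrable lborel G"
  proof (rule Bochner_Integration.integrable_bound[OF i])
    show "AE X in lborel. norm (G X) \<le> norm (indicator (cyl 0 1) X + (norm (G X))\<^sup>2)"
    proof (rule AE_I2)
      fix X
      have "2 * norm (G X) \<le> 1 + (norm (G X))\<^sup>2"
        using sum_power2_ge_zero[of "norm (G X) - 1" 0] by (simp add: power2_diff)
      moreover have "0 \<le> norm (G X)" by simp
      ultimately have "norm (G X) \<le> 1 + (norm (G X))\<^sup>2" by linarith
      then show "norm (G X) \<le> norm (indicator (cyl 0 1) X + (norm (G X))\<^sup>2)"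
        using unit_solutionD(7)[OF assms, of X] by (auto simp: indicator_def)
    qed
  qed measurable
qed

lemma weighted_flux_measurable:
  fixes G :: "(real^'n::finite) \<times> real \<Rightarrow> (real^'n) \<times> real"
  assumes "\<mu> \<in> borel_measurable borel" "G \<in> borel_measurable borel"
  shows "(\<lambda>X. \<mu> (snd X) *\<^sub>R flux B (G X)) \<in> borel_measurable borel"
proof -
  note [measurable] = assms linear_measurable[OF linear_flux, of B]
  have [measurable]: "snd \<in> borel_measurable (borel :: ((real^'n) \<times> real) measure)"
    by (intro borel_measurable_continuous_onI continuous_on_snd continuous_on_id)
  show ?thesis by measurable
qed

lemma unit_solution_flux_integrable:
  assumes "unit_solution \<Lambda> c B \<mu> G"
  shows "integrable lborel (\<lambda>X. \<mu> (snd X) *\<^sub>R flux B (G X))"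
proof (rule Bochner_Integration.integrable_bound[OF integrable_mult_right[OF integrable_norm[OF unit_solution_integrable(2)[OF assms]], of "c * \<Lambda>"]])
  show "(\<lambda>X. \<mu> (snd X) *\<^sub>R flux B (G X)) \<in> borel_measurable lborel"
    using weighted_flux_measurable[OF unit_solutionD(3,6)[OF assms]] by simp
  show "AE X in lborel. norm (\<mu> (snd X) *\<^sub>R flux B (G X)) \<le> norm (c * \<Lambda> * norm (G X))"
  proof (rule AE_I2)
    fix X
    have "\<mu> (snd X) * norm (flux B (G X)) \<le> c * (\<Lambda> * norm (G X))"
      using unit_solutionD(2)[OF assms, of "G X"] unit_solutionD(4,5)[OF assms, of "snd X"] order_trans[OF zero_le_one unit_solutionD(4)[OF assms, of "snd X"]]
      by (intro mult_mono) auto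
    moreover have "norm (\<mu> (snd X) *\<^sub>R flux B (G X)) = \<mu> (snd X) * norm (flux B (G X))"
      using unit_solutionD(4)[OF assms, of "snd X"] by simp
    ultimately have "norm (\<mu> (snd X) *\<^sub>R flux B (G X)) \<le> c * \<Lambda> * norm (G X)"
      by (metis mult.assoc)
    then show "norm (\<mu> (snd X) *\<^sub>R flux B (G X)) \<le> norm (c * \<Lambda> * norm (G X))"
      unfolding real_norm_def by (rule order_trans[OF _ abs_ge_self])
  qed
qed

text \<open>
  The coefficients do not depend on the horizontal variables, so they commute with horizontal
  convolution. This fact carries the whole interior estimate.
\<close>

lemma conv_flux_AE:
  assumes "unit_solution \<Lambda> c B \<mu> G" "kernel \<epsilon> \<kappa>"
  shows "AE X in lborel. conv horizontal (\<lambda>X. \<mu> (snd X) *\<^sub>R flux B (G X)) \<kappa> X = \<mu> (snd X) *\<^sub>R flux B (conv horizontal G \<kappa> X)"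
  using conv_AE_integrable[OF linear_horizontal unit_solution_integrable(2)[OF assms(1)] kernel_integrable[OF assms(2)]]
proof eventually_elim
  case (elim X)
  have bl: "bounded_linear (\<lambda>\<xi>. \<mu> (snd X) *\<^sub>R flux B \<xi>)"
    using linear_flux[of B] by (intro bounded_linear_scaleR_right[THEN bounded_linear_compose]) (simp add: linear_conv_bounded_linear)
  have "(LINT w|lborel. \<mu> (snd X) *\<^sub>R flux B (\<kappa> w *\<^sub>R G (X - horizontal w))) = \<mu> (snd X) *\<^sub>R flux B (conv horizontal G \<kappa> X)"
    unfolding conv_def by (rule integral_bounded_linear[OF bl elim])
  then show ?case
    by (simp add: conv_def horizontal_def linear_scale[OF linear_flux] mult.commute)
qed

text \<open>
  The weak equation for \<open>G\<close> is tested with the horizontal convolution of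
  \<open>\<phi>\<close> with the reflected kernel, which is still supported in the unit
  cylinder.
\<close>

lemma weak_equation_mollified:
  assumes G: "unit_solution \<Lambda> c B \<mu> G" and \<kappa>: "kernel \<epsilon> \<kappa>"
    and \<phi>: "C1 \<phi> h" "compact K" "K \<subseteq> cyl 0 r" "r + \<epsilon> \<le> 1" "\<And>X. X \<notin> K \<Longrightarrow> \<phi> X = 0"
  shows "integrable lborel (\<lambda>X. \<mu> (snd X) * (flux B (conv horizontal G \<kappa> X) \<bullet> h X))"
    and "(LINT X|lborel. \<mu> (snd X) * (flux B (conv horizontal G \<kappa> X) \<bullet> h X)) = 0"
proof -
  let ?F = "\<lambda>X. \<mu> (snd X) *\<^sub>R flux B (G X)"
  have h0: "h X = 0" if "X \<notin> K" for X
    using C1_gradient_zero_outside[OF \<phi>(1) compact_imp_closed[OF \<phi>(2)] \<phi>(5) that] .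
  obtain b where b: "\<And>X. norm (h X) \<le> b"
    using continuous_cpt_bounded[OF C1_continuous_gradient[OF \<phi>(1)] \<phi>(2) h0] by metis
  let ?K = "(\<lambda>(Z, w). Z + - horizontal w) ` (K \<times> cball 0 \<epsilon>)"
  have "?K \<subseteq> cyl 0 1"
  proof
    fix X assume "X \<in> ?K"
    then obtain Z w where Z: "Z \<in> K" "norm w \<le> \<epsilon>" "X = Z - horizontal w" by auto
    have "norm (fst Z) < r" "\<bar>snd Z\<bar> < r" using Z \<phi>(3) by (auto simp: mem_cyl_0)
    moreover have "norm (fst Z - w) \<le> norm (fst Z) + norm w" by (rule norm_triangle_ineq4)
    moreover have "0 \<le> \<epsilon>" using order_trans[OF norm_ge_zero Z(2)] .
    ultimately have "norm (fst Z - w) < 1" "\<bar>snd Z\<bar> < 1" using Z(2) \<phi>(4) by linarith+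
    then show "X \<in> cyl 0 1" by (simp add: mem_cyl_0 Z(3) horizontal_def)
  qed
  note sub = this
  have s0: "conv (\<lambda>w. - horizontal w) \<phi> \<kappa> X = 0" if "X \<notin> ?K" for X
    by (rule conv_support(2)[OF linear_minus_horizontal \<kappa> \<phi>(2) \<phi>(5) that])
  have "(LINT X|lborel. ?F X \<bullet> conv (\<lambda>w. - horizontal w) h \<kappa> X) = 0"
    by (rule unit_solution_weak[OF G C1_conv[OF \<phi>(1) linear_minus_horizontal \<kappa>]
        conv_support(1)[OF linear_minus_horizontal \<kappa> \<phi>(2) \<phi>(5)] sub s0])
  then have *: "(LINT X|lborel. conv horizontal ?F \<kappa> X \<bullet> h X) = 0"
    using conv_duality[OF linear_horizontal unit_solution_flux_integrable[OF G] \<kappa> C1_measurable(2)[OF \<phi>(1)] b] by simp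
  note [measurable] = C1_measurable(2)[OF \<phi>(1)] unit_solutionD(3)[OF G]
    conv_measurable[OF linear_horizontal unit_solutionD(6)[OF G] kernel_measurable[OF \<kappa>]] linear_measurable[OF linear_flux, of B]
  have [measurable]: "snd \<in> borel_measurable (borel :: ((real^'a) \<times> real) measure)"
    by (intro borel_measurable_continuous_onI continuous_on_snd continuous_on_id)
  have m1: "(\<lambda>X. \<mu> (snd X) * (flux B (conv horizontal G \<kappa> X) \<bullet> h X)) \<in> borel_measurable lborel" by measurable
  have ae: "AE X in lborel. conv horizontal ?F \<kappa> X \<bullet> h X = \<mu> (snd X) * (flux B (conv horizontal G \<kappa> X) \<bullet> h X)"
    using conv_flux_AE[OF G \<kappa>] by eventually_elim simp
  have ci: "integrable lborel (conv horizontal ?F \<kappa>)"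
    by (rule conv_integrable[OF linear_horizontal unit_solution_flux_integrable[OF G] kernel_integrable[OF \<kappa>]])
  note [measurable] = borel_measurable_integrable[OF ci]
  have m2: "(\<lambda>X. conv horizontal ?F \<kappa> X \<bullet> h X) \<in> borel_measurable lborel" by measurable
  have i: "integrable lborel (\<lambda>X. conv horizontal ?F \<kappa> X \<bullet> h X)"
  proof (rule Bochner_Integration.integrable_bound[OF integrable_mult_right[OF integrable_norm[OF ci], of b] m2])
    show "AE X in lborel. norm (conv horizontal ?F \<kappa> X \<bullet> h X) \<le> norm (b * norm (conv horizontal ?F \<kappa> X))"
    proof (rule AE_I2)
      fix X
      have "\<bar>conv horizontal ?F \<kappa> X \<bullet> h X\<bar> \<le> b * norm (conv horizontal ?F \<kappa> X)"
        unfolding mult.commute[of b]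
        by (rule order_trans[OF Cauchy_Schwarz_ineq2 mult_left_mono[OF b norm_ge_zero]])
      then show "norm (conv horizontal ?F \<kappa> X \<bullet> h X) \<le> norm (b * norm (conv horizontal ?F \<kappa> X))"
        unfolding real_norm_def by (rule order_trans[OF _ abs_ge_self])
    qed
  qed
  show "integrable lborel (\<lambda>X. \<mu> (snd X) * (flux B (conv horizontal G \<kappa> X) \<bullet> h X))"
    by (rule iffD1[OF integrable_cong_AE[OF m2 m1 ae] i])
  show "(LINT X|lborel. \<mu> (snd X) * (flux B (conv horizontal G \<kappa> X) \<bullet> h X)) = 0"
    unfolding integral_cong_AE[OF m2 m1 ae, symmetric] by (rule *)
qed

section \<open>Energy estimates for horizontal derivatives\<close>

text \<open>
  A pointwise inequality is integrated although the integrability of \<open>P\<close> is a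
  consequence and not an assumption.
\<close>

lemma nn_integral_le_of_integral_eq_0:
  fixes T P N :: "'a \<Rightarrow> real"
  assumes T: "integrable M T" "(LINT x|M. T x) = 0"
    and P: "P \<in> borel_measurable M" "\<And>x. 0 \<le> P x" and N: "N \<in> borel_measurable M" "\<And>x. 0 \<le> N x"
    and le: "AE x in M. P x \<le> T x + N x"
  shows "(\<integral>\<^sup>+x. ennreal (P x) \<partial>M) \<le> (\<integral>\<^sup>+x. ennreal (N x) \<partial>M)"
proof (cases "(\<integral>\<^sup>+x. ennreal (N x) \<partial>M) < \<infinity>")
  case True
  then have Ni: "integrable M N" using N by (simp add: integrable_iff_bounded)
  have "integrable M (\<lambda>x. T x + N x)" using T Ni by simp
  then have Pi: "integrable M P"
  proof (rule Bochner_Integration.integrable_bound[OF _ P(1)])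
    show "AE x in M. norm (P x) \<le> norm (T x + N x)" using le by eventually_elim (use P(2) in auto)
  qed
  have "(LINT x|M. P x) \<le> (LINT x|M. T x + N x)"
    by (rule integral_mono_AE[OF Pi _ le]) (use T Ni in simp)
  then have "(LINT x|M. P x) \<le> (LINT x|M. N x)" using T Ni by simp
  then show ?thesis
    using P(2) N(2) by (simp add: nn_integral_eq_integral[OF Pi] nn_integral_eq_integral[OF Ni] ennreal_leI)
qed (auto simp: not_less top.extremum_unique)

text \<open>
  The algebra of the Caccioppoli inequality at one point: \<open>\<xi>\<close> is the gradient
  of the solution, \<open>F\<close> its flux, \<open>\<xi> - D\<close> and \<open>w\<close> the
  gradient and the value of the approximating function, \<open>\<zeta>\<close> the cut-off with
  gradient \<open>z\<close>. Ellipticity bounds the quadratic term from below, Young's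
  inequality absorbs the rest.
\<close>

lemma energy_pointwise:
  fixes \<xi> D z F :: "'a::real_inner" and \<zeta> w m \<Lambda> c L :: real
  assumes "\<Lambda> > 0" "1 \<le> m" "m \<le> c" "0 \<le> \<zeta>" "\<zeta> \<le> 1" "norm z \<le> L"
    and F: "(norm \<xi>)\<^sup>2 / \<Lambda> \<le> F \<bullet> \<xi>" "norm F \<le> \<Lambda> * norm \<xi>"
  shows "\<zeta>\<^sup>2 * (norm \<xi>)\<^sup>2 / (2 * \<Lambda>) \<le> m * (F \<bullet> (\<zeta>\<^sup>2 *\<^sub>R (\<xi> - D) + w *\<^sub>R (2 * \<zeta>) *\<^sub>R z))
    + \<Lambda> ^ 3 * c\<^sup>2 * ((norm D)\<^sup>2 + 4 * L\<^sup>2 * w\<^sup>2)"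
proof -
  have c0: "c \<ge> 0" and L0: "L \<ge> 0" using assms order_trans[OF norm_ge_zero assms(6)] by auto
  have young: "a * b \<le> b\<^sup>2 / (4 * \<Lambda>) + \<Lambda> * a\<^sup>2" for a b :: real
  proof -
    have "0 \<le> (b - 2 * \<Lambda> * a)\<^sup>2 / (4 * \<Lambda>)" using assms(1) by simp
    also have "\<dots> = b\<^sup>2 / (4 * \<Lambda>) + \<Lambda> * a\<^sup>2 - a * b"
      using assms(1) by (simp add: power2_eq_square field_simps)
    finally show ?thesis by simp
  qed
  have 1: "\<zeta>\<^sup>2 * (norm \<xi>)\<^sup>2 / \<Lambda> \<le> m * (\<zeta>\<^sup>2 * (F \<bullet> \<xi>))"
  proof -
    have "\<zeta>\<^sup>2 * ((norm \<xi>)\<^sup>2 / \<Lambda>) \<le> \<zeta>\<^sup>2 * (F \<bullet> \<xi>)" using F(1) by (intro mult_left_mono) auto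
    moreover have "0 \<le> \<zeta>\<^sup>2 * ((norm \<xi>)\<^sup>2 / \<Lambda>)" using assms by simp
    moreover have "1 * (\<zeta>\<^sup>2 * (F \<bullet> \<xi>)) \<le> m * (\<zeta>\<^sup>2 * (F \<bullet> \<xi>))"
      using assms(2) calculation by (intro mult_right_mono) linarith+
    ultimately show ?thesis by simp
  qed
  have mF: "m * \<bar>F \<bullet> v\<bar> \<le> c * \<Lambda> * norm v * norm \<xi>" for v
  proof -
    have "\<bar>F \<bullet> v\<bar> \<le> \<Lambda> * norm \<xi> * norm v"
      using order_trans[OF Cauchy_Schwarz_ineq2 mult_right_mono[OF F(2) norm_ge_zero]] .
    then have "m * \<bar>F \<bullet> v\<bar> \<le> c * (\<Lambda> * norm \<xi> * norm v)"
      using assms c0 by (intro mult_mono) auto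
    then show ?thesis by (simp add: ac_simps)
  qed
  have 2: "m * (\<zeta>\<^sup>2 * (F \<bullet> D)) \<le> \<zeta>\<^sup>2 * (norm \<xi>)\<^sup>2 / (4 * \<Lambda>) + \<Lambda> ^ 3 * c\<^sup>2 * (norm D)\<^sup>2"
  proof -
    have "m * (F \<bullet> D) \<le> c * \<Lambda> * norm D * norm \<xi>"
      using mF[of D] assms(2) by (meson abs_ge_self mult_left_mono order_trans zero_le_one)
    also have "\<dots> \<le> (norm \<xi>)\<^sup>2 / (4 * \<Lambda>) + \<Lambda> * (c * \<Lambda> * norm D)\<^sup>2"
      by (rule young)
    finally have "\<zeta>\<^sup>2 * (m * (F \<bullet> D)) \<le> \<zeta>\<^sup>2 * ((norm \<xi>)\<^sup>2 / (4 * \<Lambda>) + \<Lambda> * (c * \<Lambda> * norm D)\<^sup>2)"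
      by (rule mult_left_mono) simp
    moreover have "\<zeta>\<^sup>2 * (\<Lambda> * (c * \<Lambda> * norm D)\<^sup>2) \<le> 1 * (\<Lambda> * (c * \<Lambda> * norm D)\<^sup>2)"
      using assms by (intro mult_right_mono) (auto simp: power_le_one)
    ultimately show ?thesis by (simp add: distrib_left power_mult_distrib power3_eq_cube power2_eq_square ac_simps)
  qed
  have 3: "- (m * (w * (2 * \<zeta>) * (F \<bullet> z))) \<le> \<zeta>\<^sup>2 * (norm \<xi>)\<^sup>2 / (4 * \<Lambda>) + \<Lambda> ^ 3 * c\<^sup>2 * (4 * L\<^sup>2 * w\<^sup>2)"
  proof -
    have "- (m * (w * (2 * \<zeta>) * (F \<bullet> z))) \<le> \<bar>m * (w * (2 * \<zeta>) * (F \<bullet> z))\<bar>" by simp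
    also have "\<dots> = (2 * \<bar>w\<bar> * \<zeta>) * (m * \<bar>F \<bullet> z\<bar>)"
      using assms by (simp add: abs_mult)
    also have "\<dots> \<le> (2 * \<bar>w\<bar> * \<zeta>) * (c * \<Lambda> * norm z * norm \<xi>)"
      using mF[of z] assms(4) by (intro mult_left_mono) auto
    also have "\<dots> \<le> (2 * \<bar>w\<bar> * \<zeta>) * (c * \<Lambda> * L * norm \<xi>)"
      using assms c0 by (intro mult_left_mono mult_right_mono) auto
    also have "\<dots> = (2 * \<bar>w\<bar> * c * \<Lambda> * L) * (\<zeta> * norm \<xi>)" by (simp add: ac_simps)
    also have "\<dots> \<le> (\<zeta> * norm \<xi>)\<^sup>2 / (4 * \<Lambda>) + \<Lambda> * (2 * \<bar>w\<bar> * c * \<Lambda> * L)\<^sup>2" by (rule young)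
    finally show ?thesis by (simp add: power_mult_distrib power3_eq_cube power2_eq_square ac_simps)
  qed
  have 4: "m * (F \<bullet> (\<zeta>\<^sup>2 *\<^sub>R (\<xi> - D) + w *\<^sub>R (2 * \<zeta>) *\<^sub>R z))
    = m * (\<zeta>\<^sup>2 * (F \<bullet> \<xi>)) - m * (\<zeta>\<^sup>2 * (F \<bullet> D)) + m * (w * (2 * \<zeta>) * (F \<bullet> z))"
    by (simp add: inner_simps algebra_simps)
  have 5: "\<zeta>\<^sup>2 * (norm \<xi>)\<^sup>2 / (2 * \<Lambda>) = \<zeta>\<^sup>2 * (norm \<xi>)\<^sup>2 / \<Lambda> - \<zeta>\<^sup>2 * (norm \<xi>)\<^sup>2 / (4 * \<Lambda>) - \<zeta>\<^sup>2 * (norm \<xi>)\<^sup>2 / (4 * \<Lambda>)"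
    using assms(1) by (simp add: field_simps)
  have arith: "P \<le> T + (d1 + d2)" if "A \<le> u" "v \<le> q + d1" "- x \<le> q + d2" "T = u - v + x" "P = A - q - q" for A u v q d1 x d2 T P :: real
    using that by linarith
  show ?thesis
    unfolding distrib_left[of "\<Lambda> ^ 3 * c\<^sup>2"] by (rule arith[OF 1 2 3 4 5])
qed

lemma norm_horizontal: "norm (horizontal w) = norm w"
  by (simp add: horizontal_def)

lemma shift_cyl:
  assumes "X \<in> cyl 0 r" "norm w \<le> \<epsilon>" "r + \<epsilon> \<le> r'"
  shows "X - horizontal w \<in> cyl 0 r'"
proof -
  have "norm (fst X) < r" "\<bar>snd X\<bar> < r" using assms(1) by (auto simp: mem_cyl_0)
  moreover have "norm (fst X - w) \<le> norm (fst X) + norm w" by (rule norm_triangle_ineq4)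
  moreover have "0 \<le> \<epsilon>" using order_trans[OF norm_ge_zero assms(2)] .
  ultimately have "norm (fst X - w) < r'" "\<bar>snd X\<bar> < r'" using assms(2,3) by linarith+
  then show ?thesis by (simp add: mem_cyl_0 horizontal_def)
qed

text \<open>
  The convolution of \<open>G\<close> with \<open>\<partial>\<^sub>b \<kappa>\<close> is the
  gradient of the horizontal derivative \<open>w = \<partial>\<^sub>b v\<^sub>\<kappa>\<close>
  of the mollified solution, and \<open>w\<close> itself is a component of the convolution of
  \<open>G\<close> with \<open>\<kappa>\<close>. The equation for \<open>w\<close> is tested
  with \<open>\<zeta>\<^sup>2 w\<close>. Since \<open>G\<close> is only a limit of gradients,
  \<open>w\<close> is replaced by the corresponding derivative of an approximating function, at
  the price of an error that tends to zero.
\<close>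

lemma caccioppoli:
  assumes "\<Lambda> > 0" "1 \<le> c" "0 < r" "r < r'" "r' \<le> 3/4"
  shows "\<exists>C>0. \<forall>B \<mu> (G :: (real^'n::finite) \<times> real \<Rightarrow> _) \<kappa> \<kappa>' b.
    unit_solution \<Lambda> c B \<mu> G \<longrightarrow> C1 \<kappa> \<kappa>' \<longrightarrow> kernel (1/8) \<kappa> \<longrightarrow> norm b = 1 \<longrightarrow>
    (\<integral>\<^sup>+X\<in>cyl 0 r. ennreal ((norm (conv horizontal G (\<lambda>w. \<kappa>' w \<bullet> b) X))\<^sup>2) \<partial>lborel)
      \<le> ennreal C * (\<integral>\<^sup>+X\<in>cyl 0 r'. ennreal ((norm (conv horizontal G \<kappa> X))\<^sup>2) \<partial>lborel)"
proof -
  obtain \<zeta> :: "(real^'n) \<times> real \<Rightarrow> real" and z K L where \<zeta>: "C1 \<zeta> z" "\<And>X. 0 \<le> \<zeta> X" "\<And>X. \<zeta> X \<le> 1"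
    "\<And>X. X \<in> cyl 0 r \<Longrightarrow> \<zeta> X = 1" "compact K" "K \<subseteq> cyl 0 r'" "\<And>X. X \<notin> K \<Longrightarrow> \<zeta> X = 0"
    "L > 0" "\<And>X. norm (z X) \<le> L"
    using cutoff[OF assms(3,4)] by metis
  define a where "a = \<Lambda> ^ 3 * c\<^sup>2"
  have a: "a > 0" using assms by (simp add: a_def)
  define C where "C = 2 * \<Lambda> * (a * (8 * L\<^sup>2))"
  have "C > 0" using a assms \<zeta>(8) by (simp add: C_def)
  show ?thesis
  proof (intro exI[of _ C] conjI \<open>C > 0\<close> allI impI)
    fix B \<mu> and G :: "(real^'n) \<times> real \<Rightarrow> (real^'n) \<times> real" and \<kappa> :: "real^'n \<Rightarrow> real" and \<kappa>' and b :: "real^'n"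
    assume G: "unit_solution \<Lambda> c B \<mu> G" and \<kappa>: "C1 \<kappa> \<kappa>'" "kernel (1/8) \<kappa>" and b: "norm b = 1"
    define k where "k = (\<lambda>w. \<kappa>' w \<bullet> b)"
    have k: "kernel (1/8) k" unfolding k_def by (rule kernel_partial[OF \<kappa>])
    define H W where "H = conv horizontal G k" and "W = conv horizontal G \<kappa>"
    define mk mq where "mk = (LINT w|lborel. \<bar>k w\<bar>)\<^sup>2" and "mq = (LINT w|lborel. \<bar>\<kappa> w\<bar>)\<^sup>2"
    have m0: "mk \<ge> 0" "mq \<ge> 0" by (simp_all add: mk_def mq_def)
    note [measurable] = unit_solutionD(6)[OF G] unit_solutionD(3)[OF G]
    have [measurable]: "H \<in> borel_measurable borel" "W \<in> borel_measurable borel"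
      unfolding H_def W_def by (rule conv_measurable[OF linear_horizontal unit_solutionD(6)[OF G]] kernel_measurable[OF k] kernel_measurable[OF \<kappa>(2)])+
    define IH IW where "IH = (\<integral>\<^sup>+X\<in>cyl 0 r. ennreal ((norm (H X))\<^sup>2) \<partial>lborel)" and "IW = (\<integral>\<^sup>+X\<in>cyl 0 r'. ennreal ((norm (W X))\<^sup>2) \<partial>lborel)"
    \<comment> \<open>The error terms have a factor that may depend on the kernel, but the
      approximation can be chosen after the kernel.\<close>
    have key: "IH \<le> ennreal C * IW + ennreal ((2 * \<Lambda> * (a * (mk + 8 * L\<^sup>2 * mq))) * \<delta>)" if "\<delta> > 0" for \<delta>
    proof -
      obtain f g where fg: "C1 f g" "(\<integral>\<^sup>+X\<in>cyl 0 1. ennreal ((norm (G X - g X))\<^sup>2) \<partial>lborel) < ennreal \<delta>"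
        using unit_solutionD(8)[OF G \<open>\<delta> > 0\<close>] by blast
      note [measurable] = C1_measurable[OF fg(1)] C1_measurable[OF \<zeta>(1)]
      define D E where "D = conv horizontal (\<lambda>X. G X - g X) k" and "E = conv horizontal (\<lambda>X. G X - g X) \<kappa>"
      have [measurable]: "D \<in> borel_measurable borel" "E \<in> borel_measurable borel"
        unfolding D_def E_def by (rule conv_measurable[OF linear_horizontal] kernel_measurable[OF k] kernel_measurable[OF \<kappa>(2)]; measurable)+
      define wf Hf where "wf = conv horizontal f k" and "Hf = conv horizontal g k"
      have w: "C1 wf Hf" unfolding wf_def Hf_def by (rule C1_conv[OF fg(1) linear_horizontal k])
      note [measurable] = C1_measurable[OF w]
      define h where "h X = (\<zeta> X)\<^sup>2 *\<^sub>R Hf X + wf X *\<^sub>R (2 * \<zeta> X) *\<^sub>R z X" for X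
      have \<phi>: "C1 (\<lambda>X. \<zeta> X * \<zeta> X * wf X) h"
        using C1_mult[OF C1_mult[OF \<zeta>(1,1)] w] by (simp add: h_def[abs_def] power2_eq_square scaleR_add_left[symmetric] del: scaleR_add_left)
      have \<phi>0: "\<zeta> X * \<zeta> X * wf X = 0" if "X \<notin> K" for X using \<zeta>(7)[OF that] by simp
      have r1: "r' + 1/8 \<le> 1" using assms(5) by simp
      note T = weak_equation_mollified[OF G k \<phi> \<zeta>(5,6) r1 \<phi>0, folded H_def]
      define P where "P X = (\<zeta> X)\<^sup>2 * (norm (H X))\<^sup>2 / (2 * \<Lambda>)" for X
      define N where "N X = a * ((norm (D X))\<^sup>2 + 8 * L\<^sup>2 * ((norm (W X))\<^sup>2 + (norm (E X))\<^sup>2)) * indicator (cyl 0 r') X" for X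
      have kint: "integrable lborel (\<lambda>w. q w *\<^sub>R g (X - horizontal w))" if "kernel (1/8) q" for q X
        by (rule continuous_cpt_integrable[of _ "cball 0 (1/8)"])
          (use kernel_zero[OF that] in \<open>auto intro!: continuous_on_scaleR kernel_continuous[OF that]
            continuous_on_compose2[OF C1_continuous_gradient[OF fg(1), of UNIV]] continuous_on_diff continuous_on_const
            linear_continuous_on[OF linear_conv_bounded_linear[THEN iffD1, OF linear_horizontal]]\<close>)
      have conv_diff: "AE X in lborel. conv horizontal (\<lambda>X. G X - g X) q X = conv horizontal G q X - conv horizontal g q X"
        if "kernel (1/8) q" for q
        using conv_AE_integrable[OF linear_horizontal unit_solution_integrable(2)[OF G] kernel_integrable[OF that]]
      proof eventually_elim
        case (elim X)
        then show ?case
          using Bochner_Integration.integral_diff[OF elim kint[OF that]] by (simp add: conv_def scaleR_diff_right)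
      qed
      have wf: "\<bar>wf X\<bar> \<le> norm (conv horizontal g \<kappa> X)" for X
      proof -
        have "wf X = conv horizontal (\<lambda>X. g X \<bullet> horizontal b) \<kappa> X"
          unfolding wf_def k_def by (rule conv_gradient_kernel[OF fg(1) \<kappa> linear_horizontal, symmetric])
        also have "\<dots> = conv horizontal g \<kappa> X \<bullet> horizontal b"
          unfolding conv_def using kint[OF \<kappa>(2), of X] by (subst integral_inner_left[symmetric]) auto
        finally show ?thesis using Cauchy_Schwarz_ineq2[of "conv horizontal g \<kappa> X" "horizontal b"] b
          by (simp add: norm_horizontal)
      qed
      have "(\<integral>\<^sup>+X. ennreal (P X) \<partial>lborel) \<le> (\<integral>\<^sup>+X. ennreal (N X) \<partial>lborel)"
      proof (rule nn_integral_le_of_integral_eq_0[OF T])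
        show "P \<in> borel_measurable lborel" unfolding P_def by measurable
        show "N \<in> borel_measurable lborel" unfolding N_def by measurable
        show "0 \<le> P X" for X using assms(1) by (simp add: P_def)
        show "0 \<le> N X" for X using a by (simp add: N_def)
        show "AE X in lborel. P X \<le> \<mu> (snd X) * (flux B (H X) \<bullet> h X) + N X"
          using conv_diff[OF k] conv_diff[OF \<kappa>(2)]
        proof eventually_elim
          case (elim X)
          show ?case
          proof (cases "X \<in> cyl 0 r'")
            case False
            then have "\<zeta> X = 0" using \<zeta>(6,7) by blast
            then show ?thesis using False by (simp add: P_def N_def h_def)
          next
            case True
            have Hf: "Hf X = H X - D X" using elim(1) by (simp add: D_def H_def Hf_def)
            have "\<bar>wf X\<bar> \<le> norm (W X - E X)" using wf[of X] elim(2) by (simp add: W_def E_def)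
            also have "\<dots> \<le> norm (W X) + norm (E X)" by (rule norm_triangle_ineq4)
            finally have "\<bar>wf X\<bar>\<^sup>2 \<le> (norm (W X) + norm (E X))\<^sup>2" by (rule power_mono) simp
            also have "\<dots> \<le> 2 * ((norm (W X))\<^sup>2 + (norm (E X))\<^sup>2)"
              using sum_squares_bound[of "norm (W X)" "norm (E X)"] by (simp add: power2_sum)
            finally have "4 * L\<^sup>2 * (wf X)\<^sup>2 \<le> 4 * L\<^sup>2 * (2 * ((norm (W X))\<^sup>2 + (norm (E X))\<^sup>2))"
              by (intro mult_left_mono) auto
            also have "4 * L\<^sup>2 * (2 * ((norm (W X))\<^sup>2 + (norm (E X))\<^sup>2)) = 8 * L\<^sup>2 * ((norm (W X))\<^sup>2 + (norm (E X))\<^sup>2)"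
              by simp
            finally have "a * ((norm (D X))\<^sup>2 + 4 * L\<^sup>2 * (wf X)\<^sup>2) \<le> a * ((norm (D X))\<^sup>2 + 8 * L\<^sup>2 * ((norm (W X))\<^sup>2 + (norm (E X))\<^sup>2))"
              using a by (intro mult_left_mono add_left_mono) auto
            then have "a * ((norm (D X))\<^sup>2 + 4 * L\<^sup>2 * (wf X)\<^sup>2) \<le> N X"
              using True by (simp add: N_def)
            moreover have "P X \<le> \<mu> (snd X) * (flux B (H X) \<bullet> h X) + a * ((norm (D X))\<^sup>2 + 4 * L\<^sup>2 * (wf X)\<^sup>2)"
              unfolding P_def h_def Hf a_def
              by (rule energy_pointwise[OF assms(1) unit_solutionD(4,5)[OF G] \<zeta>(2,3,9) unit_solutionD(1,2)[OF G]])
            ultimately show ?thesis by linarith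
          qed
        qed
      qed
      moreover have "IH \<le> ennreal (2 * \<Lambda>) * (\<integral>\<^sup>+X. ennreal (P X) \<partial>lborel)"
      proof -
        have "IH \<le> (\<integral>\<^sup>+X. ennreal (2 * \<Lambda>) * ennreal (P X) \<partial>lborel)"
          unfolding IH_def
        proof (rule nn_integral_mono)
          fix X
          show "ennreal ((norm (H X))\<^sup>2) * indicator (cyl 0 r) X \<le> ennreal (2 * \<Lambda>) * ennreal (P X)"
            using \<zeta>(4)[of X] assms(1) by (cases "X \<in> cyl 0 r") (auto simp: P_def ennreal_mult[symmetric])
        qed
        also have "\<dots> = ennreal (2 * \<Lambda>) * (\<integral>\<^sup>+X. ennreal (P X) \<partial>lborel)"
          unfolding P_def by (rule nn_integral_cmult) measurable
        finally show ?thesis .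
      qed
      moreover have "(\<integral>\<^sup>+X. ennreal (N X) \<partial>lborel) \<le> ennreal a * (ennreal (mk * \<delta>) + ennreal (8 * L\<^sup>2) * (IW + ennreal (mq * \<delta>)))"
      proof -
        have "(\<integral>\<^sup>+X. ennreal (N X) \<partial>lborel) = (\<integral>\<^sup>+X. ennreal a * (ennreal ((norm (D X))\<^sup>2) * indicator (cyl 0 r') X
          + ennreal (8 * L\<^sup>2) * (ennreal ((norm (W X))\<^sup>2) * indicator (cyl 0 r') X + ennreal ((norm (E X))\<^sup>2) * indicator (cyl 0 r') X)) \<partial>lborel)"
          using a by (intro nn_integral_cong) (auto simp: N_def indicator_def ennreal_mult)
        also have "\<dots> = ennreal a * ((\<integral>\<^sup>+X\<in>cyl 0 r'. ennreal ((norm (D X))\<^sup>2) \<partial>lborel)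
          + ennreal (8 * L\<^sup>2) * (IW + (\<integral>\<^sup>+X\<in>cyl 0 r'. ennreal ((norm (E X))\<^sup>2) \<partial>lborel)))"
          unfolding IW_def by (simp add: nn_integral_cmult nn_integral_add)
        also have "\<dots> \<le> ennreal a * (ennreal (mk * \<delta>) + ennreal (8 * L\<^sup>2) * (IW + ennreal (mq * \<delta>)))"
        proof (intro mult_left_mono add_mono order_refl)
          have "(\<integral>\<^sup>+X\<in>cyl 0 r'. ennreal ((norm (D X))\<^sup>2) \<partial>lborel) \<le> ennreal mk * (\<integral>\<^sup>+X\<in>cyl 0 1. ennreal ((norm (G X - g X))\<^sup>2) \<partial>lborel)"
            unfolding D_def mk_def by (rule conv_L2_bound[OF linear_horizontal _ k borel_cyl borel_cyl shift_cyl[OF _ _ r1]]) (measurable; assumption)+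
          also have "\<dots> \<le> ennreal mk * ennreal \<delta>" using fg(2) by (intro mult_left_mono) auto
          finally show "(\<integral>\<^sup>+X\<in>cyl 0 r'. ennreal ((norm (D X))\<^sup>2) \<partial>lborel) \<le> ennreal (mk * \<delta>)"
            using m0 \<open>\<delta> > 0\<close> by (simp add: ennreal_mult)
          have "(\<integral>\<^sup>+X\<in>cyl 0 r'. ennreal ((norm (E X))\<^sup>2) \<partial>lborel) \<le> ennreal mq * (\<integral>\<^sup>+X\<in>cyl 0 1. ennreal ((norm (G X - g X))\<^sup>2) \<partial>lborel)"
            unfolding E_def mq_def by (rule conv_L2_bound[OF linear_horizontal _ \<kappa>(2) borel_cyl borel_cyl shift_cyl[OF _ _ r1]]) (measurable; assumption)+
          also have "\<dots> \<le> ennreal mq * ennreal \<delta>" using fg(2) by (intro mult_left_mono) auto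
          finally show "(\<integral>\<^sup>+X\<in>cyl 0 r'. ennreal ((norm (E X))\<^sup>2) \<partial>lborel) \<le> ennreal (mq * \<delta>)"
            using m0 \<open>\<delta> > 0\<close> by (simp add: ennreal_mult)
        qed auto
        finally show ?thesis .
      qed
      ultimately have "IH \<le> ennreal (2 * \<Lambda>) * (ennreal a * (ennreal (mk * \<delta>) + ennreal (8 * L\<^sup>2) * (IW + ennreal (mq * \<delta>))))"
        by (meson mult_left_mono order_trans zero_le)
      also have "\<dots> = ennreal C * IW + ennreal ((2 * \<Lambda> * (a * (mk + 8 * L\<^sup>2 * mq))) * \<delta>)"
      proof -
        have "ennreal ((2 * \<Lambda> * (a * (mk + 8 * L\<^sup>2 * mq))) * \<delta>)
          = ennreal (2 * \<Lambda>) * (ennreal a * (ennreal (mk * \<delta>) + ennreal (8 * L\<^sup>2) * ennreal (mq * \<delta>)))"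
          using m0 a assms \<open>\<delta> > 0\<close>
          by (simp add: ennreal_mult[symmetric] ennreal_plus[symmetric] del: ennreal_plus) (simp add: algebra_simps)
        moreover have "ennreal C = ennreal (2 * \<Lambda>) * (ennreal a * ennreal (8 * L\<^sup>2))"
          using a assms by (simp add: C_def ennreal_mult[symmetric])
        ultimately show ?thesis by (simp add: distrib_left distrib_right ac_simps)
      qed
      finally show ?thesis .
    qed
    define Kc where "Kc = 2 * \<Lambda> * (a * (mk + 8 * L\<^sup>2 * mq)) + 1"
    have Kc: "Kc > 0" using m0 a assms by (simp add: Kc_def add_nonneg_pos)
    have "IH \<le> ennreal C * IW"
    proof (rule ennreal_le_epsilon)
      fix e :: real assume "e > 0"
      have "(Kc - 1) * (e / Kc) \<le> Kc * (e / Kc)" using Kc \<open>e > 0\<close> by (intro mult_right_mono) auto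
      then have "(Kc - 1) * (e / Kc) \<le> e" using Kc by simp
      then have "ennreal ((2 * \<Lambda> * (a * (mk + 8 * L\<^sup>2 * mq))) * (e / Kc)) \<le> ennreal e"
        by (intro ennreal_leI) (simp add: Kc_def)
      then show "IH \<le> ennreal C * IW + ennreal e"
        using key[of "e / Kc"] Kc \<open>e > 0\<close> by (meson add_left_mono divide_pos_pos order_trans)
    qed
    then show "(\<integral>\<^sup>+X\<in>cyl 0 r. ennreal ((norm (conv horizontal G (\<lambda>w. \<kappa>' w \<bullet> b) X))\<^sup>2) \<partial>lborel)
      \<le> ennreal C * (\<integral>\<^sup>+X\<in>cyl 0 r'. ennreal ((norm (conv horizontal G \<kappa> X))\<^sup>2) \<partial>lborel)"
      by (simp add: IH_def IW_def H_def W_def k_def)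
  qed
qed

primrec iterated_partial :: "'a::euclidean_space list \<Rightarrow> ('a \<Rightarrow> real) \<Rightarrow> 'a \<Rightarrow> real"
  where "iterated_partial [] \<kappa> = \<kappa>"
  | "iterated_partial (b # bs) \<kappa> = (\<lambda>w. grad (iterated_partial bs \<kappa>) w \<bullet> b)"

lemma smooth_iterated_partial: "smooth \<kappa> \<Longrightarrow> set bs \<subseteq> Basis \<Longrightarrow> smooth (iterated_partial bs \<kappa>)"
  by (induction bs) (auto intro: smooth_partial)

lemma kernel_iterated_partial: "smooth \<kappa> \<Longrightarrow> kernel \<epsilon> \<kappa> \<Longrightarrow> set bs \<subseteq> Basis \<Longrightarrow> kernel \<epsilon> (iterated_partial bs \<kappa>)"
  by (induction bs) (auto intro!: kernel_partial smooth_C1 smooth_iterated_partial)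

text \<open>
  Each derivative costs one application of the Caccioppoli inequality between two cylinders, the
  larger being half way to the limit \<open>3/4\<close>. The bound depends on the kernel through
  its mass only, so it survives the limit of vanishing mollification.
\<close>

lemma iterated_caccioppoli:
  assumes "\<Lambda> > 0" "1 \<le> c" "0 < r" "r < 3/4"
  shows "\<exists>C>0. \<forall>B \<mu> (G :: (real^'n::finite) \<times> real \<Rightarrow> _) \<kappa> bs.
    unit_solution \<Lambda> c B \<mu> G \<longrightarrow> smooth \<kappa> \<longrightarrow> kernel (1/8) \<kappa> \<longrightarrow> (LINT w|lborel. \<bar>\<kappa> w\<bar>) \<le> 1 \<longrightarrow>
    set bs \<subseteq> Basis \<longrightarrow> length bs = m \<longrightarrow>
    (\<integral>\<^sup>+X\<in>cyl 0 r. ennreal ((norm (conv horizontal G (iterated_partial bs \<kappa>) X))\<^sup>2) \<partial>lborel)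
      \<le> ennreal C * (\<integral>\<^sup>+X\<in>cyl 0 1. ennreal ((norm (G X))\<^sup>2) \<partial>lborel)"
  using assms(3,4)
proof (induction m arbitrary: r)
  case 0
  show ?case
  proof (intro exI[of _ "1::real"] conjI allI impI)
    fix B \<mu> and G :: "(real^'n) \<times> real \<Rightarrow> (real^'n) \<times> real" and \<kappa> :: "real^'n \<Rightarrow> real" and bs :: "(real^'n) list"
    assume G: "unit_solution \<Lambda> c B \<mu> G" and \<kappa>: "kernel (1/8) \<kappa>" "(LINT w|lborel. \<bar>\<kappa> w\<bar>) \<le> 1" and bs: "length bs = 0"
    have "(\<integral>\<^sup>+X\<in>cyl 0 r. ennreal ((norm (conv horizontal G \<kappa> X))\<^sup>2) \<partial>lborel)
      \<le> ennreal ((LINT w|lborel. \<bar>\<kappa> w\<bar>)\<^sup>2) * (\<integral>\<^sup>+X\<in>cyl 0 1. ennreal ((norm (G X))\<^sup>2) \<partial>lborel)"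
      using 0 by (intro conv_L2_bound[OF linear_horizontal unit_solutionD(6)[OF G] \<kappa>(1) borel_cyl borel_cyl] shift_cyl[where r=r and \<epsilon>="1/8"]) auto
    also have "\<dots> \<le> ennreal 1 * (\<integral>\<^sup>+X\<in>cyl 0 1. ennreal ((norm (G X))\<^sup>2) \<partial>lborel)"
      using \<kappa>(2) by (intro mult_right_mono ennreal_leI) (auto simp: power_le_one)
    finally show "(\<integral>\<^sup>+X\<in>cyl 0 r. ennreal ((norm (conv horizontal G (iterated_partial bs \<kappa>) X))\<^sup>2) \<partial>lborel)
      \<le> ennreal 1 * (\<integral>\<^sup>+X\<in>cyl 0 1. ennreal ((norm (G X))\<^sup>2) \<partial>lborel)"
      using bs by simp
  qed auto
next
  case (Suc m)
  define r' where "r' = (r + 3/4) / 2"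
  have r': "0 < r'" "r < r'" "r' < 3/4" "r' \<le> 3/4" using Suc.prems by (auto simp: r'_def)
  obtain Ca where Ca: "Ca > 0" "\<And>B \<mu> (G :: (real^'n::finite) \<times> real \<Rightarrow> _) \<kappa> \<kappa>' b.
    unit_solution \<Lambda> c B \<mu> G \<Longrightarrow> C1 \<kappa> \<kappa>' \<Longrightarrow> kernel (1/8) \<kappa> \<Longrightarrow> norm b = 1 \<Longrightarrow>
    (\<integral>\<^sup>+X\<in>cyl 0 r. ennreal ((norm (conv horizontal G (\<lambda>w. \<kappa>' w \<bullet> b) X))\<^sup>2) \<partial>lborel)
      \<le> ennreal Ca * (\<integral>\<^sup>+X\<in>cyl 0 r'. ennreal ((norm (conv horizontal G \<kappa> X))\<^sup>2) \<partial>lborel)"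
    using caccioppoli[OF assms(1,2) Suc.prems(1) r'(2,4), where 'n='n] by blast
  obtain C2 where C2: "C2 > 0" "\<And>B \<mu> (G :: (real^'n::finite) \<times> real \<Rightarrow> _) \<kappa> bs.
    unit_solution \<Lambda> c B \<mu> G \<Longrightarrow> smooth \<kappa> \<Longrightarrow> kernel (1/8) \<kappa> \<Longrightarrow> (LINT w|lborel. \<bar>\<kappa> w\<bar>) \<le> 1 \<Longrightarrow>
    set bs \<subseteq> Basis \<Longrightarrow> length bs = m \<Longrightarrow>
    (\<integral>\<^sup>+X\<in>cyl 0 r'. ennreal ((norm (conv horizontal G (iterated_partial bs \<kappa>) X))\<^sup>2) \<partial>lborel)
      \<le> ennreal C2 * (\<integral>\<^sup>+X\<in>cyl 0 1. ennreal ((norm (G X))\<^sup>2) \<partial>lborel)"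
    using Suc.IH[OF r'(1,3)] by blast
  show ?case
  proof (intro exI[of _ "Ca * C2"] conjI allI impI)
    fix B \<mu> and G :: "(real^'n) \<times> real \<Rightarrow> (real^'n) \<times> real" and \<kappa> :: "real^'n \<Rightarrow> real" and bs :: "(real^'n) list"
    assume G: "unit_solution \<Lambda> c B \<mu> G" and \<kappa>: "smooth \<kappa>" "kernel (1/8) \<kappa>" "(LINT w|lborel. \<bar>\<kappa> w\<bar>) \<le> 1" and bs: "set bs \<subseteq> Basis" "length bs = Suc m"
    obtain b bs' where bs': "bs = b # bs'" using bs(2) by (cases bs) auto
    have b: "b \<in> Basis" "set bs' \<subseteq> Basis" "length bs' = m" using bs bs' by auto
    have "(\<integral>\<^sup>+X\<in>cyl 0 r. ennreal ((norm (conv horizontal G (iterated_partial bs \<kappa>) X))\<^sup>2) \<partial>lborel)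
      \<le> ennreal Ca * (\<integral>\<^sup>+X\<in>cyl 0 r'. ennreal ((norm (conv horizontal G (iterated_partial bs' \<kappa>) X))\<^sup>2) \<partial>lborel)"
      unfolding bs' iterated_partial.simps
      by (rule Ca(2)[OF G smooth_C1[OF smooth_iterated_partial[OF \<kappa>(1) b(2)]] kernel_iterated_partial[OF \<kappa>(1,2) b(2)] norm_Basis[OF b(1)]])
    also have "\<dots> \<le> ennreal Ca * (ennreal C2 * (\<integral>\<^sup>+X\<in>cyl 0 1. ennreal ((norm (G X))\<^sup>2) \<partial>lborel))"
      by (intro mult_left_mono C2(2)[OF G \<kappa> b(2,3)]) simp
    finally show "(\<integral>\<^sup>+X\<in>cyl 0 r. ennreal ((norm (conv horizontal G (iterated_partial bs \<kappa>) X))\<^sup>2) \<partial>lborel)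
      \<le> ennreal (Ca * C2) * (\<integral>\<^sup>+X\<in>cyl 0 1. ennreal ((norm (G X))\<^sup>2) \<partial>lborel)"
      using Ca(1) C2(1) by (simp add: ennreal_mult mult.assoc)
  qed (use Ca(1) C2(1) in simp)
qed

section \<open>A Sobolev inequality in the horizontal variables\<close>

lemma integrable_reflect:
  fixes f :: "'a::euclidean_space \<Rightarrow> 'b::{banach,second_countable_topology}"
  assumes "integrable lborel f"
  shows "integrable lborel (\<lambda>x. f (c - x))"
proof -
  note [measurable] = borel_measurable_integrable[OF assms]
  have "(lborel :: 'a measure) = distr lborel borel (\<lambda>x. c - x)"
    using lborel_affine[of "-1" c] by (simp add: density_1)
  then have "integrable (distr lborel borel (\<lambda>x. c - x)) f" using assms by metis
  then show ?thesis by (subst (asm) integrable_distr_eq) auto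
qed

text \<open>
  The fundamental theorem of calculus for \<open>t \<mapsto> - (r - t) \<kappa> (w + t
  b)\<close>: a value is expressed by the average over a segment and the derivative along it.
\<close>

lemma kernel_line_identity:
  assumes \<kappa>: "C1 \<kappa> \<kappa>'" and r: "0 \<le> r"
  shows "has_bochner_integral lborel (\<lambda>t. (\<kappa> (w + t *\<^sub>R b) - (r - t) * (\<kappa>' (w + t *\<^sub>R b) \<bullet> b)) * indicator {0..r} t) (r * \<kappa> w)"
proof -
  have "has_bochner_integral lborel (\<lambda>t. (\<kappa> (w + t *\<^sub>R b) - (r - t) * (\<kappa>' (w + t *\<^sub>R b) \<bullet> b)) * indicator {0..r} t)
    ((- (r - r) * \<kappa> (w + r *\<^sub>R b)) - (- (r - 0) * \<kappa> (w + 0 *\<^sub>R b)))"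
  proof (rule has_bochner_integral_FTC_Icc_real[OF r])
    fix t
    show "((\<lambda>t. - (r - t) * \<kappa> (w + t *\<^sub>R b)) has_real_derivative \<kappa> (w + t *\<^sub>R b) - (r - t) * (\<kappa>' (w + t *\<^sub>R b) \<bullet> b)) (at t)"
      by (auto intro!: derivative_eq_intros C1_line[OF \<kappa>] simp: algebra_simps)
    have c: "continuous_on UNIV (\<lambda>t::real. w + t *\<^sub>R b)" by (intro continuous_intros)
    have "continuous_on UNIV (\<lambda>t. \<kappa> (w + t *\<^sub>R b) - (r - t) * (\<kappa>' (w + t *\<^sub>R b) \<bullet> b))"
      by (intro continuous_on_diff continuous_on_mult continuous_on_inner continuous_on_const continuous_on_id
          continuous_on_compose2[OF C1_continuous[OF \<kappa>, of UNIV] c] continuous_on_compose2[OF C1_continuous_gradient[OF \<kappa>, of UNIV] c]) auto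
    then show "isCont (\<lambda>t. \<kappa> (w + t *\<^sub>R b) - (r - t) * (\<kappa>' (w + t *\<^sub>R b) \<bullet> b)) t"
      by (simp add: continuous_on_eq_continuous_at)
  qed
  then show ?thesis by simp
qed

lemma conv_line_average:
  fixes F :: "'a::euclidean_space \<Rightarrow> 'c::euclidean_space" and \<iota> :: "'b::euclidean_space \<Rightarrow> 'a"
  assumes \<iota>: "linear \<iota>" and F: "F \<in> borel_measurable borel" "integrable lborel (\<lambda>w. F (X - \<iota> w))"
    and \<kappa>: "C1 \<kappa> \<kappa>'" "kernel \<epsilon> \<kappa>" and r: "0 \<le> r"
  shows "ennreal (r * norm (conv \<iota> F \<kappa> X)) \<le>
    (\<integral>\<^sup>+t\<in>{0..r}. ennreal (norm (conv \<iota> F \<kappa> (X + t *\<^sub>R \<iota> b)) + r * norm (conv \<iota> F (\<lambda>w. \<kappa>' w \<bullet> b) (X + t *\<^sub>R \<iota> b))) \<partial>lborel)"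
proof -
  define k where "k = (\<lambda>w. \<kappa>' w \<bullet> b)"
  have k: "kernel \<epsilon> k" unfolding k_def by (rule kernel_partial[OF \<kappa>])
  define \<Phi> where "\<Phi> w = F (X - \<iota> w)" for w
  have \<Phi>: "integrable lborel \<Phi>" using F(2) by (simp add: \<Phi>_def[abs_def])
  note [measurable] = F(1) linear_measurable[OF \<iota>] kernel_measurable[OF k] kernel_measurable[OF \<kappa>(2)] borel_measurable_integrable[OF \<Phi>, simplified]
  obtain m1 where m1: "\<And>w. norm (\<kappa> w) \<le> m1"
    using continuous_cpt_bounded[OF kernel_continuous[OF \<kappa>(2)] compact_cball kernel_zero[OF \<kappa>(2)]] by metis
  obtain m2 where m2: "\<And>w. norm (k w) \<le> m2"
    using continuous_cpt_bounded[OF kernel_continuous[OF k] compact_cball kernel_zero[OF k]] by metis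
  have shift: "conv \<iota> F q (X + t *\<^sub>R \<iota> b) = (LINT w|lborel. q (w + t *\<^sub>R b) *\<^sub>R \<Phi> w)" if [measurable]: "q \<in> borel_measurable borel" for q t
  proof -
    have "conv \<iota> F q (X + t *\<^sub>R \<iota> b) = (LINT w|lborel. q (t *\<^sub>R b + w) *\<^sub>R F (X + t *\<^sub>R \<iota> b - \<iota> (t *\<^sub>R b + w)))"
      unfolding conv_def by (rule integral_translate[symmetric]) measurable
    then show ?thesis by (simp add: \<Phi>_def linear_add[OF \<iota>] linear_scale[OF \<iota>] add.commute)
  qed
  have qi: "integrable lborel (\<lambda>w. q (w + v) *\<^sub>R \<Phi> w)" if [measurable]: "q \<in> borel_measurable borel" and q: "\<And>w. norm (q w) \<le> m" for q m v
  proof (rule Bochner_Integration.integrable_bound[OF integrable_mult_right[OF integrable_norm[OF \<Phi>], of m]])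
    have "m \<ge> 0" using order_trans[OF norm_ge_zero q] .
    then show "AE w in lborel. norm (q (w + v) *\<^sub>R \<Phi> w) \<le> norm (m * norm (\<Phi> w))"
      using q by (intro AE_I2) (simp add: abs_mult mult_right_mono)
  qed measurable
  define Q where "Q t w = (\<kappa> (w + t *\<^sub>R b) - (r - t) * k (w + t *\<^sub>R b)) * indicator {0..r} t" for t w
  have Qm[measurable]: "(\<lambda>(w, t). Q t w) \<in> borel_measurable (borel \<Otimes>\<^sub>M borel)"
    unfolding Q_def by measurable
  have Qb: "norm (Q t w) \<le> (m1 + r * m2) * indicator {0..r} t" for t w
  proof (cases "t \<in> {0..r}")
    case True
    have "norm (\<kappa> (w + t *\<^sub>R b) - (r - t) * k (w + t *\<^sub>R b)) \<le> norm (\<kappa> (w + t *\<^sub>R b)) + norm ((r - t) * k (w + t *\<^sub>R b))"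
      by (rule norm_triangle_ineq4)
    also have "\<dots> \<le> m1 + r * m2"
      unfolding norm_mult using True m1[of "w + t *\<^sub>R b"] m2[of "w + t *\<^sub>R b"] by (intro add_mono mult_mono) auto
    finally show ?thesis using True by (simp add: Q_def)
  qed (simp add: Q_def)
  have mm: "0 \<le> m1 + r * m2" using order_trans[OF norm_ge_zero m1] order_trans[OF norm_ge_zero m2] r by simp
  have i0: "integrable (lborel \<Otimes>\<^sub>M lborel) (\<lambda>(w, t). (indicator {0..r} t :: real) *\<^sub>R \<Phi> w)"
    using conv_pair_integrable[where \<iota>="\<lambda>t::real. 0" and F=\<Phi> and \<kappa>="indicator {0..r}"] \<Phi>
    by (simp add: linear_zero integrable_real_indicator emeasure_lborel_Icc_eq)
  have pi: "integrable (lborel \<Otimes>\<^sub>M lborel) (\<lambda>(w, t). Q t w *\<^sub>R \<Phi> w)"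
  proof (rule Bochner_Integration.integrable_bound[OF integrable_mult_right[OF integrable_norm[OF i0], of "m1 + r * m2"]])
    show "AE z in lborel \<Otimes>\<^sub>M lborel. norm (case z of (w, t) \<Rightarrow> Q t w *\<^sub>R \<Phi> w) \<le> norm ((m1 + r * m2) * norm (case z of (w, t) \<Rightarrow> (indicator {0..r} t :: real) *\<^sub>R \<Phi> w))"
    proof (rule AE_I2, clarify)
      fix w t
      have "norm (Q t w) * norm (\<Phi> w) \<le> ((m1 + r * m2) * indicator {0..r} t) * norm (\<Phi> w)"
        by (intro mult_right_mono Qb) simp
      then show "norm (Q t w *\<^sub>R \<Phi> w) \<le> norm ((m1 + r * m2) * norm ((indicator {0..r} t :: real) *\<^sub>R \<Phi> w))"
        using mm by (simp add: abs_mult mult.assoc)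
    qed
  qed measurable
  have "r *\<^sub>R conv \<iota> F \<kappa> X = (LINT w|lborel. (r * \<kappa> w) *\<^sub>R \<Phi> w)"
    using qi[OF _ m1, where v=0] by (simp add: conv_def \<Phi>_def integral_scaleR_right[symmetric] del: integral_scaleR_right)
  also have "\<dots> = (LINT w|lborel. LINT t|lborel. Q t w *\<^sub>R \<Phi> w)"
  proof (rule Bochner_Integration.integral_cong[OF refl])
    fix w
    show "(r * \<kappa> w) *\<^sub>R \<Phi> w = (LINT t|lborel. Q t w *\<^sub>R \<Phi> w)"
      using kernel_line_identity[OF \<kappa>(1) r, of w b] by (simp add: has_bochner_integral_iff Q_def k_def)
  qed
  also have "\<dots> = (LINT t|lborel. LINT w|lborel. Q t w *\<^sub>R \<Phi> w)"
    by (rule lborel_pair.Fubini_integral[OF pi, symmetric])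
  finally have eq: "r *\<^sub>R conv \<iota> F \<kappa> X = (LINT t|lborel. LINT w|lborel. Q t w *\<^sub>R \<Phi> w)" .
  have "ennreal (r * norm (conv \<iota> F \<kappa> X)) = ennreal (norm (r *\<^sub>R conv \<iota> F \<kappa> X))" using r by simp
  also have "\<dots> \<le> (\<integral>\<^sup>+t. ennreal (norm (LINT w|lborel. Q t w *\<^sub>R \<Phi> w)) \<partial>lborel)"
    unfolding eq by (rule integral_norm_bound_ennreal[OF lborel_pair.integrable_snd[OF pi]])
  also have "\<dots> \<le> (\<integral>\<^sup>+t\<in>{0..r}. ennreal (norm (conv \<iota> F \<kappa> (X + t *\<^sub>R \<iota> b)) + r * norm (conv \<iota> F k (X + t *\<^sub>R \<iota> b))) \<partial>lborel)"
  proof (rule nn_integral_mono)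
    fix t
    show "ennreal (norm (LINT w|lborel. Q t w *\<^sub>R \<Phi> w)) \<le> ennreal (norm (conv \<iota> F \<kappa> (X + t *\<^sub>R \<iota> b)) + r * norm (conv \<iota> F k (X + t *\<^sub>R \<iota> b))) * indicator {0..r} t"
    proof (cases "t \<in> {0..r}")
      case True
      have i1: "integrable lborel (\<lambda>w. \<kappa> (w + t *\<^sub>R b) *\<^sub>R \<Phi> w)" and i2: "integrable lborel (\<lambda>w. k (w + t *\<^sub>R b) *\<^sub>R \<Phi> w)"
        by (rule qi[OF kernel_measurable[OF \<kappa>(2)] m1] qi[OF kernel_measurable[OF k] m2])+
      have "(LINT w|lborel. Q t w *\<^sub>R \<Phi> w) = (LINT w|lborel. \<kappa> (w + t *\<^sub>R b) *\<^sub>R \<Phi> w - (r - t) *\<^sub>R (k (w + t *\<^sub>R b) *\<^sub>R \<Phi> w))"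
        using True by (intro Bochner_Integration.integral_cong) (auto simp: Q_def scaleR_diff_left)
      also have "\<dots> = conv \<iota> F \<kappa> (X + t *\<^sub>R \<iota> b) - (r - t) *\<^sub>R conv \<iota> F k (X + t *\<^sub>R \<iota> b)"
        by (simp only: Bochner_Integration.integral_diff[OF i1 integrable_scaleR_right[OF i2]] integral_scaleR_right
            shift[OF kernel_measurable[OF \<kappa>(2)]] shift[OF kernel_measurable[OF k]])
      also have "norm \<dots> \<le> norm (conv \<iota> F \<kappa> (X + t *\<^sub>R \<iota> b)) + norm ((r - t) *\<^sub>R conv \<iota> F k (X + t *\<^sub>R \<iota> b))"
        by (rule norm_triangle_ineq4)
      also have "norm ((r - t) *\<^sub>R conv \<iota> F k (X + t *\<^sub>R \<iota> b)) \<le> r * norm (conv \<iota> F k (X + t *\<^sub>R \<iota> b))"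
        using True by (simp add: mult_right_mono)
      finally show ?thesis using True by (simp add: ennreal_leI del: ennreal_plus)
    qed (simp add: Q_def)
  qed
  finally show ?thesis by (simp add: k_def)
qed

text \<open>
  The norm in \<open>L\<^sup>1(dy)\<close> of the mollified field on the vertical segment over
  \<open>x\<close>. It is the absolute value of a function of \<open>x\<close> with values in a
  Banach space, to which the scalar Sobolev inequality extends.
\<close>

definition slice_norm :: "((real^'n::finite) \<times> real \<Rightarrow> (real^'n) \<times> real) \<Rightarrow> (real^'n \<Rightarrow> real) \<Rightarrow> real^'n \<Rightarrow> ennreal"
  where "slice_norm G \<kappa> x = (\<integral>\<^sup>+y\<in>{-1/4<..<1/4}. ennreal (norm (conv horizontal G \<kappa> (x, y))) \<partial>lborel)"

lemma slice_norm_measurable: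
  assumes [measurable]: "G \<in> borel_measurable borel" "\<kappa> \<in> borel_measurable borel"
  shows "slice_norm G \<kappa> \<in> borel_measurable borel"
proof -
  note [measurable] = conv_measurable[OF linear_horizontal assms]
  have "(\<lambda>x. \<integral>\<^sup>+y. ennreal (norm (conv horizontal G \<kappa> (x, y))) * indicator {-1/4<..<1/4} y \<partial>lborel) \<in> borel_measurable borel"
    by measurable
  then show ?thesis by (simp add: slice_norm_def[abs_def])
qed

lemma slice_norm_step:
  assumes G: "integrable lborel G" and \<kappa>: "C1 \<kappa> \<kappa>'" "kernel \<epsilon> \<kappa>" and r: "0 \<le> r"
  shows "ennreal r * slice_norm G \<kappa> x \<le>
    (\<integral>\<^sup>+t\<in>{0..r}. slice_norm G \<kappa> (x + t *\<^sub>R b) + ennreal r * slice_norm G (\<lambda>w. \<kappa>' w \<bullet> b) (x + t *\<^sub>R b) \<partial>lborel)"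
proof -
  have Gm[measurable]: "G \<in> borel_measurable borel" using borel_measurable_integrable[OF G] by simp
  define k where "k = (\<lambda>w. \<kappa>' w \<bullet> b)"
  have k: "kernel \<epsilon> k" unfolding k_def by (rule kernel_partial[OF \<kappa>])
  note [measurable] = conv_measurable[OF linear_horizontal Gm kernel_measurable[OF k]] conv_measurable[OF linear_horizontal Gm kernel_measurable[OF \<kappa>(2)]]
  let ?I = "{-1/4<..<1/4} :: real set"
  have ae: "AE y in lborel. integrable lborel (\<lambda>z. G (z, y))"
    using lborel_pair.AE_integrable_snd[of "\<lambda>z y. G (z, y)"] G by (simp add: lborel_prod)
  have "ennreal r * slice_norm G \<kappa> x = (\<integral>\<^sup>+y. ennreal (r * norm (conv horizontal G \<kappa> (x, y))) * indicator ?I y \<partial>lborel)"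
    unfolding slice_norm_def using r by (subst nn_integral_cmult[symmetric]) (auto simp: ennreal_mult mult.assoc)
  also have "\<dots> \<le> (\<integral>\<^sup>+y. (\<integral>\<^sup>+t. ennreal (norm (conv horizontal G \<kappa> (x + t *\<^sub>R b, y)) + r * norm (conv horizontal G k (x + t *\<^sub>R b, y))) * indicator {0..r} t * indicator ?I y \<partial>lborel) \<partial>lborel)"
  proof (rule nn_integral_mono_AE)
    show "AE y in lborel. ennreal (r * norm (conv horizontal G \<kappa> (x, y))) * indicator ?I y \<le>
      (\<integral>\<^sup>+t. ennreal (norm (conv horizontal G \<kappa> (x + t *\<^sub>R b, y)) + r * norm (conv horizontal G k (x + t *\<^sub>R b, y))) * indicator {0..r} t * indicator ?I y \<partial>lborel)"
      using ae
    proof eventually_elim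
      case (elim y)
      have "integrable lborel (\<lambda>w. G ((x, y) - horizontal w))"
        using integrable_reflect[OF elim, of x] by (simp add: horizontal_def)
      moreover have "(x, y) + t *\<^sub>R horizontal b = (x + t *\<^sub>R b, y)" for t by (simp add: horizontal_def)
      ultimately show ?case
        using conv_line_average[OF linear_horizontal Gm _ \<kappa> r, of "(x, y)" b]
        by (cases "y \<in> ?I") (auto simp: k_def)
    qed
  qed
  also have "\<dots> = (\<integral>\<^sup>+t. (\<integral>\<^sup>+y. ennreal (norm (conv horizontal G \<kappa> (x + t *\<^sub>R b, y)) + r * norm (conv horizontal G k (x + t *\<^sub>R b, y))) * indicator {0..r} t * indicator ?I y \<partial>lborel) \<partial>lborel)"
    by (rule lborel_pair.Fubini') measurable
  also have "\<dots> = (\<integral>\<^sup>+t\<in>{0..r}. slice_norm G \<kappa> (x + t *\<^sub>R b) + ennreal r * slice_norm G k (x + t *\<^sub>R b) \<partial>lborel)"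
  proof (rule nn_integral_cong)
    fix t
    have "(\<integral>\<^sup>+y. ennreal (norm (conv horizontal G \<kappa> (x + t *\<^sub>R b, y)) + r * norm (conv horizontal G k (x + t *\<^sub>R b, y))) * indicator {0..r} t * indicator ?I y \<partial>lborel)
      = (\<integral>\<^sup>+y. (ennreal (norm (conv horizontal G \<kappa> (x + t *\<^sub>R b, y))) * indicator ?I y + ennreal r * (ennreal (norm (conv horizontal G k (x + t *\<^sub>R b, y))) * indicator ?I y)) * indicator {0..r} t \<partial>lborel)"
      using r by (intro nn_integral_cong) (auto simp: indicator_def ennreal_mult)
    then show "(\<integral>\<^sup>+y. ennreal (norm (conv horizontal G \<kappa> (x + t *\<^sub>R b, y)) + r * norm (conv horizontal G k (x + t *\<^sub>R b, y))) * indicator {0..r} t * indicator ?I y \<partial>lborel)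
      = (slice_norm G \<kappa> (x + t *\<^sub>R b) + ennreal r * slice_norm G k (x + t *\<^sub>R b)) * indicator {0..r} t"
      unfolding slice_norm_def by (simp add: nn_integral_multc nn_integral_add nn_integral_cmult)
  qed
  finally show ?thesis by (simp add: k_def)
qed

lemma slice_norm_step':
  assumes G: "integrable lborel G" and \<kappa>: "C1 \<kappa> \<kappa>'" "kernel \<epsilon> \<kappa>" and r: "0 < r"
  shows "slice_norm G \<kappa> x \<le>
    (\<integral>\<^sup>+t. indicator {0..r} t * (ennreal (1 / r) * slice_norm G \<kappa> (x + t *\<^sub>R b) + slice_norm G (\<lambda>w. \<kappa>' w \<bullet> b) (x + t *\<^sub>R b)) \<partial>lborel)"
proof -
  have Gm[measurable]: "G \<in> borel_measurable borel" using borel_measurable_integrable[OF G] by simp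
  note [measurable] = slice_norm_measurable[OF Gm kernel_measurable[OF kernel_partial[OF \<kappa>, of b]]] slice_norm_measurable[OF Gm kernel_measurable[OF \<kappa>(2)]]
  have e1: "ennreal (1 / r) * ennreal r = 1" using r by (simp add: ennreal_mult[symmetric])
  have "slice_norm G \<kappa> x = ennreal (1 / r) * (ennreal r * slice_norm G \<kappa> x)"
    using e1 by (simp add: mult.assoc[symmetric])
  also have "\<dots> \<le> ennreal (1 / r) * (\<integral>\<^sup>+t\<in>{0..r}. slice_norm G \<kappa> (x + t *\<^sub>R b) + ennreal r * slice_norm G (\<lambda>w. \<kappa>' w \<bullet> b) (x + t *\<^sub>R b) \<partial>lborel)"
    using slice_norm_step[OF G \<kappa>, of r x b] r by (intro mult_left_mono) auto
  also have "\<dots> = (\<integral>\<^sup>+t. ennreal (1 / r) * ((slice_norm G \<kappa> (x + t *\<^sub>R b) + ennreal r * slice_norm G (\<lambda>w. \<kappa>' w \<bullet> b) (x + t *\<^sub>R b)) * indicator {0..r} t) \<partial>lborel)"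
    by (rule nn_integral_cmult[symmetric]) measurable
  also have "\<dots> = (\<integral>\<^sup>+t. indicator {0..r} t * (ennreal (1 / r) * slice_norm G \<kappa> (x + t *\<^sub>R b) + slice_norm G (\<lambda>w. \<kappa>' w \<bullet> b) (x + t *\<^sub>R b)) \<partial>lborel)"
  proof (rule nn_integral_cong)
    fix t
    show "ennreal (1 / r) * ((slice_norm G \<kappa> (x + t *\<^sub>R b) + ennreal r * slice_norm G (\<lambda>w. \<kappa>' w \<bullet> b) (x + t *\<^sub>R b)) * indicator {0..r} t)
      = indicator {0..r} t * (ennreal (1 / r) * slice_norm G \<kappa> (x + t *\<^sub>R b) + slice_norm G (\<lambda>w. \<kappa>' w \<bullet> b) (x + t *\<^sub>R b))"
      using e1 by (simp add: distrib_left mult.assoc[symmetric] indicator_def)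
  qed
  finally show ?thesis .
qed

text \<open>
  The indicator function of the cube \<open>[0, r]\<^sup>I\<close> as a product, the form in
  which it splits off one factor in an induction on \<open>I\<close>.
\<close>

definition cube_weight :: "real \<Rightarrow> 'a set \<Rightarrow> ('a \<Rightarrow> real) \<Rightarrow> ennreal"
  where "cube_weight r I z = (\<Prod>b\<in>I. indicator {0..r} (z b))"

text \<open>
  The one-dimensional inequality is applied once in every coordinate direction. The result
  bounds a value by integrals over a cube of mixed derivatives in which every direction occurs
  at most once, whence the condition that \<open>bs\<close> be distinct.
\<close>

lemma cube_sobolev:
  fixes G :: "(real^'n::finite) \<times> real \<Rightarrow> (real^'n) \<times> real"
  assumes G: "integrable lborel G" and \<kappa>: "smooth \<kappa>" "kernel \<epsilon> \<kappa>" and r: "0 < r"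
    and I: "finite I" "I \<subseteq> Basis"
    and U: "\<And>bs. set bs \<subseteq> I \<Longrightarrow> distinct bs \<Longrightarrow>
      (\<integral>\<^sup>+z. cube_weight r I z * slice_norm G (iterated_partial bs \<kappa>) (x + (\<Sum>b\<in>I. z b *\<^sub>R b)) \<partial>Pi\<^sub>M I (\<lambda>_. lborel)) \<le> U"
  shows "slice_norm G \<kappa> x \<le> ennreal ((1 + 1 / r) ^ card I) * U"
  using I U
proof (induction I arbitrary: U rule: finite_induct)
  case empty
  interpret product_sigma_finite "\<lambda>_::real^'n. lborel :: real measure" by standard
  from empty.prems(2)[of "[]"] show ?case
    by (simp add: nn_integral_empty cube_weight_def PiM_empty)
next
  case (insert i I)
  interpret product_sigma_finite "\<lambda>_::real^'n. lborel :: real measure" by standard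
  have Gm[measurable]: "G \<in> borel_measurable borel" using borel_measurable_integrable[OF G] by simp
  have i: "i \<in> Basis" "I \<subseteq> Basis" using insert.prems(1) by auto
  have cr: "ennreal (1 / r) * U + U = ennreal (1 + 1 / r) * U"
    using r by (subst add.commute[of 1]) (simp add: ennreal_plus distrib_right del: ennreal_plus_if)
  have "slice_norm G \<kappa> x \<le> ennreal ((1 + 1 / r) ^ card I) * (ennreal (1 + 1 / r) * U)"
  proof (rule insert.IH[OF i(2)])
    fix bs assume bs: "set bs \<subseteq> I" "distinct bs"
    define f where "f = iterated_partial bs \<kappa>"
    have bsB: "set bs \<subseteq> Basis" using bs i by auto
    have f: "smooth f" "kernel \<epsilon> f"
      unfolding f_def by (rule smooth_iterated_partial[OF \<kappa>(1) bsB] kernel_iterated_partial[OF \<kappa> bsB])+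
    define f' where "f' = (\<lambda>w. grad f w \<bullet> i)"
    have f': "f' = iterated_partial (i # bs) \<kappa>" by (simp add: f'_def f_def)
    have kf': "kernel \<epsilon> f'" unfolding f'_def by (rule kernel_partial[OF smooth_C1[OF f(1)] f(2)])
    note [measurable] = slice_norm_measurable[OF Gm kernel_measurable[OF f(2)]] slice_norm_measurable[OF Gm kernel_measurable[OF kf']]
    define S where "S z = x + (\<Sum>b\<in>I. z b *\<^sub>R b)" for z :: "real^'n \<Rightarrow> real"
    have ins: "(\<integral>\<^sup>+z. cube_weight r (insert i I) z * slice_norm G q (x + (\<Sum>b\<in>insert i I. z b *\<^sub>R b)) \<partial>Pi\<^sub>M (insert i I) (\<lambda>_. lborel))
      = (\<integral>\<^sup>+z. cube_weight r I z * (\<integral>\<^sup>+t. indicator {0..r} t * slice_norm G q (S z + t *\<^sub>R i) \<partial>lborel) \<partial>Pi\<^sub>M I (\<lambda>_. lborel))"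
      if q: "kernel \<epsilon> q" for q
    proof -
      note [measurable] = slice_norm_measurable[OF Gm kernel_measurable[OF q]]
      have "(\<integral>\<^sup>+z. cube_weight r (insert i I) z * slice_norm G q (x + (\<Sum>b\<in>insert i I. z b *\<^sub>R b)) \<partial>Pi\<^sub>M (insert i I) (\<lambda>_. lborel))
        = (\<integral>\<^sup>+z. (\<integral>\<^sup>+t. cube_weight r (insert i I) (z(i := t)) * slice_norm G q (x + (\<Sum>b\<in>insert i I. (z(i := t)) b *\<^sub>R b)) \<partial>lborel) \<partial>Pi\<^sub>M I (\<lambda>_. lborel))"
        by (rule product_nn_integral_insert[OF insert.hyps(1,2)]) (unfold cube_weight_def, measurable)
      also have "\<dots> = (\<integral>\<^sup>+z. (\<integral>\<^sup>+t. cube_weight r I z * (indicator {0..r} t * slice_norm G q (S z + t *\<^sub>R i)) \<partial>lborel) \<partial>Pi\<^sub>M I (\<lambda>_. lborel))"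
      proof (intro nn_integral_cong)
        fix z t
        have 1: "(\<Prod>b\<in>I. indicator {0..r} ((z(i := t)) b)) = (\<Prod>b\<in>I. indicator {0..r} (z b) :: ennreal)"
          using insert.hyps(2) by (intro prod.cong) auto
        have 2: "(\<Sum>b\<in>I. (z(i := t)) b *\<^sub>R b) = (\<Sum>b\<in>I. z b *\<^sub>R b)"
          using insert.hyps(2) by (intro sum.cong) auto
        show "cube_weight r (insert i I) (z(i := t)) * slice_norm G q (x + (\<Sum>b\<in>insert i I. (z(i := t)) b *\<^sub>R b))
          = cube_weight r I z * (indicator {0..r} t * slice_norm G q (S z + t *\<^sub>R i))"
          unfolding cube_weight_def prod.insert[OF insert.hyps(1,2)] sum.insert[OF insert.hyps(1,2)] 1 2 S_def
          by (simp add: ac_simps)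
      qed
      also have "\<dots> = (\<integral>\<^sup>+z. cube_weight r I z * (\<integral>\<^sup>+t. indicator {0..r} t * slice_norm G q (S z + t *\<^sub>R i) \<partial>lborel) \<partial>Pi\<^sub>M I (\<lambda>_. lborel))"
        by (intro nn_integral_cong nn_integral_cmult) measurable
      finally show ?thesis .
    qed
    have Sm[measurable]: "S \<in> borel_measurable (Pi\<^sub>M I (\<lambda>_. lborel))" unfolding S_def by measurable
    have cm[measurable]: "cube_weight r I \<in> borel_measurable (Pi\<^sub>M I (\<lambda>_. lborel))" unfolding cube_weight_def[abs_def] by measurable
    define A where "A q z = (\<integral>\<^sup>+t. indicator {0..r} t * slice_norm G q (S z + t *\<^sub>R i) \<partial>lborel)" for q z
    have Am[measurable]: "A f \<in> borel_measurable (Pi\<^sub>M I (\<lambda>_. lborel))" "A f' \<in> borel_measurable (Pi\<^sub>M I (\<lambda>_. lborel))"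
      unfolding A_def[abs_def] by measurable
    have "(\<integral>\<^sup>+z. cube_weight r I z * slice_norm G f (S z) \<partial>Pi\<^sub>M I (\<lambda>_. lborel))
      \<le> (\<integral>\<^sup>+z. ennreal (1 / r) * (cube_weight r I z * A f z) + cube_weight r I z * A f' z \<partial>Pi\<^sub>M I (\<lambda>_. lborel))"
    proof (rule nn_integral_mono)
      fix z
      have "slice_norm G f (S z) \<le> (\<integral>\<^sup>+t. indicator {0..r} t * (ennreal (1 / r) * slice_norm G f (S z + t *\<^sub>R i) + slice_norm G f' (S z + t *\<^sub>R i)) \<partial>lborel)"
        unfolding f'_def by (rule slice_norm_step'[OF G smooth_C1[OF f(1)] f(2) r])
      also have "\<dots> = (\<integral>\<^sup>+t. ennreal (1 / r) * (indicator {0..r} t * slice_norm G f (S z + t *\<^sub>R i)) + indicator {0..r} t * slice_norm G f' (S z + t *\<^sub>R i) \<partial>lborel)"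
        by (intro nn_integral_cong) (simp add: distrib_left ac_simps)
      also have "\<dots> = ennreal (1 / r) * A f z + A f' z"
        unfolding A_def by (subst nn_integral_add) (auto simp: nn_integral_cmult)
      finally have "cube_weight r I z * slice_norm G f (S z) \<le> cube_weight r I z * (ennreal (1 / r) * A f z + A f' z)"
        by (rule mult_left_mono) simp
      then show "cube_weight r I z * slice_norm G f (S z) \<le> ennreal (1 / r) * (cube_weight r I z * A f z) + cube_weight r I z * A f' z"
        by (simp add: distrib_left ac_simps)
    qed
    also have "\<dots> = ennreal (1 / r) * (\<integral>\<^sup>+z. cube_weight r I z * A f z \<partial>Pi\<^sub>M I (\<lambda>_. lborel)) + (\<integral>\<^sup>+z. cube_weight r I z * A f' z \<partial>Pi\<^sub>M I (\<lambda>_. lborel))"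
      by (subst nn_integral_add) (auto simp: nn_integral_cmult)
    also have "\<dots> \<le> ennreal (1 / r) * U + U"
    proof (intro add_mono mult_left_mono)
      show "(\<integral>\<^sup>+z. cube_weight r I z * A f z \<partial>Pi\<^sub>M I (\<lambda>_. lborel)) \<le> U"
        unfolding A_def ins[OF f(2), symmetric] unfolding f_def by (rule insert.prems(2)) (use bs in auto)
      show "(\<integral>\<^sup>+z. cube_weight r I z * A f' z \<partial>Pi\<^sub>M I (\<lambda>_. lborel)) \<le> U"
        unfolding A_def ins[OF kf', symmetric] unfolding f' by (rule insert.prems(2)) (use bs insert.hyps in auto)
    qed simp
    finally show "(\<integral>\<^sup>+z. cube_weight r I z * slice_norm G (iterated_partial bs \<kappa>) (x + (\<Sum>b\<in>I. z b *\<^sub>R b)) \<partial>Pi\<^sub>M I (\<lambda>_. lborel)) \<le> ennreal (1 + 1 / r) * U"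
      unfolding cr by (simp add: f_def S_def)
  qed
  then show ?case
    using insert.hyps r by (simp add: ennreal_mult mult.assoc[symmetric] mult.commute)
qed

text \<open>
  Integrating the coordinates one at a time is integrating over the space.
\<close>

lemma cube_integral_le:
  fixes N :: "'a::euclidean_space \<Rightarrow> ennreal" and r :: real
  assumes [measurable]: "N \<in> borel_measurable borel" and r: "0 < r" "DIM('a) * r < 1/4" and x: "norm x < 1/4"
  shows "(\<integral>\<^sup>+z. cube_weight r Basis z * N (x + (\<Sum>b\<in>Basis. z b *\<^sub>R b)) \<partial>Pi\<^sub>M Basis (\<lambda>_. lborel)) \<le> (\<integral>\<^sup>+x\<in>ball 0 (1/2). N x \<partial>lborel)"
proof -
  have "(\<integral>\<^sup>+z. cube_weight r Basis z * N (x + (\<Sum>b\<in>Basis. z b *\<^sub>R b)) \<partial>Pi\<^sub>M Basis (\<lambda>_. lborel))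
    = (\<integral>\<^sup>+z. cube_weight r Basis (\<lambda>b. (\<Sum>b\<in>Basis. z b *\<^sub>R b) \<bullet> b) * N (x + (\<Sum>b\<in>Basis. z b *\<^sub>R b)) \<partial>Pi\<^sub>M (Basis::'a set) (\<lambda>_. lborel))"
    unfolding cube_weight_def by (intro nn_integral_cong arg_cong2[where f="(*)"] prod.cong refl) simp
  also have "\<dots> = (\<integral>\<^sup>+v. cube_weight r Basis (\<lambda>b. v \<bullet> b) * N (x + v) \<partial>lborel)"
    by (subst lborel_eq, subst nn_integral_distr) (unfold cube_weight_def, measurable)
  also have "\<dots> \<le> (\<integral>\<^sup>+v. N (x + v) * indicator (ball 0 (1/2)) (x + v) \<partial>lborel)"
  proof (rule nn_integral_mono)
    fix v :: 'a
    show "cube_weight r Basis (\<lambda>b. v \<bullet> b) * N (x + v) \<le> N (x + v) * indicator (ball 0 (1/2)) (x + v)"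
    proof (cases "\<forall>b\<in>Basis. v \<bullet> b \<in> {0..r}")
      case True
      have "norm v \<le> (\<Sum>b\<in>Basis. \<bar>v \<bullet> b\<bar>)" by (rule norm_le_l1)
      also have "\<dots> \<le> (\<Sum>b\<in>(Basis::'a set). r)" using True by (intro sum_mono) auto
      finally have "norm v < 1/4" using r by simp
      then have "norm (x + v) < 1/2" using norm_triangle_ineq[of x v] x by simp
      then show ?thesis using True by (simp add: cube_weight_def)
    next
      case False
      then have "cube_weight r Basis (\<lambda>b. v \<bullet> b) = 0" by (auto simp: cube_weight_def indicator_def)
      then show ?thesis by simp
    qed
  qed
  also have "\<dots> = (\<integral>\<^sup>+x\<in>ball 0 (1/2). N x \<partial>lborel)"
    by (rule nn_integral_translate[where f="\<lambda>x. N x * indicator (ball 0 (1/2)) x"])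
      (auto intro!: borel_measurable_times_ennreal borel_measurable_indicator assms(1))
  finally show ?thesis .
qed

text \<open>
  Sobolev's inequality is fed with the iterated energy estimates; the vertical
  \<open>L\<^sup>1\<close> norm over a bounded segment is at most the \<open>L\<^sup>2\<close>
  norm by Cauchy--Schwarz. Up to dimension plus one derivatives occur.
\<close>

lemma slice_norm_bound:
  assumes "\<Lambda> > 0" "1 \<le> c"
  shows "\<exists>C>0. \<forall>B \<mu> (G :: (real^'n::finite) \<times> real \<Rightarrow> _) \<kappa> bs M x.
    unit_solution \<Lambda> c B \<mu> G \<longrightarrow> smooth \<kappa> \<longrightarrow> kernel (1/8) \<kappa> \<longrightarrow> (LINT w|lborel. \<bar>\<kappa> w\<bar>) \<le> 1 \<longrightarrow>
    set bs \<subseteq> Basis \<longrightarrow> length bs \<le> 1 \<longrightarrow> 0 < M \<longrightarrow> (\<integral>\<^sup>+X\<in>cyl 0 1. ennreal ((norm (G X))\<^sup>2) \<partial>lborel) \<le> ennreal (M\<^sup>2) \<longrightarrow>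
    norm x < 1/4 \<longrightarrow> slice_norm G (iterated_partial bs \<kappa>) x \<le> ennreal (C * M)"
proof -
  \<comment> \<open>Cubes of this size at points of the ball of radius \<open>1/4\<close> stay in
    the ball of radius \<open>1/2\<close>.\<close>
  define r where "r = 1 / (8 * DIM(real^'n))"
  have r: "0 < r" "DIM(real^'n) * r < 1/4" by (simp_all add: r_def)
  define P where "P m C \<longleftrightarrow> (\<forall>B \<mu> (G :: (real^'n) \<times> real \<Rightarrow> _) \<kappa> bs.
    unit_solution \<Lambda> c B \<mu> G \<longrightarrow> smooth \<kappa> \<longrightarrow> kernel (1/8) \<kappa> \<longrightarrow> (LINT w|lborel. \<bar>\<kappa> w\<bar>) \<le> 1 \<longrightarrow>
    set bs \<subseteq> Basis \<longrightarrow> length bs = m \<longrightarrow>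
    (\<integral>\<^sup>+X\<in>cyl 0 (1/2). ennreal ((norm (conv horizontal G (iterated_partial bs \<kappa>) X))\<^sup>2) \<partial>lborel)
      \<le> ennreal C * (\<integral>\<^sup>+X\<in>cyl 0 1. ennreal ((norm (G X))\<^sup>2) \<partial>lborel))" for m :: nat and C :: real
  have "\<forall>m. \<exists>C. C > 0 \<and> P m C"
    unfolding P_def using iterated_caccioppoli[OF assms, of "1/2", where 'n='n] by simp
  from choice[OF this] obtain Cm where Cm': "\<forall>m. Cm m > 0 \<and> P m (Cm m)" by blast
  have Cm: "Cm m > 0" "P m (Cm m)" for m using Cm' by auto
  define V where "V = measure lborel (cyl (0 :: (real^'n) \<times> real) (1/2))"
  have V: "emeasure lborel (cyl (0 :: (real^'n) \<times> real) (1/2)) = ennreal V"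
    unfolding V_def using emeasure_bounded_finite[OF bounded_cyl, of "0 :: (real^'n) \<times> real" "1/2"] by (intro emeasure_eq_ennreal_measure) auto
  have V0: "V \<ge> 0" by (simp add: V_def)
  define CC where "CC = (\<Sum>m\<le>DIM(real^'n) + 1. Cm m)"
  have CC: "Cm m \<le> CC" if "m \<le> DIM(real^'n) + 1" for m
    unfolding CC_def using that less_imp_le[OF Cm(1)] by (intro member_le_sum) auto
  have CC0: "CC > 0" using CC[of 0] Cm(1)[of 0] by simp
  define C where "C = (1 + 1 / r) ^ DIM(real^'n) * (V + CC)"
  have "C > 0" using r CC0 V0 unfolding C_def by (intro mult_pos_pos zero_less_power add_pos_nonneg add_nonneg_pos) auto
  show ?thesis
  proof (intro exI[of _ C] conjI \<open>C > 0\<close> allI impI)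
    fix B \<mu> and G :: "(real^'n) \<times> real \<Rightarrow> (real^'n) \<times> real" and \<kappa> :: "real^'n \<Rightarrow> real" and bs :: "(real^'n) list" and M :: real and x :: "real^'n"
    assume G: "unit_solution \<Lambda> c B \<mu> G" and \<kappa>: "smooth \<kappa>" "kernel (1/8) \<kappa>" "(LINT w|lborel. \<bar>\<kappa> w\<bar>) \<le> 1"
      and bs: "set bs \<subseteq> Basis" "length bs \<le> 1" and M: "0 < M" "(\<integral>\<^sup>+X\<in>cyl 0 1. ennreal ((norm (G X))\<^sup>2) \<partial>lborel) \<le> ennreal (M\<^sup>2)"
      and x: "norm x < 1/4"
    note [measurable] = unit_solutionD(6)[OF G]
    have L1: "(\<integral>\<^sup>+X\<in>cyl 0 (1/2). ennreal (norm (conv horizontal G (iterated_partial as \<kappa>) X)) \<partial>lborel) \<le> ennreal (M * (V + CC))"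
      if as: "set as \<subseteq> Basis" "length as \<le> DIM(real^'n) + 1" for as
    proof -
      define H where "H = conv horizontal G (iterated_partial as \<kappa>)"
      have [measurable]: "H \<in> borel_measurable borel" unfolding H_def
        by (rule conv_measurable[OF linear_horizontal unit_solutionD(6)[OF G] kernel_measurable[OF kernel_iterated_partial[OF \<kappa>(1,2) as(1)]]])
      have "(\<integral>\<^sup>+X\<in>cyl 0 (1/2). ennreal ((norm (H X))\<^sup>2) \<partial>lborel) \<le> ennreal (Cm (length as)) * (\<integral>\<^sup>+X\<in>cyl 0 1. ennreal ((norm (G X))\<^sup>2) \<partial>lborel)"
        unfolding H_def using Cm(2)[of "length as", unfolded P_def] G \<kappa> as(1) by blast
      also have "\<dots> \<le> ennreal CC * ennreal (M\<^sup>2)"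
        using CC[OF as(2)] M(2) by (intro mult_mono ennreal_leI) auto
      finally have 1: "(\<integral>\<^sup>+X\<in>cyl 0 (1/2). ennreal ((norm (H X))\<^sup>2) \<partial>lborel) \<le> ennreal (CC * M\<^sup>2)"
        using CC0 by (simp add: ennreal_mult)
      have "(\<integral>\<^sup>+X\<in>cyl 0 (1/2). ennreal (norm (H X)) \<partial>lborel)
        \<le> (\<integral>\<^sup>+X. ennreal M * indicator (cyl 0 (1/2)) X + ennreal (1 / M) * (ennreal ((norm (H X))\<^sup>2) * indicator (cyl 0 (1/2)) X) \<partial>lborel)"
      proof (rule nn_integral_mono)
        fix X
        have "norm (H X) \<le> M + 1 / M * (norm (H X))\<^sup>2"
        proof (cases "norm (H X) \<le> M")
          case True
          then show ?thesis using M(1) by (simp add: add_increasing2)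
        next
          case False
          then have "M * norm (H X) \<le> (norm (H X))\<^sup>2" by (simp add: power2_eq_square mult_right_mono)
          then show ?thesis using M(1) by (simp add: field_simps add_increasing)
        qed
        then show "ennreal (norm (H X)) * indicator (cyl 0 (1/2)) X
          \<le> ennreal M * indicator (cyl 0 (1/2)) X + ennreal (1 / M) * (ennreal ((norm (H X))\<^sup>2) * indicator (cyl 0 (1/2)) X)"
          using M(1) by (auto simp: indicator_def ennreal_mult[symmetric] ennreal_plus[symmetric] simp del: ennreal_plus intro!: ennreal_leI)
      qed
      also have "\<dots> = ennreal M * ennreal V + ennreal (1 / M) * (\<integral>\<^sup>+X\<in>cyl 0 (1/2). ennreal ((norm (H X))\<^sup>2) \<partial>lborel)"
        by (simp add: nn_integral_add nn_integral_cmult nn_integral_cmult_indicator V)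
      also have "\<dots> \<le> ennreal M * ennreal V + ennreal (1 / M) * ennreal (CC * M\<^sup>2)"
        by (intro add_mono mult_left_mono 1) auto
      also have "\<dots> = ennreal (M * (V + CC))"
        using M(1) V0 CC0 by (simp add: ennreal_mult[symmetric] ennreal_plus[symmetric] power2_eq_square distrib_left mult.commute del: ennreal_plus)
      finally show ?thesis by (simp add: H_def)
    qed
    define f where "f = iterated_partial bs \<kappa>"
    have f: "smooth f" "kernel (1/8) f"
      unfolding f_def by (rule smooth_iterated_partial[OF \<kappa>(1) bs(1)] kernel_iterated_partial[OF \<kappa>(1,2) bs(1)])+
    have app: "iterated_partial as f = iterated_partial (as @ bs) \<kappa>" for as
      by (induction as) (auto simp: f_def)
    have "slice_norm G f x \<le> ennreal ((1 + 1 / r) ^ card (Basis :: (real^'n) set)) * ennreal (M * (V + CC))"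
    proof (rule cube_sobolev[OF unit_solution_integrable(2)[OF G] f r(1) finite_Basis subset_refl])
      fix as :: "(real^'n) list" assume as: "set as \<subseteq> Basis" "distinct as"
      have "length as \<le> DIM(real^'n)"
        using card_mono[OF finite_Basis as(1)] distinct_card[OF as(2)] by simp
      then have ab: "set (as @ bs) \<subseteq> Basis" "length (as @ bs) \<le> DIM(real^'n) + 1" using as bs by auto
      define q where "q = iterated_partial as f"
      have [measurable]: "q \<in> borel_measurable borel"
        unfolding q_def by (rule kernel_measurable[OF kernel_iterated_partial[OF f as(1)]])
      note [measurable] = conv_measurable[OF linear_horizontal unit_solutionD(6)[OF G] this]
      have "(\<integral>\<^sup>+z. cube_weight r Basis z * slice_norm G q (x + (\<Sum>b\<in>Basis. z b *\<^sub>R b)) \<partial>Pi\<^sub>M Basis (\<lambda>_. lborel))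
        \<le> (\<integral>\<^sup>+x\<in>ball 0 (1/2). slice_norm G q x \<partial>lborel)"
        by (rule cube_integral_le[OF slice_norm_measurable r x]) measurable
      also have "\<dots> = (\<integral>\<^sup>+x. (\<integral>\<^sup>+y. (\<lambda>X. ennreal (norm (conv horizontal G q X)) * indicator (ball 0 (1/2) \<times> {-1/4<..<1/4}) X) (x, y) \<partial>lborel) \<partial>lborel)"
        unfolding slice_norm_def by (subst nn_integral_multc[symmetric]) (auto intro!: nn_integral_cong simp: indicator_def)
      also have "\<dots> = (\<integral>\<^sup>+X. ennreal (norm (conv horizontal G q X)) * indicator (ball 0 (1/2) \<times> {-1/4<..<1/4}) X \<partial>(lborel \<Otimes>\<^sub>M lborel))"
      proof (rule lborel.nn_integral_fst)
        have "(ball 0 (1/2) \<times> {-1/4<..<1/4} :: ((real^'n) \<times> real) set) \<in> sets borel"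
          by (intro borel_open open_Times) auto
        then show "(\<lambda>X. ennreal (norm (conv horizontal G q X)) * indicator (ball 0 (1/2) \<times> {-1/4<..<1/4}) X) \<in> borel_measurable (lborel \<Otimes>\<^sub>M lborel)"
          unfolding lborel_prod by (simp add: borel_measurable_indicator)
      qed
      also have "\<dots> \<le> (\<integral>\<^sup>+X\<in>cyl 0 (1/2). ennreal (norm (conv horizontal G q X)) \<partial>lborel)"
        unfolding lborel_prod by (intro nn_integral_mono) (auto simp: indicator_def mem_cyl_0)
      also have "\<dots> \<le> ennreal (M * (V + CC))"
        unfolding q_def app by (rule L1[OF ab])
      finally show "(\<integral>\<^sup>+z. cube_weight r Basis z * slice_norm G (iterated_partial as f) (x + (\<Sum>b\<in>Basis. z b *\<^sub>R b)) \<partial>Pi\<^sub>M Basis (\<lambda>_. lborel)) \<le> ennreal (M * (V + CC))"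
        by (simp add: q_def)
    qed
    also have "\<dots> = ennreal (C * M)"
      using r V0 CC0 M(1) by (simp add: C_def ennreal_mult[symmetric] ac_simps)
    finally show "slice_norm G (iterated_partial bs \<kappa>) x \<le> ennreal (C * M)" by (simp add: f_def)
  qed
qed

section \<open>Pointwise bounds by duality\<close>

lemma C1_prod:
  assumes "finite I" "\<And>i. i \<in> I \<Longrightarrow> \<exists>g. C1 (f i) g"
  shows "\<exists>g. C1 (\<lambda>X. \<Prod>i\<in>I. f i X) g"
  using assms
proof (induction I rule: finite_induct)
  case empty
  show ?case using C1_const[of 1] by auto
next
  case (insert i I)
  obtain g h where "C1 (f i) g" "C1 (\<lambda>X. \<Prod>i\<in>I. f i X) h" using insert by blast
  from C1_mult[OF this] show ?case using insert.hyps by auto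
qed

lemma C1_inner_left: "C1 (\<lambda>X. X \<bullet> e) (\<lambda>X. e)"
  unfolding C1_def by (auto intro!: derivative_eq_intros simp: inner_commute)

text \<open>
  The product over the coordinates of \<open>(max 0 ((X\<^sub>e - a\<^sub>e) (b\<^sub>e -
  X\<^sub>e)))\<^sup>2\<close>.
\<close>

lemma box_bump:
  fixes a b :: "'a::euclidean_space"
  assumes ab: "\<And>e. e \<in> Basis \<Longrightarrow> a \<bullet> e < b \<bullet> e"
  obtains \<beta> g where "C1 \<beta> g" "\<And>X. 0 \<le> \<beta> X" "\<And>X. X \<in> box a b \<longleftrightarrow> 0 < \<beta> X"
proof -
  define f where "f e X = (max 0 ((X \<bullet> e - a \<bullet> e) * (b \<bullet> e - X \<bullet> e)))\<^sup>2" for e X :: 'a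
  have "continuous_on UNIV (\<lambda>t::real. 2 * max 0 t)" by (intro continuous_intros)
  then have "\<exists>g. C1 (f e) g" for e
    unfolding f_def
    using C1_compose_real[OF C1_mult[OF C1_diff[OF C1_inner_left[of e] C1_const[of "a \<bullet> e"]] C1_diff[OF C1_const[of "b \<bullet> e"] C1_inner_left[of e]]] max0_squared_derivative]
    by blast
  then obtain g where g: "C1 (\<lambda>X. \<Prod>e\<in>Basis. f e X) g" using C1_prod[OF finite_Basis] by blast
  have f: "f e X > 0 \<longleftrightarrow> a \<bullet> e < X \<bullet> e \<and> X \<bullet> e < b \<bullet> e" if "e \<in> Basis" for e X
  proof -
    have "(max 0 t)\<^sup>2 > 0 \<longleftrightarrow> t > 0" for t :: real by (auto simp: max_def)
    then have "f e X > 0 \<longleftrightarrow> 0 < (X \<bullet> e - a \<bullet> e) * (b \<bullet> e - X \<bullet> e)" by (simp only: f_def)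
    then show ?thesis using ab[OF that] unfolding zero_less_mult_iff by linarith
  qed
  have f0: "f e X \<ge> 0" for e X by (simp add: f_def)
  show ?thesis
  proof (rule that[OF g])
    show "0 \<le> (\<Prod>e\<in>Basis. f e X)" for X using f0 by (simp add: prod_nonneg)
    show "X \<in> box a b \<longleftrightarrow> 0 < (\<Prod>e\<in>Basis. f e X)" for X
    proof
      assume "X \<in> box a b"
      then show "0 < (\<Prod>e\<in>Basis. f e X)" using f by (intro prod_pos) (auto simp: box_def)
    next
      assume "0 < (\<Prod>e\<in>Basis. f e X)"
      then have "f e X \<noteq> 0" if "e \<in> Basis" for e
        using that prod_zero_iff[OF finite_Basis, of "\<lambda>e. f e X"] by (metis less_irrefl)
      then have "f e X > 0" if "e \<in> Basis" for e using that f0[of e X] by (metis order_le_imp_less_or_eq)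
      then show "X \<in> box a b" using f by (auto simp: box_def)
    qed
  qed
qed

text \<open>
  The indicator function of an open box is the limit of \<open>transition (j \<beta>)\<close>,
  where \<open>\<beta>\<close> is positive exactly in the box.
\<close>

lemma dual_bound_box:
  fixes F :: "'a::euclidean_space \<Rightarrow> real"
  assumes F: "integrable lborel F"
    and K: "\<And>\<phi> h S. C1 \<phi> h \<Longrightarrow> compact S \<Longrightarrow> S \<subseteq> U \<Longrightarrow> (\<And>X. X \<notin> S \<Longrightarrow> \<phi> X = 0) \<Longrightarrow>
      \<bar>LINT X|lborel. F X * \<phi> X\<bar> \<le> K * (LINT X|lborel. \<bar>\<phi> X\<bar>)"
    and ab: "\<And>e. e \<in> Basis \<Longrightarrow> a \<bullet> e < b \<bullet> e" "cbox a b \<subseteq> U"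
  shows "\<bar>LINT X|lborel. F X * indicator (box a b) X\<bar> \<le> K * measure lborel (box a b)"
proof -
  obtain \<beta> g where \<beta>: "C1 \<beta> g" "\<And>X. 0 \<le> \<beta> X" "\<And>X. X \<in> box a b \<longleftrightarrow> 0 < \<beta> X"
    using box_bump[OF ab(1)] by blast
  define \<phi> where "\<phi> j X = transition (real j * \<beta> X)" for j :: nat and X
  have \<phi>C: "\<exists>h. C1 (\<phi> j) h" for j
    unfolding \<phi>_def using C1_transition[OF C1_mult[OF C1_const \<beta>(1)]] by blast
  have \<phi>m[measurable]: "\<phi> j \<in> borel_measurable borel" for j using \<phi>C[of j] C1_measurable(1) by blast
  note [measurable] = borel_measurable_integrable[OF F, simplified]
  have \<phi>0: "\<phi> j X = 0" if "X \<notin> cbox a b" for j X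
  proof -
    have "X \<notin> box a b" using that box_subset_cbox by blast
    then have "\<beta> X = 0" using \<beta>(2)[of X] \<beta>(3)[of X] by simp
    then show ?thesis by (simp add: \<phi>_def transition_eq)
  qed
  have \<phi>b: "0 \<le> \<phi> j X" "\<phi> j X \<le> 1" for j X by (simp_all add: \<phi>_def transition_range)
  have lim: "(\<lambda>j. \<phi> j X) \<longlonglongrightarrow> indicator (box a b) X" for X
  proof (cases "X \<in> box a b")
    case True
    then have p: "\<beta> X > 0" using \<beta>(3) by blast
    obtain N :: nat where N: "1 / \<beta> X \<le> real N" using real_arch_simple by blast
    have "eventually (\<lambda>j. \<phi> j X = 1) sequentially"
    proof (rule eventually_sequentiallyI[of N])
      fix j assume "N \<le> j"
      then have "1 / \<beta> X \<le> real j" using N by linarith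
      then have "1 \<le> real j * \<beta> X" using p by (simp add: divide_simps)
      then show "\<phi> j X = 1" by (simp add: \<phi>_def transition_eq)
    qed
    then show ?thesis using True by (simp add: tendsto_eventually)
  next
    case False
    then have "\<beta> X = 0" using \<beta>(2)[of X] \<beta>(3)[of X] by simp
    then show ?thesis using False by (simp add: \<phi>_def transition_eq)
  qed
  have "(\<lambda>j. LINT X|lborel. F X * \<phi> j X) \<longlonglongrightarrow> (LINT X|lborel. F X * indicator (box a b) X)"
  proof (rule integral_dominated_convergence[where w="\<lambda>X. \<bar>F X\<bar>"])
    show "AE X in lborel. (\<lambda>j. F X * \<phi> j X) \<longlonglongrightarrow> F X * indicator (box a b) X"
      by (intro AE_I2 tendsto_mult tendsto_const lim)
    show "AE X in lborel. norm (F X * \<phi> j X) \<le> \<bar>F X\<bar>" for j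
      using \<phi>b by (intro AE_I2) (simp add: abs_mult mult_left_le)
    show "integrable lborel (\<lambda>X. \<bar>F X\<bar>)" using F by simp
  qed measurable
  then have l1: "(\<lambda>j. \<bar>LINT X|lborel. F X * \<phi> j X\<bar>) \<longlonglongrightarrow> \<bar>LINT X|lborel. F X * indicator (box a b) X\<bar>"
    by (rule tendsto_rabs)
  have "(\<lambda>j. LINT X|lborel. \<bar>\<phi> j X\<bar>) \<longlonglongrightarrow> (LINT X|lborel. indicator (box a b) X)"
  proof (rule integral_dominated_convergence[where w="indicator (cbox a b)"])
    show "integrable lborel (indicator (cbox a b) :: 'a \<Rightarrow> real)"
      by (auto intro!: integrable_real_indicator emeasure_bounded_finite)
    show "AE X in lborel. (\<lambda>j. \<bar>\<phi> j X\<bar>) \<longlonglongrightarrow> indicator (box a b) X"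
      using lim \<phi>b(1) by (intro AE_I2) simp
    show "AE X in lborel. norm \<bar>\<phi> j X\<bar> \<le> indicator (cbox a b) X" for j
      using \<phi>b \<phi>0 by (intro AE_I2) (auto simp: indicator_def)
  qed measurable
  then have l2: "(\<lambda>j. K * (LINT X|lborel. \<bar>\<phi> j X\<bar>)) \<longlonglongrightarrow> K * measure lborel (box a b)"
    using tendsto_mult_left[of _ "measure lborel (box a b)" sequentially K] by simp
  show ?thesis
  proof (rule LIMSEQ_le[OF l1 l2], intro exI allI impI)
    fix j :: nat
    obtain h where "C1 (\<phi> j) h" using \<phi>C by blast
    then show "\<bar>LINT X|lborel. F X * \<phi> j X\<bar> \<le> K * (LINT X|lborel. \<bar>\<phi> j X\<bar>)"
      by (rule K[OF _ compact_cbox ab(2)]) (rule \<phi>0)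
  qed
qed

text \<open>
  Testing with boxes bounds the averages of \<open>F\<close>, and Lebesgue's differentiation
  theorem turns averages over small boxes into values.
\<close>

lemma AE_bound_by_duality:
  fixes F :: "'a::euclidean_space \<Rightarrow> real"
  assumes F: "integrable lborel F" and U: "open U"
    and K: "\<And>\<phi> h S. C1 \<phi> h \<Longrightarrow> compact S \<Longrightarrow> S \<subseteq> U \<Longrightarrow> (\<And>X. X \<notin> S \<Longrightarrow> \<phi> X = 0) \<Longrightarrow>
      \<bar>LINT X|lborel. F X * \<phi> X\<bar> \<le> K * (LINT X|lborel. \<bar>\<phi> X\<bar>)"
  shows "AE X in lborel. X \<in> U \<longrightarrow> \<bar>F X\<bar> \<le> K"
proof -
  have "F integrable_on cbox a b" for a b
    using integrable_on_lborel[OF F] integrable_on_subcbox by blast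
  then obtain N where N: "negligible N"
    "\<And>x e. \<lbrakk>x \<notin> N; 0 < e\<rbrakk> \<Longrightarrow> \<exists>d>0. \<forall>h. 0 < h \<and> h < d \<longrightarrow> norm (integral (cbox x (x + h *\<^sub>R One)) F /\<^sub>R h ^ DIM('a) - F x) < e"
    using integrable_ccontinuous_explicit by metis
  have "\<bar>F x\<bar> \<le> K" if x: "x \<in> U" "x \<notin> N" for x
  proof (rule field_le_epsilon)
    fix e :: real assume "e > 0"
    obtain d where d: "d > 0" "\<And>h. 0 < h \<Longrightarrow> h < d \<Longrightarrow> norm (integral (cbox x (x + h *\<^sub>R One)) F /\<^sub>R h ^ DIM('a) - F x) < e"
      using N(2)[OF x(2) \<open>e > 0\<close>] by blast
    obtain \<rho> where \<rho>: "\<rho> > 0" "ball x \<rho> \<subseteq> U" using U x(1) openE by blast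
    define h where "h = min (d / 2) (\<rho> / (2 * DIM('a)))"
    have h: "h > 0" "h < d" using d(1) \<rho>(1) by (auto simp: h_def)
    have "h \<le> \<rho> / (2 * DIM('a))" by (simp add: h_def)
    then have hD: "DIM('a) * h \<le> \<rho> / 2" by (simp add: field_simps)
    let ?b = "x + h *\<^sub>R One"
    have xb: "x \<bullet> e < ?b \<bullet> e" if "e \<in> Basis" for e using h that by (simp add: inner_add_left)
    have "cbox x ?b \<subseteq> ball x \<rho>"
    proof
      fix y assume y: "y \<in> cbox x ?b"
      have "norm (y - x) \<le> (\<Sum>b\<in>Basis. \<bar>(y - x) \<bullet> b\<bar>)" by (rule norm_le_l1)
      also have "\<dots> \<le> (\<Sum>b\<in>(Basis::'a set). h)"
        using y by (intro sum_mono) (auto simp: mem_box inner_diff_left inner_add_left)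
      finally have "norm (y - x) < \<rho>" using hD \<rho>(1) by simp
      then show "y \<in> ball x \<rho>" by (simp add: dist_norm norm_minus_commute)
    qed
    then have sub: "cbox x ?b \<subseteq> U" using \<rho>(2) by blast
    have "integral (cbox x ?b) F = (LINT X|lborel. F X * indicator (box x ?b) X)"
    proof -
      have "set_integrable lborel (box x ?b) F"
        unfolding set_integrable_def using F by (intro integrable_mult_indicator) auto
      from set_borel_integral_eq_integral(2)[OF this] show ?thesis
        by (simp add: integral_open_interval set_lebesgue_integral_def mult.commute)
    qed
    moreover have "\<bar>LINT X|lborel. F X * indicator (box x ?b) X\<bar> \<le> K * measure lborel (box x ?b)"
    proof (rule dual_bound_box[OF F _ xb sub])
      fix \<phi> h S
      assume *: "C1 \<phi> h" "compact S" "S \<subseteq> U" "\<And>X. X \<notin> S \<Longrightarrow> \<phi> X = 0"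
      show "\<bar>LINT X|lborel. F X * \<phi> X\<bar> \<le> K * (LINT X|lborel. \<bar>\<phi> X\<bar>)"
        by (rule K[OF *])
    qed
    ultimately have "\<bar>integral (cbox x ?b) F\<bar> \<le> K * measure lborel (box x ?b)"
      by (simp only:)
    also have "measure lborel (box x ?b) = h ^ DIM('a)"
      using h by (simp add: measure_lborel_box_eq inner_add_left)
    finally have "\<bar>integral (cbox x ?b) F\<bar> / h ^ DIM('a) \<le> K" using h by (simp add: divide_simps)
    moreover have "\<bar>integral (cbox x ?b) F /\<^sub>R h ^ DIM('a)\<bar> = \<bar>integral (cbox x ?b) F\<bar> / h ^ DIM('a)"
      using h by (simp add: abs_mult divide_inverse mult.commute)
    moreover have "\<bar>integral (cbox x ?b) F /\<^sub>R h ^ DIM('a) - F x\<bar> < e" using d(2)[OF h] by simp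
    ultimately show "\<bar>F x\<bar> \<le> K + e" by linarith
  qed
  then have "AE x in lebesgue. x \<in> U \<longrightarrow> \<bar>F x\<bar> \<le> K"
    using N(1) unfolding negligible_iff_null_sets by (intro AE_I'[of N]) auto
  then show ?thesis by (simp add: AE_completion_iff)
qed

section \<open>Integration in the vertical direction\<close>

lemma integral_cbox_lborel:
  fixes q :: "'b::euclidean_space \<Rightarrow> 'c::euclidean_space"
  assumes "continuous_on UNIV q"
  shows "set_integrable lborel (cbox a b) q" "integral (cbox a b) q = (LINT t:cbox a b|lborel. q t)"
proof -
  show s: "set_integrable lborel (cbox a b) q"
    unfolding set_integrable_def using assms by (intro borel_integrable_compact compact_cbox) (rule continuous_on_subset, auto)
  show "integral (cbox a b) q = (LINT t:cbox a b|lborel. q t)"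
    using set_borel_integral_eq_integral(2)[OF s] by simp
qed

definition fibre_mass :: "((real^'n::finite) \<times> real \<Rightarrow> real) \<Rightarrow> real^'n \<Rightarrow> ennreal"
  where "fibre_mass \<phi> x = (\<integral>\<^sup>+s. ennreal \<bar>\<phi> (x, s)\<bar> \<partial>lborel)"

text \<open>
  With \<open>\<psi> (x, y) = \<integral>\<^bsub>0\<^esub>\<^bsup>1/8\<^esup> (1 - 8 t) \<phi>
  (x, y + t) dt\<close> one integration by parts gives \<open>\<partial>\<^sub>y \<psi> = A -
  \<phi>\<close>, where \<open>A\<close> is the average of \<open>\<phi>\<close> over a vertical
  segment of length \<open>1/8\<close>. Both \<open>\<psi>\<close> and \<open>A\<close> are
  bounded by the fibre integral of \<open>|\<phi>|\<close>. Dually this is the estimate of a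
  function of \<open>y\<close> by the integrals of itself and its derivative.
\<close>

lemma vertical_split:
  fixes \<phi> :: "(real^'n::finite) \<times> real \<Rightarrow> real"
  assumes \<phi>: "C1 \<phi> h" "compact K" "K \<subseteq> cyl 0 (1/8)" "\<And>X. X \<notin> K \<Longrightarrow> \<phi> X = 0"
  obtains \<psi> h' K' A where "C1 \<psi> h'" "compact K'" "K' \<subseteq> cyl 0 (1/4)" "\<And>X. X \<notin> K' \<Longrightarrow> \<psi> X = 0"
    "continuous_on UNIV A" "\<And>X. X \<notin> K' \<Longrightarrow> A X = 0" "\<And>X. \<phi> X = A X - h' X \<bullet> (0, 1)"
    "\<And>X. ennreal \<bar>\<psi> X\<bar> \<le> fibre_mass \<phi> (fst X)" "\<And>X. ennreal \<bar>A X\<bar> \<le> 8 * fibre_mass \<phi> (fst X)"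
proof -
  define v where "v t = ((0, - t) :: (real^'n) \<times> real)" for t :: real
  have v: "linear v" by (rule linearI) (auto simp: v_def)
  have vs: "X - v t = X + t *\<^sub>R (0, 1)" for X t by (simp add: v_def prod_eq_iff)
  define \<psi> where "\<psi> X = integral (cbox 0 (1/8)) (\<lambda>t. (1 - 8 * t) *\<^sub>R \<phi> (X - v t))" for X
  define h' where "h' X = integral (cbox 0 (1/8)) (\<lambda>t. (1 - 8 * t) *\<^sub>R h (X - v t))" for X
  define A where "A X = integral (cbox 0 (1/8)) (\<lambda>t. 8 *\<^sub>R \<phi> (X - v t))" for X
  have C: "C1 \<psi> h'"
    unfolding \<psi>_def[abs_def] h'_def[abs_def] by (rule C1_integral_cbox[OF \<phi>(1) v]) (intro continuous_intros)
  have CA: "C1 A (\<lambda>X. integral (cbox 0 (1/8)) (\<lambda>t. 8 *\<^sub>R h (X - v t)))"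
    unfolding A_def[abs_def] by (rule C1_integral_cbox[OF \<phi>(1) v]) (intro continuous_intros)
  define K' where "K' = (\<lambda>(Z, t). Z + v t) ` (K \<times> {0..1/8})"
  have cv: "continuous_on UNIV v"
    using v by (simp add: linear_continuous_on linear_conv_bounded_linear)
  have "compact K'"
    unfolding K'_def case_prod_beta
    by (intro compact_continuous_image compact_Times \<phi>(2) compact_Icc continuous_on_add continuous_on_compose2[OF cv]
        continuous_on_fst continuous_on_snd continuous_on_id) auto
  have K'sub: "K' \<subseteq> cyl 0 (1/4)"
  proof
    fix X assume "X \<in> K'"
    then obtain Z t where "Z \<in> K" "0 \<le> t" "t \<le> 1/8" "X = Z + v t" by (auto simp: K'_def)
    moreover from this have "Z \<in> cyl 0 (1/8)" using \<phi>(3) by blast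
    moreover have "\<bar>snd Z - t\<bar> \<le> \<bar>snd Z\<bar> + \<bar>t\<bar>" by (rule abs_triangle_ineq4)
    ultimately show "X \<in> cyl 0 (1/4)" by (simp add: mem_cyl_0 v_def)
  qed
  have 0: "\<phi> (X - v t) = 0" if "X \<notin> K'" "t \<in> cbox 0 (1/8)" for X t
  proof (rule \<phi>(4), rule)
    assume "X - v t \<in> K"
    then have "X \<in> K'" unfolding K'_def using that(2) by (intro image_eqI[of _ _ "(X - v t, t)"]) auto
    with that(1) show False by simp
  qed
  have c\<phi>: "continuous_on UNIV (\<lambda>t. \<phi> (X - v t))" for X
    by (intro continuous_on_compose2[OF C1_continuous[OF \<phi>(1), of UNIV]] continuous_on_diff continuous_on_const cv) auto
  have ch: "continuous_on UNIV (\<lambda>t. h (X - v t))" for X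
    by (intro continuous_on_compose2[OF C1_continuous_gradient[OF \<phi>(1), of UNIV]] continuous_on_diff continuous_on_const cv) auto
  have bound: "ennreal \<bar>integral (cbox 0 (1/8)) (\<lambda>t. q t *\<^sub>R \<phi> (X - v t))\<bar> \<le> ennreal m * fibre_mass \<phi> (fst X)"
    if q: "continuous_on UNIV q" "\<And>t. t \<in> cbox 0 (1/8) \<Longrightarrow> \<bar>q t\<bar> \<le> m" for q m X
  proof -
    note [measurable] = C1_measurable(1)[OF \<phi>(1)]
    have m: "m \<ge> 0" using q(2)[of 0] by simp
    note i = integral_cbox_lborel[OF continuous_on_scaleR[OF q(1) c\<phi>[of X]], of 0 "1/8"]
    have "ennreal \<bar>integral (cbox 0 (1/8)) (\<lambda>t. q t *\<^sub>R \<phi> (X - v t))\<bar>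
      \<le> (\<integral>\<^sup>+t. ennreal (norm (indicator (cbox 0 (1/8)) t *\<^sub>R (q t *\<^sub>R \<phi> (X - v t)))) \<partial>lborel)"
      unfolding i(2) set_lebesgue_integral_def real_norm_def[symmetric]
      by (rule integral_norm_bound_ennreal) (use i(1) in \<open>simp add: set_integrable_def\<close>)
    also have "\<dots> \<le> (\<integral>\<^sup>+t. ennreal m * ennreal \<bar>\<phi> (fst X, snd X + t)\<bar> \<partial>lborel)"
    proof (rule nn_integral_mono)
      fix t
      have "norm (indicator (cbox 0 (1/8)) t *\<^sub>R (q t *\<^sub>R \<phi> (X - v t))) \<le> m * \<bar>\<phi> (X - v t)\<bar>"
        using q(2)[of t] m by (auto simp: indicator_def abs_mult intro!: mult_right_mono)
      moreover have "X - v t = (fst X, snd X + t)" by (simp add: v_def prod_eq_iff)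
      ultimately show "ennreal (norm (indicator (cbox 0 (1/8)) t *\<^sub>R (q t *\<^sub>R \<phi> (X - v t)))) \<le> ennreal m * ennreal \<bar>\<phi> (fst X, snd X + t)\<bar>"
        using m by (simp add: ennreal_mult[symmetric] ennreal_leI)
    qed
    also have "\<dots> = ennreal m * (\<integral>\<^sup>+t. ennreal \<bar>\<phi> (fst X, snd X + t)\<bar> \<partial>lborel)"
      by (rule nn_integral_cmult) measurable
    also have "(\<integral>\<^sup>+t. ennreal \<bar>\<phi> (fst X, snd X + t)\<bar> \<partial>lborel) = fibre_mass \<phi> (fst X)"
      unfolding fibre_mass_def by (rule nn_integral_translate[where f="\<lambda>s. ennreal \<bar>\<phi> (fst X, s)\<bar>"]) measurable
    finally show ?thesis .
  qed
  show ?thesis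
  proof (rule that[OF C \<open>compact K'\<close> K'sub _ C1_continuous[OF CA]])
    show "\<psi> X = 0" if "X \<notin> K'" for X
    proof -
      have "\<psi> X = integral (cbox 0 (1/8)) (\<lambda>t::real. 0)"
        unfolding \<psi>_def by (rule Henstock_Kurzweil_Integration.integral_cong) (simp only: 0[OF that] scaleR_zero_right)
      then show ?thesis by simp
    qed
    show "A X = 0" if "X \<notin> K'" for X
    proof -
      have "A X = integral (cbox 0 (1/8)) (\<lambda>t::real. 0)"
        unfolding A_def by (rule Henstock_Kurzweil_Integration.integral_cong) (simp only: 0[OF that] scaleR_zero_right)
      then show ?thesis by simp
    qed
    show "ennreal \<bar>\<psi> X\<bar> \<le> fibre_mass \<phi> (fst X)" for X
    proof -
      have "continuous_on UNIV (\<lambda>t::real. 1 - 8 * t)" by (intro continuous_intros)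
      from bound[OF this, of 1 X] show ?thesis by (simp add: \<psi>_def abs_le_iff)
    qed
    show "ennreal \<bar>A X\<bar> \<le> 8 * fibre_mass \<phi> (fst X)" for X
      using bound[OF continuous_on_const, of 8 8 X] by (simp add: A_def)
    show "\<phi> X = A X - h' X \<bullet> (0, 1)" for X
    proof -
      define p where "p t = 8 *\<^sub>R \<phi> (X - v t)" for t
      define q where "q t = (1 - 8 * t) *\<^sub>R h (X - v t)" for t
      have cp: "continuous_on UNIV p" unfolding p_def by (intro continuous_on_scaleR continuous_on_const c\<phi>)
      have cq: "continuous_on UNIV q" unfolding q_def by (intro continuous_on_scaleR ch continuous_intros)
      have cq': "continuous_on UNIV (\<lambda>t. q t \<bullet> (0, 1))" by (intro continuous_on_inner cq continuous_on_const)
      have hb: "has_bochner_integral lborel (\<lambda>t. (\<phi> (X + t *\<^sub>R (0, 1)) - (1/8 - t) * (h (X + t *\<^sub>R (0, 1)) \<bullet> (0, 1))) * indicator {0..1/8} t) (1/8 * \<phi> X)"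
        by (rule kernel_line_identity[OF \<phi>(1)]) simp
      have "\<phi> X = 8 * (LINT t|lborel. (\<phi> (X + t *\<^sub>R (0, 1)) - (1/8 - t) * (h (X + t *\<^sub>R (0, 1)) \<bullet> (0, 1))) * indicator {0..1/8} t)"
        using has_bochner_integral_integral_eq[OF hb] by simp
      also have "\<dots> = (LINT t|lborel. 8 * ((\<phi> (X + t *\<^sub>R (0, 1)) - (1/8 - t) * (h (X + t *\<^sub>R (0, 1)) \<bullet> (0, 1))) * indicator {0..1/8} t))"
        by simp
      also have "\<dots> = (LINT t:cbox 0 (1/8)|lborel. p t - q t \<bullet> (0, 1))"
        unfolding set_lebesgue_integral_def p_def q_def
        by (intro Bochner_Integration.integral_cong) (auto simp: vs algebra_simps indicator_def)
      also have "\<dots> = (LINT t:cbox 0 (1/8)|lborel. p t) - (LINT t:cbox 0 (1/8)|lborel. q t \<bullet> (0, 1))"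
        by (rule set_integral_diff(2)[OF integral_cbox_lborel(1)[OF cp] integral_cbox_lborel(1)[OF cq']])
      also have "(LINT t:cbox 0 (1/8)|lborel. q t \<bullet> (0, 1)) = (LINT t:cbox 0 (1/8)|lborel. q t) \<bullet> (0, 1)"
        unfolding set_lebesgue_integral_def
        using integral_inner_left[of "(0,1)" lborel "\<lambda>t. indicator (cbox 0 (1/8)) t *\<^sub>R q t"] integral_cbox_lborel(1)[OF cq, of 0 "1/8"]
        by (simp add: set_integrable_def)
      finally show ?thesis
        using integral_cbox_lborel(2)[OF cp, of 0 "1/8"] integral_cbox_lborel(2)[OF cq, of 0 "1/8"]
        by (simp add: A_def h'_def p_def[abs_def] q_def[abs_def])
    qed
  qed
qed

text \<open>
  A field with bounded integrals over vertical segments is paired with a function that is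
  dominated by fibre integrals: Fubini's theorem, with the supremum taken over \<open>y\<close>
  in one factor and the integral in the other.
\<close>

lemma slice_pairing:
  fixes V :: "(real^'n::finite) \<times> real \<Rightarrow> (real^'n) \<times> real"
  assumes [measurable]: "V \<in> borel_measurable borel" "a \<in> borel_measurable borel" and \<phi>: "\<phi> \<in> borel_measurable borel" "integrable lborel \<phi>"
    and S: "0 \<le> S" "\<And>x. norm x < 1/4 \<Longrightarrow> (\<integral>\<^sup>+y\<in>{-1/4<..<1/4}. ennreal (norm (V (x, y))) \<partial>lborel) \<le> ennreal S"
    and a: "0 \<le> \<gamma>" "\<And>X. ennreal \<bar>a X\<bar> \<le> ennreal \<gamma> * fibre_mass \<phi> (fst X)" "\<And>X. X \<notin> cyl 0 (1/4) \<Longrightarrow> a X = 0"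
  shows "(\<integral>\<^sup>+X. ennreal (norm (V X) * \<bar>a X\<bar>) \<partial>lborel) \<le> ennreal (\<gamma> * S * (LINT X|lborel. \<bar>\<phi> X\<bar>))"
proof -
  note [measurable] = \<phi>(1)
  have fm[measurable]: "fibre_mass \<phi> \<in> borel_measurable borel"
  proof -
    have "(\<lambda>x. \<integral>\<^sup>+s. ennreal \<bar>\<phi> (x, s)\<bar> \<partial>lborel) \<in> borel_measurable borel" by measurable
    then show ?thesis by (simp add: fibre_mass_def[abs_def])
  qed
  have "(\<integral>\<^sup>+X. ennreal (norm (V X) * \<bar>a X\<bar>) \<partial>lborel) = (\<integral>\<^sup>+X. ennreal (norm (V X) * \<bar>a X\<bar>) \<partial>(lborel \<Otimes>\<^sub>M lborel))"
    by (simp add: lborel_prod)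
  also have "\<dots> = (\<integral>\<^sup>+x. (\<integral>\<^sup>+y. ennreal (norm (V (x, y)) * \<bar>a (x, y)\<bar>) \<partial>lborel) \<partial>lborel)"
    by (rule lborel.nn_integral_fst[symmetric]) (simp add: lborel_prod)
  also have "\<dots> \<le> (\<integral>\<^sup>+x. ennreal \<gamma> * ennreal S * fibre_mass \<phi> x \<partial>lborel)"
  proof (rule nn_integral_mono)
    fix x
    show "(\<integral>\<^sup>+y. ennreal (norm (V (x, y)) * \<bar>a (x, y)\<bar>) \<partial>lborel) \<le> ennreal \<gamma> * ennreal S * fibre_mass \<phi> x"
    proof (cases "norm x < 1/4")
      case True
      have "(\<integral>\<^sup>+y. ennreal (norm (V (x, y)) * \<bar>a (x, y)\<bar>) \<partial>lborel)
        \<le> (\<integral>\<^sup>+y. (ennreal \<gamma> * fibre_mass \<phi> x) * (ennreal (norm (V (x, y))) * indicator {-1/4<..<1/4} y) \<partial>lborel)"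
      proof (rule nn_integral_mono)
        fix y
        show "ennreal (norm (V (x, y)) * \<bar>a (x, y)\<bar>) \<le> (ennreal \<gamma> * fibre_mass \<phi> x) * (ennreal (norm (V (x, y))) * indicator {-1/4<..<1/4} y)"
        proof (cases "(x, y) \<in> cyl 0 (1/4)")
          case True
          then have "y \<in> {-1/4<..<1/4}" by (auto simp: mem_cyl_0)
          moreover have "ennreal (norm (V (x, y)) * \<bar>a (x, y)\<bar>) = ennreal \<bar>a (x, y)\<bar> * ennreal (norm (V (x, y)))"
            by (simp add: ennreal_mult mult.commute)
          ultimately show ?thesis using a(2)[of "(x, y)"] by (simp add: mult_right_mono)
        next
          case False
          then show ?thesis using a(3) by simp
        qed
      qed
      also have "\<dots> = (ennreal \<gamma> * fibre_mass \<phi> x) * (\<integral>\<^sup>+y\<in>{-1/4<..<1/4}. ennreal (norm (V (x, y))) \<partial>lborel)"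
        by (rule nn_integral_cmult) measurable
      also have "\<dots> \<le> (ennreal \<gamma> * fibre_mass \<phi> x) * ennreal S"
        by (intro mult_left_mono S(2) True) simp
      finally show ?thesis by (simp add: ac_simps)
    next
      case False
      then have "a (x, y) = 0" for y using a(3)[of "(x, y)"] by (auto simp: mem_cyl_0)
      then show ?thesis by simp
    qed
  qed
  also have "\<dots> = ennreal \<gamma> * ennreal S * (\<integral>\<^sup>+x. fibre_mass \<phi> x \<partial>lborel)"
    by (rule nn_integral_cmult) measurable
  also have "(\<integral>\<^sup>+x. fibre_mass \<phi> x \<partial>lborel) = (\<integral>\<^sup>+X. ennreal \<bar>\<phi> X\<bar> \<partial>(lborel \<Otimes>\<^sub>M lborel))"
    unfolding fibre_mass_def by (rule lborel.nn_integral_fst[where f="\<lambda>X. ennreal \<bar>\<phi> X\<bar>"]) (simp add: lborel_prod)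
  also have "\<dots> = ennreal (LINT X|lborel. \<bar>\<phi> X\<bar>)"
    unfolding lborel_prod by (rule nn_integral_eq_integral) (use \<phi>(2) in simp_all)
  finally have "(\<integral>\<^sup>+X. ennreal (norm (V X) * \<bar>a X\<bar>) \<partial>lborel) \<le> ennreal \<gamma> * ennreal S * ennreal (LINT X|lborel. \<bar>\<phi> X\<bar>)" .
  moreover have I: "0 \<le> (LINT X|lborel. \<bar>\<phi> X\<bar>)" by simp
  ultimately show ?thesis
    by (simp only: ennreal_mult[OF mult_nonneg_nonneg[OF a(1) S(1)] I] ennreal_mult[OF a(1) S(1)])
qed

section \<open>The gradient bound on the unit cylinder\<close>

abbreviation vertical :: "(real^'n::finite) \<times> real"
  where "vertical \<equiv> (0, 1)"

lemma inner_horizontal_vertical: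
  fixes X Y :: "(real^'n::finite) \<times> real"
  shows "X \<bullet> Y = (\<Sum>i\<in>Basis. (X \<bullet> horizontal i) * (Y \<bullet> horizontal i)) + (X \<bullet> vertical) * (Y \<bullet> vertical)"
  by (simp add: inner_prod_def horizontal_def) (rule euclidean_inner)

lemma abs_integral_le_of_nn_integral:
  fixes f :: "'a \<Rightarrow> real"
  assumes "(\<integral>\<^sup>+x. ennreal \<bar>f x\<bar> \<partial>M) \<le> ennreal r" "0 \<le> r"
  shows "\<bar>LINT x|M. f x\<bar> \<le> r"
proof (cases "integrable M f")
  case True
  have "ennreal \<bar>LINT x|M. f x\<bar> \<le> (\<integral>\<^sup>+x. ennreal \<bar>f x\<bar> \<partial>M)"
    using integral_norm_bound_ennreal[OF True] by simp
  then show ?thesis using assms by (metis ennreal_le_iff order_trans)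
qed (use assms in \<open>simp add: not_integrable_integral_eq\<close>)

lemma integrable_inner_bounded:
  fixes F \<Psi> :: "'a \<Rightarrow> 'c::euclidean_space"
  assumes F: "integrable M F" and [measurable]: "\<Psi> \<in> borel_measurable M" and b: "\<And>X. norm (\<Psi> X) \<le> b"
  shows "integrable M (\<lambda>X. F X \<bullet> \<Psi> X)"
proof (rule Bochner_Integration.integrable_bound[OF integrable_mult_right[OF integrable_norm[OF F], of b]])
  note [measurable] = borel_measurable_integrable[OF F]
  show "(\<lambda>X. F X \<bullet> \<Psi> X) \<in> borel_measurable M" by measurable
  show "AE X in M. norm (F X \<bullet> \<Psi> X) \<le> norm (b * norm (F X))"
  proof (rule AE_I2)
    fix X
    have "\<bar>F X \<bullet> \<Psi> X\<bar> \<le> b * norm (F X)"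
      unfolding mult.commute[of b] by (rule order_trans[OF Cauchy_Schwarz_ineq2 mult_left_mono[OF b norm_ge_zero]])
    then show "norm (F X \<bullet> \<Psi> X) \<le> norm (b * norm (F X))"
      unfolding real_norm_def by (rule order_trans[OF _ abs_ge_self])
  qed
qed

lemma conv_bounded:
  fixes F :: "'a::euclidean_space \<Rightarrow> 'c::euclidean_space" and \<iota> :: "'b::euclidean_space \<Rightarrow> 'a"
  assumes \<iota>: "linear \<iota>" and [measurable]: "F \<in> borel_measurable borel" and \<kappa>: "kernel \<epsilon> \<kappa>" and b: "\<And>X. norm (F X) \<le> b"
  shows "norm (conv \<iota> F \<kappa> X) \<le> b * (LINT w|lborel. \<bar>\<kappa> w\<bar>)"
proof -
  have b0: "0 \<le> b" by (rule order_trans[OF norm_ge_zero b])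
  have "ennreal (norm (conv \<iota> F \<kappa> X)) \<le> (\<integral>\<^sup>+w. ennreal (\<bar>\<kappa> w\<bar> * norm (F (X - \<iota> w))) \<partial>lborel)"
    by (rule conv_norm_le[OF \<iota> _ kernel_measurable[OF \<kappa>]]) measurable
  also have "\<dots> \<le> (\<integral>\<^sup>+w. ennreal (b * \<bar>\<kappa> w\<bar>) \<partial>lborel)"
    by (intro nn_integral_mono ennreal_leI) (simp add: mult.commute[of b] mult_left_mono b)
  also have "\<dots> = ennreal (LINT w|lborel. b * \<bar>\<kappa> w\<bar>)"
    using kernel_integrable[OF \<kappa>] b0 by (intro nn_integral_eq_integral) auto
  finally have "ennreal (norm (conv \<iota> F \<kappa> X)) \<le> ennreal (b * (LINT w|lborel. \<bar>\<kappa> w\<bar>))" by simp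
  then show ?thesis using b0 by (subst (asm) ennreal_le_iff) simp_all
qed

lemma conv_scaleR_const:
  fixes \<iota> :: "'b::euclidean_space \<Rightarrow> 'a::euclidean_space" and u :: "'c::euclidean_space"
  assumes \<iota>: "linear \<iota>" and \<kappa>: "kernel \<epsilon> \<kappa>" and s: "continuous_on UNIV s"
  shows "conv \<iota> (\<lambda>X. s X *\<^sub>R u) \<kappa> X = conv \<iota> s \<kappa> X *\<^sub>R u"
proof -
  have c\<iota>: "continuous_on UNIV \<iota>"
    using \<iota> by (simp add: linear_continuous_on linear_conv_bounded_linear)
  have "integrable lborel (\<lambda>w. \<kappa> w * s (X - \<iota> w))"
    by (rule continuous_cpt_integrable[of _ "cball 0 \<epsilon>"])
      (use kernel_zero[OF \<kappa>] in \<open>auto intro!: continuous_on_mult kernel_continuous[OF \<kappa>]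
        continuous_on_compose2[OF s] continuous_on_diff continuous_on_const c\<iota>\<close>)
  then show ?thesis by (simp add: conv_def)
qed

lemma horizontal_integration_by_parts:
  fixes F :: "(real^'n::finite) \<times> real \<Rightarrow> (real^'n) \<times> real"
  assumes F: "integrable lborel F" and \<kappa>: "C1 \<kappa> \<kappa>'" "kernel \<epsilon> \<kappa>"
    and \<psi>: "C1 \<psi> h" "compact K" "\<And>X. X \<notin> K \<Longrightarrow> \<psi> X = 0"
  shows "(LINT X|lborel. (conv horizontal F \<kappa> X \<bullet> u) * (h X \<bullet> horizontal b)) = - (LINT X|lborel. (conv horizontal F (\<lambda>w. \<kappa>' w \<bullet> b) X \<bullet> u) * \<psi> X)"
proof -
  let ?i = "\<lambda>w::real^'n. - horizontal w"
  define k where "k = (\<lambda>w. \<kappa>' w \<bullet> b)"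
  have k: "kernel \<epsilon> k" unfolding k_def by (rule kernel_partial[OF \<kappa>])
  have h0: "h X = 0" if "X \<notin> K" for X
    by (rule C1_gradient_zero_outside[OF \<psi>(1) compact_imp_closed[OF \<psi>(2)] \<psi>(3) that])
  have ch: "continuous_on UNIV (\<lambda>X. h X \<bullet> horizontal b)"
    by (intro continuous_on_inner continuous_on_const C1_continuous_gradient[OF \<psi>(1)])
  have c\<psi>: "continuous_on UNIV \<psi>" by (rule C1_continuous[OF \<psi>(1)])
  have "(h X \<bullet> horizontal b) *\<^sub>R u = 0" if "X \<notin> K" for X using h0[OF that] by simp
  from continuous_cpt_bounded[OF continuous_on_scaleR[OF ch continuous_on_const] \<psi>(2) this]
  obtain b1 where b1: "\<And>X. norm ((h X \<bullet> horizontal b) *\<^sub>R u) \<le> b1" by metis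
  have "\<psi> X *\<^sub>R u = 0" if "X \<notin> K" for X using \<psi>(3)[OF that] by simp
  from continuous_cpt_bounded[OF continuous_on_scaleR[OF c\<psi> continuous_on_const] \<psi>(2) this]
  obtain b2 where b2: "\<And>X. norm (\<psi> X *\<^sub>R u) \<le> b2" by metis
  note [measurable] = C1_measurable[OF \<psi>(1)]
  have "(LINT X|lborel. (conv horizontal F \<kappa> X \<bullet> u) * (h X \<bullet> horizontal b)) = (LINT X|lborel. conv horizontal F \<kappa> X \<bullet> ((h X \<bullet> horizontal b) *\<^sub>R u))"
    by (simp add: mult.commute)
  also have "\<dots> = (LINT X|lborel. F X \<bullet> conv ?i (\<lambda>X. (h X \<bullet> horizontal b) *\<^sub>R u) \<kappa> X)"
    by (rule conv_duality[OF linear_horizontal F \<kappa>(2) _ b1]) measurable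
  also have "\<dots> = (LINT X|lborel. - (F X \<bullet> conv ?i (\<lambda>X. \<psi> X *\<^sub>R u) k X))"
  proof (rule Bochner_Integration.integral_cong[OF refl])
    fix X
    have "conv ?i (\<lambda>X. h X \<bullet> ?i b) \<kappa> X = conv ?i \<psi> k X"
      unfolding k_def by (rule conv_gradient_kernel[OF \<psi>(1) \<kappa> linear_minus_horizontal])
    moreover have "conv ?i (\<lambda>X. h X \<bullet> ?i b) \<kappa> X = - conv ?i (\<lambda>X. h X \<bullet> horizontal b) \<kappa> X"
      by (simp add: conv_def)
    ultimately show "F X \<bullet> conv ?i (\<lambda>X. (h X \<bullet> horizontal b) *\<^sub>R u) \<kappa> X = - (F X \<bullet> conv ?i (\<lambda>X. \<psi> X *\<^sub>R u) k X)"
      unfolding conv_scaleR_const[OF linear_minus_horizontal \<kappa>(2) ch] conv_scaleR_const[OF linear_minus_horizontal k c\<psi>] by simp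
  qed
  also have "\<dots> = - (LINT X|lborel. conv horizontal F k X \<bullet> (\<psi> X *\<^sub>R u))"
    by (subst conv_duality[OF linear_horizontal F k _ b2]) simp_all
  finally show ?thesis by (simp add: k_def mult.commute)
qed

lemma integrable_indicator_cyl:
  fixes g :: "(real^'n::finite) \<times> real \<Rightarrow> 'c::{banach,second_countable_topology}"
  assumes "continuous_on UNIV g"
  shows "integrable lborel (\<lambda>X. indicator (cyl 0 r) X *\<^sub>R g X)"
proof -
  let ?K = "{X::(real^'n) \<times> real. norm (fst X) \<le> r \<and> \<bar>snd X\<bar> \<le> r}"
  have "integrable lborel (\<lambda>X. indicator ?K X *\<^sub>R g X)"
    by (rule borel_integrable_compact[OF compact_closed_cyl continuous_on_subset[OF assms]]) simp
  then have "integrable lborel (\<lambda>X. indicator (cyl 0 r) X *\<^sub>R (indicator ?K X *\<^sub>R g X))"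
    by (rule integrable_mult_indicator[rotated]) simp
  moreover have "indicator (cyl 0 r) X *\<^sub>R (indicator ?K X *\<^sub>R g X) = indicator (cyl 0 r) X *\<^sub>R g X" for X
    by (auto simp: indicator_def mem_cyl_0)
  ultimately show ?thesis by (simp only:)
qed

text \<open>
  Fields orthogonal to all gradients of \<open>C\<^sup>1\<close> functions are orthogonal to
  their limits.
\<close>

lemma gradient_closure_orthogonal:
  fixes G :: "(real^'n::finite) \<times> real \<Rightarrow> (real^'n) \<times> real"
  assumes G: "unit_solution \<Lambda> c B \<mu> G" and [measurable]: "\<Psi> \<in> borel_measurable borel" and b: "\<And>X. norm (\<Psi> X) \<le> b"
    and orth: "\<And>f g. C1 f g \<Longrightarrow> (LINT X|lborel. (indicator (cyl 0 1) X *\<^sub>R g X) \<bullet> \<Psi> X) = 0"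
  shows "(LINT X|lborel. G X \<bullet> \<Psi> X) = 0"
proof -
  define V where "V = measure lborel (cyl (0 :: (real^'n) \<times> real) 1)"
  have V: "emeasure lborel (cyl (0 :: (real^'n) \<times> real) 1) = ennreal V"
    unfolding V_def using emeasure_bounded_finite[OF bounded_cyl, of "0 :: (real^'n) \<times> real" 1] by (intro emeasure_eq_ennreal_measure) auto
  have V0: "V \<ge> 0" by (simp add: V_def)
  have b0: "0 \<le> b" by (rule order_trans[OF norm_ge_zero b])
  note [measurable] = unit_solutionD(6)[OF G]
  note Gi = unit_solution_integrable(2)[OF G]
  have key: "\<bar>LINT X|lborel. G X \<bullet> \<Psi> X\<bar> \<le> b * (V + 1) * \<eta>" if \<eta>: "\<eta> > 0" for \<eta>
  proof -
    obtain f g where fg: "C1 f g" "(\<integral>\<^sup>+X\<in>cyl 0 1. ennreal ((norm (G X - g X))\<^sup>2) \<partial>lborel) < ennreal (\<eta>\<^sup>2)"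
      using unit_solutionD(8)[OF G, of "\<eta>\<^sup>2"] \<eta> by auto
    note [measurable] = C1_measurable[OF fg(1)]
    define g1 where "g1 X = indicator (cyl 0 1) X *\<^sub>R g X" for X
    have g1i: "integrable lborel g1"
      unfolding g1_def by (rule integrable_indicator_cyl[OF C1_continuous_gradient[OF fg(1)]])
    have [measurable]: "g1 \<in> borel_measurable borel" unfolding g1_def by measurable
    have "(LINT X|lborel. G X \<bullet> \<Psi> X) = (LINT X|lborel. G X \<bullet> \<Psi> X) - (LINT X|lborel. g1 X \<bullet> \<Psi> X)"
      using orth[OF fg(1)] by (simp add: g1_def)
    also have "\<dots> = (LINT X|lborel. (G X - g1 X) \<bullet> \<Psi> X)"
      by (subst Bochner_Integration.integral_diff[symmetric])
        (auto intro!: integrable_inner_bounded[OF Gi _ b] integrable_inner_bounded[OF g1i _ b] simp: inner_diff_left)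
    also have "\<bar>\<dots>\<bar> \<le> b * (V + 1) * \<eta>"
    proof (rule abs_integral_le_of_nn_integral)
      have "(\<integral>\<^sup>+X. ennreal \<bar>(G X - g1 X) \<bullet> \<Psi> X\<bar> \<partial>lborel)
        \<le> (\<integral>\<^sup>+X. ennreal (b * \<eta>) * indicator (cyl 0 1) X + ennreal (b / \<eta>) * (ennreal ((norm (G X - g X))\<^sup>2) * indicator (cyl 0 1) X) \<partial>lborel)"
      proof (rule nn_integral_mono)
        fix X
        show "ennreal \<bar>(G X - g1 X) \<bullet> \<Psi> X\<bar> \<le> ennreal (b * \<eta>) * indicator (cyl 0 1) X + ennreal (b / \<eta>) * (ennreal ((norm (G X - g X))\<^sup>2) * indicator (cyl 0 1) X)"
        proof (cases "X \<in> cyl 0 1")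
          case True
          define d where "d = norm (G X - g X)"
          have "\<bar>(G X - g1 X) \<bullet> \<Psi> X\<bar> \<le> d * b"
            using True order_trans[OF Cauchy_Schwarz_ineq2 mult_left_mono[OF b norm_ge_zero]] by (simp add: g1_def d_def)
          also have "\<dots> \<le> b * (\<eta> + d\<^sup>2 / \<eta>)"
          proof -
            have "d \<le> \<eta> + d\<^sup>2 / \<eta>"
            proof (cases "d \<le> \<eta>")
              case True
              then show ?thesis using \<eta> by (simp add: add_increasing2)
            next
              case False
              then have "\<eta> * d \<le> d\<^sup>2" using \<eta> by (simp add: power2_eq_square mult_right_mono)
              then have "d \<le> d\<^sup>2 / \<eta>" using \<eta> by (simp add: field_simps)
              then show ?thesis using \<eta> by simp
            qed
            then show ?thesis unfolding mult.commute[of d] using b0 by (rule mult_left_mono)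
          qed
          finally have "\<bar>(G X - g1 X) \<bullet> \<Psi> X\<bar> \<le> b * \<eta> + b / \<eta> * d\<^sup>2" by (simp add: distrib_left)
          from ennreal_leI[OF this] show ?thesis
            using True b0 \<eta> by (simp add: ennreal_plus[symmetric] ennreal_mult[symmetric] d_def del: ennreal_plus)
        next
          case False
          then show ?thesis using unit_solutionD(7)[OF G, of X] by (simp add: g1_def)
        qed
      qed
      also have "\<dots> = ennreal (b * \<eta>) * ennreal V + ennreal (b / \<eta>) * (\<integral>\<^sup>+X\<in>cyl 0 1. ennreal ((norm (G X - g X))\<^sup>2) \<partial>lborel)"
        by (simp add: nn_integral_add nn_integral_cmult nn_integral_cmult_indicator V)
      also have "\<dots> \<le> ennreal (b * \<eta>) * ennreal V + ennreal (b / \<eta>) * ennreal (\<eta>\<^sup>2)"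
        using fg(2) by (intro add_mono mult_left_mono) auto
      also have "\<dots> = ennreal (b * (V + 1) * \<eta>)"
        using b0 \<eta> V0 by (simp add: ennreal_mult[symmetric] ennreal_plus[symmetric] power2_eq_square del: ennreal_plus) (simp add: algebra_simps)
      finally show "(\<integral>\<^sup>+X. ennreal \<bar>(G X - g1 X) \<bullet> \<Psi> X\<bar> \<partial>lborel) \<le> ennreal (b * (V + 1) * \<eta>)" .
    qed (use b0 V0 \<eta> in simp)
    finally show ?thesis .
  qed
  have "\<bar>LINT X|lborel. G X \<bullet> \<Psi> X\<bar> \<le> 0"
  proof (rule field_le_epsilon)
    fix e :: real assume "e > 0"
    define m where "m = b * (V + 1) + 1"
    have m: "m > 0" using b0 V0 by (simp add: m_def add_nonneg_pos)
    have "b * (V + 1) * (e / m) \<le> m * (e / m)" using m \<open>e > 0\<close> by (intro mult_right_mono) (auto simp: m_def)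
    then show "\<bar>LINT X|lborel. G X \<bullet> \<Psi> X\<bar> \<le> 0 + e" using key[of "e / m"] m \<open>e > 0\<close> by simp
  qed
  then show ?thesis by simp
qed

text \<open>
  The identity \<open>\<partial>\<^sub>y \<partial>\<^sub>b v = \<partial>\<^sub>b
  \<partial>\<^sub>y v\<close> in weak form. It holds for gradients by two integrations by parts
  and passes to the limit because both sides are one pairing of the field with a fixed bounded
  function.
\<close>

lemma curl_free:
  fixes G :: "(real^'n::finite) \<times> real \<Rightarrow> (real^'n) \<times> real"
  assumes G: "unit_solution \<Lambda> c B \<mu> G" and \<kappa>: "C1 \<kappa> \<kappa>'" "kernel (1/8) \<kappa>"
    and \<psi>: "C1 \<psi> h" "compact K" "K \<subseteq> cyl 0 (1/4)" "\<And>X. X \<notin> K \<Longrightarrow> \<psi> X = 0"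
  shows "(LINT X|lborel. (conv horizontal G \<kappa> X \<bullet> horizontal b) * (h X \<bullet> vertical)) = - (LINT X|lborel. (conv horizontal G (\<lambda>w. \<kappa>' w \<bullet> b) X \<bullet> vertical) * \<psi> X)"
proof -
  let ?i = "\<lambda>w::real^'n. - horizontal w"
  define k where "k = (\<lambda>w. \<kappa>' w \<bullet> b)"
  have k: "kernel (1/8) k" unfolding k_def by (rule kernel_partial[OF \<kappa>])
  have h0: "h X = 0" if "X \<notin> K" for X
    by (rule C1_gradient_zero_outside[OF \<psi>(1) compact_imp_closed[OF \<psi>(2)] \<psi>(4) that])
  note [measurable] = C1_measurable[OF \<psi>(1)]
  define p q where "p X = (h X \<bullet> vertical) *\<^sub>R horizontal b" and "q X = \<psi> X *\<^sub>R (vertical :: (real^'n) \<times> real)" for X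
  have pm[measurable]: "p \<in> borel_measurable borel" and qm[measurable]: "q \<in> borel_measurable borel" unfolding p_def q_def by measurable
  have cp: "continuous_on UNIV p" unfolding p_def
    by (rule continuous_on_scaleR[OF continuous_on_inner[OF C1_continuous_gradient[OF \<psi>(1)] continuous_on_const] continuous_on_const])
  have cq: "continuous_on UNIV q" unfolding q_def
    by (rule continuous_on_scaleR[OF C1_continuous[OF \<psi>(1)] continuous_on_const])
  have p0: "p X = 0" and q0: "q X = 0" if "X \<notin> K" for X using h0[OF that] \<psi>(4)[OF that] by (auto simp: p_def q_def zero_prod_def)
  obtain b1 where b1: "\<And>X. norm (p X) \<le> b1" using continuous_cpt_bounded[OF cp \<psi>(2) p0] by metis
  obtain b2 where b2: "\<And>X. norm (q X) \<le> b2" using continuous_cpt_bounded[OF cq \<psi>(2) q0] by metis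
  define \<Psi> where "\<Psi> X = conv ?i p \<kappa> X + conv ?i q k X" for X
  have m1[measurable]: "conv ?i p \<kappa> \<in> borel_measurable borel" by (rule conv_measurable[OF linear_minus_horizontal pm kernel_measurable[OF \<kappa>(2)]])
  have m2[measurable]: "conv ?i q k \<in> borel_measurable borel" by (rule conv_measurable[OF linear_minus_horizontal qm kernel_measurable[OF k]])
  note cb1 = conv_bounded[OF linear_minus_horizontal pm \<kappa>(2) b1] and cb2 = conv_bounded[OF linear_minus_horizontal qm k b2]
  have pair: "(LINT X|lborel. F X \<bullet> \<Psi> X) = (LINT X|lborel. conv horizontal F \<kappa> X \<bullet> p X) + (LINT X|lborel. conv horizontal F k X \<bullet> q X)"
    if F: "integrable lborel F" for F
  proof -
    have m1': "conv ?i p \<kappa> \<in> borel_measurable lborel" and m2': "conv ?i q k \<in> borel_measurable lborel" using m1 m2 by auto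
    have "(LINT X|lborel. F X \<bullet> \<Psi> X) = (LINT X|lborel. F X \<bullet> conv ?i p \<kappa> X) + (LINT X|lborel. F X \<bullet> conv ?i q k X)"
      unfolding \<Psi>_def inner_add_right
      by (rule Bochner_Integration.integral_add[OF integrable_inner_bounded[OF F m1' cb1] integrable_inner_bounded[OF F m2' cb2]])
    then show ?thesis
      using conv_duality[OF linear_horizontal F \<kappa>(2) pm b1] conv_duality[OF linear_horizontal F k qm b2] by simp
  qed
  have "(LINT X|lborel. G X \<bullet> \<Psi> X) = 0"
  proof (rule gradient_closure_orthogonal[OF G])
    show "\<Psi> \<in> borel_measurable borel" unfolding \<Psi>_def by measurable
    show "norm (\<Psi> X) \<le> b1 * (LINT w|lborel. \<bar>\<kappa> w\<bar>) + b2 * (LINT w|lborel. \<bar>k w\<bar>)" for X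
      unfolding \<Psi>_def by (rule norm_triangle_le[OF add_mono[OF cb1 cb2]])
    fix f g assume fg: "C1 f (g :: (real^'n) \<times> real \<Rightarrow> _)"
    define g1 where "g1 X = indicator (cyl 0 1) X *\<^sub>R g X" for X
    have g1i: "integrable lborel g1"
      unfolding g1_def by (rule integrable_indicator_cyl[OF C1_continuous_gradient[OF fg(1)]])
    have loc: "conv horizontal g1 r X = conv horizontal g r X" if r: "kernel (1/8) r" and X: "X \<in> K" for r X
      unfolding conv_def
    proof (rule Bochner_Integration.integral_cong[OF refl])
      fix w
      show "r w *\<^sub>R g1 (X - horizontal w) = r w *\<^sub>R g (X - horizontal w)"
      proof (cases "w \<in> cball 0 (1/8)")
        case True
        then have "X - horizontal w \<in> cyl 0 1" using X \<psi>(3) by (intro shift_cyl[of X "1/4" w "1/8"]) auto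
        then show ?thesis by (simp add: g1_def)
      qed (simp add: kernel_zero[OF r])
    qed
    have w: "C1 (conv horizontal f k) (conv horizontal g k)" by (rule C1_conv[OF fg linear_horizontal k])
    have wX: "conv horizontal f k X = conv horizontal g \<kappa> X \<bullet> horizontal b" for X
    proof -
      have "integrable lborel (\<lambda>w. \<kappa> w *\<^sub>R g (X - horizontal w))"
        by (rule continuous_cpt_integrable[of _ "cball 0 (1/8)"])
          (use kernel_zero[OF \<kappa>(2)] in \<open>auto intro!: continuous_on_scaleR kernel_continuous[OF \<kappa>(2)]
            continuous_on_compose2[OF C1_continuous_gradient[OF fg, of UNIV]] continuous_on_diff continuous_on_const
            linear_continuous_on[OF linear_conv_bounded_linear[THEN iffD1, OF linear_horizontal]]\<close>)
      then have "conv horizontal (\<lambda>X. g X \<bullet> horizontal b) \<kappa> X = conv horizontal g \<kappa> X \<bullet> horizontal b"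
        unfolding conv_def by (subst integral_inner_left[symmetric]) auto
      then show ?thesis unfolding k_def using conv_gradient_kernel[OF fg \<kappa> linear_horizontal, of b X] by simp
    qed
    have "(LINT X|lborel. g1 X \<bullet> \<Psi> X) = (LINT X|lborel. conv horizontal g1 \<kappa> X \<bullet> p X + conv horizontal g1 k X \<bullet> q X)"
      unfolding pair[OF g1i]
      using integrable_inner_bounded[OF conv_integrable[OF linear_horizontal g1i kernel_integrable[OF \<kappa>(2)]] _ b1]
        integrable_inner_bounded[OF conv_integrable[OF linear_horizontal g1i kernel_integrable[OF k]] _ b2] pm qm
      by (intro Bochner_Integration.integral_add[symmetric]) auto
    also have "\<dots> = (LINT X|lborel. (conv horizontal f k X *\<^sub>R h X + \<psi> X *\<^sub>R conv horizontal g k X) \<bullet> vertical)"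
    proof (rule Bochner_Integration.integral_cong[OF refl])
      fix X
      show "conv horizontal g1 \<kappa> X \<bullet> p X + conv horizontal g1 k X \<bullet> q X = (conv horizontal f k X *\<^sub>R h X + \<psi> X *\<^sub>R conv horizontal g k X) \<bullet> vertical"
      proof (cases "X \<in> K")
        case True
        then show ?thesis
          by (simp only: loc[OF \<kappa>(2)] loc[OF k] wX p_def q_def inner_add_left inner_scaleR_left inner_scaleR_right) (simp only: mult.commute)
      next
        case False
        then show ?thesis using p0 q0 h0 \<psi>(4) by simp
      qed
    qed
    also have "\<dots> = 0"
      by (rule integral_of_derivative_eq_0[OF C1_mult[OF w \<psi>(1)] \<psi>(2)]) (use \<psi>(4) in simp)
    finally show "(LINT X|lborel. (indicator (cyl 0 1) X *\<^sub>R g X) \<bullet> \<Psi> X) = 0" by (simp add: g1_def)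
  qed
  with pair[OF unit_solution_integrable(2)[OF G]]
  have 0: "(LINT X|lborel. conv horizontal G \<kappa> X \<bullet> p X) + (LINT X|lborel. conv horizontal G k X \<bullet> q X) = 0" by simp
  have 1: "conv horizontal G \<kappa> X \<bullet> p X = (conv horizontal G \<kappa> X \<bullet> horizontal b) * (h X \<bullet> vertical)"
    and 2: "conv horizontal G k X \<bullet> q X = (conv horizontal G k X \<bullet> vertical) * \<psi> X" for X
    by (simp_all only: p_def q_def inner_scaleR_right mult.commute)
  show ?thesis using 0[unfolded 1 2] unfolding k_def by linarith
qed

text \<open>
  In the decomposition of \<open>\<phi>\<close>, the average is paired with
  \<open>\<partial>\<^sub>b v\<close> directly, and the vertical derivative is moved to
  \<open>\<partial>\<^sub>b \<partial>\<^sub>y v\<close>. The factor 9 is 8 from the average and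
  1 from the derivative.
\<close>

lemma horizontal_component_bound:
  fixes G :: "(real^'n::finite) \<times> real \<Rightarrow> (real^'n) \<times> real"
  assumes G: "unit_solution \<Lambda> c B \<mu> G" and \<kappa>: "C1 \<kappa> \<kappa>'" "kernel (1/8) \<kappa>" and b: "norm b = 1"
    and S: "0 \<le> S" "\<And>x. norm x < 1/4 \<Longrightarrow> slice_norm G \<kappa> x \<le> ennreal S" "\<And>x. norm x < 1/4 \<Longrightarrow> slice_norm G (\<lambda>w. \<kappa>' w \<bullet> b) x \<le> ennreal S"
    and \<phi>: "C1 \<phi> h" "compact K" "K \<subseteq> cyl 0 (1/8)" "\<And>X. X \<notin> K \<Longrightarrow> \<phi> X = 0"
  shows "\<bar>LINT X|lborel. (conv horizontal G \<kappa> X \<bullet> horizontal b) * \<phi> X\<bar> \<le> 9 * S * (LINT X|lborel. \<bar>\<phi> X\<bar>)"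
proof -
  obtain \<psi> h' K' A where s: "C1 \<psi> h'" "compact K'" "K' \<subseteq> cyl 0 (1/4)" "\<And>X. X \<notin> K' \<Longrightarrow> \<psi> X = 0"
    "continuous_on UNIV A" "\<And>X. X \<notin> K' \<Longrightarrow> A X = 0" "\<And>X. \<phi> X = A X - h' X \<bullet> (0, 1)"
    "\<And>X. ennreal \<bar>\<psi> X\<bar> \<le> fibre_mass \<phi> (fst X)" "\<And>X. ennreal \<bar>A X\<bar> \<le> 8 * fibre_mass \<phi> (fst X)"
    by (rule vertical_split[OF \<phi>], assumption, (rule that; assumption))
  define k where "k = (\<lambda>w. \<kappa>' w \<bullet> b)"
  have k: "kernel (1/8) k" unfolding k_def by (rule kernel_partial[OF \<kappa>])
  note Gi = unit_solution_integrable(2)[OF G] and Gm = unit_solutionD(6)[OF G]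
  have \<phi>i: "integrable lborel \<phi>" by (rule continuous_cpt_integrable[OF C1_continuous[OF \<phi>(1)] \<phi>(2,4)])
  have I0: "0 \<le> (LINT X|lborel. \<bar>\<phi> X\<bar>)" by simp
  have Am: "A \<in> borel_measurable borel" using s(5) by (rule borel_measurable_continuous_onI)
  have h'0: "h' X = 0" if "X \<notin> K'" for X
    by (rule C1_gradient_zero_outside[OF s(1) compact_imp_closed[OF s(2)] s(4) that])
  have K4: "X \<notin> K'" if "X \<notin> cyl 0 (1/4)" for X using that s(3) by blast
  define w where "w X = conv horizontal G \<kappa> X \<bullet> horizontal b" for X
  have Vi: "integrable lborel (conv horizontal G \<kappa>)" by (rule conv_integrable[OF linear_horizontal Gi kernel_integrable[OF \<kappa>(2)]])
  have wi: "integrable lborel w" unfolding w_def using Vi by simp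
  have wm: "\<bar>w X\<bar> \<le> norm (conv horizontal G \<kappa> X)" for X
    using Cauchy_Schwarz_ineq2[of "conv horizontal G \<kappa> X" "horizontal b"] b by (simp add: w_def norm_horizontal)
  obtain b1 where b1: "\<And>X. norm (A X) \<le> b1" using continuous_cpt_bounded[OF s(5,2,6)] by metis
  have c: "continuous_on UNIV (\<lambda>X. h' X \<bullet> vertical)"
    by (rule continuous_on_inner[OF C1_continuous_gradient[OF s(1)] continuous_on_const])
  have z: "h' X \<bullet> vertical = 0" if "X \<notin> K'" for X using h'0[OF that] by simp
  obtain b2 where b2: "\<And>X. norm (h' X \<bullet> vertical) \<le> b2" using continuous_cpt_bounded[OF c s(2) z] by metis
  have hm: "(\<lambda>X. h' X \<bullet> vertical) \<in> borel_measurable borel" using C1_measurable(2)[OF s(1)] by measurable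
  have i1: "integrable lborel (\<lambda>X. w X * A X)" and i2: "integrable lborel (\<lambda>X. w X * (h' X \<bullet> vertical))"
    using integrable_inner_bounded[OF wi _ b1] integrable_inner_bounded[OF wi _ b2] Am hm by auto
  have "(LINT X|lborel. w X * \<phi> X) = (LINT X|lborel. w X * A X - w X * (h' X \<bullet> vertical))"
    by (simp add: s(7) right_diff_distrib)
  also have "\<dots> = (LINT X|lborel. w X * A X) - (LINT X|lborel. w X * (h' X \<bullet> vertical))"
    by (rule Bochner_Integration.integral_diff[OF i1 i2])
  also have "(LINT X|lborel. w X * (h' X \<bullet> vertical)) = - (LINT X|lborel. (conv horizontal G k X \<bullet> vertical) * \<psi> X)"
    unfolding w_def k_def by (rule curl_free[OF G \<kappa> s(1-4)])
  finally have eq: "(LINT X|lborel. w X * \<phi> X) = (LINT X|lborel. w X * A X) + (LINT X|lborel. (conv horizontal G k X \<bullet> vertical) * \<psi> X)" by simp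
  have 1: "\<bar>LINT X|lborel. w X * A X\<bar> \<le> 8 * S * (LINT X|lborel. \<bar>\<phi> X\<bar>)"
  proof (rule abs_integral_le_of_nn_integral)
    have "(\<integral>\<^sup>+X. ennreal \<bar>w X * A X\<bar> \<partial>lborel) \<le> (\<integral>\<^sup>+X. ennreal (norm (conv horizontal G \<kappa> X) * \<bar>A X\<bar>) \<partial>lborel)"
      using wm by (intro nn_integral_mono ennreal_leI) (simp add: abs_mult mult_right_mono)
    also have "\<dots> \<le> ennreal (8 * S * (LINT X|lborel. \<bar>\<phi> X\<bar>))"
      by (rule slice_pairing[OF conv_measurable[OF linear_horizontal Gm kernel_measurable[OF \<kappa>(2)]] Am C1_measurable(1)[OF \<phi>(1)] \<phi>i S(1) S(2)[unfolded slice_norm_def]])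
        (use s(9) s(6) K4 in auto)
    finally show "(\<integral>\<^sup>+X. ennreal \<bar>w X * A X\<bar> \<partial>lborel) \<le> ennreal (8 * S * (LINT X|lborel. \<bar>\<phi> X\<bar>))" .
  qed (use S(1) I0 in simp)
  have 2: "\<bar>LINT X|lborel. (conv horizontal G k X \<bullet> vertical) * \<psi> X\<bar> \<le> 1 * S * (LINT X|lborel. \<bar>\<phi> X\<bar>)"
  proof (rule abs_integral_le_of_nn_integral)
    have "(\<integral>\<^sup>+X. ennreal \<bar>(conv horizontal G k X \<bullet> vertical) * \<psi> X\<bar> \<partial>lborel) \<le> (\<integral>\<^sup>+X. ennreal (norm (conv horizontal G k X) * \<bar>\<psi> X\<bar>) \<partial>lborel)"
    proof (intro nn_integral_mono ennreal_leI)
      fix X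
      have "\<bar>conv horizontal G k X \<bullet> vertical\<bar> \<le> norm (conv horizontal G k X)"
        using Cauchy_Schwarz_ineq2[of "conv horizontal G k X" vertical] by simp
      then show "\<bar>(conv horizontal G k X \<bullet> vertical) * \<psi> X\<bar> \<le> norm (conv horizontal G k X) * \<bar>\<psi> X\<bar>"
        unfolding abs_mult by (rule mult_right_mono) simp
    qed
    also have "\<dots> \<le> ennreal (1 * S * (LINT X|lborel. \<bar>\<phi> X\<bar>))"
      by (rule slice_pairing[OF conv_measurable[OF linear_horizontal Gm kernel_measurable[OF k]] C1_measurable(1)[OF s(1)] C1_measurable(1)[OF \<phi>(1)] \<phi>i S(1) S(3)[unfolded slice_norm_def, folded k_def]])
        (use s(8) s(4) K4 in auto)
    finally show "(\<integral>\<^sup>+X. ennreal \<bar>(conv horizontal G k X \<bullet> vertical) * \<psi> X\<bar> \<partial>lborel) \<le> ennreal (1 * S * (LINT X|lborel. \<bar>\<phi> X\<bar>))" .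
  qed (use S(1) I0 in simp)
  show ?thesis using eq 1 2 unfolding w_def by linarith
qed

text \<open>
  The weak equation, tested with \<open>\<psi>\<close>, replaces the pairing of the vertical
  flux with \<open>\<partial>\<^sub>y \<psi>\<close> by pairings of the horizontal flux with the
  horizontal derivatives of \<open>\<psi>\<close>, and these are moved to the kernel. The flux
  is taken instead of \<open>\<partial>\<^sub>y v\<close> because the weight cannot be
  differentiated.
\<close>

lemma vertical_component_bound:
  fixes G :: "(real^'n::finite) \<times> real \<Rightarrow> (real^'n) \<times> real" and \<Lambda> c S :: real
  assumes G: "unit_solution \<Lambda> c B \<mu> G" and pos: "0 < \<Lambda>" "1 \<le> c" and \<kappa>: "C1 \<kappa> \<kappa>'" "kernel (1/8) \<kappa>"
    and S: "0 \<le> S" "\<And>x. norm x < 1/4 \<Longrightarrow> slice_norm G \<kappa> x \<le> ennreal S" "\<And>b x. b \<in> Basis \<Longrightarrow> norm x < 1/4 \<Longrightarrow> slice_norm G (\<lambda>w. \<kappa>' w \<bullet> b) x \<le> ennreal S"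
    and \<phi>: "C1 \<phi> h" "compact K" "K \<subseteq> cyl 0 (1/8)" "\<And>X. X \<notin> K \<Longrightarrow> \<phi> X = 0"
  shows "\<bar>LINT X|lborel. (conv horizontal (\<lambda>X. \<mu> (snd X) *\<^sub>R flux B (G X)) \<kappa> X \<bullet> vertical) * \<phi> X\<bar> \<le> (8 + DIM(real^'n)) * (c * \<Lambda>) * S * (LINT X|lborel. \<bar>\<phi> X\<bar>)"
proof -
  obtain \<psi> h' K' A where s: "C1 \<psi> h'" "compact K'" "K' \<subseteq> cyl 0 (1/4)" "\<And>X. X \<notin> K' \<Longrightarrow> \<psi> X = 0"
    "continuous_on UNIV A" "\<And>X. X \<notin> K' \<Longrightarrow> A X = 0" "\<And>X. \<phi> X = A X - h' X \<bullet> (0, 1)"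
    "\<And>X. ennreal \<bar>\<psi> X\<bar> \<le> fibre_mass \<phi> (fst X)" "\<And>X. ennreal \<bar>A X\<bar> \<le> 8 * fibre_mass \<phi> (fst X)"
    by (rule vertical_split[OF \<phi>], assumption, (rule that; assumption))
  define F where "F X = \<mu> (snd X) *\<^sub>R flux B (G X)" for X
  have Fi: "integrable lborel F" unfolding F_def by (rule unit_solution_flux_integrable[OF G])
  have Fm: "F \<in> borel_measurable borel" using borel_measurable_integrable[OF Fi] by simp
  note Gi = unit_solution_integrable(2)[OF G] and Gm = unit_solutionD(6)[OF G]
  have \<phi>i: "integrable lborel \<phi>" by (rule continuous_cpt_integrable[OF C1_continuous[OF \<phi>(1)] \<phi>(2,4)])
  have I0: "0 \<le> (LINT X|lborel. \<bar>\<phi> X\<bar>)" by simp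
  have Am: "A \<in> borel_measurable borel" using s(5) by (rule borel_measurable_continuous_onI)
  have h'0: "h' X = 0" if "X \<notin> K'" for X
    by (rule C1_gradient_zero_outside[OF s(1) compact_imp_closed[OF s(2)] s(4) that])
  have K4: "X \<notin> K'" if "X \<notin> cyl 0 (1/4)" for X using that s(3) by blast
  have Fle: "AE X in lborel. norm (conv horizontal F k X) \<le> c * \<Lambda> * norm (conv horizontal G k X)" if k: "kernel (1/8) k" for k
    using conv_flux_AE[OF G k]
  proof eventually_elim
    case (elim X)
    have "\<mu> (snd X) * norm (flux B (conv horizontal G k X)) \<le> c * (\<Lambda> * norm (conv horizontal G k X))"
      using unit_solutionD(2)[OF G, of "conv horizontal G k X"] unit_solutionD(4,5)[OF G, of "snd X"] pos
      by (intro mult_mono) auto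
    moreover have "norm (conv horizontal F k X) = \<mu> (snd X) * norm (flux B (conv horizontal G k X))"
      using elim unit_solutionD(4)[OF G, of "snd X"] by (simp add: F_def[abs_def])
    ultimately show ?case by (simp only: mult.assoc)
  qed
  define I where "I = (LINT X|lborel. \<bar>\<phi> X\<bar>)"
  have est: "\<bar>LINT X|lborel. (conv horizontal F k X \<bullet> u) * a X\<bar> \<le> \<gamma> * (c * \<Lambda>) * S * I"
    if k: "kernel (1/8) k" "\<And>x. norm x < 1/4 \<Longrightarrow> slice_norm G k x \<le> ennreal S" and u: "norm u = 1" and a: "a \<in> borel_measurable borel"
      "0 \<le> \<gamma>" "\<And>X. ennreal \<bar>a X\<bar> \<le> ennreal \<gamma> * fibre_mass \<phi> (fst X)" "\<And>X. X \<notin> K' \<Longrightarrow> a X = 0" for k u a \<gamma>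
  proof (rule abs_integral_le_of_nn_integral)
    note [measurable] = a(1) conv_measurable[OF linear_horizontal Gm kernel_measurable[OF k(1)]]
    have "(\<integral>\<^sup>+X. ennreal \<bar>(conv horizontal F k X \<bullet> u) * a X\<bar> \<partial>lborel) \<le> (\<integral>\<^sup>+X. ennreal (c * \<Lambda>) * ennreal (norm (conv horizontal G k X) * \<bar>a X\<bar>) \<partial>lborel)"
    proof (rule nn_integral_mono_AE)
      show "AE X in lborel. ennreal \<bar>(conv horizontal F k X \<bullet> u) * a X\<bar> \<le> ennreal (c * \<Lambda>) * ennreal (norm (conv horizontal G k X) * \<bar>a X\<bar>)"
        using Fle[OF k(1)]
      proof eventually_elim
        case (elim X)
        have "\<bar>conv horizontal F k X \<bullet> u\<bar> \<le> c * \<Lambda> * norm (conv horizontal G k X)"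
          using Cauchy_Schwarz_ineq2[of "conv horizontal F k X" u] elim u by simp
        then have "\<bar>(conv horizontal F k X \<bullet> u) * a X\<bar> \<le> (c * \<Lambda> * norm (conv horizontal G k X)) * \<bar>a X\<bar>"
          unfolding abs_mult by (rule mult_right_mono) simp
        then have "\<bar>(conv horizontal F k X \<bullet> u) * a X\<bar> \<le> (c * \<Lambda>) * (norm (conv horizontal G k X) * \<bar>a X\<bar>)" by (simp only: mult.assoc)
        from ennreal_leI[OF this] show ?case using pos by (subst ennreal_mult[symmetric]) auto
      qed
    qed
    also have "\<dots> = ennreal (c * \<Lambda>) * (\<integral>\<^sup>+X. ennreal (norm (conv horizontal G k X) * \<bar>a X\<bar>) \<partial>lborel)"
      by (rule nn_integral_cmult) measurable
    also have "\<dots> \<le> ennreal (c * \<Lambda>) * ennreal (\<gamma> * S * I)"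
      unfolding I_def
      by (intro mult_left_mono slice_pairing[OF conv_measurable[OF linear_horizontal Gm kernel_measurable[OF k(1)]] a(1) C1_measurable(1)[OF \<phi>(1)] \<phi>i S(1) k(2)[unfolded slice_norm_def] a(2,3)])
        (use a(4) K4 in auto)
    also have "\<dots> = ennreal (\<gamma> * (c * \<Lambda>) * S * I)"
      using pos a(2) S(1) I0 by (subst ennreal_mult[symmetric]) (auto simp: I_def ac_simps)
    finally show "(\<integral>\<^sup>+X. ennreal \<bar>(conv horizontal F k X \<bullet> u) * a X\<bar> \<partial>lborel) \<le> ennreal (\<gamma> * (c * \<Lambda>) * S * I)" .
  qed (use pos a(2) S(1) I0 in \<open>simp add: I_def\<close>)
  define V where "V = conv horizontal F \<kappa>"
  have Vi: "integrable lborel V" unfolding V_def by (rule conv_integrable[OF linear_horizontal Fi kernel_integrable[OF \<kappa>(2)]])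
  have comp: "integrable lborel (\<lambda>X. (V X \<bullet> u) * (h' X \<bullet> u'))" for u u' :: "(real^'n) \<times> real"
  proof -
    have c: "continuous_on UNIV (\<lambda>X. h' X \<bullet> u')"
      by (rule continuous_on_inner[OF C1_continuous_gradient[OF s(1)] continuous_on_const])
    have z: "h' X \<bullet> u' = 0" if "X \<notin> K'" for X using h'0[OF that] by simp
    obtain b2 where b2: "\<And>X. norm (h' X \<bullet> u') \<le> b2" using continuous_cpt_bounded[OF c s(2) z] by metis
    have m: "(\<lambda>X. h' X \<bullet> u') \<in> borel_measurable lborel" using C1_measurable(2)[OF s(1)] by simp
    have i: "integrable lborel (\<lambda>X. V X \<bullet> u)" by (intro integrable_inner_left Vi)
    show ?thesis using integrable_inner_bounded[OF i m b2] by simp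
  qed
  have 0: "(LINT X|lborel. V X \<bullet> h' X) = 0"
  proof -
    have "K' \<subseteq> cyl 0 (1/2)" using s(3) by (auto simp: mem_cyl_0)
    then have "(LINT X|lborel. \<mu> (snd X) * (flux B (conv horizontal G \<kappa> X) \<bullet> h' X)) = 0"
      by (rule weak_equation_mollified(2)[OF G \<kappa>(2) s(1,2) _ _ s(4)]) simp
    moreover have "(LINT X|lborel. V X \<bullet> h' X) = (LINT X|lborel. \<mu> (snd X) * (flux B (conv horizontal G \<kappa> X) \<bullet> h' X))"
    proof (rule integral_cong_AE)
      show "AE X in lborel. V X \<bullet> h' X = \<mu> (snd X) * (flux B (conv horizontal G \<kappa> X) \<bullet> h' X)"
        using conv_flux_AE[OF G \<kappa>(2)] by eventually_elim (simp add: V_def F_def[abs_def])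
      show "(\<lambda>X. V X \<bullet> h' X) \<in> borel_measurable lborel"
        using borel_measurable_integrable[OF Vi] C1_measurable(2)[OF s(1)] by measurable
      show "(\<lambda>X. \<mu> (snd X) * (flux B (conv horizontal G \<kappa> X) \<bullet> h' X)) \<in> borel_measurable lborel"
        using borel_measurable_inner[OF weighted_flux_measurable[OF unit_solutionD(3)[OF G] conv_measurable[OF linear_horizontal Gm kernel_measurable[OF \<kappa>(2)]], of B] C1_measurable(2)[OF s(1)]]
        by simp
    qed
    ultimately show ?thesis by simp
  qed
  have "(LINT X|lborel. V X \<bullet> h' X) = (\<Sum>i\<in>Basis. LINT X|lborel. (V X \<bullet> horizontal i) * (h' X \<bullet> horizontal i)) + (LINT X|lborel. (V X \<bullet> vertical) * (h' X \<bullet> vertical))"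
  proof -
    have "(LINT X|lborel. V X \<bullet> h' X) = (LINT X|lborel. (\<Sum>i\<in>Basis. (V X \<bullet> horizontal i) * (h' X \<bullet> horizontal i)) + (V X \<bullet> vertical) * (h' X \<bullet> vertical))"
      by (rule Bochner_Integration.integral_cong[OF refl inner_horizontal_vertical])
    also have "\<dots> = (LINT X|lborel. (\<Sum>i\<in>Basis. (V X \<bullet> horizontal i) * (h' X \<bullet> horizontal i))) + (LINT X|lborel. (V X \<bullet> vertical) * (h' X \<bullet> vertical))"
      by (rule Bochner_Integration.integral_add[OF Bochner_Integration.integrable_sum[OF comp] comp])
    also have "(LINT X|lborel. (\<Sum>i\<in>Basis. (V X \<bullet> horizontal i) * (h' X \<bullet> horizontal i))) = (\<Sum>i\<in>Basis. LINT X|lborel. (V X \<bullet> horizontal i) * (h' X \<bullet> horizontal i))"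
      by (rule Bochner_Integration.integral_sum[OF comp])
    finally show ?thesis .
  qed
  moreover have "(LINT X|lborel. (V X \<bullet> horizontal i) * (h' X \<bullet> horizontal i)) = - (LINT X|lborel. (conv horizontal F (\<lambda>w. \<kappa>' w \<bullet> i) X \<bullet> horizontal i) * \<psi> X)" for i
    unfolding V_def by (rule horizontal_integration_by_parts[OF Fi \<kappa> s(1,2,4)])
  ultimately have v: "(LINT X|lborel. (V X \<bullet> vertical) * (h' X \<bullet> vertical)) = (\<Sum>i\<in>Basis. LINT X|lborel. (conv horizontal F (\<lambda>w. \<kappa>' w \<bullet> i) X \<bullet> horizontal i) * \<psi> X)"
    using 0 by (simp add: sum_negf)
  obtain b1 where b1: "\<And>X. norm (A X) \<le> b1" using continuous_cpt_bounded[OF s(5,2,6)] by metis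
  have i1: "integrable lborel (\<lambda>X. (V X \<bullet> vertical) * A X)"
  proof -
    have "integrable lborel (\<lambda>X. V X \<bullet> vertical)" using Vi by simp
    from integrable_inner_bounded[OF this _ b1] show ?thesis using Am by simp
  qed
  have "(LINT X|lborel. (V X \<bullet> vertical) * \<phi> X) = (LINT X|lborel. (V X \<bullet> vertical) * A X - (V X \<bullet> vertical) * (h' X \<bullet> vertical))"
    by (simp only: s(7) right_diff_distrib)
  also have "\<dots> = (LINT X|lborel. (V X \<bullet> vertical) * A X) - (LINT X|lborel. (V X \<bullet> vertical) * (h' X \<bullet> vertical))"
    by (rule Bochner_Integration.integral_diff[OF i1 comp])
  finally have eq: "(LINT X|lborel. (V X \<bullet> vertical) * \<phi> X) = (LINT X|lborel. (V X \<bullet> vertical) * A X) - (\<Sum>i\<in>Basis. LINT X|lborel. (conv horizontal F (\<lambda>w. \<kappa>' w \<bullet> i) X \<bullet> horizontal i) * \<psi> X)"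
    unfolding v .
  have 1: "\<bar>LINT X|lborel. (V X \<bullet> vertical) * A X\<bar> \<le> 8 * (c * \<Lambda>) * S * I"
    unfolding V_def by (rule est[OF \<kappa>(2) S(2) _ Am]) (use s(9) s(6) in auto)
  have 2: "\<bar>\<Sum>i\<in>Basis. LINT X|lborel. (conv horizontal F (\<lambda>w. \<kappa>' w \<bullet> i) X \<bullet> horizontal i) * \<psi> X\<bar> \<le> (\<Sum>i\<in>(Basis :: (real^'n) set). 1 * (c * \<Lambda>) * S * I)"
  proof (rule order_trans[OF sum_abs sum_mono])
    fix i :: "real^'n" assume i: "i \<in> Basis"
    show "\<bar>LINT X|lborel. (conv horizontal F (\<lambda>w. \<kappa>' w \<bullet> i) X \<bullet> horizontal i) * \<psi> X\<bar> \<le> 1 * (c * \<Lambda>) * S * I"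
      by (rule est[OF kernel_partial[OF \<kappa>] S(3)[OF i] _ C1_measurable(1)[OF s(1)]]) (use s(8) s(4) i in \<open>auto simp: norm_horizontal\<close>)
  qed
  have "\<bar>LINT X|lborel. (V X \<bullet> vertical) * \<phi> X\<bar> \<le> 8 * (c * \<Lambda>) * S * I + DIM(real^'n) * ((c * \<Lambda>) * S * I)"
    using eq 1 2 by (simp only: sum_constant mult_1_left)
  also have "\<dots> = (8 + DIM(real^'n)) * (c * \<Lambda>) * S * I" by (simp add: algebra_simps)
  finally show ?thesis by (simp add: V_def F_def[abs_def] I_def)
qed

text \<open>
  Mollifiers of shrinking support; the convolution is moved to the test function, where it
  converges uniformly.
\<close>

lemma dual_bound_limit:
  fixes F :: "(real^'n::finite) \<times> real \<Rightarrow> (real^'n) \<times> real" and \<phi> :: "(real^'n) \<times> real \<Rightarrow> real"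
  assumes F: "integrable lborel F" and \<phi>: "C1 \<phi> h" "compact K" "\<And>X. X \<notin> K \<Longrightarrow> \<phi> X = 0" and u: "norm u = 1"
    and R: "\<And>\<kappa>. smooth \<kappa> \<Longrightarrow> kernel (1/8) \<kappa> \<Longrightarrow> (LINT w|lborel. \<bar>\<kappa> w\<bar>) \<le> 1 \<Longrightarrow> \<bar>LINT X|lborel. (conv horizontal F \<kappa> X \<bullet> u) * \<phi> X\<bar> \<le> R"
  shows "\<bar>LINT X|lborel. (F X \<bullet> u) * \<phi> X\<bar> \<le> R"
proof (rule field_le_epsilon)
  fix e :: real assume e: "e > 0"
  define N where "N = (LINT X|lborel. norm (F X)) + 1"
  have N: "N > 0" by (simp add: N_def add_nonneg_pos)
  let ?i = "\<lambda>w::real^'n. - horizontal w"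
  have eN: "e / N > 0" using e N by simp
  obtain d where d: "d > 0" "\<And>\<kappa> X. kernel d \<kappa> \<Longrightarrow> (\<And>w. \<kappa> w \<ge> 0) \<Longrightarrow> (LINT w|lborel. \<kappa> w) = 1 \<Longrightarrow> norm (conv ?i \<phi> \<kappa> X - \<phi> X) \<le> e / N"
    using conv_approximates[OF linear_minus_horizontal C1_continuous[OF \<phi>(1)] \<phi>(2,3) eN] by metis
  define \<epsilon> where "\<epsilon> = min d (1/8)"
  have "\<epsilon> > 0" using d(1) by (simp add: \<epsilon>_def)
  then obtain \<kappa> :: "real^'n \<Rightarrow> real" where \<kappa>: "smooth \<kappa>" "\<And>x. 0 \<le> \<kappa> x" "\<And>x. x \<notin> cball 0 \<epsilon> \<Longrightarrow> \<kappa> x = 0" "(LINT x|lborel. \<kappa> x) = 1"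
    using smooth_bump by metis
  have c\<kappa>: "continuous_on UNIV \<kappa>" by (rule C1_continuous[OF smooth_C1[OF \<kappa>(1)]])
  have k1: "kernel (1/8) \<kappa>" and k2: "kernel d \<kappa>" using c\<kappa> \<kappa>(3) by (auto simp: kernel_def \<epsilon>_def)
  have ab: "(LINT w|lborel. \<bar>\<kappa> w\<bar>) \<le> 1" using \<kappa>(2,4) by simp
  obtain b where b: "\<And>X. norm (\<phi> X *\<^sub>R u) \<le> b"
    using continuous_cpt_bounded[OF C1_continuous[OF \<phi>(1)] \<phi>(2,3)] u by (metis mult.right_neutral norm_scaleR real_norm_def)
  note [measurable] = C1_measurable[OF \<phi>(1)]
  have m\<phi>: "(\<lambda>X. \<phi> X *\<^sub>R u) \<in> borel_measurable borel" by measurable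
  have "(LINT X|lborel. (conv horizontal F \<kappa> X \<bullet> u) * \<phi> X) = (LINT X|lborel. conv horizontal F \<kappa> X \<bullet> (\<phi> X *\<^sub>R u))"
    by (simp add: mult.commute)
  also have "\<dots> = (LINT X|lborel. F X \<bullet> conv ?i (\<lambda>X. \<phi> X *\<^sub>R u) \<kappa> X)"
    by (rule conv_duality[OF linear_horizontal F k1 m\<phi> b])
  finally have eq: "(LINT X|lborel. (conv horizontal F \<kappa> X \<bullet> u) * \<phi> X) = (LINT X|lborel. F X \<bullet> (conv ?i \<phi> \<kappa> X *\<^sub>R u))"
    by (simp only: conv_scaleR_const[OF linear_minus_horizontal k1 C1_continuous[OF \<phi>(1)]])
  have cm: "(\<lambda>X. conv ?i \<phi> \<kappa> X *\<^sub>R u) \<in> borel_measurable lborel"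
    using conv_measurable[OF linear_minus_horizontal C1_measurable(1)[OF \<phi>(1)] kernel_measurable[OF k1]] by simp
  have cb: "norm (conv ?i \<phi> \<kappa> X *\<^sub>R u) \<le> b + e / N" for X
  proof -
    have "norm (conv ?i \<phi> \<kappa> X) \<le> norm (\<phi> X) + norm (conv ?i \<phi> \<kappa> X - \<phi> X)" by (rule norm_triangle_sub)
    then show ?thesis using d(2)[OF k2 \<kappa>(2,4), of X] b[of X] u by simp
  qed
  have mm: "(\<lambda>X. \<phi> X *\<^sub>R u) \<in> borel_measurable lborel" using m\<phi> by simp
  have "(LINT X|lborel. (F X \<bullet> u) * \<phi> X) - (LINT X|lborel. (conv horizontal F \<kappa> X \<bullet> u) * \<phi> X)
    = (LINT X|lborel. F X \<bullet> (\<phi> X *\<^sub>R u) - F X \<bullet> (conv ?i \<phi> \<kappa> X *\<^sub>R u))"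
    unfolding eq Bochner_Integration.integral_diff[OF integrable_inner_bounded[OF F mm b] integrable_inner_bounded[OF F cm cb]]
    by (simp add: mult.commute)
  also have "\<bar>\<dots>\<bar> \<le> (LINT X|lborel. e / N * norm (F X))"
  proof (rule order_trans[OF integral_abs_bound integral_mono])
    show "integrable lborel (\<lambda>X. \<bar>F X \<bullet> (\<phi> X *\<^sub>R u) - F X \<bullet> (conv ?i \<phi> \<kappa> X *\<^sub>R u)\<bar>)"
      by (rule integrable_abs[OF Bochner_Integration.integrable_diff[OF integrable_inner_bounded[OF F mm b] integrable_inner_bounded[OF F cm cb]]])
    show "integrable lborel (\<lambda>X. e / N * norm (F X))" using F by simp
    fix X
    have "\<bar>F X \<bullet> u\<bar> \<le> norm (F X)" using Cauchy_Schwarz_ineq2[of "F X" u] u by simp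
    moreover have "\<bar>\<phi> X - conv ?i \<phi> \<kappa> X\<bar> \<le> e / N" using d(2)[OF k2 \<kappa>(2,4), of X] by (simp add: abs_minus_commute)
    ultimately have "\<bar>\<phi> X - conv ?i \<phi> \<kappa> X\<bar> * \<bar>F X \<bullet> u\<bar> \<le> e / N * norm (F X)"
      using e N by (intro mult_mono) auto
    then show "\<bar>F X \<bullet> (\<phi> X *\<^sub>R u) - F X \<bullet> (conv ?i \<phi> \<kappa> X *\<^sub>R u)\<bar> \<le> e / N * norm (F X)"
      by (simp add: abs_mult[symmetric] left_diff_distrib)
  qed
  also have "\<dots> \<le> e"
  proof -
    have "e / N * (LINT X|lborel. norm (F X)) \<le> e / N * N" using e N by (intro mult_left_mono) (auto simp: N_def)
    then show ?thesis using N by simp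
  qed
  finally show "\<bar>LINT X|lborel. (F X \<bullet> u) * \<phi> X\<bar> \<le> R + e" using R[OF \<kappa>(1) k1 ab] by linarith
qed

text \<open>
  The components are bounded one by one, by duality and uniformly in the mollifier. A bound of
  the vertical flux bounds the vertical component since the weight is at least 1.
\<close>

theorem unit_gradient_bound:
  fixes \<Lambda> c :: real
  assumes "\<Lambda> > 0" "1 \<le> c"
  shows "\<exists>C>0. \<forall>B \<mu> (G :: (real^'n::finite) \<times> real \<Rightarrow> _) M.
    unit_solution \<Lambda> c B \<mu> G \<longrightarrow> 0 < M \<longrightarrow> (\<integral>\<^sup>+X\<in>cyl 0 1. ennreal ((norm (G X))\<^sup>2) \<partial>lborel) \<le> ennreal (M\<^sup>2) \<longrightarrow>
    (AE X in lborel. X \<in> cyl 0 (1/8) \<longrightarrow> norm (G X) \<le> C * M)"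
proof -
  define P where "P C \<longleftrightarrow> (\<forall>B \<mu> (G :: (real^'n::finite) \<times> real \<Rightarrow> _) \<kappa> bs M x.
    unit_solution \<Lambda> c B \<mu> G \<longrightarrow> smooth \<kappa> \<longrightarrow> kernel (1/8) \<kappa> \<longrightarrow> (LINT w|lborel. \<bar>\<kappa> w\<bar>) \<le> 1 \<longrightarrow>
    set bs \<subseteq> Basis \<longrightarrow> length bs \<le> 1 \<longrightarrow> 0 < M \<longrightarrow> (\<integral>\<^sup>+X\<in>cyl 0 1. ennreal ((norm (G X))\<^sup>2) \<partial>lborel) \<le> ennreal (M\<^sup>2) \<longrightarrow>
    norm x < 1/4 \<longrightarrow> slice_norm G (iterated_partial bs \<kappa>) x \<le> ennreal (C * M))" for C
  have "\<exists>C>0. P C" unfolding P_def by (rule slice_norm_bound[OF assms])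
  then obtain C where C: "C > 0" "P C" by blast
  define D where "D = DIM(real^'n) * (9 * C) + (8 + DIM(real^'n)) * (c * \<Lambda>) * C"
  have "D > 0" unfolding D_def using assms C(1) by (intro add_nonneg_pos mult_pos_pos) auto
  show ?thesis
  proof (intro exI[of _ D] conjI \<open>D > 0\<close> allI impI)
    fix B \<mu> and G :: "(real^'n) \<times> real \<Rightarrow> (real^'n) \<times> real" and M :: real
    assume G: "unit_solution \<Lambda> c B \<mu> G" and M: "0 < M" "(\<integral>\<^sup>+X\<in>cyl 0 1. ennreal ((norm (G X))\<^sup>2) \<partial>lborel) \<le> ennreal (M\<^sup>2)"
    note Gi = unit_solution_integrable(2)[OF G] and Fi = unit_solution_flux_integrable[OF G]
    have S0: "0 \<le> C * M" using C(1) M(1) by simp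
    have S1: "slice_norm G \<kappa> x \<le> ennreal (C * M)" if "smooth \<kappa>" "kernel (1/8) \<kappa>" "(LINT w|lborel. \<bar>\<kappa> w\<bar>) \<le> 1" "norm x < 1/4" for \<kappa> x
      using C(2)[unfolded P_def, rule_format, OF G that(1-3), of "[]" M x] M that(4) by simp
    have S2: "slice_norm G (\<lambda>w. grad \<kappa> w \<bullet> b) x \<le> ennreal (C * M)" if "smooth \<kappa>" "kernel (1/8) \<kappa>" "(LINT w|lborel. \<bar>\<kappa> w\<bar>) \<le> 1" "b \<in> Basis" "norm x < 1/4" for \<kappa> b x
      using C(2)[unfolded P_def, rule_format, OF G that(1-3), of "[b]" M x] M that(4,5) by simp
    have h: "AE X in lborel. X \<in> cyl 0 (1/8) \<longrightarrow> \<bar>G X \<bullet> horizontal b\<bar> \<le> 9 * (C * M)" if b: "b \<in> Basis" for b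
    proof (rule AE_bound_by_duality[OF _ open_cyl])
      show "integrable lborel (\<lambda>X. G X \<bullet> horizontal b)" using Gi by simp
      fix \<phi> :: "(real^'n) \<times> real \<Rightarrow> real" and h S
      assume \<phi>: "C1 \<phi> h" "compact S" "S \<subseteq> cyl 0 (1/8)" "\<And>X. X \<notin> S \<Longrightarrow> \<phi> X = 0"
      show "\<bar>LINT X|lborel. (G X \<bullet> horizontal b) * \<phi> X\<bar> \<le> 9 * (C * M) * (LINT X|lborel. \<bar>\<phi> X\<bar>)"
      proof (rule dual_bound_limit[OF Gi \<phi>(1,2,4)])
        show "norm (horizontal b) = 1" using b by (simp add: norm_horizontal)
        fix \<kappa> :: "real^'n \<Rightarrow> real" assume \<kappa>: "smooth \<kappa>" "kernel (1/8) \<kappa>" "(LINT w|lborel. \<bar>\<kappa> w\<bar>) \<le> 1"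
        show "\<bar>LINT X|lborel. (conv horizontal G \<kappa> X \<bullet> horizontal b) * \<phi> X\<bar> \<le> 9 * (C * M) * (LINT X|lborel. \<bar>\<phi> X\<bar>)"
          by (rule horizontal_component_bound[OF G smooth_C1[OF \<kappa>(1)] \<kappa>(2) norm_Basis[OF b] S0 S1[OF \<kappa>] S2[OF \<kappa> b] \<phi>])
      qed
    qed
    have v: "AE X in lborel. X \<in> cyl 0 (1/8) \<longrightarrow> \<bar>(\<mu> (snd X) *\<^sub>R flux B (G X)) \<bullet> vertical\<bar> \<le> (8 + DIM(real^'n)) * (c * \<Lambda>) * (C * M)"
    proof (rule AE_bound_by_duality[OF _ open_cyl])
      show "integrable lborel (\<lambda>X. (\<mu> (snd X) *\<^sub>R flux B (G X)) \<bullet> vertical)" by (intro integrable_inner_left Fi)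
      fix \<phi> :: "(real^'n) \<times> real \<Rightarrow> real" and h S
      assume \<phi>: "C1 \<phi> h" "compact S" "S \<subseteq> cyl 0 (1/8)" "\<And>X. X \<notin> S \<Longrightarrow> \<phi> X = 0"
      show "\<bar>LINT X|lborel. ((\<mu> (snd X) *\<^sub>R flux B (G X)) \<bullet> vertical) * \<phi> X\<bar> \<le> (8 + DIM(real^'n)) * (c * \<Lambda>) * (C * M) * (LINT X|lborel. \<bar>\<phi> X\<bar>)"
      proof (rule dual_bound_limit[OF Fi \<phi>(1,2,4)])
        show "norm (vertical :: (real^'n) \<times> real) = 1" by simp
        fix \<kappa> :: "real^'n \<Rightarrow> real" assume \<kappa>: "smooth \<kappa>" "kernel (1/8) \<kappa>" "(LINT w|lborel. \<bar>\<kappa> w\<bar>) \<le> 1"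
        show "\<bar>LINT X|lborel. (conv horizontal (\<lambda>X. \<mu> (snd X) *\<^sub>R flux B (G X)) \<kappa> X \<bullet> vertical) * \<phi> X\<bar> \<le> (8 + DIM(real^'n)) * (c * \<Lambda>) * (C * M) * (LINT X|lborel. \<bar>\<phi> X\<bar>)"
          by (rule vertical_component_bound[OF G assms smooth_C1[OF \<kappa>(1)] \<kappa>(2) S0 S1[OF \<kappa>] S2[OF \<kappa>] \<phi>])
      qed
    qed
    have "AE X in lborel. \<forall>b\<in>Basis. X \<in> cyl 0 (1/8) \<longrightarrow> \<bar>G X \<bullet> horizontal b\<bar> \<le> 9 * (C * M)"
      using h by (subst AE_ball_countable) (auto intro: countable_finite)
    with v show "AE X in lborel. X \<in> cyl 0 (1/8) \<longrightarrow> norm (G X) \<le> D * M"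
    proof eventually_elim
      case (elim X)
      show ?case
      proof
        assume X: "X \<in> cyl 0 (1/8)"
        have "norm (fst (G X)) \<le> (\<Sum>b\<in>Basis. \<bar>fst (G X) \<bullet> b\<bar>)" by (rule norm_le_l1)
        also have "\<dots> \<le> (\<Sum>b\<in>(Basis :: (real^'n) set). 9 * (C * M))"
          using elim(2) X by (intro sum_mono) (simp add: horizontal_def inner_prod_def)
        finally have 1: "norm (fst (G X)) \<le> DIM(real^'n) * (9 * (C * M))" by simp
        have "\<bar>snd (G X)\<bar> \<le> \<mu> (snd X) * \<bar>snd (G X)\<bar>"
          using mult_right_mono[OF unit_solutionD(4)[OF G, of "snd X"], of "\<bar>snd (G X)\<bar>"] by simp
        also have "\<dots> = \<bar>(\<mu> (snd X) *\<^sub>R flux B (G X)) \<bullet> vertical\<bar>"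
          using unit_solutionD(4)[OF G, of "snd X"] by (simp add: flux_def abs_mult)
        also have "\<dots> \<le> (8 + DIM(real^'n)) * (c * \<Lambda>) * (C * M)" using elim(1) X by blast
        finally have "\<bar>snd (G X)\<bar> \<le> (8 + DIM(real^'n)) * (c * \<Lambda>) * (C * M)" .
        moreover have "norm (G X) \<le> norm (fst (G X)) + norm (snd (G X))" using norm_Pair_le[of "fst (G X)" "snd (G X)"] by simp
        ultimately have "norm (G X) \<le> DIM(real^'n) * (9 * (C * M)) + (8 + DIM(real^'n)) * (c * \<Lambda>) * (C * M)"
          using 1 by simp
        also have "\<dots> = D * M" unfolding D_def by (simp only: distrib_right mult.assoc)
        finally show "norm (G X) \<le> D * M" .
      qed
    qed
  qed
qed

section \<open>Scaling of solutions\<close>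

lemma solution_onD:
  assumes "solution_on B \<mu> E F G"
  shows "G \<in> borel_measurable borel" "(\<integral>\<^sup>+X\<in>E. ennreal ((norm (G X))\<^sup>2) \<partial>lborel) < \<infinity>"
    "e > 0 \<Longrightarrow> \<exists>f g. C1 f g \<and> (\<forall>X\<in>F. f X = 0) \<and> (\<integral>\<^sup>+X\<in>E. ennreal ((norm (G X - g X))\<^sup>2) \<partial>lborel) < ennreal e"
    "C1 \<phi> h \<Longrightarrow> compact K \<Longrightarrow> K \<subseteq> E \<Longrightarrow> (\<And>X. X \<notin> K \<Longrightarrow> \<phi> X = 0) \<Longrightarrow>
       (LINT X:E|lborel. \<mu> (snd X) * (flux B (G X) \<bullet> h X)) = 0"
  using assms unfolding solution_on_def by (blast, blast, blast, blast)

lemma solution_on_subset: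
  assumes s: "solution_on B \<mu> E F G" and E: "E' \<subseteq> E" and F: "F' \<subseteq> F"
  shows "solution_on B \<mu> E' F' G"
proof -
  have mono: "(\<integral>\<^sup>+X\<in>E'. p X \<partial>lborel) \<le> (\<integral>\<^sup>+X\<in>E. p X \<partial>lborel)" for p :: "_ \<Rightarrow> ennreal"
    using E by (intro nn_integral_mono) (auto simp: indicator_def)
  show ?thesis
    unfolding solution_on_def
  proof (intro conjI allI impI)
    show "G \<in> borel_measurable borel" by (rule solution_onD(1)[OF s])
    show "(\<integral>\<^sup>+X\<in>E'. ennreal ((norm (G X))\<^sup>2) \<partial>lborel) < \<infinity>"
      by (rule order_le_less_trans[OF mono solution_onD(2)[OF s]])
    fix e :: real assume "e > 0"
    from solution_onD(3)[OF s this] obtain f g where "C1 f g" "\<forall>X\<in>F. f X = 0" "(\<integral>\<^sup>+X\<in>E. ennreal ((norm (G X - g X))\<^sup>2) \<partial>lborel) < ennreal e"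
      by blast
    then show "\<exists>f g. C1 f g \<and> (\<forall>X\<in>F'. f X = 0) \<and> (\<integral>\<^sup>+X\<in>E'. ennreal ((norm (G X - g X))\<^sup>2) \<partial>lborel) < ennreal e"
      using F by (intro exI[of _ f] exI[of _ g] conjI order_le_less_trans[OF mono]) auto
  next
    fix \<phi> h K assume \<phi>: "C1 \<phi> h" "compact K" "K \<subseteq> E'" "\<forall>X. X \<notin> K \<longrightarrow> \<phi> X = 0"
    have h0: "h X = 0" if "X \<notin> K" for X
      by (rule C1_gradient_zero_outside[OF \<phi>(1) compact_imp_closed[OF \<phi>(2)] _ that]) (use \<phi>(4) in auto)
    have "(LINT X:E'|lborel. \<mu> (snd X) * (flux B (G X) \<bullet> h X)) = (LINT X:E|lborel. \<mu> (snd X) * (flux B (G X) \<bullet> h X))"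
      unfolding set_lebesgue_integral_def
    proof (rule Bochner_Integration.integral_cong[OF refl])
      fix X
      show "indicator E' X *\<^sub>R (\<mu> (snd X) * (flux B (G X) \<bullet> h X)) = indicator E X *\<^sub>R (\<mu> (snd X) * (flux B (G X) \<bullet> h X))"
        using E \<phi>(3) h0[of X] by (cases "X \<in> K") (auto simp: indicator_def)
    qed
    also have "\<dots> = 0"
      by (rule solution_onD(4)[OF s \<phi>(1,2)]) (use \<phi>(3,4) E in auto)
    finally show "(LINT X:E'|lborel. \<mu> (snd X) * (flux B (G X) \<bullet> h X)) = 0" .
  qed
qed

lemma nn_integral_scale:
  fixes p :: "'a::euclidean_space \<Rightarrow> ennreal"
  assumes [measurable]: "p \<in> borel_measurable borel" and d: "d > 0"
  shows "(\<integral>\<^sup>+X. p X \<partial>lborel) = ennreal (d ^ DIM('a)) * (\<integral>\<^sup>+Z. p (c + d *\<^sub>R Z) \<partial>lborel)"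
  by (subst lborel_affine[of d c]) (use d in \<open>simp_all add: nn_integral_density nn_integral_distr nn_integral_cmult\<close>)

lemma integral_scale:
  fixes p :: "'a::euclidean_space \<Rightarrow> real"
  assumes [measurable]: "p \<in> borel_measurable borel" and d: "d > 0"
  shows "(LINT X|lborel. p X) = d ^ DIM('a) * (LINT Z|lborel. p (c + d *\<^sub>R Z))"
  by (subst lborel_affine[of d c]) (use d in \<open>simp_all add: integral_density integral_distr\<close>)

lemma C1_scale:
  assumes "C1 f g"
  shows "C1 (\<lambda>Z. f (c + d *\<^sub>R Z)) (\<lambda>Z. d *\<^sub>R g (c + d *\<^sub>R Z))"
  by (rule C1_compose_affine[OF assms]) (auto intro!: linearI simp: algebra_simps)

lemma solution_on_scale:
  fixes G :: "(real^'n::finite) \<times> real \<Rightarrow> (real^'n) \<times> real"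
  assumes s: "solution_on B \<mu> E F G" and E: "E \<in> sets borel" and \<mu>: "\<mu> \<in> borel_measurable borel" and d: "d > 0"
  shows "solution_on B (\<lambda>y. \<mu> (snd X1 + d * y)) {Z. X1 + d *\<^sub>R Z \<in> E} {Z. X1 + d *\<^sub>R Z \<in> F} (\<lambda>Z. G (X1 + d *\<^sub>R Z))"
    and "(\<integral>\<^sup>+Z\<in>{Z. X1 + d *\<^sub>R Z \<in> E}. ennreal ((norm (G (X1 + d *\<^sub>R Z)))\<^sup>2) \<partial>lborel)
      = ennreal (1 / d ^ DIM((real^'n) \<times> real)) * (\<integral>\<^sup>+X\<in>E. ennreal ((norm (G X))\<^sup>2) \<partial>lborel)"
proof -
  let ?D = "DIM((real^'n) \<times> real)"
  note [measurable] = solution_onD(1)[OF s] E \<mu>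
  have dinv: "ennreal (1 / d ^ ?D) * ennreal (d ^ ?D) = 1" using d by (simp add: ennreal_mult[symmetric])
  have sc: "(\<integral>\<^sup>+Z\<in>{Z. X1 + d *\<^sub>R Z \<in> E}. p (X1 + d *\<^sub>R Z) \<partial>lborel) = ennreal (1 / d ^ ?D) * (\<integral>\<^sup>+X\<in>E. p X \<partial>lborel)"
    if [measurable]: "p \<in> borel_measurable borel" for p :: "(real^'n) \<times> real \<Rightarrow> ennreal"
  proof -
    have "ennreal (1 / d ^ ?D) * (\<integral>\<^sup>+X\<in>E. p X \<partial>lborel) = (\<integral>\<^sup>+Z. p (X1 + d *\<^sub>R Z) * indicator E (X1 + d *\<^sub>R Z) \<partial>lborel)"
      by (subst nn_integral_scale[OF _ d, of _ X1]) (simp_all add: mult.assoc[symmetric] dinv del: DIM_prod)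
    also have "\<dots> = (\<integral>\<^sup>+Z\<in>{Z. X1 + d *\<^sub>R Z \<in> E}. p (X1 + d *\<^sub>R Z) \<partial>lborel)"
      by (intro nn_integral_cong) (auto simp: indicator_def)
    finally show ?thesis by simp
  qed
  show e: "(\<integral>\<^sup>+Z\<in>{Z. X1 + d *\<^sub>R Z \<in> E}. ennreal ((norm (G (X1 + d *\<^sub>R Z)))\<^sup>2) \<partial>lborel)
      = ennreal (1 / d ^ ?D) * (\<integral>\<^sup>+X\<in>E. ennreal ((norm (G X))\<^sup>2) \<partial>lborel)"
    by (rule sc) measurable
  show "solution_on B (\<lambda>y. \<mu> (snd X1 + d * y)) {Z. X1 + d *\<^sub>R Z \<in> E} {Z. X1 + d *\<^sub>R Z \<in> F} (\<lambda>Z. G (X1 + d *\<^sub>R Z))"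
    unfolding solution_on_def
  proof (intro conjI allI impI)
    show "(\<lambda>Z. G (X1 + d *\<^sub>R Z)) \<in> borel_measurable borel" by measurable
    show "(\<integral>\<^sup>+Z\<in>{Z. X1 + d *\<^sub>R Z \<in> E}. ennreal ((norm (G (X1 + d *\<^sub>R Z)))\<^sup>2) \<partial>lborel) < \<infinity>"
      unfolding e using solution_onD(2)[OF s] by (simp add: ennreal_mult_less_top)
    fix e :: real assume "e > 0"
    then have "e * d ^ ?D > 0" using d by simp
    from solution_onD(3)[OF s this] obtain f g where fg: "C1 f g" "\<forall>X\<in>F. f X = 0" "(\<integral>\<^sup>+X\<in>E. ennreal ((norm (G X - g X))\<^sup>2) \<partial>lborel) < ennreal (e * d ^ ?D)"
      by blast
    note [measurable] = C1_measurable[OF fg(1)]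
    have "(\<integral>\<^sup>+Z\<in>{Z. X1 + d *\<^sub>R Z \<in> E}. ennreal ((norm (G (X1 + d *\<^sub>R Z) - g (X1 + d *\<^sub>R Z)))\<^sup>2) \<partial>lborel)
      = ennreal (1 / d ^ ?D) * (\<integral>\<^sup>+X\<in>E. ennreal ((norm (G X - g X))\<^sup>2) \<partial>lborel)"
      by (rule sc) measurable
    also have "\<dots> < ennreal (1 / d ^ ?D) * ennreal (e * d ^ ?D)"
      using fg(3) d by (intro ennreal_mult_strict_left_mono) auto
    also have "\<dots> = ennreal e" using d \<open>e > 0\<close> by (simp add: ennreal_mult[symmetric])
    finally have lt: "(\<integral>\<^sup>+Z\<in>{Z. X1 + d *\<^sub>R Z \<in> E}. ennreal ((norm (G (X1 + d *\<^sub>R Z) - g (X1 + d *\<^sub>R Z)))\<^sup>2) \<partial>lborel) < ennreal e" .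
    have "C1 (\<lambda>Z. (1 / d) * f (X1 + d *\<^sub>R Z)) (\<lambda>Z. g (X1 + d *\<^sub>R Z))"
      using C1_mult[OF C1_const[of "1 / d"] C1_scale[OF fg(1), of X1 d]] d by simp
    then show "\<exists>f g. C1 f g \<and> (\<forall>X\<in>{Z. X1 + d *\<^sub>R Z \<in> F}. f X = 0) \<and>
        (\<integral>\<^sup>+X\<in>{Z. X1 + d *\<^sub>R Z \<in> E}. ennreal ((norm (G (X1 + d *\<^sub>R X) - g X))\<^sup>2) \<partial>lborel) < ennreal e"
      using fg(2) lt by (intro exI[of _ "\<lambda>Z. (1 / d) * f (X1 + d *\<^sub>R Z)"] exI[of _ "\<lambda>Z. g (X1 + d *\<^sub>R Z)"]) auto
  next
    fix \<phi> h K assume \<phi>: "C1 \<phi> h" "compact K" "K \<subseteq> {Z. X1 + d *\<^sub>R Z \<in> E}" "\<forall>X. X \<notin> K \<longrightarrow> \<phi> X = 0"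
    define c where "c = - (1 / d) *\<^sub>R X1"
    have inv: "c + (1 / d) *\<^sub>R (X1 + d *\<^sub>R Z) = Z" for Z using d by (simp add: c_def algebra_simps)
    have inv': "X1 + d *\<^sub>R (c + (1 / d) *\<^sub>R X) = X" for X using d by (simp add: c_def algebra_simps)
    note C = C1_scale[OF \<phi>(1), of c "1 / d"]
    note [measurable] = C1_measurable[OF \<phi>(1)] linear_measurable[OF linear_flux, of B]
    have [measurable]: "snd \<in> borel_measurable (borel :: ((real^'n) \<times> real) measure)"
      by (intro borel_measurable_continuous_onI continuous_on_snd continuous_on_id)
    define p where "p X = indicator E X * (\<mu> (snd X) * (flux B (G X) \<bullet> ((1 / d) *\<^sub>R h (c + (1 / d) *\<^sub>R X))))" for X
    have pm: "p \<in> borel_measurable borel" unfolding p_def by measurable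
    have "(LINT X:E|lborel. \<mu> (snd X) * (flux B (G X) \<bullet> ((1 / d) *\<^sub>R h (c + (1 / d) *\<^sub>R X)))) = 0"
    proof (rule solution_onD(4)[OF s C])
      show "compact ((\<lambda>Z. X1 + d *\<^sub>R Z) ` K)"
        by (intro compact_continuous_image \<phi>(2) continuous_intros)
      show "(\<lambda>Z. X1 + d *\<^sub>R Z) ` K \<subseteq> E" using \<phi>(3) by auto
      show "\<phi> (c + (1 / d) *\<^sub>R X) = 0" if "X \<notin> (\<lambda>Z. X1 + d *\<^sub>R Z) ` K" for X
      proof -
        have "c + (1 / d) *\<^sub>R X \<notin> K" using that inv'[of X] by (metis imageI)
        then show ?thesis using \<phi>(4) by blast
      qed
    qed
    then have "(LINT X|lborel. p X) = 0" by (simp add: p_def set_lebesgue_integral_def)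
    then have "(LINT Z|lborel. p (X1 + d *\<^sub>R Z)) = 0"
      using integral_scale[OF pm d, of X1] d by simp
    moreover have "p (X1 + d *\<^sub>R Z) = (1 / d) * (indicator {Z. X1 + d *\<^sub>R Z \<in> E} Z *\<^sub>R (\<mu> (snd X1 + d * snd Z) * (flux B (G (X1 + d *\<^sub>R Z)) \<bullet> h Z)))" for Z
      unfolding p_def inv by (simp add: indicator_def)
    ultimately show "(LINT X:{Z. X1 + d *\<^sub>R Z \<in> E}|lborel. \<mu> (snd X1 + d * snd X) * (flux B (G (X1 + d *\<^sub>R X)) \<bullet> h X)) = 0"
      using d by (simp add: set_lebesgue_integral_def)
  qed
qed

section \<open>Reflection across the flat boundary\<close>

text \<open>
  The reflection that fixes the hyperplane \<open>x\<^sub>k = 0\<close> and reverses the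
  conormal direction \<open>B e\<^sub>k\<close>. It is orthogonal for the quadratic form dual to
  \<open>B\<close>, though in general not for the Euclidean one.
\<close>

definition conormal_reflection :: "'n \<Rightarrow> real^'n^'n \<Rightarrow> real^'n \<Rightarrow> real^'n::finite"
  where "conormal_reflection k B x = x - (2 * x $ k / (B $ k $ k)) *\<^sub>R (B *v axis k 1)"

definition reflect :: "'n \<Rightarrow> real^'n^'n \<Rightarrow> (real^'n) \<times> real \<Rightarrow> (real^'n::finite) \<times> real"
  where "reflect k B X = (conormal_reflection k B (fst X), snd X)"

definition reflect_adjoint :: "'n \<Rightarrow> real^'n^'n \<Rightarrow> (real^'n) \<times> real \<Rightarrow> (real^'n::finite) \<times> real"
  where "reflect_adjoint k B X = (fst X - (2 * (fst X \<bullet> (B *v axis k 1)) / (B $ k $ k)) *\<^sub>R axis k 1, snd X)"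

definition elliptic_sym :: "real \<Rightarrow> real^'n^'n \<Rightarrow> bool"
  where "elliptic_sym \<Lambda> B \<longleftrightarrow> (\<forall>\<xi>::(real^'n::finite) \<times> real. (norm \<xi>)\<^sup>2 / \<Lambda> \<le> flux B \<xi> \<bullet> \<xi>) \<and>
    (\<forall>\<xi>. norm (flux B \<xi>) \<le> \<Lambda> * norm \<xi>) \<and> (\<forall>v w. (B *v v) \<bullet> w = v \<bullet> (B *v w))"

lemma inner_axis_1: "x \<bullet> axis k 1 = x $ k" for x :: "real^'n::finite"
  by (simp add: inner_axis)

lemma matrix_axis_entry: "(B *v axis k 1) $ k = B $ k $ k" for B :: "real^'n^'n::finite"
  by (simp add: matrix_vector_mul_component inner_axis_1)

lemma linear_conormal_reflection: "linear (conormal_reflection k B)"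
  by (rule linearI) (simp_all add: conormal_reflection_def add_divide_distrib algebra_simps)

lemma linear_reflect: "linear (reflect k B)"
  using linear_conormal_reflection[of k B]
  by (intro linearI) (simp_all add: reflect_def linear_add linear_scale)

lemma linear_reflect_adjoint: "linear (reflect_adjoint k B)"
  by (rule linearI) (simp_all add: reflect_adjoint_def inner_add_left add_divide_distrib algebra_simps)

lemma reflect_adjoint_inner: "reflect_adjoint k B w \<bullet> v = w \<bullet> reflect k B v"
  by (simp add: reflect_adjoint_def reflect_def conormal_reflection_def inner_prod_def inner_diff_left inner_diff_right inner_commute[of "axis k 1"] inner_axis_1)

text \<open>
  The map \<open>X \<mapsto> X - 2 \<sigma>(X) b\<close> reverses each line in direction
  \<open>b\<close> about the point where \<open>\<sigma>\<close> vanishes, so it preserves the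
  measure on every line. To integrate over the lines without choosing coordinates, each function
  is first averaged: by Tonelli's theorem its integral is the integral over \<open>0 \<le>
  \<sigma> \<le> 1\<close> of its line integrals.
\<close>

lemma nn_integral_oblique_reflection:
  fixes b :: "'a::euclidean_space" and \<sigma> :: "'a \<Rightarrow> real"
  assumes \<sigma>: "\<And>X t. \<sigma> (X + t *\<^sub>R b) = \<sigma> X + t" and m[measurable]: "\<sigma> \<in> borel_measurable borel"
    and [measurable]: "p \<in> borel_measurable borel"
  shows "(\<integral>\<^sup>+X. p (X - (2 * \<sigma> X) *\<^sub>R b) \<partial>lborel) = (\<integral>\<^sup>+X. p X \<partial>lborel)"
proof -
  have average: "(\<integral>\<^sup>+X. q X \<partial>lborel) = (\<integral>\<^sup>+X. (\<integral>\<^sup>+s. indicator {0..1} (\<sigma> X) * q (X - s *\<^sub>R b) \<partial>lborel) \<partial>lborel)"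
    if [measurable]: "q \<in> borel_measurable borel" for q
  proof -
    have "(\<integral>\<^sup>+s. indicator {0..1} (\<sigma> X + s) * q X \<partial>lborel) = q X" for X
    proof -
      have "(\<integral>\<^sup>+s. indicator {0..1} (\<sigma> X + s) * q X \<partial>lborel) = (\<integral>\<^sup>+s. indicator {0..1::real} s * q X \<partial>lborel)"
        by (rule nn_integral_translate[where f="\<lambda>s::real. indicator {0..1} s * q X"]) measurable
      then show ?thesis by (simp add: nn_integral_multc)
    qed
    then have "(\<integral>\<^sup>+X. q X \<partial>lborel) = (\<integral>\<^sup>+X. (\<integral>\<^sup>+s. indicator {0..1} (\<sigma> X + s) * q X \<partial>lborel) \<partial>lborel)"
      by simp
    also have "\<dots> = (\<integral>\<^sup>+s. (\<integral>\<^sup>+X. indicator {0..1} (\<sigma> X + s) * q X \<partial>lborel) \<partial>lborel)"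
      by (rule lborel_pair.Fubini') measurable
    also have "\<dots> = (\<integral>\<^sup>+s. (\<integral>\<^sup>+X. indicator {0..1} (\<sigma> X) * q (X - s *\<^sub>R b) \<partial>lborel) \<partial>lborel)"
    proof (rule nn_integral_cong)
      fix s
      have "(\<integral>\<^sup>+X. indicator {0..1} (\<sigma> X + s) * q X \<partial>lborel) = (\<integral>\<^sup>+X. indicator {0..1} (\<sigma> (- (s *\<^sub>R b) + X) + s) * q (- (s *\<^sub>R b) + X) \<partial>lborel)"
        by (rule nn_integral_translate[symmetric]) measurable
      moreover have "\<sigma> (- (s *\<^sub>R b) + X) + s = \<sigma> X" for X
        using \<sigma>[of X "- s"] by (simp add: add.commute)
      ultimately show "(\<integral>\<^sup>+X. indicator {0..1} (\<sigma> X + s) * q X \<partial>lborel) = (\<integral>\<^sup>+X. indicator {0..1} (\<sigma> X) * q (X - s *\<^sub>R b) \<partial>lborel)"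
        by simp
    qed
    also have "\<dots> = (\<integral>\<^sup>+X. (\<integral>\<^sup>+s. indicator {0..1} (\<sigma> X) * q (X - s *\<^sub>R b) \<partial>lborel) \<partial>lborel)"
      by (rule lborel_pair.Fubini') measurable
    finally show ?thesis .
  qed
  have "(\<integral>\<^sup>+X. p (X - (2 * \<sigma> X) *\<^sub>R b) \<partial>lborel)
    = (\<integral>\<^sup>+X. (\<integral>\<^sup>+s. indicator {0..1} (\<sigma> X) * p (X - s *\<^sub>R b - (2 * \<sigma> (X - s *\<^sub>R b)) *\<^sub>R b) \<partial>lborel) \<partial>lborel)"
    by (rule average) measurable
  also have "\<dots> = (\<integral>\<^sup>+X. (\<integral>\<^sup>+s. indicator {0..1} (\<sigma> X) * p (X - s *\<^sub>R b) \<partial>lborel) \<partial>lborel)"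
  proof (rule nn_integral_cong)
    fix X
    have e: "X - s *\<^sub>R b - (2 * \<sigma> (X - s *\<^sub>R b)) *\<^sub>R b = X - (2 * \<sigma> X + (-1) * s) *\<^sub>R b" for s
    proof -
      have "\<sigma> (X - s *\<^sub>R b) = \<sigma> X - s" using \<sigma>[of X "- s"] by simp
      moreover have "s *\<^sub>R b + (2 * (\<sigma> X - s)) *\<^sub>R b = (2 * \<sigma> X + (-1) * s) *\<^sub>R b"
        unfolding scaleR_add_left[symmetric] by (rule arg_cong[where f="\<lambda>t. t *\<^sub>R b"]) simp
      ultimately show ?thesis by (simp only: diff_diff_add)
    qed
    show "(\<integral>\<^sup>+s. indicator {0..1} (\<sigma> X) * p (X - s *\<^sub>R b - (2 * \<sigma> (X - s *\<^sub>R b)) *\<^sub>R b) \<partial>lborel)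
      = (\<integral>\<^sup>+s. indicator {0..1} (\<sigma> X) * p (X - s *\<^sub>R b) \<partial>lborel)"
      unfolding e using nn_integral_real_affine[where f="\<lambda>s. indicator {0..1} (\<sigma> X) * p (X - s *\<^sub>R b)" and c="-1" and t="2 * \<sigma> X"]
      by simp
  qed
  also have "\<dots> = (\<integral>\<^sup>+X. p X \<partial>lborel)" by (rule average[symmetric]) measurable
  finally show ?thesis .
qed

context
  fixes k :: "'n::finite" and B :: "real^'n^'n" and \<Lambda> :: real
  assumes \<Lambda>: "\<Lambda> > 0" and B: "elliptic_sym \<Lambda> B"
begin

lemma diagonal_entry_pos: "1 / \<Lambda> \<le> B $ k $ k" "B $ k $ k > 0"
proof -
  have "(norm (axis k 1 :: real^'n, 0::real))\<^sup>2 / \<Lambda> \<le> flux B (axis k 1, 0) \<bullet> (axis k 1, 0)"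
    using B unfolding elliptic_sym_def by blast
  then show "1 / \<Lambda> \<le> B $ k $ k" by (simp add: flux_def inner_axis_1 matrix_axis_entry)
  then show "B $ k $ k > 0" using \<Lambda> by (meson divide_pos_pos less_le_trans zero_less_one)
qed

lemma conormal_reflection_component: "conormal_reflection k B x $ k = - (x $ k)"
  using diagonal_entry_pos(2) by (simp add: conormal_reflection_def matrix_axis_entry)

lemma conormal_reflection_involution: "conormal_reflection k B (conormal_reflection k B x) = x"
proof -
  have "conormal_reflection k B (conormal_reflection k B x)
    = conormal_reflection k B x - (2 * (- (x $ k)) / (B $ k $ k)) *\<^sub>R (B *v axis k 1)"
    by (subst conormal_reflection_def) (simp only: conormal_reflection_component)
  then show ?thesis by (simp add: conormal_reflection_def)
qed

lemma reflect_involution: "reflect k B (reflect k B X) = X"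
  by (simp add: reflect_def conormal_reflection_involution)

lemma reflect_flat: "fst X $ k = 0 \<Longrightarrow> reflect k B X = X"
  by (simp add: reflect_def conormal_reflection_def)

text \<open>
  The matrix \<open>B\<close> is invariant under the reflection. This is what makes the
  reflected field a solution of the same equation.
\<close>

lemma flux_reflect_adjoint: "flux B (reflect_adjoint k B X) = reflect k B (flux B X)"
proof -
  have "(B *v fst X) $ k = fst X \<bullet> (B *v axis k 1)"
    using B inner_axis_1[of "B *v fst X" k] unfolding elliptic_sym_def by metis
  then show ?thesis
    by (simp add: flux_def reflect_adjoint_def reflect_def conormal_reflection_def matrix_vector_mult_diff_distrib matrix_vector_mult_scaleR)
qed

lemma norm_conormal: "norm (B *v axis k 1) \<le> \<Lambda>"
proof -
  have "norm (flux B (axis k 1, 0)) \<le> \<Lambda> * norm (axis k 1 :: real^'n, 0::real)"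
    using B unfolding elliptic_sym_def by blast
  then show ?thesis by (simp add: flux_def)
qed

lemma norm_conormal_reflection: "norm (conormal_reflection k B x) \<le> (1 + 2 * \<Lambda>\<^sup>2) * norm x"
proof -
  have "1 / (B $ k $ k) \<le> \<Lambda>" using diagonal_entry_pos \<Lambda> by (simp add: field_simps)
  have "norm (conormal_reflection k B x) \<le> norm x + norm ((2 * x $ k / (B $ k $ k)) *\<^sub>R (B *v axis k 1))"
    unfolding conormal_reflection_def by (rule norm_triangle_ineq4)
  also have "norm ((2 * x $ k / (B $ k $ k)) *\<^sub>R (B *v axis k 1)) = 2 * \<bar>x $ k\<bar> * (1 / (B $ k $ k)) * norm (B *v axis k 1)"
    using diagonal_entry_pos(2) by (simp add: abs_mult)
  also have "\<dots> \<le> 2 * norm x * \<Lambda> * \<Lambda>"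
    using \<Lambda> diagonal_entry_pos(2) norm_conormal \<open>1 / (B $ k $ k) \<le> \<Lambda>\<close> component_le_norm_cart[of x k] by (intro mult_mono) auto
  finally show ?thesis by (simp add: algebra_simps power2_eq_square)
qed

lemma norm_reflect_adjoint: "norm (reflect_adjoint k B X) \<le> (1 + 2 * \<Lambda>\<^sup>2) * norm X"
proof -
  have n: "norm (reflect k B v) \<le> (1 + 2 * \<Lambda>\<^sup>2) * norm v" for v
  proof -
    have v: "norm v = sqrt ((norm (fst v))\<^sup>2 + (snd v)\<^sup>2)" by (cases v) (simp add: norm_Pair)
    have "(norm (conormal_reflection k B (fst v)))\<^sup>2 \<le> ((1 + 2 * \<Lambda>\<^sup>2) * norm (fst v))\<^sup>2"
      by (intro power_mono norm_conormal_reflection) simp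
    moreover have "(snd v)\<^sup>2 \<le> ((1 + 2 * \<Lambda>\<^sup>2))\<^sup>2 * (snd v)\<^sup>2"
      using mult_right_mono[OF one_le_power[of "1 + 2 * \<Lambda>\<^sup>2" 2], of "(snd v)\<^sup>2"] by simp
    ultimately have "sqrt ((norm (conormal_reflection k B (fst v)))\<^sup>2 + (snd v)\<^sup>2) \<le> sqrt ((1 + 2 * \<Lambda>\<^sup>2)\<^sup>2 * ((norm (fst v))\<^sup>2 + (snd v)\<^sup>2))"
      by (intro real_sqrt_le_mono) (simp add: power_mult_distrib distrib_left)
    also have "\<dots> = (1 + 2 * \<Lambda>\<^sup>2) * norm v" by (simp add: v real_sqrt_mult)
    finally show ?thesis by (simp add: reflect_def norm_Pair)
  qed
  let ?w = "reflect_adjoint k B X"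
  have "(norm ?w)\<^sup>2 = X \<bullet> reflect k B ?w" by (simp add: reflect_adjoint_inner[symmetric] dot_square_norm)
  also have "\<dots> \<le> norm X * ((1 + 2 * \<Lambda>\<^sup>2) * norm ?w)"
    by (rule order_trans[OF norm_cauchy_schwarz mult_left_mono[OF n norm_ge_zero]])
  finally have "norm ?w * norm ?w \<le> ((1 + 2 * \<Lambda>\<^sup>2) * norm X) * norm ?w" by (simp add: power2_eq_square ac_simps)
  note le = this
  show ?thesis
  proof (cases "norm ?w = 0")
    case False
    then have "norm ?w > 0" by simp
    with le show ?thesis by (rule mult_right_le_imp_le)
  qed simp
qed

lemma reflect_measurable: "reflect k B \<in> borel_measurable borel" "reflect_adjoint k B \<in> borel_measurable borel"
  by (rule linear_measurable[OF linear_reflect] linear_measurable[OF linear_reflect_adjoint])+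

lemma nn_integral_reflect:
  assumes "p \<in> borel_measurable borel"
  shows "(\<integral>\<^sup>+X. p (reflect k B X) \<partial>lborel) = (\<integral>\<^sup>+X. p X \<partial>lborel)"
proof -
  define \<sigma> where "\<sigma> X = fst X $ k / (B $ k $ k)" for X :: "(real^'n) \<times> real"
  have "reflect k B X = X - (2 * \<sigma> X) *\<^sub>R (B *v axis k 1, 0)" for X
    by (simp add: reflect_def conormal_reflection_def \<sigma>_def prod_eq_iff)
  moreover have "(\<integral>\<^sup>+X. p (X - (2 * \<sigma> X) *\<^sub>R (B *v axis k 1, 0)) \<partial>lborel) = (\<integral>\<^sup>+X. p X \<partial>lborel)"
  proof (rule nn_integral_oblique_reflection[OF _ _ assms])
    show "\<sigma> (X + t *\<^sub>R (B *v axis k 1, 0)) = \<sigma> X + t" for X t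
      using diagonal_entry_pos(2) by (simp add: \<sigma>_def matrix_axis_entry add_divide_distrib)
    show "\<sigma> \<in> borel_measurable borel"
      unfolding \<sigma>_def using diagonal_entry_pos(2) by (intro borel_measurable_continuous_onI continuous_intros) auto
  qed
  ultimately show ?thesis by simp
qed

lemma lborel_reflect: "distr lborel borel (reflect k B) = (lborel :: ((real^'n) \<times> real) measure)"
proof (rule measure_eqI)
  fix A assume "A \<in> sets (distr lborel borel (reflect k B))"
  then have A[measurable]: "A \<in> sets borel" by simp
  note [measurable] = reflect_measurable
  have "emeasure (distr lborel borel (reflect k B)) A = (\<integral>\<^sup>+X. indicator A X \<partial>distr lborel borel (reflect k B))" by simp
  also have "\<dots> = (\<integral>\<^sup>+X. indicator A (reflect k B X) \<partial>lborel)" by (rule nn_integral_distr) measurable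
  also have "\<dots> = (\<integral>\<^sup>+X. indicator A X \<partial>lborel)" by (rule nn_integral_reflect) measurable
  finally show "emeasure (distr lborel borel (reflect k B)) A = emeasure lborel A" by simp
qed simp

lemma lebesgue_integral_reflect:
  fixes p :: "(real^'n) \<times> real \<Rightarrow> real"
  assumes "p \<in> borel_measurable borel"
  shows "(LINT X|lborel. p (reflect k B X)) = (LINT X|lborel. p X)"
  by (subst (2) lborel_reflect[symmetric]) (simp add: integral_distr assms reflect_measurable)

end

section \<open>Odd extension across the flat boundary\<close>

lemma has_derivative_either:
  fixes p q :: "'a::real_normed_vector \<Rightarrow> 'b::real_normed_vector"
  assumes p: "(p has_derivative D) (at x)" and q: "(q has_derivative D) (at x)" and "p x = q x"
  shows "((\<lambda>y. if P y then p y else q y) has_derivative D) (at x)"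
  unfolding has_derivative_at_alt
proof (intro conjI allI impI)
  show "bounded_linear D" using p by (rule has_derivative_bounded_linear)
  fix e :: real assume "e > 0"
  note small = conjunct2[OF has_derivative_at_alt[THEN iffD1], rule_format, OF _ \<open>e > 0\<close>]
  from small[OF p] small[OF q] obtain d1 d2 where d:
    "d1 > 0" "\<And>y. norm (y - x) < d1 \<Longrightarrow> norm (p y - p x - D (y - x)) \<le> e * norm (y - x)"
    "d2 > 0" "\<And>y. norm (y - x) < d2 \<Longrightarrow> norm (q y - q x - D (y - x)) \<le> e * norm (y - x)"
    by auto
  show "\<exists>d>0. \<forall>y. norm (y - x) < d \<longrightarrow>
      norm ((if P y then p y else q y) - (if P x then p x else q x) - D (y - x)) \<le> e * norm (y - x)"
    using d assms(3) by (intro exI[of _ "min d1 d2"]) auto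
qed

lemma isCont_either:
  fixes p q :: "'a::real_normed_vector \<Rightarrow> 'b::real_normed_vector"
  assumes "isCont p x" "isCont q x" "p x = q x"
  shows "isCont (\<lambda>y. if P y then p y else q y) x"
proof -
  have pq: "(p \<longlongrightarrow> p x) (at x)" "(q \<longlongrightarrow> p x) (at x)" using assms by (simp_all add: isCont_def)
  have "((\<lambda>y. if P y then p y else q y) \<longlongrightarrow> p x) (at x)"
  proof (intro tendstoI)
    fix e :: real assume "e > 0"
    show "\<forall>\<^sub>F y in at x. dist (if P y then p y else q y) (p x) < e"
      using tendstoD[OF pq(1) \<open>e > 0\<close>] tendstoD[OF pq(2) \<open>e > 0\<close>] by eventually_elim auto
  qed
  then show ?thesis using assms(3) by (auto simp: isCont_def)
qed

lemma square_integrable_imp_integrable: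
  fixes G :: "'a::euclidean_space \<Rightarrow> 'b::euclidean_space"
  assumes [measurable]: "G \<in> borel_measurable borel" and L2: "(\<integral>\<^sup>+X\<in>E. ennreal ((norm (G X))\<^sup>2) \<partial>lborel) < \<infinity>"
    and [measurable]: "E \<in> sets borel" and E: "bounded E"
  shows "integrable lborel (\<lambda>X. indicator E X * norm (G X))"
proof -
  from L2 have "integrable lborel (\<lambda>X. indicator E X * (norm (G X))\<^sup>2)"
    by (simp add: integrable_iff_bounded ennreal_mult ennreal_indicator abs_mult mult.commute)
  then have i: "integrable lborel (\<lambda>X. indicator E X + indicator E X * (norm (G X))\<^sup>2)"
    using emeasure_bounded_finite[OF E] by (intro Bochner_Integration.integrable_add integrable_real_indicator) (auto simp: less_top)
  show ?thesis
  proof (rule Bochner_Integration.integrable_bound[OF i])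
    show "AE X in lborel. norm (indicator E X * norm (G X)) \<le> norm (indicator E X + indicator E X * (norm (G X))\<^sup>2)"
    proof (rule AE_I2)
      fix X
      have "2 * norm (G X) \<le> 1 + (norm (G X))\<^sup>2"
        using sum_power2_ge_zero[of "norm (G X) - 1" 0] by (simp add: power2_diff)
      moreover have "0 \<le> norm (G X)" by simp
      ultimately have "norm (G X) \<le> 1 + (norm (G X))\<^sup>2" by linarith
      then show "norm (indicator E X * norm (G X)) \<le> norm (indicator E X + indicator E X * (norm (G X))\<^sup>2)"
        by (simp add: indicator_def)
    qed
  qed measurable
qed

lemmas solution_on_integrable = square_integrable_imp_integrable[OF solution_onD(1,2)]

lemma open_upper: "open {X::(real^'n) \<times> real. 0 < fst X $ k}"
  and open_lower: "open {X::(real^'n) \<times> real. fst X $ k < 0}"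
  by (intro open_Collect_less continuous_intros)+

lemma AE_not_flat: "AE X::(real^'n) \<times> real in lborel. fst X $ k \<noteq> 0"
proof -
  have "(axis k 1, 0) \<in> (Basis :: ((real^'n) \<times> real) set)" by (simp add: Basis_prod_def axis_in_Basis_iff)
  from negligible_standard_hyperplane[OF this, of 0]
  have "negligible {X::(real^'n) \<times> real. X \<bullet> (axis k 1, 0) = 0}" .
  moreover have "{X::(real^'n) \<times> real. X \<bullet> (axis k 1, 0) = 0} = {X. fst X $ k = 0}"
    by (rule Collect_cong) (simp add: inner_prod_def inner_axis)
  ultimately have "negligible {X::(real^'n) \<times> real. fst X $ k = 0}" by simp
  then have "{X::(real^'n) \<times> real. fst X $ k = 0} \<in> null_sets lebesgue"
    unfolding negligible_iff_null_sets .
  then have "AE X::(real^'n) \<times> real in lebesgue. \<not> (fst X $ k = 0)" by (intro AE_I'[of "{X. fst X $ k = 0}"]) auto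
  then show ?thesis by (simp add: AE_completion_iff)
qed

lemma mem_half_cyl: "X \<in> half_cyl k 0 \<rho> \<longleftrightarrow> X \<in> cyl 0 \<rho> \<and> 0 < fst X $ k"
  by (cases X) (auto simp: half_cyl_def half_ball_def cyl_def)

lemma open_half_cyl: "open (half_cyl k X0 r)" for X0 :: "(real^'n::finite) \<times> real"
proof -
  have "half_cyl k X0 r = cyl X0 r \<inter> {X. fst X0 $ k < fst X $ k}"
    by (auto simp: half_cyl_def half_ball_def cyl_def)
  moreover have "open {X::(real^'n) \<times> real. fst X0 $ k < fst X $ k}" by (intro open_Collect_less continuous_intros)
  ultimately show ?thesis by (simp add: open_Int[OF open_cyl])
qed

lemma borel_half_cyl: "half_cyl k X0 r \<in> sets borel"
  by (rule borel_open[OF open_half_cyl])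

context
  fixes k :: "'n::finite" and B :: "real^'n^'n" and \<Lambda> :: real
  assumes \<Lambda>: "\<Lambda> > 0" and B: "elliptic_sym \<Lambda> B"
begin

lemma C1_reflect:
  assumes "C1 f g"
  shows "C1 (\<lambda>X. f (reflect k B X)) (\<lambda>X. reflect_adjoint k B (g (reflect k B X)))"
  using C1_compose_affine[OF assms linear_reflect reflect_adjoint_inner linear_reflect_adjoint, of 0] by simp

text \<open>
  Where \<open>f\<close> vanishes on the hyperplane its gradient annihilates all tangential
  directions, and the sum of a vector and its reflection is tangential. Hence the gradients of
  \<open>f\<close> and of its odd extension agree there.
\<close>

lemma gradient_odd_at_flat:
  assumes f: "C1 f g" and flat: "open U" "X \<in> U" "\<And>Y. Y \<in> U \<Longrightarrow> fst Y $ k = 0 \<Longrightarrow> f Y = 0" and X: "fst X $ k = 0"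
  shows "- reflect_adjoint k B (g X) = g X"
proof -
  have tang: "g X \<bullet> v = 0" if v: "fst v $ k = 0" for v
  proof -
    have "((\<lambda>t. f (X + t *\<^sub>R v)) has_field_derivative g X \<bullet> v) (at 0)"
      using C1_line[OF f, of X v 0] by simp
    moreover have "((\<lambda>t. f (X + t *\<^sub>R v)) has_field_derivative 0) (at 0)"
    proof -
      have "continuous_on UNIV (\<lambda>t::real. X + t *\<^sub>R v)" by (intro continuous_intros)
      then have "open ((\<lambda>t::real. X + t *\<^sub>R v) -` U)" using flat(1) open_vimage by blast
      then show ?thesis
      proof (rule has_field_derivative_transform_within_open[OF DERIV_const, of _ 0])
        show "0 \<in> (\<lambda>t. X + t *\<^sub>R v) -` U" using flat(2) by simp
        fix t assume "t \<in> (\<lambda>t. X + t *\<^sub>R v) -` U"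
        then show "0 = f (X + t *\<^sub>R v)" using flat(3) X v by simp
      qed
    qed
    ultimately show ?thesis by (rule DERIV_unique)
  qed
  have "reflect_adjoint k B (g X) \<bullet> v = - (g X \<bullet> v)" for v
  proof -
    have "fst (v + reflect k B v) $ k = 0"
      using conormal_reflection_component[OF \<Lambda> B, of k "fst v"] by (simp add: reflect_def)
    from tang[OF this] have "g X \<bullet> v + g X \<bullet> reflect k B v = 0" by (simp add: inner_add_right)
    then show ?thesis by (simp add: reflect_adjoint_inner)
  qed
  then have "(reflect_adjoint k B (g X) + g X) \<bullet> v = 0" for v by (simp add: inner_add_left)
  then have "reflect_adjoint k B (g X) + g X = 0" by (metis inner_eq_zero_iff)
  then show ?thesis by (rule minus_unique)
qed

definition odd_extension :: "((real^'n) \<times> real \<Rightarrow> real) \<Rightarrow> (real^'n) \<times> real \<Rightarrow> real"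
  where "odd_extension f X = (if 0 < fst X $ k then f X else - f (reflect k B X))"

text \<open>
  The gradient of the odd extension, by the chain rule.
\<close>

definition odd_gradient :: "((real^'n) \<times> real \<Rightarrow> (real^'n) \<times> real) \<Rightarrow> (real^'n) \<times> real \<Rightarrow> (real^'n) \<times> real"
  where "odd_gradient g X = (if 0 < fst X $ k then g X else - reflect_adjoint k B (g (reflect k B X)))"

text \<open>
  The odd extension is differentiable only near those parts of the hyperplane on which
  \<open>f\<close> vanishes, so it is multiplied by a cut-off.
\<close>

lemma C1_odd_extension:
  fixes f :: "(real^'n) \<times> real \<Rightarrow> real"
  assumes f: "C1 f g" and flat: "\<And>Y. Y \<in> cyl 0 2 \<Longrightarrow> fst Y $ k = 0 \<Longrightarrow> f Y = 0"
    and \<zeta>: "C1 \<zeta> z" "compact K" "K \<subseteq> cyl 0 2" "\<And>X. X \<notin> K \<Longrightarrow> \<zeta> X = 0"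
  shows "C1 (\<lambda>X. \<zeta> X * odd_extension f X) (\<lambda>X. \<zeta> X *\<^sub>R odd_gradient g X + odd_extension f X *\<^sub>R z X)"
proof -
  define fm gm where "fm X = - f (reflect k B X)" and "gm X = - reflect_adjoint k B (g (reflect k B X))" for X
  have fm: "C1 fm gm"
    unfolding fm_def gm_def using C1_diff[OF C1_const[of 0] C1_reflect[OF f]] by simp
  have z0: "z X = 0" if "X \<notin> K" for X
    by (rule C1_gradient_zero_outside[OF \<zeta>(1) compact_imp_closed[OF \<zeta>(2)] \<zeta>(4) that])
  have iso: "isCont q X" if "C1 p q" for p q X
    using C1_continuous_gradient[OF that, of UNIV] by (simp add: continuous_on_eq_continuous_at)
  have loc: "(odd_extension f has_derivative (\<lambda>v. odd_gradient g X \<bullet> v)) (at X) \<and> isCont (odd_gradient g) X" if X: "X \<in> cyl 0 2" for X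
  proof -
    consider "0 < fst X $ k" | "fst X $ k < 0" | "fst X $ k = 0" by linarith
    then show ?thesis
    proof cases
      case 1
      have "(odd_extension f has_derivative (\<lambda>v. g X \<bullet> v)) (at X)"
        by (rule has_derivative_transform_within_open[OF C1_D[OF f] open_upper[of k]]) (use 1 in \<open>auto simp: odd_extension_def\<close>)
      moreover have "isCont (odd_gradient g) X"
      proof -
        have "eventually (\<lambda>Y. odd_gradient g Y = g Y) (nhds X)"
          using eventually_nhds_in_open[OF open_upper[of k], of X] 1 by (auto elim!: eventually_mono simp: odd_gradient_def)
        then show ?thesis using iso[OF f] by (simp add: isCont_cong)
      qed
      ultimately show ?thesis using 1 by (simp add: odd_gradient_def)
    next
      case 2
      have "(odd_extension f has_derivative (\<lambda>v. gm X \<bullet> v)) (at X)"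
        by (rule has_derivative_transform_within_open[OF C1_D[OF fm] open_lower[of k]]) (use 2 in \<open>auto simp: odd_extension_def fm_def\<close>)
      moreover have "isCont (odd_gradient g) X"
      proof -
        have "eventually (\<lambda>Y. odd_gradient g Y = gm Y) (nhds X)"
          using eventually_nhds_in_open[OF open_lower[of k], of X] 2 by (auto elim!: eventually_mono simp: odd_gradient_def gm_def)
        then show ?thesis using iso[OF fm] by (simp add: isCont_cong)
      qed
      ultimately show ?thesis using 2 by (simp add: odd_gradient_def gm_def)
    next
      case 3
      have refl: "reflect k B X = X" by (rule reflect_flat[OF \<Lambda> B 3])
      have fX: "f X = 0" by (rule flat[OF X 3])
      have gX: "gm X = g X"
        unfolding gm_def refl by (rule gradient_odd_at_flat[OF f open_cyl X flat 3])
      have "((\<lambda>Y. if 0 < fst Y $ k then f Y else fm Y) has_derivative (\<lambda>v. g X \<bullet> v)) (at X)"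
        by (rule has_derivative_either[OF C1_D[OF f] C1_D[OF fm, of X UNIV, unfolded gX]]) (simp add: fm_def refl fX)
      moreover have "isCont (\<lambda>Y. if 0 < fst Y $ k then g Y else gm Y) X"
        by (rule isCont_either[OF iso[OF f] iso[OF fm] gX[symmetric]])
      moreover have "odd_gradient g X = g X" using 3 gX by (simp add: odd_gradient_def gm_def)
      moreover have "odd_extension f = (\<lambda>Y. if 0 < fst Y $ k then f Y else fm Y)"
        by (rule ext) (simp add: odd_extension_def fm_def)
      moreover have "odd_gradient g = (\<lambda>Y. if 0 < fst Y $ k then g Y else gm Y)"
        by (rule ext) (simp add: odd_gradient_def gm_def)
      ultimately show ?thesis by metis
    qed
  qed
  have out: "open (- K)" using \<zeta>(2) by (simp add: compact_imp_closed open_Compl)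
  show ?thesis
    unfolding C1_def
  proof (intro conjI allI)
    fix X
    show "((\<lambda>X. \<zeta> X * odd_extension f X) has_derivative (\<lambda>v. (\<zeta> X *\<^sub>R odd_gradient g X + odd_extension f X *\<^sub>R z X) \<bullet> v)) (at X)"
    proof (cases "X \<in> K")
      case True
      then have "X \<in> cyl 0 2" using \<zeta>(3) by blast
      from has_derivative_mult[OF C1_D[OF \<zeta>(1)] conjunct1[OF loc[OF this]]]
      show ?thesis by (rule has_derivative_eq_rhs) (auto simp: inner_add_left algebra_simps)
    next
      case False
      have "((\<lambda>X. 0::real) has_derivative (\<lambda>v. 0)) (at X)" by simp
      then have "((\<lambda>X. \<zeta> X * odd_extension f X) has_derivative (\<lambda>v. 0)) (at X)"
        by (rule has_derivative_transform_within_open[OF _ out]) (use False \<zeta>(4) in auto)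
      then show ?thesis using False \<zeta>(4) z0 by simp
    qed
  next
    have "isCont (\<lambda>X. \<zeta> X *\<^sub>R odd_gradient g X + odd_extension f X *\<^sub>R z X) X" for X
    proof (cases "X \<in> K")
      case True
      then have X: "X \<in> cyl 0 2" using \<zeta>(3) by blast
      have "isCont (odd_extension f) X" using has_derivative_continuous[OF conjunct1[OF loc[OF X]]] .
      moreover have "isCont \<zeta> X" using C1_continuous[OF \<zeta>(1), of UNIV] continuous_on_eq_continuous_at[OF open_UNIV, of \<zeta>] by blast
      ultimately show ?thesis using conjunct2[OF loc[OF X]] iso[OF \<zeta>(1)] by (intro continuous_intros) auto
    next
      case False
      have "eventually (\<lambda>Y. \<zeta> Y *\<^sub>R odd_gradient g Y + odd_extension f Y *\<^sub>R z Y = 0) (nhds X)"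
        using eventually_nhds_in_open[OF out, of X] False \<zeta>(4) z0 by (auto elim!: eventually_mono)
      then show ?thesis by (simp add: isCont_cong)
    qed
    then show "continuous_on UNIV (\<lambda>X. \<zeta> X *\<^sub>R odd_gradient g X + odd_extension f X *\<^sub>R z X)"
      by (simp add: continuous_on_eq_continuous_at)
  qed
qed

text \<open>
  Test functions that vanish on the hyperplane, but not near it, are admissible. They are
  multiplied by cut-off functions \<open>transition (j x\<^sub>k - 1)\<close>; the derivative of
  these is of size \<open>j\<close> on the layer \<open>x\<^sub>k \<le> 2 / j\<close>, where
  \<open>\<psi>\<close> is of size \<open>1 / j\<close>. Dominated convergence removes the
  cut-off.
\<close>

lemma weak_equation_flat_test:
  fixes G :: "(real^'n) \<times> real \<Rightarrow> (real^'n) \<times> real"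
  assumes s: "solution_on B \<mu> (half_cyl k 0 \<rho>) F G" and \<mu>: "\<mu> \<in> borel_measurable borel" "\<And>y. 1 \<le> \<mu> y \<and> \<mu> y \<le> c"
    and \<psi>: "C1 \<psi> h" "compact K" "K \<subseteq> cyl 0 \<rho>" "\<And>X. X \<notin> K \<Longrightarrow> \<psi> X = 0" "\<And>X. fst X $ k = 0 \<Longrightarrow> \<psi> X = 0"
  shows "(LINT X:half_cyl k 0 \<rho>|lborel. \<mu> (snd X) * (flux B (G X) \<bullet> h X)) = 0"
proof -
  define E where "E = (half_cyl k 0 \<rho> :: ((real^'n) \<times> real) set)"
  have Emem: "X \<in> E \<longleftrightarrow> X \<in> cyl 0 \<rho> \<and> 0 < fst X $ k" for X
    by (cases X) (auto simp: E_def half_cyl_def half_ball_def cyl_def)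
  have "E = cyl 0 \<rho> \<inter> {X. 0 < fst X $ k}" using Emem by blast
  then have Eo: "open E" by (simp add: open_Int[OF open_cyl open_upper[of k]])
  note Gm = solution_onD(1)[OF s]
  have em[measurable]: "E \<in> sets borel" using Eo by simp
  note [measurable] = Gm \<mu>(1) linear_measurable[OF linear_flux, of B] C1_measurable[OF \<psi>(1)]
  have sm[measurable]: "snd \<in> borel_measurable (borel :: ((real^'n) \<times> real) measure)"
    by (intro borel_measurable_continuous_onI continuous_on_snd continuous_on_id)
  have "E \<subseteq> cyl 0 \<rho>" using Emem by blast
  then have Gi: "integrable lborel (\<lambda>X. indicator E X * norm (G X))"
    using solution_on_integrable[OF s[folded E_def] s[folded E_def] em bounded_subset[OF bounded_cyl]] by blast
  have h0: "h X = 0" if "X \<notin> K" for X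
    by (rule C1_gradient_zero_outside[OF \<psi>(1) compact_imp_closed[OF \<psi>(2)] \<psi>(4) that])
  obtain L where L: "L > 0" "\<And>X. norm (h X) \<le> L"
    using continuous_cpt_bounded[OF C1_continuous_gradient[OF \<psi>(1)] \<psi>(2) h0] by metis
  have \<psi>L: "\<bar>\<psi> X\<bar> \<le> L * \<bar>fst X $ k\<bar>" for X
  proof -
    define X0 where "X0 = X - (fst X $ k) *\<^sub>R (axis k 1, 0)"
    have "norm (\<psi> X - \<psi> X0) \<le> L * norm (X - X0)"
    proof (rule differentiable_bound[where S=UNIV and f'="\<lambda>X v. h X \<bullet> v"])
      show "onorm (\<lambda>v. h x \<bullet> v) \<le> L" for x
        using order_trans[OF Cauchy_Schwarz_ineq2 mult_right_mono[OF L(2) norm_ge_zero]]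
        by (intro onorm_le) (simp add: real_norm_def)
    qed (auto intro!: C1_D[OF \<psi>(1)])
    moreover have "\<psi> X0 = 0" by (rule \<psi>(5)) (simp add: X0_def)
    moreover have "norm (X - X0) = \<bar>fst X $ k\<bar>" by (simp add: X0_def)
    ultimately show ?thesis by simp
  qed
  obtain s' where s': "\<And>t. (transition has_field_derivative s' t) (at t)" "continuous_on UNIV s'"
    using transition_C1 by blast
  have s'0: "s' t = 0" if "t < 0 \<or> 1 < t" for t
  proof -
    have "(transition has_field_derivative 0) (at t)"
      using that
    proof
      assume "t < 0"
      show ?thesis
      proof (rule has_field_derivative_transform_within_open[where f="\<lambda>_. 0" and S="{..<0}"])
        show "0 = transition x" if "x \<in> {..<0}" for x using that by (simp add: transition_eq)
      qed (use \<open>t < 0\<close> in simp_all)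
    next
      assume "1 < t"
      show ?thesis
      proof (rule has_field_derivative_transform_within_open[where f="\<lambda>_. 1" and S="{1<..}"])
        show "1 = transition x" if "x \<in> {1<..}" for x using that by (simp add: transition_eq)
      qed (use \<open>1 < t\<close> in simp_all)
    qed
    then show ?thesis using s'(1) DERIV_unique by blast
  qed
  have s'0': "s' t = 0" if "t \<notin> cball (0::real) 1" for t using s'0[of t] that by (auto simp: abs_le_iff)
  obtain M where M: "M > 0" "\<And>t. norm (s' t) \<le> M"
    using continuous_cpt_bounded[OF s'(2) compact_cball s'0'] by metis
  define e where "e = ((axis k 1, 0) :: (real^'n) \<times> real)"
  have xk: "X \<bullet> e = fst X $ k" for X by (simp add: e_def inner_prod_def inner_axis_1)
  define a where "a j X = real j * (X \<bullet> e) - 1" for j :: nat and X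
  have aC: "C1 (a j) (\<lambda>X. real j *\<^sub>R e)" for j
    unfolding a_def using C1_diff[OF C1_mult[OF C1_const[of "real j"] C1_inner_left[of e]] C1_const[of 1]] by simp
  define \<psi>j hj where "\<psi>j j X = \<psi> X * transition (a j X)"
    and "hj j X = \<psi> X *\<^sub>R (s' (a j X) *\<^sub>R (real j *\<^sub>R e)) + transition (a j X) *\<^sub>R h X" for j X
  have \<psi>jC: "C1 (\<psi>j j) (hj j)" for j
    unfolding \<psi>j_def hj_def by (rule C1_mult[OF \<psi>(1) C1_compose_real[OF aC s']])
  have zero: "(LINT X|lborel. indicator E X *\<^sub>R (\<mu> (snd X) * (flux B (G X) \<bullet> hj j X))) = 0" if j: "j > 0" for j
  proof -
    have "(LINT X:half_cyl k 0 \<rho>|lborel. \<mu> (snd X) * (flux B (G X) \<bullet> hj j X)) = 0"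
    proof (rule solution_onD(4)[OF s \<psi>jC])
      have "closed {X::(real^'n) \<times> real. 1 / real j \<le> X \<bullet> e}"
        by (intro closed_Collect_le continuous_intros)
      then show "compact (K \<inter> {X. 1 / real j \<le> X \<bullet> e})" by (rule compact_Int_closed[OF \<psi>(2)])
      show "K \<inter> {X. 1 / real j \<le> X \<bullet> e} \<subseteq> half_cyl k 0 \<rho>"
      proof
        fix X assume X: "X \<in> K \<inter> {X. 1 / real j \<le> X \<bullet> e}"
        have "0 < 1 / real j" using j by simp
        moreover have "1 / real j \<le> X \<bullet> e" using X by blast
        ultimately have "0 < fst X $ k" unfolding xk by linarith
        then show "X \<in> half_cyl k 0 \<rho>" using X \<psi>(3) Emem unfolding E_def by blast
      qed
      fix X assume X: "X \<notin> K \<inter> {X. 1 / real j \<le> X \<bullet> e}"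
      show "\<psi>j j X = 0"
      proof (cases "X \<in> K")
        case True
        then have "X \<bullet> e < 1 / real j" using X by auto
        then have "a j X \<le> 0" using j by (simp add: a_def field_simps)
        then show ?thesis by (simp add: \<psi>j_def transition_eq)
      qed (simp add: \<psi>j_def \<psi>(4))
    qed
    then show ?thesis by (simp add: set_lebesgue_integral_def E_def)
  qed
  have "(\<lambda>j. LINT X|lborel. indicator E X *\<^sub>R (\<mu> (snd X) * (flux B (G X) \<bullet> hj (Suc j) X))) \<longlonglongrightarrow> (LINT X|lborel. indicator E X *\<^sub>R (\<mu> (snd X) * (flux B (G X) \<bullet> h X)))"
  proof (rule integral_dominated_convergence[where w="\<lambda>X. (c * (\<Lambda> * (2 * L * M + L))) * (indicator E X * norm (G X))"])
    show "integrable lborel (\<lambda>X. (c * (\<Lambda> * (2 * L * M + L))) * (indicator E X * norm (G X)))" using Gi by simp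
    show "(\<lambda>X. indicator E X *\<^sub>R (\<mu> (snd X) * (flux B (G X) \<bullet> h X))) \<in> borel_measurable lborel" by measurable
    show "(\<lambda>X. indicator E X *\<^sub>R (\<mu> (snd X) * (flux B (G X) \<bullet> hj (Suc j) X))) \<in> borel_measurable lborel" for j
    proof -
      note [measurable] = C1_measurable(2)[OF \<psi>jC, of "Suc j"]
      show ?thesis by measurable
    qed
    show "AE X in lborel. (\<lambda>j. indicator E X *\<^sub>R (\<mu> (snd X) * (flux B (G X) \<bullet> hj (Suc j) X))) \<longlonglongrightarrow> indicator E X *\<^sub>R (\<mu> (snd X) * (flux B (G X) \<bullet> h X))"
    proof (rule AE_I2)
      fix X
      show "(\<lambda>j. indicator E X *\<^sub>R (\<mu> (snd X) * (flux B (G X) \<bullet> hj (Suc j) X))) \<longlonglongrightarrow> indicator E X *\<^sub>R (\<mu> (snd X) * (flux B (G X) \<bullet> h X))"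
      proof (cases "X \<in> E")
        case True
        then have p: "X \<bullet> e > 0" using Emem xk by simp
        obtain N :: nat where N: "3 / (X \<bullet> e) \<le> real N" using real_arch_simple by blast
        have "hj (Suc j) X = h X" if "N \<le> j" for j
        proof -
          have "3 / (X \<bullet> e) \<le> real (Suc j)" using N that by linarith
          then have "3 \<le> real (Suc j) * (X \<bullet> e)" using p by (simp add: divide_simps)
          then have "1 < a (Suc j) X" by (simp add: a_def)
          then show ?thesis by (simp add: hj_def s'0 transition_eq)
        qed
        then have "eventually (\<lambda>j. indicator E X *\<^sub>R (\<mu> (snd X) * (flux B (G X) \<bullet> hj (Suc j) X)) = indicator E X *\<^sub>R (\<mu> (snd X) * (flux B (G X) \<bullet> h X))) sequentially"
          by (intro eventually_sequentiallyI[of N]) simp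
        then show ?thesis by (rule tendsto_eventually)
      qed simp
    qed
    show "AE X in lborel. norm (indicator E X *\<^sub>R (\<mu> (snd X) * (flux B (G X) \<bullet> hj (Suc j) X))) \<le> (c * (\<Lambda> * (2 * L * M + L))) * (indicator E X * norm (G X))" for j
    proof (rule AE_I2)
      fix X
      show "norm (indicator E X *\<^sub>R (\<mu> (snd X) * (flux B (G X) \<bullet> hj (Suc j) X))) \<le> (c * (\<Lambda> * (2 * L * M + L))) * (indicator E X * norm (G X))"
      proof (cases "X \<in> E")
        case True
        then have p: "X \<bullet> e > 0" using Emem xk by simp
        have 1: "\<bar>\<psi> X\<bar> * (\<bar>s' (a (Suc j) X)\<bar> * real (Suc j)) \<le> 2 * L * M"
        proof (cases "a (Suc j) X > 1")
          case True
          then show ?thesis using s'0 L M by simp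
        next
          case False
          then have j2: "real (Suc j) * (X \<bullet> e) \<le> 2" by (simp add: a_def)
          have "\<bar>\<psi> X\<bar> * (\<bar>s' (a (Suc j) X)\<bar> * real (Suc j)) \<le> (L * (X \<bullet> e)) * (M * real (Suc j))"
            using \<psi>L[of X] p xk[of X] M(2)[of "a (Suc j) X"] M(1) L(1) by (intro mult_mono) auto
          also have "\<dots> = (L * M) * (real (Suc j) * (X \<bullet> e))" by (simp only: ac_simps)
          also have "\<dots> \<le> (L * M) * 2" using L M by (intro mult_left_mono j2) auto
          finally show ?thesis by simp
        qed
        have ne: "norm e = 1" by (simp add: e_def)
        have "norm (hj (Suc j) X) \<le> \<bar>\<psi> X\<bar> * (\<bar>s' (a (Suc j) X)\<bar> * real (Suc j)) + transition (a (Suc j) X) * norm (h X)"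
          unfolding hj_def by (rule order_trans[OF norm_triangle_ineq]) (simp add: ne transition_range abs_mult)
        moreover have "transition (a (Suc j) X) * norm (h X) \<le> 1 * L"
          using transition_range L by (intro mult_mono) auto
        ultimately have hb: "norm (hj (Suc j) X) \<le> 2 * L * M + L" using 1 by linarith
        have fl: "norm (flux B (G X)) \<le> \<Lambda> * norm (G X)" using B unfolding elliptic_sym_def by blast
        have "\<bar>flux B (G X) \<bullet> hj (Suc j) X\<bar> \<le> (\<Lambda> * norm (G X)) * (2 * L * M + L)"
          using \<Lambda> by (intro order_trans[OF Cauchy_Schwarz_ineq2 mult_mono[OF fl hb]]) auto
        then have "\<mu> (snd X) * \<bar>flux B (G X) \<bullet> hj (Suc j) X\<bar> \<le> c * ((\<Lambda> * norm (G X)) * (2 * L * M + L))"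
          using \<mu>(2)[of "snd X"] by (intro mult_mono) auto
        then show ?thesis using True \<mu>(2)[of "snd X"] by (simp add: abs_mult ac_simps)
      qed simp
    qed
  qed
  then have "(LINT X|lborel. indicator E X *\<^sub>R (\<mu> (snd X) * (flux B (G X) \<bullet> h X))) = 0"
    using zero by (simp add: LIMSEQ_const_iff)
  then show ?thesis by (simp add: set_lebesgue_integral_def E_def)
qed

lemma reflect_mem_half_cyl:
  assumes "X \<in> cyl 0 1" "fst X $ k < 0" "1 + 2 * \<Lambda>\<^sup>2 \<le> \<rho>"
  shows "reflect k B X \<in> half_cyl k 0 \<rho>"
proof -
  have X: "norm (fst X) < 1" "\<bar>snd X\<bar> < 1" using assms(1) by (auto simp: mem_cyl_0)
  have "norm (conormal_reflection k B (fst X)) \<le> (1 + 2 * \<Lambda>\<^sup>2) * norm (fst X)" by (rule norm_conormal_reflection[OF \<Lambda> B])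
  also have "\<dots> < (1 + 2 * \<Lambda>\<^sup>2) * 1" using X by (intro mult_strict_left_mono) (auto simp: add_pos_nonneg)
  finally have "norm (conormal_reflection k B (fst X)) < \<rho>" using assms(3) by simp
  moreover have "1 \<le> \<rho>" using assms(3) zero_le_power2[of \<Lambda>] by linarith
  ultimately show ?thesis
    using X assms(2) conormal_reflection_component[OF \<Lambda> B, of k "fst X"]
    by (simp add: mem_half_cyl mem_cyl_0 reflect_def)
qed

lemma odd_gradient_L2:
  fixes W :: "(real^'n) \<times> real \<Rightarrow> (real^'n) \<times> real"
  assumes [measurable]: "W \<in> borel_measurable borel" and \<rho>: "1 + 2 * \<Lambda>\<^sup>2 \<le> \<rho>"
  shows "(\<integral>\<^sup>+X\<in>cyl 0 1. ennreal ((norm (odd_gradient W X))\<^sup>2) \<partial>lborel)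
    \<le> ennreal (1 + (1 + 2 * \<Lambda>\<^sup>2)\<^sup>2) * (\<integral>\<^sup>+X\<in>half_cyl k 0 \<rho>. ennreal ((norm (W X))\<^sup>2) \<partial>lborel)"
proof -
  define m where "m = (1 + 2 * \<Lambda>\<^sup>2)\<^sup>2"
  define p where "p X = ennreal ((norm (W X))\<^sup>2) * indicator (half_cyl k 0 \<rho>) X" for X
  note [measurable] = borel_half_cyl reflect_measurable(1)[OF \<Lambda> B]
  have pm[measurable]: "p \<in> borel_measurable borel" unfolding p_def by measurable
  have \<rho>1: "1 \<le> \<rho>" using \<rho> zero_le_power2[of \<Lambda>] by linarith
  have "(\<integral>\<^sup>+X\<in>cyl 0 1. ennreal ((norm (odd_gradient W X))\<^sup>2) \<partial>lborel)
    \<le> (\<integral>\<^sup>+X. p X + ennreal m * p (reflect k B X) \<partial>lborel)"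
  proof (rule nn_integral_mono_AE)
    show "AE X in lborel. ennreal ((norm (odd_gradient W X))\<^sup>2) * indicator (cyl 0 1) X \<le> p X + ennreal m * p (reflect k B X)"
      using AE_not_flat[of k]
    proof eventually_elim
      case (elim X)
      show ?case
      proof (cases "X \<in> cyl 0 1")
        case True
        show ?thesis
        proof (cases "0 < fst X $ k")
          case pos: True
          then have "X \<in> half_cyl k 0 \<rho>" using True \<rho>1 by (auto simp: mem_half_cyl mem_cyl_0)
          then show ?thesis using True pos by (simp add: odd_gradient_def p_def)
        next
          case False
          then have "fst X $ k < 0" using elim by simp
          from reflect_mem_half_cyl[OF True this \<rho>] have "p (reflect k B X) = ennreal ((norm (W (reflect k B X)))\<^sup>2)" by (simp add: p_def)
          moreover have "(norm (odd_gradient W X))\<^sup>2 \<le> m * (norm (W (reflect k B X)))\<^sup>2"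
            unfolding m_def power_mult_distrib[symmetric]
            using False norm_reflect_adjoint[OF \<Lambda> B] by (intro power_mono) (auto simp: odd_gradient_def)
          ultimately have "ennreal ((norm (odd_gradient W X))\<^sup>2) \<le> ennreal m * p (reflect k B X)"
            by (simp add: ennreal_mult[symmetric] m_def ennreal_leI)
          then show ?thesis using True by (simp add: add_increasing)
        qed
      qed simp
    qed
  qed
  also have "\<dots> = (\<integral>\<^sup>+X. p X \<partial>lborel) + ennreal m * (\<integral>\<^sup>+X. p (reflect k B X) \<partial>lborel)"
    by (simp add: nn_integral_add nn_integral_cmult)
  also have "(\<integral>\<^sup>+X. p (reflect k B X) \<partial>lborel) = (\<integral>\<^sup>+X. p X \<partial>lborel)"
    by (rule nn_integral_reflect[OF \<Lambda> B pm])
  also have "(\<integral>\<^sup>+X. p X \<partial>lborel) + ennreal m * (\<integral>\<^sup>+X. p X \<partial>lborel) = ennreal (1 + m) * (\<integral>\<^sup>+X. p X \<partial>lborel)"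
    by (simp add: m_def distrib_right)
  finally show ?thesis by (simp add: p_def m_def)
qed

text \<open>
  A test function \<open>\<phi>\<close> on the full cylinder is replaced by its odd part
  \<open>\<phi> - \<phi> \<circ> reflect\<close> on the half cylinder, which vanishes on the
  hyperplane. Changing variables in the lower half gives the weak equation for the odd
  extension. The half cylinder must contain the reflected lower half of the unit cylinder, and a
  further neighbourhood for the cut-off; hence the bound from below on \<open>\<rho>\<close>.
\<close>

lemma solution_on_odd_reflection:
  fixes G :: "(real^'n) \<times> real \<Rightarrow> (real^'n) \<times> real"
  assumes s: "solution_on B \<mu> (half_cyl k 0 \<rho>) (flat_cyl k 0 \<rho>) G" and \<mu>: "\<mu> \<in> borel_measurable borel" "\<And>y. 1 \<le> \<mu> y \<and> \<mu> y \<le> c"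
    and \<rho>: "2 * (1 + 2 * \<Lambda>\<^sup>2) \<le> \<rho>"
  shows "solution_on B \<mu> (cyl 0 1) {} (odd_gradient G)"
proof -
  define m where "m = 1 + (1 + 2 * \<Lambda>\<^sup>2)\<^sup>2"
  have m: "m > 0" by (simp add: m_def add_pos_nonneg)
  have \<Lambda>2: "0 \<le> \<Lambda>\<^sup>2" by simp
  have \<rho>1: "1 + 2 * \<Lambda>\<^sup>2 \<le> \<rho>" and \<rho>2: "2 \<le> \<rho>" using \<rho> \<Lambda>2 unfolding distrib_left by linarith+
  note Gm = solution_onD(1)[OF s]
  note [measurable] = Gm reflect_measurable[OF \<Lambda> B] borel_half_cyl
  have up[measurable]: "{X::(real^'n) \<times> real. 0 < fst X $ k} \<in> sets borel" using open_upper[of k] by simp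
  have oddm: "odd_gradient W \<in> borel_measurable borel" if [measurable]: "W \<in> borel_measurable borel" for W
  proof -
    have "(\<lambda>X. if X \<in> {X. 0 < fst X $ k} then W X else - reflect_adjoint k B (W (reflect k B X))) \<in> borel_measurable borel"
      by measurable
    then show ?thesis by (simp add: odd_gradient_def[abs_def])
  qed
  show ?thesis
    unfolding solution_on_def
  proof (intro conjI allI impI)
    show "odd_gradient G \<in> borel_measurable borel" by (rule oddm[OF Gm])
    show "(\<integral>\<^sup>+X\<in>cyl 0 1. ennreal ((norm (odd_gradient G X))\<^sup>2) \<partial>lborel) < \<infinity>"
      using order_le_less_trans[OF odd_gradient_L2[OF Gm \<rho>1]] solution_onD(2)[OF s] by (simp add: ennreal_mult_less_top)
    fix e :: real assume "e > 0"
    then have "e / m > 0" using m by simp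
    from solution_onD(3)[OF s this] obtain f g where fg: "C1 f g" "\<forall>X\<in>flat_cyl k 0 \<rho>. f X = 0"
      "(\<integral>\<^sup>+X\<in>half_cyl k 0 \<rho>. ennreal ((norm (G X - g X))\<^sup>2) \<partial>lborel) < ennreal (e / m)" by blast
    have flat: "f Y = 0" if "Y \<in> cyl 0 2" "fst Y $ k = 0" for Y
    proof -
      have "Y \<in> flat_cyl k 0 \<rho>" using that \<rho>2 by (cases Y) (auto simp: flat_cyl_def flat_ball_def mem_cyl_0)
      then show ?thesis using fg(2) by blast
    qed
    obtain \<zeta> :: "(real^'n) \<times> real \<Rightarrow> real" and z K L where \<zeta>: "C1 \<zeta> z" "\<And>X. 0 \<le> \<zeta> X" "\<And>X. \<zeta> X \<le> 1"
      "\<And>X. X \<in> cyl 0 1 \<Longrightarrow> \<zeta> X = 1" "compact K" "K \<subseteq> cyl 0 2" "\<And>X. X \<notin> K \<Longrightarrow> \<zeta> X = 0"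
      "L > 0" "\<And>X. norm (z X) \<le> L"
      by (rule cutoff[of 1 2]) (simp, simp, (rule that; assumption))
    have z0: "z X = 0" if "X \<in> cyl 0 1" for X
      using C1_gradient_zero[OF C1_diff[OF \<zeta>(1) C1_const[of 1]] open_cyl that] \<zeta>(4) by simp
    let ?h = "\<lambda>X. \<zeta> X *\<^sub>R odd_gradient g X + odd_extension f X *\<^sub>R z X"
    have "(\<integral>\<^sup>+X\<in>cyl 0 1. ennreal ((norm (odd_gradient G X - ?h X))\<^sup>2) \<partial>lborel)
      = (\<integral>\<^sup>+X\<in>cyl 0 1. ennreal ((norm (odd_gradient (\<lambda>X. G X - g X) X))\<^sup>2) \<partial>lborel)"
    proof (rule nn_integral_cong)
      fix X
      have "odd_gradient G X - odd_gradient g X = odd_gradient (\<lambda>X. G X - g X) X"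
        by (simp add: odd_gradient_def linear_diff[OF linear_reflect_adjoint])
      then show "ennreal ((norm (odd_gradient G X - ?h X))\<^sup>2) * indicator (cyl 0 1) X = ennreal ((norm (odd_gradient (\<lambda>X. G X - g X) X))\<^sup>2) * indicator (cyl 0 1) X"
        using \<zeta>(4) z0 by (cases "X \<in> cyl 0 1") auto
    qed
    also have "\<dots> \<le> ennreal m * (\<integral>\<^sup>+X\<in>half_cyl k 0 \<rho>. ennreal ((norm (G X - g X))\<^sup>2) \<partial>lborel)"
      unfolding m_def by (rule odd_gradient_L2[OF _ \<rho>1]) (rule borel_measurable_diff[OF Gm C1_measurable(2)[OF fg(1)]])
    also have "\<dots> < ennreal m * ennreal (e / m)"
      using fg(3) m by (intro ennreal_mult_strict_left_mono) auto
    also have "\<dots> = ennreal e" using m \<open>e > 0\<close> by (simp add: ennreal_mult[symmetric])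
    finally have lt: "(\<integral>\<^sup>+X\<in>cyl 0 1. ennreal ((norm (odd_gradient G X - ?h X))\<^sup>2) \<partial>lborel) < ennreal e" .
    show "\<exists>f g. C1 f g \<and> (\<forall>X\<in>{}. f X = 0) \<and> (\<integral>\<^sup>+X\<in>cyl 0 1. ennreal ((norm (odd_gradient G X - g X))\<^sup>2) \<partial>lborel) < ennreal e"
    proof (intro exI[of _ "\<lambda>X. \<zeta> X * odd_extension f X"] exI[of _ ?h] conjI ballI)
      show "C1 (\<lambda>X. \<zeta> X * odd_extension f X) ?h" by (rule C1_odd_extension[OF fg(1) flat \<zeta>(1,5,6,7)])
    qed (use lt in simp_all)
  next
    fix \<phi> :: "(real^'n) \<times> real \<Rightarrow> real" and h K assume \<phi>: "C1 \<phi> h" "compact K" "K \<subseteq> cyl 0 1" "\<forall>X. X \<notin> K \<longrightarrow> \<phi> X = 0"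
    define E where "E = (half_cyl k 0 \<rho> :: ((real^'n) \<times> real) set)"
    have Em[measurable]: "E \<in> sets borel" unfolding E_def by (rule borel_half_cyl)
    have h0: "h X = 0" if "X \<notin> K" for X
      by (rule C1_gradient_zero_outside[OF \<phi>(1) compact_imp_closed[OF \<phi>(2)] _ that]) (use \<phi>(4) in auto)
    define hr where "hr X = reflect_adjoint k B (h (reflect k B X))" for X
    have hrC: "C1 (\<lambda>X. \<phi> (reflect k B X)) hr" unfolding hr_def by (rule C1_reflect[OF \<phi>(1)])
    define K2 where "K2 = K \<union> reflect k B ` K"
    have cr: "continuous_on UNIV (reflect k B)" by (rule linear_continuous_on[OF linear_conv_bounded_linear[THEN iffD1, OF linear_reflect]])
    have K2: "compact K2" unfolding K2_def using \<phi>(2) cr by (intro compact_Un compact_continuous_image) (auto intro: continuous_on_subset)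
    have K2sub: "K2 \<subseteq> cyl 0 \<rho>"
    proof -
      have "reflect k B X \<in> cyl 0 \<rho>" if "X \<in> cyl 0 1" for X
      proof -
        have X: "norm (fst X) < 1" "\<bar>snd X\<bar> < 1" using that by (auto simp: mem_cyl_0)
        have "norm (conormal_reflection k B (fst X)) \<le> (1 + 2 * \<Lambda>\<^sup>2) * norm (fst X)" by (rule norm_conormal_reflection[OF \<Lambda> B])
        also have "\<dots> < (1 + 2 * \<Lambda>\<^sup>2) * 1" using X by (intro mult_strict_left_mono) (auto simp: add_pos_nonneg)
        finally show ?thesis using X \<rho>1 \<rho>2 by (simp add: mem_cyl_0 reflect_def)
      qed
      moreover have "X \<in> cyl 0 \<rho>" if "X \<in> cyl 0 1" for X :: "(real^'n) \<times> real" using that \<rho>2 by (auto simp: mem_cyl_0)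
      ultimately show ?thesis using \<phi>(3) by (auto simp: K2_def)
    qed
    have out2: "reflect k B X \<notin> K" if "X \<notin> K2" for X
      using that reflect_involution[OF \<Lambda> B, of k X] unfolding K2_def by (metis UnI2 imageI)
    have \<psi>: "C1 (\<lambda>X. \<phi> X - \<phi> (reflect k B X)) (\<lambda>X. h X - hr X)" by (rule C1_diff[OF \<phi>(1) hrC])
    have zero: "(LINT X:half_cyl k 0 \<rho>|lborel. \<mu> (snd X) * (flux B (G X) \<bullet> (h X - hr X))) = 0"
    proof (rule weak_equation_flat_test[OF s \<mu> \<psi> K2 K2sub])
      show "\<phi> X - \<phi> (reflect k B X) = 0" if "X \<notin> K2" for X
        using \<phi>(4)[rule_format, OF out2[OF that]] \<phi>(4)[rule_format, of X] that by (simp add: K2_def)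
      show "\<phi> X - \<phi> (reflect k B X) = 0" if "fst X $ k = 0" for X
        using reflect_flat[OF \<Lambda> B that] by simp
    qed
    define V where "V X = indicator E X *\<^sub>R (\<mu> (snd X) *\<^sub>R flux B (G X))" for X
    have Vm[measurable]: "V \<in> borel_measurable borel"
      unfolding V_def using borel_measurable_scaleR[OF borel_measurable_indicator[OF Em] weighted_flux_measurable[OF \<mu>(1) Gm, of B]] by simp
    have bE: "bounded E" unfolding E_def using mem_half_cyl by (intro bounded_subset[OF bounded_cyl[of 0 \<rho>]]) auto
    have Vi: "integrable lborel V"
    proof (rule Bochner_Integration.integrable_bound[OF integrable_mult_right[OF solution_on_integrable[OF s[folded E_def] s[folded E_def] Em bE], of "c * \<Lambda>"]])
      show "V \<in> borel_measurable lborel" by simp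
      show "AE X in lborel. norm (V X) \<le> norm (c * \<Lambda> * (indicator E X * norm (G X)))"
      proof (rule AE_I2)
        fix X
        have "norm (flux B (G X)) \<le> \<Lambda> * norm (G X)" using B unfolding elliptic_sym_def by blast
        then have "\<mu> (snd X) * norm (flux B (G X)) \<le> c * (\<Lambda> * norm (G X))"
          using \<mu>(2)[of "snd X"] by (intro mult_mono) auto
        then have "norm (V X) \<le> c * \<Lambda> * (indicator E X * norm (G X))"
          using \<mu>(2)[of "snd X"] by (simp add: V_def indicator_def mult.assoc)
        then show "norm (V X) \<le> norm (c * \<Lambda> * (indicator E X * norm (G X)))"
          unfolding real_norm_def by (rule order_trans[OF _ abs_ge_self])
      qed
    qed
    have hr0: "hr X = 0" if "X \<notin> K2" for X
      using h0[OF out2[OF that]] by (simp add: hr_def linear_0[OF linear_reflect_adjoint])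
    obtain b1 where b1: "\<And>X. norm (h X) \<le> b1" using continuous_cpt_bounded[OF C1_continuous_gradient[OF \<phi>(1)] \<phi>(2) h0] by metis
    obtain b2 where b2: "\<And>X. norm (hr X) \<le> b2" using continuous_cpt_bounded[OF C1_continuous_gradient[OF hrC] K2 hr0] by metis
    have hm: "h \<in> borel_measurable lborel" "hr \<in> borel_measurable lborel" using C1_measurable(2)[OF \<phi>(1)] C1_measurable(2)[OF hrC] by auto
    define p1 p2 where "p1 X = V X \<bullet> h X" and "p2 X = V X \<bullet> hr X" for X
    have i1: "integrable lborel p1" and i2: "integrable lborel p2"
      unfolding p1_def p2_def by (rule integrable_inner_bounded[OF Vi hm(1) b1] integrable_inner_bounded[OF Vi hm(2) b2])+
    have p2m: "p2 \<in> borel_measurable borel" using borel_measurable_integrable[OF i2] by simp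
    have i2': "integrable lborel (\<lambda>X. p2 (reflect k B X))"
    proof -
      have "integrable (distr lborel borel (reflect k B)) p2" using i2 by (simp add: lborel_reflect[OF \<Lambda> B])
      then show ?thesis by (subst (asm) integrable_distr_eq) (auto simp: p2m reflect_measurable[OF \<Lambda> B])
    qed
    define q where "q X = indicator (cyl 0 1) X *\<^sub>R (\<mu> (snd X) * (flux B (odd_gradient G X) \<bullet> h X))" for X
    have "AE X in lborel. q X = p1 X - p2 (reflect k B X)"
      using AE_not_flat[of k]
    proof eventually_elim
      case (elim X)
      have sr: "snd (reflect k B X) = snd X" by (simp add: reflect_def)
      show ?case
      proof (cases "X \<in> cyl 0 1")
        case False
        then have "h X = 0" using h0 \<phi>(3) by blast
        moreover have "hr (reflect k B X) = 0"
          unfolding hr_def reflect_involution[OF \<Lambda> B] using calculation by (simp add: linear_0[OF linear_reflect_adjoint])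
        ultimately show ?thesis using False by (simp add: q_def p1_def p2_def)
      next
        case True
        show ?thesis
        proof (cases "0 < fst X $ k")
          case pos: True
          then have "X \<in> E" using True \<rho>2 by (auto simp: E_def mem_half_cyl mem_cyl_0)
          moreover have "reflect k B X \<notin> E"
            using pos conormal_reflection_component[OF \<Lambda> B, of k "fst X"] by (simp add: E_def mem_half_cyl reflect_def)
          ultimately show ?thesis using True pos by (simp add: q_def p1_def p2_def V_def odd_gradient_def)
        next
          case False
          then have neg: "fst X $ k < 0" using elim by simp
          have "reflect k B X \<in> E" unfolding E_def by (rule reflect_mem_half_cyl[OF True neg \<rho>1])
          moreover have "X \<notin> E" using False by (simp add: E_def mem_half_cyl)
          moreover have "flux B (odd_gradient G X) \<bullet> h X = - (flux B (G (reflect k B X)) \<bullet> reflect_adjoint k B (h X))"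
            using False by (simp add: odd_gradient_def linear_neg[OF linear_flux] flux_reflect_adjoint[OF \<Lambda> B] inner_commute[of "flux B _"] reflect_adjoint_inner inner_commute[of "reflect k B _"])
          ultimately show ?thesis using True
            by (simp add: q_def p1_def p2_def V_def sr hr_def reflect_involution[OF \<Lambda> B])
        qed
      qed
    qed
    moreover have "q \<in> borel_measurable lborel"
    proof -
      have "(\<lambda>X. indicator (cyl 0 1) X *\<^sub>R ((\<mu> (snd X) *\<^sub>R flux B (odd_gradient G X)) \<bullet> h X)) \<in> borel_measurable borel"
        using hm(1) by (intro borel_measurable_scaleR borel_measurable_indicator borel_measurable_inner weighted_flux_measurable[OF \<mu>(1) oddm[OF Gm]]) auto
      then show ?thesis by (simp add: q_def[abs_def])
    qed
    ultimately have "(LINT X|lborel. q X) = (LINT X|lborel. p1 X - p2 (reflect k B X))"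
      using i1 i2' by (intro integral_cong_AE) auto
    also have "\<dots> = (LINT X|lborel. p1 X) - (LINT X|lborel. p2 (reflect k B X))"
      by (rule Bochner_Integration.integral_diff[OF i1 i2'])
    also have "(LINT X|lborel. p2 (reflect k B X)) = (LINT X|lborel. p2 X)"
      by (rule lebesgue_integral_reflect[OF \<Lambda> B p2m])
    also have "(LINT X|lborel. p1 X) - (LINT X|lborel. p2 X) = (LINT X|lborel. p1 X - p2 X)"
      by (rule Bochner_Integration.integral_diff[OF i1 i2, symmetric])
    also have "\<dots> = 0"
      using zero by (simp add: p1_def p2_def V_def inner_diff_right set_lebesgue_integral_def E_def right_diff_distrib mult.assoc)
    finally show "(LINT X:cyl 0 1|lborel. \<mu> (snd X) * (flux B (odd_gradient G X) \<bullet> h X)) = 0"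
      by (simp add: q_def set_lebesgue_integral_def)
  qed
qed

end

section \<open>Covering a half cylinder\<close>

text \<open>
  In a second countable space every open cover has a countable subcover (Lindeloef).
\<close>

lemma AE_local:
  fixes S :: "'a::second_countable_topology set"
  assumes "\<And>X. X \<in> S \<Longrightarrow> \<exists>U. open U \<and> X \<in> U \<and> (AE Y in M. Y \<in> U \<longrightarrow> P Y)"
  shows "AE Y in M. Y \<in> S \<longrightarrow> P Y"
proof -
  define \<F> where "\<F> = {U. open U \<and> (AE Y in M. Y \<in> U \<longrightarrow> P Y)}"
  obtain \<F>' where \<F>': "\<F>' \<subseteq> \<F>" "countable \<F>'" "\<Union>\<F>' = \<Union>\<F>"
    using Lindelof[of \<F>] unfolding \<F>_def by auto
  have "AE Y in M. \<forall>U\<in>\<F>'. Y \<in> U \<longrightarrow> P Y"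
    using \<F>' unfolding \<F>_def by (subst AE_ball_countable) auto
  then show ?thesis
  proof eventually_elim
    case (elim Y)
    show ?case
    proof
      assume "Y \<in> S"
      from assms[OF this] have "Y \<in> \<Union>\<F>" unfolding \<F>_def by blast
      then show "P Y" using elim \<F>'(3) by blast
    qed
  qed
qed

lemma AE_affine:
  fixes c :: "'a::euclidean_space"
  assumes "{X. P X} \<in> sets borel" "d > 0" "AE Z in lborel. P (c + d *\<^sub>R Z)"
  shows "AE X in lborel. P X"
proof -
  have m: "(\<lambda>Z. c + d *\<^sub>R Z) \<in> borel_measurable lborel" by simp
  have "AE X in distr lborel borel (\<lambda>Z. c + d *\<^sub>R Z). P X"
    using AE_distr_iff[of "\<lambda>Z. c + d *\<^sub>R Z" lborel borel P] assms m by simp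
  then show ?thesis
    by (subst lborel_affine[of d c]) (use assms(2) in \<open>simp_all add: AE_density\<close>)
qed

lemma solution_on_cong:
  assumes s: "solution_on B \<mu> E F G" and "G' \<in> borel_measurable borel" and eq: "\<And>X. X \<in> E \<Longrightarrow> G' X = G X"
  shows "solution_on B \<mu> E F G'"
  unfolding solution_on_def
proof (intro conjI allI impI)
  have i: "(\<integral>\<^sup>+X\<in>E. ennreal ((norm (G' X - g X))\<^sup>2) \<partial>lborel) = (\<integral>\<^sup>+X\<in>E. ennreal ((norm (G X - g X))\<^sup>2) \<partial>lborel)" for g
    using eq by (intro nn_integral_cong) (simp add: indicator_def)
  show "(\<integral>\<^sup>+X\<in>E. ennreal ((norm (G' X))\<^sup>2) \<partial>lborel) < \<infinity>"
    using i[of "\<lambda>_. 0"] solution_onD(2)[OF s] by simp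
  show "\<exists>f g. C1 f g \<and> (\<forall>X\<in>F. f X = 0) \<and> (\<integral>\<^sup>+X\<in>E. ennreal ((norm (G' X - g X))\<^sup>2) \<partial>lborel) < ennreal e" if "e > 0" for e
    unfolding i by (rule solution_onD(3)[OF s that])
  fix \<phi> h K assume \<phi>: "C1 \<phi> h" "compact K" "K \<subseteq> E" "\<forall>X. X \<notin> K \<longrightarrow> \<phi> X = 0"
  have "(LINT X:E|lborel. \<mu> (snd X) * (flux B (G' X) \<bullet> h X)) = (LINT X:E|lborel. \<mu> (snd X) * (flux B (G X) \<bullet> h X))"
    unfolding set_lebesgue_integral_def using eq by (intro Bochner_Integration.integral_cong) (simp_all add: indicator_def)
  also have "\<dots> = 0" by (rule solution_onD(4)[OF s \<phi>(1-3)]) (use \<phi>(4) in blast)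
  finally show "(LINT X:E|lborel. \<mu> (snd X) * (flux B (G' X) \<bullet> h X)) = 0" .
qed (fact assms(2))

lemma unit_solution_truncated:
  fixes G :: "(real^'n::finite) \<times> real \<Rightarrow> (real^'n) \<times> real"
  assumes B: "elliptic_sym \<Lambda> B" and \<mu>: "\<mu> \<in> borel_measurable borel" "\<And>y. 1 \<le> \<mu> y \<and> \<mu> y \<le> c"
    and s: "solution_on B \<mu> (cyl 0 1) {} G"
  shows "unit_solution \<Lambda> c B \<mu> (\<lambda>X. indicator (cyl 0 1) X *\<^sub>R G X)"
proof -
  have "(\<lambda>X. indicator (cyl 0 1) X *\<^sub>R G X) \<in> borel_measurable borel"
    using solution_onD(1)[OF s] borel_cyl by measurable
  from solution_on_cong[OF s this] show ?thesis
    using B \<mu> unfolding unit_solution_def elliptic_sym_def by simp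
qed

lemma half_cyl_scale:
  assumes "d > 0"
  shows "X1 + d *\<^sub>R Z \<in> half_cyl k X1 (d * \<rho>) \<longleftrightarrow> Z \<in> half_cyl k 0 \<rho>"
    and "X1 + d *\<^sub>R Z \<in> flat_cyl k X1 (d * \<rho>) \<longleftrightarrow> Z \<in> flat_cyl k 0 \<rho>"
    and "X1 + d *\<^sub>R Z \<in> cyl X1 (d * \<rho>) \<longleftrightarrow> Z \<in> cyl 0 \<rho>"
proof -
  obtain x1 y1 x y where e: "X1 = (x1, y1)" "Z = (x, y)" by (cases X1, cases Z) auto
  have "- (d * \<rho>) < d * y \<longleftrightarrow> - \<rho> < y"
    using mult_less_cancel_left_pos[OF assms, of "- \<rho>" y] by simp
  then show "X1 + d *\<^sub>R Z \<in> half_cyl k X1 (d * \<rho>) \<longleftrightarrow> Z \<in> half_cyl k 0 \<rho>"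
    "X1 + d *\<^sub>R Z \<in> flat_cyl k X1 (d * \<rho>) \<longleftrightarrow> Z \<in> flat_cyl k 0 \<rho>"
    "X1 + d *\<^sub>R Z \<in> cyl X1 (d * \<rho>) \<longleftrightarrow> Z \<in> cyl 0 \<rho>"
    using assms by (auto simp: e half_cyl_def flat_cyl_def half_ball_def flat_ball_def cyl_def dist_norm zero_less_mult_iff)
qed

lemma gradient_measurable_set:
  fixes G :: "'a::euclidean_space \<Rightarrow> 'b::euclidean_space"
  assumes [measurable]: "G \<in> borel_measurable borel" "S \<in> sets borel"
  shows "{X. X \<in> S \<longrightarrow> norm (G X) \<le> Q} \<in> sets borel"
proof -
  have "{X \<in> space borel. X \<in> S \<longrightarrow> norm (G X) \<le> Q} \<in> sets borel" by measurable
  then show ?thesis by simp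
qed

text \<open>
  Points at distance less than \<open>d / 8\<close> from the flat boundary, \<open>d\<close>
  being proportional to \<open>(1 - \<theta>) R\<close>, are reached from their projection to
  the boundary by odd reflection; around the other points there is room for a full cylinder.
  Either way the solution is scaled to the unit cylinder.
\<close>

theorem half_cylinder_gradient_bound:
  fixes \<Lambda> c \<theta> :: real
  assumes \<Lambda>: "\<Lambda> > 0" and c: "1 \<le> c" and \<theta>: "0 < \<theta>" "\<theta> < 1"
  shows "\<exists>C>0. \<forall>k B \<mu> X0 R (G :: (real^'n::finite) \<times> real \<Rightarrow> _) M.
    elliptic_sym \<Lambda> B \<longrightarrow> \<mu> \<in> borel_measurable borel \<longrightarrow> (\<forall>y. 1 \<le> \<mu> y \<and> \<mu> y \<le> c) \<longrightarrow> 0 < R \<longrightarrow>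
    solution_on B \<mu> (half_cyl k X0 R) (flat_cyl k X0 R) G \<longrightarrow> 0 \<le> M \<longrightarrow>
    (\<integral>\<^sup>+X\<in>half_cyl k X0 R. ennreal ((norm (G X))\<^sup>2) \<partial>lborel) \<le> ennreal (M\<^sup>2) \<longrightarrow>
    (AE X in lborel. X \<in> half_cyl k X0 (\<theta> * R) \<longrightarrow> norm (G X) \<le> C * M / sqrt (R ^ DIM((real^'n) \<times> real)))"
proof -
  define N where "N = DIM((real^'n) \<times> real)"
  from unit_gradient_bound[OF \<Lambda> c, where 'n='n] obtain C0 where C0: "C0 > 0"
    and core: "\<And>B \<mu> (G :: (real^'n) \<times> real \<Rightarrow> _) M. unit_solution \<Lambda> c B \<mu> G \<Longrightarrow> 0 < M \<Longrightarrow>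
      (\<integral>\<^sup>+X\<in>cyl 0 1. ennreal ((norm (G X))\<^sup>2) \<partial>lborel) \<le> ennreal (M\<^sup>2) \<Longrightarrow>
      AE X in lborel. X \<in> cyl 0 (1/8) \<longrightarrow> norm (G X) \<le> C0 * M" by blast
  define \<rho> where "\<rho> = 2 * (1 + 2 * \<Lambda>\<^sup>2)"
  define m where "m = 1 + (1 + 2 * \<Lambda>\<^sup>2)\<^sup>2"
  have \<rho>: "\<rho> \<ge> 2" by (simp add: \<rho>_def)
  have m: "m \<ge> 1" by (simp add: m_def)
  define a where "a = (1 - \<theta>) / (8 * \<rho>)"
  have a: "a > 0" using \<theta> \<rho> by (simp add: a_def)
  define C where "C = C0 * sqrt m / sqrt (a ^ N)"
  have C: "C > 0" using C0 m a by (simp add: C_def)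
  have unit: "AE X in lborel. X \<in> cyl 0 (1/8) \<longrightarrow> norm (G X) \<le> C0 * M"
    if B: "elliptic_sym \<Lambda> B" and \<mu>: "\<mu> \<in> borel_measurable borel" "\<And>y. 1 \<le> \<mu> y \<and> \<mu> y \<le> c"
      and s: "solution_on B \<mu> (cyl 0 1) {} G" and M: "0 < M" "(\<integral>\<^sup>+X\<in>cyl 0 1. ennreal ((norm (G X))\<^sup>2) \<partial>lborel) \<le> ennreal (M\<^sup>2)"
    for B \<mu> and G :: "(real^'n) \<times> real \<Rightarrow> (real^'n) \<times> real" and M
  proof -
    have "(\<integral>\<^sup>+X\<in>cyl 0 1. ennreal ((norm (indicator (cyl 0 1) X *\<^sub>R G X))\<^sup>2) \<partial>lborel) = (\<integral>\<^sup>+X\<in>cyl 0 1. ennreal ((norm (G X))\<^sup>2) \<partial>lborel)"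
      by (intro nn_integral_cong) (simp add: indicator_def)
    then have "AE X in lborel. X \<in> cyl 0 (1/8) \<longrightarrow> norm (indicator (cyl 0 1) X *\<^sub>R G X) \<le> C0 * M"
      using core[OF unit_solution_truncated[OF B \<mu> s] M(1)] M(2) by simp
    then show ?thesis
    proof eventually_elim
      case (elim X)
      show ?case
      proof
        assume "X \<in> cyl 0 (1/8)"
        then show "norm (G X) \<le> C0 * M" using elim by (auto simp: mem_cyl_0 indicator_def split: if_splits)
      qed
    qed
  qed
  have scaled_mass: "ennreal (1 / d ^ N) * ennreal (M\<^sup>2) = ennreal ((M / sqrt (d ^ N))\<^sup>2)" if "d > 0" for d M
    using that by (simp add: ennreal_mult[symmetric] power_divide)
  have interior: "AE Y in lborel. Y \<in> cyl X (d / 8) \<longrightarrow> norm (G Y) \<le> C0 * (M / sqrt (d ^ N))"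
    if B: "elliptic_sym \<Lambda> B" and \<mu>: "\<mu> \<in> borel_measurable borel" "\<And>y. 1 \<le> \<mu> y \<and> \<mu> y \<le> c"
      and s: "solution_on B \<mu> E F G" "E \<in> sets borel" and d: "d > 0" "cyl X d \<subseteq> E"
      and M: "0 < M" "(\<integral>\<^sup>+X\<in>E. ennreal ((norm (G X))\<^sup>2) \<partial>lborel) \<le> ennreal (M\<^sup>2)"
    for B \<mu> E F X d and G :: "(real^'n) \<times> real \<Rightarrow> (real^'n) \<times> real" and M
  proof -
    note sc = solution_on_scale[OF s \<mu>(1) d(1), of X]
    have sub: "cyl 0 1 \<subseteq> {Z. X + d *\<^sub>R Z \<in> E}" using half_cyl_scale(3)[OF d(1), of X _ 1] d(2) by auto
    have "(\<integral>\<^sup>+Z\<in>cyl 0 1. ennreal ((norm (G (X + d *\<^sub>R Z)))\<^sup>2) \<partial>lborel) \<le> (\<integral>\<^sup>+Z\<in>{Z. X + d *\<^sub>R Z \<in> E}. ennreal ((norm (G (X + d *\<^sub>R Z)))\<^sup>2) \<partial>lborel)"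
      using sub by (intro nn_integral_mono) (auto simp: indicator_def)
    also have "\<dots> \<le> ennreal (1 / d ^ N) * ennreal (M\<^sup>2)"
      unfolding sc(2) N_def by (intro mult_left_mono M(2)) simp
    also have "\<dots> = ennreal ((M / sqrt (d ^ N))\<^sup>2)" by (rule scaled_mass[OF d(1)])
    finally have "AE Z in lborel. Z \<in> cyl 0 (1/8) \<longrightarrow> norm (G (X + d *\<^sub>R Z)) \<le> C0 * (M / sqrt (d ^ N))"
      using \<mu> d(1) M(1) by (intro unit[OF B _ _ solution_on_subset[OF sc(1) sub]]) (auto intro: measurable_compose[OF _ \<mu>(1)])
    then have "AE Z in lborel. X + d *\<^sub>R Z \<in> cyl X (d / 8) \<longrightarrow> norm (G (X + d *\<^sub>R Z)) \<le> C0 * (M / sqrt (d ^ N))"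
      using half_cyl_scale(3)[OF d(1), of X _ "1/8"] by simp
    then show ?thesis
      by (rule AE_affine[OF gradient_measurable_set[OF solution_onD(1)[OF s(1)] borel_cyl] d(1)])
  qed
  have boundary: "AE Y in lborel. Y \<in> half_cyl k X (d / 8) \<longrightarrow> norm (G Y) \<le> C0 * (sqrt m * M / sqrt (d ^ N))"
    if B: "elliptic_sym \<Lambda> B" and \<mu>: "\<mu> \<in> borel_measurable borel" "\<And>y. 1 \<le> \<mu> y \<and> \<mu> y \<le> c"
      and s: "solution_on B \<mu> (half_cyl k X (d * \<rho>)) (flat_cyl k X (d * \<rho>)) G" and d: "d > 0"
      and M: "0 < M" "(\<integral>\<^sup>+X\<in>half_cyl k X (d * \<rho>). ennreal ((norm (G X))\<^sup>2) \<partial>lborel) \<le> ennreal (M\<^sup>2)"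
    for B \<mu> k X d and G :: "(real^'n) \<times> real \<Rightarrow> (real^'n) \<times> real" and M
  proof -
    have hb: "half_cyl k X r \<in> sets borel" for r by (rule borel_open[OF open_half_cyl])
    note sc = solution_on_scale[OF s hb \<mu>(1) d, of X, unfolded half_cyl_scale[OF d] Collect_mem_eq]
    let ?W = "\<lambda>Z. G (X + d *\<^sub>R Z)"
    have \<mu>': "(\<lambda>y. \<mu> (snd X + d * y)) \<in> borel_measurable borel" by (rule measurable_compose[OF _ \<mu>(1)]) simp
    have so: "solution_on B (\<lambda>y. \<mu> (snd X + d * y)) (cyl 0 1) {} (odd_gradient k B ?W)"
      by (rule solution_on_odd_reflection[OF \<Lambda> B sc(1) \<mu>' \<mu>(2)]) (simp add: \<rho>_def)
    have \<rho>1: "1 + 2 * \<Lambda>\<^sup>2 \<le> \<rho>" unfolding \<rho>_def by simp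
    have "(\<integral>\<^sup>+Z\<in>cyl 0 1. ennreal ((norm (odd_gradient k B ?W Z))\<^sup>2) \<partial>lborel) \<le> ennreal m * (\<integral>\<^sup>+Z\<in>half_cyl k 0 \<rho>. ennreal ((norm (?W Z))\<^sup>2) \<partial>lborel)"
      unfolding m_def by (rule odd_gradient_L2[OF \<Lambda> B solution_onD(1)[OF sc(1)] \<rho>1])
    also have "\<dots> \<le> ennreal m * (ennreal (1 / d ^ N) * ennreal (M\<^sup>2))"
      unfolding sc(2) N_def by (intro mult_left_mono M(2)) simp_all
    also have "\<dots> = ennreal ((sqrt m * M / sqrt (d ^ N))\<^sup>2)"
      unfolding scaled_mass[OF d] using m d by (simp add: ennreal_mult[symmetric] power_divide power_mult_distrib)
    finally have "AE Z in lborel. Z \<in> cyl 0 (1/8) \<longrightarrow> norm (odd_gradient k B ?W Z) \<le> C0 * (sqrt m * M / sqrt (d ^ N))"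
      by (rule unit[OF B \<mu>' \<mu>(2) so, rotated]) (use m M(1) d in simp)
    then have "AE Z in lborel. X + d *\<^sub>R Z \<in> half_cyl k X (d / 8) \<longrightarrow> norm (?W Z) \<le> C0 * (sqrt m * M / sqrt (d ^ N))"
    proof eventually_elim
      case (elim Z)
      show ?case
      proof
        assume "X + d *\<^sub>R Z \<in> half_cyl k X (d / 8)"
        then have "Z \<in> half_cyl k 0 (1/8)" using half_cyl_scale(1)[OF d, of X Z k "1/8"] by simp
        then have "Z \<in> cyl 0 (1/8)" "0 < fst Z $ k" using mem_half_cyl[of Z k "1/8"] by blast+
        then show "norm (?W Z) \<le> C0 * (sqrt m * M / sqrt (d ^ N))"
          using elim by (simp add: odd_gradient_def[OF \<Lambda> B])
      qed
    qed
    then show ?thesis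
      by (rule AE_affine[OF gradient_measurable_set[OF solution_onD(1)[OF s] hb] d])
  qed
  have pos: "AE X in lborel. X \<in> half_cyl k X0 (\<theta> * R) \<longrightarrow> norm (G X) \<le> C * M / sqrt (R ^ N)"
    if B: "elliptic_sym \<Lambda> B" and \<mu>: "\<mu> \<in> borel_measurable borel" "\<And>y. 1 \<le> \<mu> y \<and> \<mu> y \<le> c"
      and R: "0 < R" and s: "solution_on B \<mu> (half_cyl k X0 R) (flat_cyl k X0 R) G"
      and M: "0 < M" "(\<integral>\<^sup>+X\<in>half_cyl k X0 R. ennreal ((norm (G X))\<^sup>2) \<partial>lborel) \<le> ennreal (M\<^sup>2)"
    for k B \<mu> X0 R and G :: "(real^'n) \<times> real \<Rightarrow> (real^'n) \<times> real" and M
  proof -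
    have "AE X in lborel. X \<in> half_cyl k X0 (\<theta> * R) \<longrightarrow> (X \<in> half_cyl k X0 (\<theta> * R) \<longrightarrow> norm (G X) \<le> C * M / sqrt (R ^ N))"
  proof (rule AE_local)
    define d where "d = (1 - \<theta>) * R / \<rho>"
    have d: "d > 0" "d * \<rho> = (1 - \<theta>) * R" using \<theta> R \<rho> by (auto simp: d_def)
    have da: "d / 8 = a * R" using \<rho> by (simp add: d_def a_def)
    have small: "d / 8 \<le> (1 - \<theta>) * R"
    proof -
      have "d * 1 \<le> d * \<rho>" using d(1) \<rho> by (intro mult_left_mono) auto
      then show ?thesis using d by linarith
    qed
    have Q: "C * M / sqrt (R ^ N) = C0 * (sqrt m * M / sqrt ((d / 8) ^ N))"
      unfolding da by (simp add: C_def power_mult_distrib real_sqrt_mult)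
    have m1: "1 \<le> sqrt m" using m by simp
    have Qint: "C0 * (M / sqrt ((d / 8) ^ N)) \<le> C * M / sqrt (R ^ N)"
      unfolding Q using C0 M(1) d(1) m1 by (intro mult_left_mono divide_right_mono) auto
    have Qbd: "C0 * (sqrt m * M / sqrt (d ^ N)) \<le> C * M / sqrt (R ^ N)"
      unfolding Q using C0 M(1) d(1) m
      by (intro mult_left_mono divide_left_mono real_sqrt_le_mono power_mono mult_pos_pos mult_nonneg_nonneg) auto
    have comp: "\<bar>z $ k\<bar> \<le> norm z" for z :: "real^'n" by (rule component_le_norm_cart)
    fix X assume X: "X \<in> half_cyl k X0 (\<theta> * R)"
    have X1: "norm (fst X - fst X0) < \<theta> * R" "\<bar>snd X - snd X0\<bar> < \<theta> * R" "fst X0 $ k < fst X $ k"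
      using X by (auto simp: half_cyl_def half_ball_def dist_norm norm_minus_commute)
    show "\<exists>U. open U \<and> X \<in> U \<and> (AE Y in lborel. Y \<in> U \<longrightarrow> (Y \<in> half_cyl k X0 (\<theta> * R) \<longrightarrow> norm (G Y) \<le> C * M / sqrt (R ^ N)))"
    proof (cases "fst X $ k - fst X0 $ k < d / 8")
      case True
      define X1 where "X1 = (fst X - (fst X $ k - fst X0 $ k) *\<^sub>R axis k 1, snd X)"
      have X1k: "fst X1 $ k = fst X0 $ k" by (simp add: X1_def)
      have "norm (fst X1 - fst X0) \<le> norm (fst X - fst X0)"
        by (rule norm_le_componentwise_cart) (simp add: X1_def axis_def)
      then have X1n: "norm (fst X1 - fst X0) < \<theta> * R" using X1 by simp
      have inR: "Y \<in> ball (fst X0) R" if "Y \<in> ball (fst X1) (d * \<rho>)" for Y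
      proof -
        have "dist (fst X0) Y \<le> norm (fst X1 - fst X0) + dist (fst X1) Y"
          using dist_triangle[of "fst X0" Y "fst X1"] by (simp add: dist_norm norm_minus_commute)
        also have "\<dots> < \<theta> * R + (1 - \<theta>) * R" using X1n that d(2) by simp
        finally show ?thesis by (simp add: algebra_simps)
      qed
      have inR': "t \<in> {snd X0 - R<..<snd X0 + R}" if "t \<in> {snd X1 - d * \<rho><..<snd X1 + d * \<rho>}" for t
      proof -
        have "\<bar>t - snd X\<bar> < (1 - \<theta>) * R" using that d(2) by (auto simp: X1_def)
        then have "\<bar>t - snd X0\<bar> < \<theta> * R + (1 - \<theta>) * R" using X1(2) by linarith
        then show ?thesis by (simp add: algebra_simps abs_less_iff)
      qed
      have sub: "half_cyl k X1 (d * \<rho>) \<subseteq> half_cyl k X0 R" "flat_cyl k X1 (d * \<rho>) \<subseteq> flat_cyl k X0 R"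
        using inR inR' unfolding half_cyl_def flat_cyl_def half_ball_def flat_ball_def X1k by auto
      have "(\<integral>\<^sup>+X\<in>half_cyl k X1 (d * \<rho>). ennreal ((norm (G X))\<^sup>2) \<partial>lborel) \<le> (\<integral>\<^sup>+X\<in>half_cyl k X0 R. ennreal ((norm (G X))\<^sup>2) \<partial>lborel)"
        using sub(1) by (intro nn_integral_mono) (auto simp: indicator_def)
      from boundary[OF B \<mu> solution_on_subset[OF s sub] d(1) M(1) order_trans[OF this M(2)]]
      have ae: "AE Y in lborel. Y \<in> half_cyl k X1 (d / 8) \<longrightarrow> norm (G Y) \<le> C0 * (sqrt m * M / sqrt (d ^ N))" .
      show ?thesis
      proof (intro exI[of _ "cyl X1 (d / 8)"] conjI)
        show "X \<in> cyl X1 (d / 8)" using True X1(3) d(1) by (simp add: mem_cyl X1_def)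
        show "AE Y in lborel. Y \<in> cyl X1 (d / 8) \<longrightarrow> (Y \<in> half_cyl k X0 (\<theta> * R) \<longrightarrow> norm (G Y) \<le> C * M / sqrt (R ^ N))"
          using ae
        proof eventually_elim
          case (elim Y)
          show ?case
          proof (intro impI)
            assume "Y \<in> cyl X1 (d / 8)" "Y \<in> half_cyl k X0 (\<theta> * R)"
            then have "Y \<in> half_cyl k X1 (d / 8)"
              unfolding half_cyl_def cyl_def half_ball_def X1k by auto
            then show "norm (G Y) \<le> C * M / sqrt (R ^ N)" using elim Qbd by linarith
          qed
        qed
      qed (rule open_cyl)
    next
      case False
      have sub: "cyl X (d / 8) \<subseteq> half_cyl k X0 R"
      proof
        fix Y assume "Y \<in> cyl X (d / 8)"
        then have Y: "norm (fst Y - fst X) < d / 8" "\<bar>snd Y - snd X\<bar> < d / 8" by (simp_all add: mem_cyl)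
        have "\<bar>fst Y $ k - fst X $ k\<bar> < d / 8" using comp[of "fst Y - fst X"] Y(1) by simp
        then have "fst X0 $ k < fst Y $ k" using False by linarith
        moreover have "norm (fst Y - fst X0) < \<theta> * R + (1 - \<theta>) * R"
          using norm_triangle_ineq[of "fst Y - fst X" "fst X - fst X0"] Y(1) X1(1) small by simp
        moreover have "\<bar>snd Y - snd X0\<bar> < \<theta> * R + (1 - \<theta>) * R" using X1(2) Y(2) small by linarith
        ultimately show "Y \<in> half_cyl k X0 R"
          by (cases Y) (simp add: half_cyl_def half_ball_def dist_norm norm_minus_commute algebra_simps abs_less_iff)
      qed
      have d8: "d / 8 > 0" using d(1) by simp
      show ?thesis
      proof (intro exI[of _ "cyl X (d / 8 / 8)"] conjI)
        show "X \<in> cyl X (d / 8 / 8)" using d(1) by (simp add: mem_cyl)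
        show "AE Y in lborel. Y \<in> cyl X (d / 8 / 8) \<longrightarrow> (Y \<in> half_cyl k X0 (\<theta> * R) \<longrightarrow> norm (G Y) \<le> C * M / sqrt (R ^ N))"
          using interior[OF B \<mu> s borel_open[OF open_half_cyl] d8 sub M]
        proof eventually_elim
          case (elim Y)
          then show ?case using Qint by linarith
        qed
      qed (rule open_cyl)
    qed
  qed
  then show ?thesis by simp
  qed
  have "AE X in lborel. X \<in> half_cyl k X0 (\<theta> * R) \<longrightarrow> norm (G X) \<le> C * M / sqrt (R ^ N)"
    if B: "elliptic_sym \<Lambda> B" and \<mu>: "\<mu> \<in> borel_measurable borel" "\<forall>y. 1 \<le> \<mu> y \<and> \<mu> y \<le> c"
      and R: "0 < R" and s: "solution_on B \<mu> (half_cyl k X0 R) (flat_cyl k X0 R) G"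
      and M: "0 \<le> M" "(\<integral>\<^sup>+X\<in>half_cyl k X0 R. ennreal ((norm (G X))\<^sup>2) \<partial>lborel) \<le> ennreal (M\<^sup>2)"
    for k B \<mu> X0 R and G :: "(real^'n) \<times> real \<Rightarrow> (real^'n) \<times> real" and M
  proof -
    \<comment> \<open>The bound for positive \<open>M\<close> extends to \<open>M = 0\<close> by
      approximation.\<close>
    have "AE X in lborel. X \<in> half_cyl k X0 (\<theta> * R) \<longrightarrow> norm (G X) \<le> C * (M + inverse (real (Suc j))) / sqrt (R ^ N)" for j
    proof (rule pos[OF B \<mu>(1) \<mu>(2)[rule_format] R s])
      show "0 < M + inverse (real (Suc j))" using M(1) by (simp add: add_nonneg_pos)
      have "ennreal (M\<^sup>2) \<le> ennreal ((M + inverse (real (Suc j)))\<^sup>2)"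
        using M(1) by (intro ennreal_leI power_mono) auto
      then show "(\<integral>\<^sup>+X\<in>half_cyl k X0 R. ennreal ((norm (G X))\<^sup>2) \<partial>lborel) \<le> ennreal ((M + inverse (real (Suc j)))\<^sup>2)"
        by (rule order_trans[OF M(2)])
    qed
    then have "AE X in lborel. \<forall>j. X \<in> half_cyl k X0 (\<theta> * R) \<longrightarrow> norm (G X) \<le> C * (M + inverse (real (Suc j))) / sqrt (R ^ N)"
      by (intro AE_all_countable[THEN iffD2] allI)
    then show ?thesis
    proof eventually_elim
      case (elim X)
      have "(\<lambda>j. C * (M + inverse (real (Suc j))) / sqrt (R ^ N)) \<longlonglongrightarrow> C * (M + 0) / sqrt (R ^ N)"
        using R by (intro tendsto_intros LIMSEQ_inverse_real_of_nat) simp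
      from LIMSEQ_le_const[OF this, of "norm (G X)"] show ?case using elim by auto
    qed
  qed
  then show ?thesis using C unfolding N_def by blast
qed

section \<open>Lebesgue measurable functions and null sets\<close>

lemma lebesgue_measurable_AE_cong:
  fixes f g :: "'a::euclidean_space \<Rightarrow> 'b::topological_space"
  assumes f: "f \<in> borel_measurable lebesgue" and ae: "AE X in lborel. f X = g X"
  shows "g \<in> borel_measurable lebesgue"
proof (rule measurableI)
  fix S :: "'b set" assume "S \<in> sets borel"
  then have s: "f -` S \<inter> space lebesgue \<in> sets lebesgue" by (rule measurable_sets[OF f])
  have e: "AE X in lebesgue. X \<in> f -` S \<inter> space lebesgue \<longleftrightarrow> X \<in> g -` S \<inter> space lebesgue"
    using AE_completion[OF ae] by eventually_elim simp
  show "g -` S \<inter> space lebesgue \<in> sets lebesgue"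
    by (rule completion.in_sets_AE[OF e s]) auto
qed simp

lemma lebesgue_measurable_imp_borel:
  fixes f :: "'a::euclidean_space \<Rightarrow> 'b::euclidean_space"
  assumes "f \<in> borel_measurable lebesgue"
  obtains g where "g \<in> borel_measurable borel" "AE X in lborel. f X = g X"
proof -
  have "\<forall>b\<in>Basis. \<exists>p\<in>borel_measurable lborel. AE X in lborel. f X \<bullet> b = p X"
    using assms by (intro ballI completion_ex_borel_measurable_real) simp
  then obtain p where p: "\<And>b. b \<in> Basis \<Longrightarrow> p b \<in> borel_measurable lborel" "\<And>b. b \<in> Basis \<Longrightarrow> AE X in lborel. f X \<bullet> b = p b X"
    by metis
  show ?thesis
  proof
    show "(\<lambda>X. \<Sum>b\<in>Basis. p b X *\<^sub>R b) \<in> borel_measurable borel" using p(1) by simp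
    have "AE X in lborel. \<forall>b\<in>Basis. f X \<bullet> b = p b X" using p(2) by (intro AE_finite_allI) auto
    then show "AE X in lborel. f X = (\<Sum>b\<in>Basis. p b X *\<^sub>R b)"
    proof eventually_elim
      case (elim X)
      have "f X = (\<Sum>b\<in>Basis. (f X \<bullet> b) *\<^sub>R b)" by (simp add: euclidean_representation)
      also have "\<dots> = (\<Sum>b\<in>Basis. p b X *\<^sub>R b)" using elim by (intro sum.cong) auto
      finally show ?case .
    qed
  qed
qed

text \<open>
  An open set is the increasing union of a sequence of compact sets.
\<close>

lemma locally_integrable_measurable:
  fixes f :: "'a::euclidean_space \<Rightarrow> 'b::{banach,second_countable_topology}"
  assumes E: "open E" and f: "\<And>K. compact K \<Longrightarrow> K \<subseteq> E \<Longrightarrow> set_integrable lebesgue K f"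
  shows "(\<lambda>X. indicator E X *\<^sub>R f X) \<in> borel_measurable lebesgue"
proof -
  obtain K where K: "\<And>n::nat. compact (K n)" "\<And>n. K n \<subseteq> E" "\<And>n. K n \<subseteq> interior (K (Suc n))" "\<Union>(range K) = E"
    by (rule open_Union_compact_subsets[OF E]) (rule that; assumption)
  have inc: "K n \<subseteq> K (Suc n)" for n using K(3)[of n] interior_subset[of "K (Suc n)"] by blast
  show ?thesis
  proof (rule borel_measurable_LIMSEQ_metric)
    show "(\<lambda>X. indicator (K n) X *\<^sub>R f X) \<in> borel_measurable lebesgue" for n
      using f[OF K(1,2)] unfolding set_integrable_def by (rule borel_measurable_integrable)
    fix X
    show "(\<lambda>n. indicator (K n) X *\<^sub>R f X) \<longlonglongrightarrow> indicator E X *\<^sub>R f X"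
    proof (cases "X \<in> E")
      case True
      then obtain n0 where n0: "X \<in> K n0" using K(4) by blast
      have "X \<in> K n" if "n0 \<le> n" for n using lift_Suc_mono_le[of K, OF inc that] n0 by blast
      then have "eventually (\<lambda>n. indicator (K n) X *\<^sub>R f X = indicator E X *\<^sub>R f X) sequentially"
        using True by (intro eventually_sequentiallyI[of n0]) simp
      then show ?thesis by (rule tendsto_eventually)
    next
      case False
      then have "X \<notin> K n" for n using K(2) by blast
      then show ?thesis using False by simp
    qed
  qed
qed

lemma AE_snd:
  assumes "AE y in lborel. P y"
  shows "AE X::'a::euclidean_space \<times> real in lborel. P (snd X)"
proof -
  obtain N where N: "{y. \<not> P y} \<subseteq> N" "N \<in> null_sets lborel" using assms unfolding eventually_ae_filter by auto
  have "emeasure (lborel \<Otimes>\<^sub>M lborel) ((UNIV :: 'a set) \<times> N) = emeasure lborel (UNIV :: 'a set) * emeasure lborel N"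
    using N(2) by (intro lborel.emeasure_pair_measure_Times) (auto simp: null_sets_def)
  then have "emeasure lborel ((UNIV :: 'a set) \<times> N) = 0" using N(2) by (simp add: lborel_prod null_sets_def)
  moreover have "(UNIV :: 'a set) \<times> N \<in> sets lborel"
    using pair_measureI[of UNIV "lborel :: 'a measure" N lborel] N(2) unfolding lborel_prod by (auto simp: null_sets_def)
  ultimately show ?thesis
    using N(1) by (intro AE_I'[of "UNIV \<times> N"]) (auto simp: null_sets_def)
qed

section \<open>The weight and the coefficient matrix\<close>

lemma AE_ex_interval:
  assumes "AE y in lebesgue. P y" "a < (b::real)"
  shows "\<exists>y\<in>{a<..<b}. P y"
proof (rule ccontr)
  assume "\<not> ?thesis"
  then have "{a<..<b} \<subseteq> {y\<in>space lebesgue. \<not> P y}" by auto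
  moreover have "{y\<in>space lebesgue. \<not> P y} \<in> null_sets lebesgue" using assms(1) by (simp add: completion.AE_iff_null_sets)
  ultimately have "{a<..<b} \<in> null_sets lebesgue" by (rule completion.complete2)
  then show False using assms(2) by (simp add: null_sets_def)
qed

text \<open>
  The hypothesis provides a positive infimum for almost every centre only. A good centre
  \<open>z\<close> slightly above \<open>y\<^sub>0\<close> is chosen, with the radius enlarged
  by \<open>z - y\<^sub>0\<close>, so that its interval contains the one about
  \<open>y\<^sub>0\<close>; the strict inequality \<open>y\<^sub>0 - 2 \<tau> > 0\<close> leaves
  room for it.
\<close>

lemma weight_comparable:
  assumes w: "weight_osc_bound \<mu> c" and y0: "y0 \<in> {0<..<1}" and \<tau>: "0 < \<tau>" "0 < y0 - 2 * \<tau>"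
  shows "\<exists>m>0. \<forall>y. \<bar>y - y0\<bar> < 3 * \<tau> / 2 \<longrightarrow> m \<le> \<mu> y \<and> \<mu> y \<le> c * m"
proof -
  have "AE y in lebesgue. y \<in> {0<..<1} \<longrightarrow> (\<forall>\<tau>. 0 < \<tau> \<and> \<tau> < y / 2 \<longrightarrow>
      bdd_below (\<mu> ` osc_interval y \<tau>) \<and> bdd_above (\<mu> ` osc_interval y \<tau>) \<and> Inf (\<mu> ` osc_interval y \<tau>) > 0)"
    using w unfolding weight_osc_bound_def by blast
  moreover have "y0 < min 1 (2 * y0 - 2 * \<tau>)" using y0 \<tau> by simp
  ultimately have "\<exists>y\<in>{y0<..<min 1 (2 * y0 - 2 * \<tau>)}. y \<in> {0<..<1} \<longrightarrow> (\<forall>\<tau>. 0 < \<tau> \<and> \<tau> < y / 2 \<longrightarrow>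
      bdd_below (\<mu> ` osc_interval y \<tau>) \<and> bdd_above (\<mu> ` osc_interval y \<tau>) \<and> Inf (\<mu> ` osc_interval y \<tau>) > 0)"
    by (rule AE_ex_interval)
  then obtain z where z: "y0 < z" "z < 1" "z < 2 * y0 - 2 * \<tau>"
    and b: "\<And>\<tau>. 0 < \<tau> \<Longrightarrow> \<tau> < z / 2 \<Longrightarrow>
      bdd_below (\<mu> ` osc_interval z \<tau>) \<and> bdd_above (\<mu> ` osc_interval z \<tau>) \<and> Inf (\<mu> ` osc_interval z \<tau>) > 0"
    using y0 by auto
  define t where "t = \<tau> + (z - y0)"
  have t: "0 < t" "t < z / 2" using z \<tau> by (auto simp: t_def)
  define m where "m = Inf (\<mu> ` osc_interval z t)"
  have "Sup (\<mu> ` osc_interval z t) / m \<le> c"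
    using w z y0 t unfolding weight_osc_bound_def m_def by auto
  then have sup: "Sup (\<mu> ` osc_interval z t) \<le> c * m" using b[OF t] by (simp add: m_def pos_divide_le_eq)
  show ?thesis
  proof (intro exI[of _ m] conjI allI impI)
    show "m > 0" using b[OF t] by (simp add: m_def)
    fix y assume "\<bar>y - y0\<bar> < 3 * \<tau> / 2"
    then have "y - y0 < 3 * \<tau> / 2" "y0 - y < 3 * \<tau> / 2" by linarith+
    then have "z - 3 * t / 2 < y" "y < z + 3 * t / 2" using z(1) by (simp_all add: t_def field_simps)
    then have "y \<in> osc_interval z t" by (simp add: osc_interval_def)
    then have y: "\<mu> y \<in> \<mu> ` osc_interval z t" by blast
    show "m \<le> \<mu> y" unfolding m_def using b[OF t] y by (intro cInf_lower) auto
    have "\<mu> y \<le> Sup (\<mu> ` osc_interval z t)" using b[OF t] y by (intro cSup_upper) auto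
    then show "\<mu> y \<le> c * m" using sup by linarith
  qed
qed

lemma block_matrix_join: "block_matrix B *v join X = join (flux B X)"
  by (auto simp: vec_eq_iff block_matrix_def join_def flux_def matrix_vector_mult_def UNIV_option_conv sum.reindex split: option.split)

lemma join_inner: "join X \<bullet> join Y = X \<bullet> Y"
  by (cases X; cases Y) (simp add: inner_vec_def join_def UNIV_option_conv sum.reindex)

lemma join_norm: "norm (join X) = norm X"
  by (simp add: norm_eq_sqrt_inner join_inner)

lemma block_matrix_transpose:
  assumes "transpose (block_matrix B) = block_matrix B"
  shows "transpose B = B"
proof -
  have "B $ j $ i = B $ i $ j" for i j
    using arg_cong[OF assms, of "\<lambda>M. M $ Some i $ Some j"] by (simp add: transpose_def block_matrix_def)
  then show ?thesis by (simp add: transpose_def vec_eq_iff)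
qed

text \<open>
  The matrix \<open>B\<close> is constant, so one point \<open>y\<close> at which the bounds
  hold and the weight is positive gives them for \<open>B\<close>.
\<close>

lemma admissible_imp_elliptic_sym:
  fixes A :: "real \<Rightarrow> real ^ 'n::finite option ^ 'n option"
  assumes \<Lambda>: "\<Lambda> > 0" and A: "admissible_matrix \<mu> \<Lambda> A"
    and ab: "a < b" "{a<..<b} \<subseteq> {0<..<2}" "\<And>y. y \<in> {a<..<b} \<Longrightarrow> \<mu> y > 0"
  obtains B where "elliptic_sym \<Lambda> B" "\<And>y. y \<in> {0<..<2} \<Longrightarrow> A y = \<mu> y *\<^sub>R block_matrix B"
proof -
  obtain B where B: "\<And>y. y \<in> {0<..<2} \<Longrightarrow> A y = \<mu> y *\<^sub>R block_matrix B"
    using A unfolding admissible_matrix_def by blast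
  have "AE y in lebesgue. y \<in> {0<..<2} \<longrightarrow> (\<forall>\<xi>. inverse \<Lambda> * \<mu> y * (norm \<xi>)\<^sup>2 \<le> (A y *v \<xi>) \<bullet> \<xi> \<and> (A y *v \<xi>) \<bullet> \<xi> \<le> \<Lambda> * \<mu> y * (norm \<xi>)\<^sup>2)"
    using A unfolding admissible_matrix_def by blast
  from AE_ex_interval[OF this ab(1)] obtain y where y: "y \<in> {a<..<b}" "y \<in> {0<..<2}"
    and e: "\<And>\<xi>. inverse \<Lambda> * \<mu> y * (norm \<xi>)\<^sup>2 \<le> (A y *v \<xi>) \<bullet> \<xi>" "\<And>\<xi>. (A y *v \<xi>) \<bullet> \<xi> \<le> \<Lambda> * \<mu> y * (norm \<xi>)\<^sup>2"
    using ab(2) by blast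
  have \<mu>: "\<mu> y > 0" by (rule ab(3)[OF y(1)])
  have q: "(A y *v join X) \<bullet> join X = \<mu> y * (flux B X \<bullet> X)" for X
    by (simp add: B[OF y(2)] scaleR_matrix_vector_assoc[symmetric] block_matrix_join join_inner)
  have lo: "(norm X)\<^sup>2 / \<Lambda> \<le> flux B X \<bullet> X" for X
  proof -
    have "\<mu> y * ((norm X)\<^sup>2 / \<Lambda>) \<le> \<mu> y * (flux B X \<bullet> X)"
      using e(1)[of "join X"] unfolding q join_norm by (simp add: divide_inverse ac_simps)
    then show ?thesis using \<mu> by (rule mult_left_le_imp_le)
  qed
  have up: "flux B X \<bullet> X \<le> \<Lambda> * (norm X)\<^sup>2" for X
  proof -
    have "\<mu> y * (flux B X \<bullet> X) \<le> \<mu> y * (\<Lambda> * (norm X)\<^sup>2)"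
      using e(2)[of "join X"] unfolding q join_norm by (simp add: ac_simps)
    then show ?thesis using \<mu> by (rule mult_left_le_imp_le)
  qed
  have "transpose (A y) = A y" using A y(2) unfolding admissible_matrix_def by blast
  then have "\<mu> y *\<^sub>R transpose (block_matrix B) = \<mu> y *\<^sub>R block_matrix B"
    unfolding B[OF y(2)] transpose_scalar .
  then have "transpose (block_matrix B) = block_matrix B"
    by (rule scaleR_left_imp_eq[rotated]) (use \<mu> in simp)
  then have BT: "transpose B = B" by (rule block_matrix_transpose)
  have sym: "(B *v v) \<bullet> w = v \<bullet> (B *v w)" for v w
    using dot_lmul_matrix[of v B w] unfolding transpose_matrix_vector[symmetric] BT .
  have sym': "flux B v \<bullet> w = v \<bullet> flux B w" for v w
    by (simp add: flux_def inner_prod_def sym)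
  have "norm (flux B X) \<le> \<Lambda> * norm X" for X
  proof -
    define u where "u = flux B X"
    \<comment> \<open>The operator bound follows from the bound on the quadratic form by its
      non-negativity at \<open>\<Lambda> X - B X\<close>.\<close>
    have "0 \<le> flux B (\<Lambda> *\<^sub>R X - u) \<bullet> (\<Lambda> *\<^sub>R X - u)"
      using lo[of "\<Lambda> *\<^sub>R X - u"] \<Lambda> by (meson order_trans divide_nonneg_pos zero_le_power2)
    also have "\<dots> = \<Lambda>\<^sup>2 * (u \<bullet> X) - 2 * \<Lambda> * (u \<bullet> u) + flux B u \<bullet> u"
    proof -
      have "flux B u \<bullet> X = u \<bullet> u" by (simp add: sym' u_def)
      then show ?thesis
        by (simp add: linear_diff[OF linear_flux] linear_scale[OF linear_flux] u_def[symmetric] inner_diff_left inner_diff_right power2_eq_square algebra_simps)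
    qed
    also have "\<dots> \<le> \<Lambda>\<^sup>2 * (\<Lambda> * (norm X)\<^sup>2) - 2 * \<Lambda> * (u \<bullet> u) + \<Lambda> * (norm u)\<^sup>2"
      using up[of X] up[of u] unfolding u_def[symmetric] by (intro add_mono diff_right_mono mult_left_mono) auto
    finally have "\<Lambda> * (norm u)\<^sup>2 \<le> \<Lambda> * (\<Lambda> * norm X)\<^sup>2"
      by (simp add: dot_square_norm power2_eq_square algebra_simps)
    then have "(norm u)\<^sup>2 \<le> (\<Lambda> * norm X)\<^sup>2" using \<Lambda> by (rule mult_left_le_imp_le)
    moreover have "0 \<le> \<Lambda> * norm X" using \<Lambda> by simp
    ultimately have "norm u \<le> \<Lambda> * norm X" by (rule power2_le_imp_le)
    then show ?thesis by (simp only: u_def)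
  qed
  then have "elliptic_sym \<Lambda> B" using lo sym unfolding elliptic_sym_def by blast
  then show ?thesis using that B by blast
qed

text \<open>
  The weight is measurable as an entry of the coefficient matrix. Truncation makes the bounds
  hold everywhere and not only on \<open>I\<close>.
\<close>

lemma normalized_weight:
  fixes A :: "real \<Rightarrow> real ^ 'n::finite option ^ 'n option"
  assumes A: "admissible_matrix \<mu> \<Lambda> A" and m: "m > 0" and c: "1 \<le> c"
    and I: "I \<subseteq> {0<..<2}" "\<And>y. y \<in> I \<Longrightarrow> m \<le> \<mu> y \<and> \<mu> y \<le> c * m"
  obtains \<nu> where "\<nu> \<in> borel_measurable borel" "\<And>y. 1 \<le> \<nu> y \<and> \<nu> y \<le> c"
    "AE y in lborel. y \<in> I \<longrightarrow> \<mu> y = m * \<nu> y"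
proof -
  obtain B :: "real ^ 'n ^ 'n" where B: "\<And>y. y \<in> {0<..<2} \<Longrightarrow> A y = \<mu> y *\<^sub>R block_matrix B"
    using A unfolding admissible_matrix_def by blast
  have "A \<in> borel_measurable (lebesgue_on {0<..<2})" using A unfolding admissible_matrix_def by blast
  moreover have "(\<lambda>M::real ^ 'n option ^ 'n option. M $ None $ None) \<in> borel_measurable borel"
    by (intro borel_measurable_continuous_onI continuous_intros)
  ultimately have "(\<lambda>y. A y $ None $ None) \<in> borel_measurable (lebesgue_on {0<..<2})"
    by (rule measurable_compose)
  then have "(\<lambda>y. indicator {0<..<2} y *\<^sub>R (A y $ None $ None)) \<in> borel_measurable lebesgue"
    by (subst (asm) borel_measurable_restrict_space_iff) auto
  then obtain p where p[measurable]: "p \<in> borel_measurable borel"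
    "AE y in lborel. indicator {0<..<2} y *\<^sub>R (A y $ None $ None) = p y"
    by (rule lebesgue_measurable_imp_borel)
  show ?thesis
  proof
    show "(\<lambda>y. max 1 (min c (p y / m))) \<in> borel_measurable borel" by measurable
    show "1 \<le> max 1 (min c (p y / m)) \<and> max 1 (min c (p y / m)) \<le> c" for y using c by auto
    show "AE y in lborel. y \<in> I \<longrightarrow> \<mu> y = m * max 1 (min c (p y / m))"
      using p(2)
    proof eventually_elim
      case (elim y)
      show ?case
      proof
        assume "y \<in> I"
        then have "p y = \<mu> y" "m \<le> \<mu> y" "\<mu> y \<le> c * m" using elim I B[of y] by (auto simp: block_matrix_def)
        then show "\<mu> y = m * max 1 (min c (p y / m))" using m c by (simp add: max_def min_def field_simps)
      qed
    qed
  qed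
qed

section \<open>Weak solutions in the weighted space\<close>

text \<open>
  The test function is mollified; its support grows by an arbitrarily small amount, and its
  gradient converges uniformly.
\<close>

lemma weak_equation_C1_test:
  fixes V :: "'a::euclidean_space \<Rightarrow> 'a"
  assumes V: "integrable lborel V" and E: "open E"
    and weak: "\<And>\<psi>. test_function E \<psi> \<Longrightarrow> (LINT X|lborel. V X \<bullet> grad \<psi> X) = 0"
    and \<phi>: "C1 \<phi> h" "compact K" "K \<subseteq> E" "\<And>X. X \<notin> K \<Longrightarrow> \<phi> X = 0"
  shows "(LINT X|lborel. V X \<bullet> h X) = 0"
proof -
  have h0: "h X = 0" if "X \<notin> K" for X
    by (rule C1_gradient_zero_outside[OF \<phi>(1) compact_imp_closed[OF \<phi>(2)] \<phi>(4) that])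
  define I where "I = (LINT X|lborel. norm (V X))"
  have I: "I \<ge> 0" by (simp add: I_def)
  have lin: "linear (\<lambda>w::'a. w)" by (simp add: linear_iff)
  obtain \<epsilon> where \<epsilon>: "\<epsilon> > 0" "(\<Union>x\<in>K. cball x \<epsilon>) \<subseteq> E"
    by (rule compact_subset_open_imp_cball_epsilon_subset[OF \<phi>(2) E \<phi>(3)])
  obtain r where r: "r > 0" "K \<subseteq> ball 0 r"
    using bounded_subset_ballD[OF compact_imp_bounded[OF \<phi>(2)], of 0] by blast
  have kernel\<phi>: "kernel r \<phi>"
    unfolding kernel_def
  proof (intro conjI allI impI)
    show "continuous_on UNIV \<phi>" by (rule C1_continuous[OF \<phi>(1)])
    fix w :: 'a assume "w \<notin> cball 0 r"
    then have "w \<notin> K" using r(2) ball_subset_cball by blast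
    then show "\<phi> w = 0" by (rule \<phi>(4))
  qed
  obtain b where b: "b > 0" "\<And>X. norm (h X) \<le> b"
    by (rule continuous_cpt_bounded[OF C1_continuous_gradient[OF \<phi>(1)] \<phi>(2) h0]) (assumption, (rule that; assumption))
  have small: "\<bar>LINT X|lborel. V X \<bullet> h X\<bar> \<le> I * e" if "e > 0" for e
  proof -
    obtain d where d: "d > 0" "\<And>\<kappa> X. kernel d \<kappa> \<Longrightarrow> (\<And>w. \<kappa> w \<ge> 0) \<Longrightarrow> (LINT w|lborel. \<kappa> w) = 1 \<Longrightarrow> norm (conv (\<lambda>w. w) h \<kappa> X - h X) \<le> e"
      by (rule conv_approximates[OF lin C1_continuous_gradient[OF \<phi>(1)] \<phi>(2) h0 \<open>e > 0\<close>]) (assumption, (erule that, blast))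
    have "min d \<epsilon> > 0" using d(1) \<epsilon>(1) by simp
    then obtain \<rho> :: "'a \<Rightarrow> real" where \<rho>: "smooth \<rho>" "\<And>x. 0 \<le> \<rho> x" "\<And>x. x \<notin> cball 0 (min d \<epsilon>) \<Longrightarrow> \<rho> x = 0" "(LINT x|lborel. \<rho> x) = 1"
      by (rule smooth_bump) (rule that; assumption)
    have c\<rho>: "continuous_on UNIV \<rho>" by (rule C1_continuous[OF smooth_C1[OF \<rho>(1)]])
    have k: "kernel d \<rho>" "kernel \<epsilon> \<rho>" using c\<rho> \<rho>(3) by (auto simp: kernel_def)
    define \<psi> where "\<psi> = conv (\<lambda>w. w) \<phi> \<rho>"
    have \<psi>C: "C1 \<psi> (conv (\<lambda>w. w) h \<rho>)" unfolding \<psi>_def by (rule C1_conv[OF \<phi>(1) lin k(1)])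
    have "\<psi> = conv (\<lambda>w. w) \<rho> \<phi>"
      unfolding \<psi>_def by (rule ext, rule conv_commute[OF C1_measurable(1)[OF \<phi>(1)] borel_measurable_continuous_onI[OF c\<rho>]])
    then have \<psi>s: "smooth \<psi>" using smooth_conv[OF \<rho>(1) kernel\<phi>] by simp
    have gr: "grad \<psi> X = conv (\<lambda>w. w) h \<rho> X" for X
      using C1_gradient_zero[OF C1_diff[OF smooth_C1[OF \<psi>s] \<psi>C] open_UNIV, of X] by simp
    define K' where "K' = (\<lambda>(Z, w). Z + w) ` (K \<times> cball 0 \<epsilon>)"
    have K': "compact K'" unfolding K'_def by (rule conv_support(1)[OF lin k(2) \<phi>(2,4)])
    have "K' \<subseteq> E"
    proof
      fix X assume "X \<in> K'"
      then obtain Z w where "X = Z + w" "Z \<in> K" "w \<in> cball 0 \<epsilon>" by (auto simp: K'_def)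
      then have "X \<in> cball Z \<epsilon>" "Z \<in> K" by (auto simp: dist_norm)
      then show "X \<in> E" using \<epsilon>(2) by blast
    qed
    moreover have "\<psi> X = 0" if "X \<notin> K'" for X
      unfolding \<psi>_def by (rule conv_support(2)[OF lin k(2) \<phi>(2,4) that[unfolded K'_def]])
    then have cl: "closure {X. \<psi> X \<noteq> 0} \<subseteq> K'" using compact_imp_closed[OF K'] by (intro closure_minimal) auto
    moreover have "compact (closure {X. \<psi> X \<noteq> 0})"
      using bounded_subset[OF compact_imp_bounded[OF K'] order_trans[OF closure_subset cl]] by simp
    ultimately have "test_function E \<psi>" unfolding test_function_def using \<psi>s by blast
    from weak[OF this] have z: "(LINT X|lborel. V X \<bullet> conv (\<lambda>w. w) h \<rho> X) = 0" by (simp add: gr)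
    have ae: "norm (conv (\<lambda>w. w) h \<rho> X - h X) \<le> e" for X by (rule d(2)[OF k(1) \<rho>(2,4)])
    have hm: "h \<in> borel_measurable lborel" "conv (\<lambda>w. w) h \<rho> \<in> borel_measurable lborel"
      using C1_measurable(2)[OF \<phi>(1)] C1_measurable(2)[OF \<psi>C] by auto
    have i1: "integrable lborel (\<lambda>X. V X \<bullet> h X)" by (rule integrable_inner_bounded[OF V hm(1) b(2)])
    have i3: "integrable lborel (\<lambda>X. V X \<bullet> (conv (\<lambda>w. w) h \<rho> X - h X))"
      by (rule integrable_inner_bounded[OF V borel_measurable_diff[OF hm(2,1)] ae])
    have i2: "integrable lborel (\<lambda>X. V X \<bullet> conv (\<lambda>w. w) h \<rho> X)"
      using Bochner_Integration.integrable_add[OF i1 i3] by (simp add: inner_diff_right)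
    have "(LINT X|lborel. V X \<bullet> (conv (\<lambda>w. w) h \<rho> X - h X)) = (LINT X|lborel. V X \<bullet> conv (\<lambda>w. w) h \<rho> X) - (LINT X|lborel. V X \<bullet> h X)"
      unfolding inner_diff_right by (rule Bochner_Integration.integral_diff[OF i2 i1])
    then have "\<bar>LINT X|lborel. V X \<bullet> h X\<bar> = norm (LINT X|lborel. V X \<bullet> (conv (\<lambda>w. w) h \<rho> X - h X))" using z by simp
    also have "\<dots> \<le> (LINT X|lborel. norm (V X) * e)"
    proof (rule Bochner_Integration.integral_norm_bound_integral[OF i3])
      show "integrable lborel (\<lambda>X. norm (V X) * e)" using V by simp
      show "norm (V X \<bullet> (conv (\<lambda>w. w) h \<rho> X - h X)) \<le> norm (V X) * e" for X
        unfolding real_norm_def by (rule order_trans[OF Cauchy_Schwarz_ineq2 mult_left_mono[OF ae norm_ge_zero]])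
    qed
    also have "\<dots> = I * e" by (simp add: I_def)
    finally show ?thesis .
  qed
  show ?thesis
  proof (rule ccontr)
    define L where "L = \<bar>LINT X|lborel. V X \<bullet> h X\<bar>"
    assume "\<not> ?thesis"
    then have L: "L > 0" by (simp add: L_def)
    have "L \<le> I * (L / (2 * (I + 1)))" unfolding L_def[symmetric] using small[of "L / (2 * (I + 1))"] L I by (simp add: L_def)
    also have "\<dots> < L" using L I by (simp add: field_simps add_nonneg_pos)
    finally show False by simp
  qed
qed

text \<open>
  On the half cylinder the weight lies between positive constants, so the weighted and the
  unweighted \<open>L\<^sup>2\<close> norms are equivalent and approximation in the weighted
  space is approximation in the unweighted one.
\<close>

lemma weak_solution_imp_solution_on:
  fixes v :: "(real^'n::finite) \<times> real \<Rightarrow> real" and G :: "(real^'n) \<times> real \<Rightarrow> (real^'n) \<times> real"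
  assumes ws: "weak_solution k \<mu> A X0 R v G" and m: "m > 0"
    and \<nu>: "\<nu> \<in> borel_measurable borel" "\<And>y. 1 \<le> \<nu> y \<and> \<nu> y \<le> c"
    and \<mu>: "\<And>y. \<bar>y - snd X0\<bar> < R \<Longrightarrow> m \<le> \<mu> y"
    and ae: "AE y in lborel. \<bar>y - snd X0\<bar> < R \<longrightarrow> \<mu> y = m * \<nu> y"
    and A: "\<And>y. \<bar>y - snd X0\<bar> < R \<Longrightarrow> A y = \<mu> y *\<^sub>R block_matrix B" and B: "elliptic_sym \<Lambda> B"
  obtains G' where "(\<lambda>X. indicator (half_cyl k X0 R) X *\<^sub>R G X) \<in> borel_measurable lebesgue"
    "AE X in lborel. X \<in> half_cyl k X0 R \<longrightarrow> G X = G' X"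
    "solution_on B \<nu> (half_cyl k X0 R) (flat_cyl k X0 R) G'"
    "(\<integral>\<^sup>+X\<in>half_cyl k X0 R. ennreal ((norm (G' X))\<^sup>2) \<partial>lborel)
      \<le> ennreal (1 / m * (LINT X:half_cyl k X0 R|lebesgue. (norm (G X))\<^sup>2 * \<mu> (snd X)))"
proof -
  define E where "E = half_cyl k X0 R"
  have Eo: "open E" unfolding E_def by (rule open_half_cyl)
  have Em[measurable]: "E \<in> sets borel" using Eo by simp
  have Ey: "\<bar>snd X - snd X0\<bar> < R" if "X \<in> E" for X
    using that unfolding E_def by (cases X) (auto simp: half_cyl_def)
  have Eb: "bounded E"
    by (rule bounded_subset[OF bounded_cyl[of X0 R]]) (auto simp: E_def half_cyl_def half_ball_def cyl_def)
  have z: "W12_zero_flat k \<mu> X0 R v G" using ws unfolding weak_solution_def by blast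
  then have w: "W12 \<mu> E v G" unfolding W12_zero_flat_def E_def by blast
  have wg: "weak_gradient E v G" and vi: "set_integrable lebesgue E (\<lambda>X. (v X)\<^sup>2 * \<mu> (snd X))"
    and Gi: "set_integrable lebesgue E (\<lambda>X. (norm (G X))\<^sup>2 * \<mu> (snd X))"
    using w unfolding W12_def by blast+
  have vm: "(\<lambda>X. indicator E X *\<^sub>R v X) \<in> borel_measurable lebesgue"
    and Gm: "(\<lambda>X. indicator E X *\<^sub>R G X) \<in> borel_measurable lebesgue"
    by (rule locally_integrable_measurable[OF Eo]; use wg in \<open>unfold weak_gradient_def, blast\<close>)+
  obtain G' where G': "G' \<in> borel_measurable borel" "AE X in lborel. indicator E X *\<^sub>R G X = G' X"
    by (rule lebesgue_measurable_imp_borel[OF Gm])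
  have GG': "AE X in lborel. X \<in> E \<longrightarrow> G X = G' X"
    using G'(2) by eventually_elim auto
  have sndm[measurable]: "snd \<in> borel_measurable (borel :: ((real^'n) \<times> real) measure)"
    by (intro borel_measurable_continuous_onI continuous_on_snd continuous_on_id)
  have ae\<mu>: "AE X in lborel. X \<in> E \<longrightarrow> \<mu> (snd X) = m * \<nu> (snd X)"
    using AE_snd[OF ae] by eventually_elim (use Ey in blast)
  have \<mu>m: "(\<lambda>X. indicator E X * \<mu> (snd X)) \<in> borel_measurable lebesgue"
  proof (rule lebesgue_measurable_AE_cong)
    have "(\<lambda>X. indicator E X * (m * \<nu> (snd X))) \<in> borel_measurable lborel" using \<nu>(1) by measurable
    then show "(\<lambda>X. indicator E X * (m * \<nu> (snd X))) \<in> borel_measurable lebesgue" by (rule measurable_completion)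
    show "AE X in lborel. indicator E X * (m * \<nu> (snd X)) = indicator E X * \<mu> (snd X)"
      using ae\<mu> by eventually_elim (auto simp: indicator_def)
  qed
  have \<mu>0: "0 \<le> \<mu> (snd X)" if "X \<in> E" for X using \<mu>[OF Ey[OF that]] m by linarith
  have mass: "(\<integral>\<^sup>+X\<in>E. ennreal (q X) \<partial>lebesgue) \<le> ennreal (1 / m * (LINT X:E|lebesgue. q X * \<mu> (snd X)))"
    if q: "\<And>X. 0 \<le> q X" and i: "set_integrable lebesgue E (\<lambda>X. q X * \<mu> (snd X))" for q
  proof -
    define p where "p X = indicator E X *\<^sub>R (q X * \<mu> (snd X))" for X
    have p: "integrable lebesgue p" using i unfolding set_integrable_def p_def .
    have p0: "0 \<le> p X" for X using q \<mu>0 by (simp add: p_def indicator_def)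
    have "(\<integral>\<^sup>+X\<in>E. ennreal (q X) \<partial>lebesgue) \<le> (\<integral>\<^sup>+X. ennreal (1 / m) * ennreal (p X) \<partial>lebesgue)"
    proof (rule nn_integral_mono)
      fix X
      show "ennreal (q X) * indicator E X \<le> ennreal (1 / m) * ennreal (p X)"
      proof (cases "X \<in> E")
        case True
        have "q X * m \<le> q X * \<mu> (snd X)" by (intro mult_left_mono \<mu>[OF Ey[OF True]] q)
        then have "q X \<le> 1 / m * p X" using True m by (simp add: p_def field_simps)
        then have "ennreal (q X) \<le> ennreal (1 / m * p X)" by (rule ennreal_leI)
        then show ?thesis using True m p0[of X] by (simp add: ennreal_mult[symmetric])
      qed simp
    qed
    also have "\<dots> = ennreal (1 / m) * (\<integral>\<^sup>+X. ennreal (p X) \<partial>lebesgue)"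
      using borel_measurable_integrable[OF p] by (intro nn_integral_cmult) simp
    also have "(\<integral>\<^sup>+X. ennreal (p X) \<partial>lebesgue) = ennreal (LINT X|lebesgue. p X)"
      by (rule nn_integral_eq_integral[OF p]) (simp add: p0)
    also have "ennreal (1 / m) * ennreal (LINT X|lebesgue. p X) = ennreal (1 / m * (LINT X|lebesgue. p X))"
      using m p0 by (intro ennreal_mult[symmetric] integral_nonneg_AE) auto
    finally show ?thesis by (simp add: p_def set_lebesgue_integral_def)
  qed
  have toleb: "(\<integral>\<^sup>+X\<in>E. ennreal ((norm (G' X - g X))\<^sup>2) \<partial>lborel) = (\<integral>\<^sup>+X\<in>E. ennreal ((norm (G X - g X))\<^sup>2) \<partial>lebesgue)" for g
    unfolding nn_integral_completion
    by (rule nn_integral_cong_AE) (use GG' in \<open>eventually_elim, auto simp: indicator_def\<close>)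
  have G'2: "(\<integral>\<^sup>+X\<in>E. ennreal ((norm (G' X))\<^sup>2) \<partial>lborel) \<le> ennreal (1 / m * (LINT X:E|lebesgue. (norm (G X))\<^sup>2 * \<mu> (snd X)))"
    using toleb[of "\<lambda>_. 0"] mass[OF _ Gi] by simp
  then have G'fin: "(\<integral>\<^sup>+X\<in>E. ennreal ((norm (G' X))\<^sup>2) \<partial>lborel) < \<infinity>"
    by (rule order_le_less_trans) simp
  have approx: "\<exists>f g. C1 f g \<and> (\<forall>X\<in>flat_cyl k X0 R. f X = 0) \<and> (\<integral>\<^sup>+X\<in>E. ennreal ((norm (G' X - g X))\<^sup>2) \<partial>lborel) < ennreal e"
    if e: "e > 0" for e
  proof -
    have "sqrt (m * e) > 0" using m e by simp
    then obtain f where f: "smooth f" "\<forall>X\<in>flat_cyl k X0 R. f X = 0" "W12 \<mu> E f (grad f)"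
      "sqrt (LINT X:E|lebesgue. ((v X - f X)\<^sup>2 + (norm (G X - grad f X))\<^sup>2) * \<mu> (snd X)) < sqrt (m * e)"
      using z unfolding W12_zero_flat_def E_def by blast
    define q where "q X = (v X - f X)\<^sup>2 + (norm (G X - grad f X))\<^sup>2" for X
    have q0: "0 \<le> q X" for X by (simp add: q_def)
    note fC = smooth_C1[OF f(1)]
    have fi: "set_integrable lebesgue E (\<lambda>X. (f X)\<^sup>2 * \<mu> (snd X))"
      and gi: "set_integrable lebesgue E (\<lambda>X. (norm (grad f X))\<^sup>2 * \<mu> (snd X))"
      using f(3) unfolding W12_def by blast+
    define H where "H X = (v X)\<^sup>2 * \<mu> (snd X) + (f X)\<^sup>2 * \<mu> (snd X) + ((norm (G X))\<^sup>2 * \<mu> (snd X) + (norm (grad f X))\<^sup>2 * \<mu> (snd X))" for X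
    have Hi: "set_integrable lebesgue E (\<lambda>X. 2 * H X)"
      unfolding H_def by (intro set_integrable_mult_right set_integral_add(1) vi fi Gi gi)
    have fm: "f \<in> borel_measurable lebesgue" "grad f \<in> borel_measurable lebesgue" "indicator E \<in> borel_measurable lebesgue"
      using C1_measurable[OF fC] by (auto intro!: measurable_completion)
    \<comment> \<open>Smallness of the integral in the definition of the closure is informative only
      because its integrand is integrable.\<close>
    have qi: "set_integrable lebesgue E (\<lambda>X. q X * \<mu> (snd X))"
      unfolding set_integrable_def
    proof (rule Bochner_Integration.integrable_bound[OF Hi[unfolded set_integrable_def]])
      define vE GE \<mu>E where "vE X = indicator E X *\<^sub>R v X" and "GE X = indicator E X *\<^sub>R G X"
        and "\<mu>E X = indicator E X * \<mu> (snd X)" for X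
      have [measurable]: "vE \<in> borel_measurable lebesgue" "GE \<in> borel_measurable lebesgue" "\<mu>E \<in> borel_measurable lebesgue"
        unfolding vE_def GE_def \<mu>E_def by (rule vm Gm \<mu>m)+
      note [measurable] = fm
      have "(\<lambda>X. ((vE X - indicator E X * f X)\<^sup>2 + (norm (GE X - indicator E X *\<^sub>R grad f X))\<^sup>2) * \<mu>E X) \<in> borel_measurable lebesgue"
        by measurable
      also have "(\<lambda>X. ((vE X - indicator E X * f X)\<^sup>2 + (norm (GE X - indicator E X *\<^sub>R grad f X))\<^sup>2) * \<mu>E X)
        = (\<lambda>X. indicator E X *\<^sub>R (q X * \<mu> (snd X)))"
        by (rule ext) (simp add: q_def indicator_def vE_def GE_def \<mu>E_def)
      finally show "(\<lambda>X. indicator E X *\<^sub>R (q X * \<mu> (snd X))) \<in> borel_measurable lebesgue" .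
      show "AE X in lebesgue. norm (indicator E X *\<^sub>R (q X * \<mu> (snd X))) \<le> norm (indicator E X *\<^sub>R (2 * H X))"
      proof (rule AE_I2)
        fix X
        show "norm (indicator E X *\<^sub>R (q X * \<mu> (snd X))) \<le> norm (indicator E X *\<^sub>R (2 * H X))"
        proof (cases "X \<in> E")
          case True
          have q1: "(v X - f X)\<^sup>2 \<le> 2 * ((v X)\<^sup>2 + (f X)\<^sup>2)"
            using sum_squares_bound[of "v X" "- f X"] by (simp add: power2_diff)
          have q2: "(norm (G X - grad f X))\<^sup>2 \<le> 2 * ((norm (G X))\<^sup>2 + (norm (grad f X))\<^sup>2)"
          proof -
            have "(norm (G X - grad f X))\<^sup>2 \<le> (norm (G X) + norm (grad f X))\<^sup>2"
              by (intro power_mono norm_triangle_ineq4) simp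
            then show ?thesis using sum_squares_bound[of "norm (G X)" "norm (grad f X)"] by (simp add: power2_sum)
          qed
          have "q X \<le> 2 * ((v X)\<^sup>2 + (f X)\<^sup>2 + ((norm (G X))\<^sup>2 + (norm (grad f X))\<^sup>2))"
            using add_mono[OF q1 q2] unfolding q_def by (simp only: distrib_left add.assoc)
          from mult_right_mono[OF this \<mu>0[OF True]] have "q X * \<mu> (snd X) \<le> 2 * H X" by (simp add: H_def algebra_simps)
          moreover have "0 \<le> q X * \<mu> (snd X)" using q0 \<mu>0[OF True] by simp
          ultimately show ?thesis using True by simp
        qed simp
      qed
    qed
    have "(\<integral>\<^sup>+X\<in>E. ennreal ((norm (G' X - grad f X))\<^sup>2) \<partial>lborel) = (\<integral>\<^sup>+X\<in>E. ennreal ((norm (G X - grad f X))\<^sup>2) \<partial>lebesgue)"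
      by (rule toleb)
    also have "\<dots> \<le> (\<integral>\<^sup>+X\<in>E. ennreal (q X) \<partial>lebesgue)"
      by (intro nn_integral_mono mult_right_mono ennreal_leI) (simp_all add: q_def)
    also have "\<dots> \<le> ennreal (1 / m * (LINT X:E|lebesgue. q X * \<mu> (snd X)))" by (rule mass[OF q0 qi])
    also have "\<dots> < ennreal e"
    proof (rule ennreal_lessI[OF e])
      have "(LINT X:E|lebesgue. q X * \<mu> (snd X)) < m * e"
        using f(4) unfolding q_def real_sqrt_less_iff .
      then show "1 / m * (LINT X:E|lebesgue. q X * \<mu> (snd X)) < e" using m by (simp add: field_simps)
    qed
    finally show ?thesis using fC f(2) by blast
  qed
  define V where "V X = indicator E X *\<^sub>R (\<nu> (snd X) *\<^sub>R flux B (G' X))" for X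
  have Vm: "V \<in> borel_measurable borel"
    unfolding V_def using weighted_flux_measurable[OF \<nu>(1) G'(1), of B] by measurable
  have Vi: "integrable lborel V"
  proof (rule Bochner_Integration.integrable_bound[OF integrable_mult_right[OF square_integrable_imp_integrable[OF G'(1) G'fin Em Eb], of "c * \<Lambda>"]])
    show "V \<in> borel_measurable lborel" using Vm by simp
    show "AE X in lborel. norm (V X) \<le> norm (c * \<Lambda> * (indicator E X * norm (G' X)))"
    proof (rule AE_I2)
      fix X
      have "norm (flux B (G' X)) \<le> \<Lambda> * norm (G' X)" using B unfolding elliptic_sym_def by blast
      then have "\<nu> (snd X) * norm (flux B (G' X)) \<le> c * (\<Lambda> * norm (G' X))"
        using \<nu>(2)[of "snd X"] by (intro mult_mono) auto
      then have "norm (V X) \<le> c * \<Lambda> * (indicator E X * norm (G' X))"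
        using \<nu>(2)[of "snd X"] by (simp add: V_def indicator_def mult.assoc)
      then show "norm (V X) \<le> norm (c * \<Lambda> * (indicator E X * norm (G' X)))"
        unfolding real_norm_def by (rule order_trans[OF _ abs_ge_self])
    qed
  qed
  have smooth_weak: "(LINT X|lborel. V X \<bullet> grad \<psi> X) = 0" if \<psi>: "test_function E \<psi>" for \<psi>
  proof -
    have gm: "grad \<psi> \<in> borel_measurable borel"
      using \<psi> C1_measurable(2)[OF smooth_C1] unfolding test_function_def by blast
    define p where "p X = indicator E X *\<^sub>R ((A (snd X) *v join (G X)) \<bullet> join (grad \<psi> X))" for X
    have "AE X in lborel. m * (V X \<bullet> grad \<psi> X) = p X"
      using GG' ae\<mu>
    proof eventually_elim
      case (elim X)
      show ?case
      proof (cases "X \<in> E")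
        case True
        have "(A (snd X) *v join (G X)) \<bullet> join (grad \<psi> X) = \<mu> (snd X) * (flux B (G X) \<bullet> grad \<psi> X)"
          unfolding A[OF Ey[OF True]] by (simp add: scaleR_matrix_vector_assoc[symmetric] block_matrix_join join_inner)
        then show ?thesis using elim True by (simp add: p_def V_def)
      qed (simp add: p_def V_def)
    qed
    moreover have bm: "(\<lambda>X. m * (V X \<bullet> grad \<psi> X)) \<in> borel_measurable lborel" using Vm gm by measurable
    ultimately have "p \<in> borel_measurable lebesgue" "AE X in lebesgue. m * (V X \<bullet> grad \<psi> X) = p X"
      using lebesgue_measurable_AE_cong[OF measurable_completion[OF bm]] AE_completion by blast+
    then have "(LINT X|lebesgue. m * (V X \<bullet> grad \<psi> X)) = (LINT X|lebesgue. p X)"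
      using measurable_completion[OF bm] by (intro integral_cong_AE)
    also have "\<dots> = 0"
      using ws \<psi> unfolding weak_solution_def p_def E_def set_lebesgue_integral_def by blast
    finally have "(LINT X|lborel. m * (V X \<bullet> grad \<psi> X)) = 0" unfolding integral_completion[OF bm] .
    then show ?thesis using m by simp
  qed
  have "solution_on B \<nu> E (flat_cyl k X0 R) G'"
    unfolding solution_on_def
  proof (intro conjI allI impI)
    fix \<phi> h K assume \<phi>: "C1 \<phi> h" "compact K" "K \<subseteq> E" "\<forall>X. X \<notin> K \<longrightarrow> \<phi> X = 0"
    have "(LINT X|lborel. V X \<bullet> h X) = 0"
      by (rule weak_equation_C1_test[OF Vi Eo smooth_weak \<phi>(1-3)]) (use \<phi>(4) in auto)
    then show "(LINT X:E|lborel. \<nu> (snd X) * (flux B (G' X) \<bullet> h X)) = 0"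
      by (simp add: V_def set_lebesgue_integral_def mult.assoc)
  qed (use G'(1) G'fin approx in blast)+
  then show ?thesis
    using that Gm GG' G'2 unfolding E_def by blast
qed

section \<open>The gradient estimate\<close>

lemma cyl_volume:
  fixes X0 :: "(real^'n::finite) \<times> real"
  assumes "R > 0"
  shows "measure lborel (cyl X0 R) = R ^ DIM((real^'n) \<times> real) * measure lborel (cyl (0 :: (real^'n) \<times> real) 1)"
proof -
  have "(\<integral>\<^sup>+X. indicator (cyl X0 R) X \<partial>lborel)
    = ennreal (R ^ DIM((real^'n) \<times> real)) * (\<integral>\<^sup>+Z. indicator (cyl X0 R) (X0 + R *\<^sub>R Z) \<partial>lborel)"
    using assms by (intro nn_integral_scale) auto
  also have "(\<lambda>Z. indicator (cyl X0 R) (X0 + R *\<^sub>R Z) :: ennreal) = indicator (cyl 0 1)"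
    using half_cyl_scale(3)[OF assms, of X0 _ 1] by (auto simp: indicator_def)
  finally have "emeasure lborel (cyl X0 R) = ennreal (R ^ DIM((real^'n) \<times> real)) * emeasure lborel (cyl (0 :: (real^'n) \<times> real) 1)"
    by simp
  then show ?thesis using assms by (simp add: measure_def enn2real_mult)
qed

lemma unit_cyl_volume_pos: "measure lborel (cyl (0 :: (real^'n::finite) \<times> real) 1) > 0"
proof (rule ccontr)
  let ?S = "cyl (0 :: (real^'n) \<times> real) 1"
  assume "\<not> ?thesis"
  then have "measure lborel ?S = 0" using measure_nonneg[of lborel ?S] by linarith
  then have "emeasure lborel ?S = 0"
    using emeasure_bounded_finite[OF bounded_cyl, of "0 :: (real^'n) \<times> real" 1] by (auto simp: measure_def enn2real_eq_0_iff)
  then have "?S \<in> null_sets lebesgue" by (simp add: null_sets_def)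
  then have "negligible ?S" by (simp add: negligible_iff_null_sets)
  moreover have "0 \<in> ?S" by (simp add: mem_cyl_0)
  ultimately show False using open_not_negligible[OF open_cyl[of 0 1]] by blast
qed

lemma weighted_measure_bounds:
  fixes X0 :: "(real^'n::finite) \<times> real"
  assumes m: "m > 0" and \<nu>: "\<nu> \<in> borel_measurable borel" "\<And>y. 1 \<le> \<nu> y \<and> \<nu> y \<le> c"
    and ae: "AE y in lborel. \<bar>y - snd X0\<bar> < R \<longrightarrow> \<mu> y = m * \<nu> y"
  shows "m * measure lborel (cyl X0 R) \<le> weighted_measure \<mu> (cyl X0 R)"
    and "weighted_measure \<mu> (cyl X0 R) \<le> c * m * measure lborel (cyl X0 R)"
proof -
  let ?S = "cyl X0 R"
  note [measurable] = \<nu>(1)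
  have [measurable]: "snd \<in> borel_measurable (borel :: ((real^'n) \<times> real) measure)"
    by (intro borel_measurable_continuous_onI continuous_on_snd continuous_on_id)
  define p where "p X = indicator ?S X * (m * \<nu> (snd X))" for X
  have pm: "p \<in> borel_measurable lborel" unfolding p_def by measurable
  have pp: "AE X in lborel. p X = indicator ?S X *\<^sub>R \<mu> (snd X)"
    using AE_snd[OF ae] by eventually_elim (auto simp: p_def indicator_def mem_cyl)
  have "(LINT X|lebesgue. p X) = (LINT X|lebesgue. indicator ?S X *\<^sub>R \<mu> (snd X))"
    by (rule integral_cong_AE[OF measurable_completion[OF pm] lebesgue_measurable_AE_cong[OF measurable_completion[OF pm] pp] AE_completion[OF pp]])
  then have wm: "weighted_measure \<mu> ?S = (LINT X|lborel. p X)"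
    unfolding integral_completion[OF pm] by (simp add: weighted_measure_def set_lebesgue_integral_def)
  have fin: "emeasure lborel ?S < \<infinity>" by (rule emeasure_bounded_finite[OF bounded_cyl])
  have ind: "integrable lborel (\<lambda>X. indicator ?S X * a)" for a :: real
    using fin by (intro integrable_mult_left integrable_real_indicator) auto
  have val: "(LINT X|lborel. indicator ?S X * a) = a * measure lborel ?S" for a by simp
  have lo: "indicator ?S X * m \<le> p X" and hi: "p X \<le> indicator ?S X * (c * m)" for X
    using \<nu>(2)[of "snd X"] m by (auto simp: p_def indicator_def mult.commute)
  have pi: "integrable lborel p"
  proof (rule Bochner_Integration.integrable_bound[OF ind[of "c * m"] pm])
    show "AE X in lborel. norm (p X) \<le> norm (indicator ?S X * (c * m))"
    proof (rule AE_I2)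
      fix X
      have "0 \<le> p X" using m \<nu>(2)[of "snd X"] by (simp add: p_def)
      then show "norm (p X) \<le> norm (indicator ?S X * (c * m))" using hi[of X] by simp
    qed
  qed
  have "(LINT X|lborel. indicator ?S X * m) \<le> (LINT X|lborel. p X)" by (rule Bochner_Integration.integral_mono[OF ind pi lo])
  then show "m * measure lborel ?S \<le> weighted_measure \<mu> ?S" unfolding wm val .
  have "(LINT X|lborel. p X) \<le> (LINT X|lborel. indicator ?S X * (c * m))" by (rule Bochner_Integration.integral_mono[OF pi ind hi])
  then show "weighted_measure \<mu> ?S \<le> c * m * measure lborel ?S" unfolding wm val .
qed

text \<open>
  The factor \<open>1 / R\<^sup>n\<^sup>+\<^sup>1\<close> from the estimate on half cylinders is
  absorbed by the weighted volume of the cylinder, which is comparable to \<open>m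
  R\<^sup>n\<^sup>+\<^sup>1\<close>, and the factor \<open>1 / m\<close> from the normalisation
  of the weight cancels against it.
\<close>

theorem lemma8p5:
  fixes \<Lambda> C1 \<theta> :: real
  assumes "0 < \<Lambda>" and "0 < C1" and "0 < \<theta>" and "\<theta> < 1"
  shows "\<exists>C>0.
    \<forall>(k :: 'n::finite) (\<mu> :: real \<Rightarrow> real) (A :: real \<Rightarrow> real ^ 'n option ^ 'n option).
      weight_function \<mu> \<longrightarrow> weight_osc_bound \<mu> C1 \<longrightarrow> admissible_matrix \<mu> \<Lambda> A \<longrightarrow>
      (\<forall>(x0 :: real ^ 'n) (y0 :: real) (\<tau> :: real)
         (v :: (real ^ 'n) \<times> real \<Rightarrow> real) (G :: (real ^ 'n) \<times> real \<Rightarrow> (real ^ 'n) \<times> real).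
        x0 \<in> closure (flat_ball k 0 1) \<longrightarrow> y0 \<in> {0<..<1} \<longrightarrow> \<tau> \<in> {0<..<1} \<longrightarrow>
        y0 - 2 * \<tau> > 0 \<longrightarrow>
        weak_solution k \<mu> A (x0, y0) (3 * \<tau> / 2) v G \<longrightarrow>
        Linfty_norm (half_cyl k (x0, y0) (3 * \<theta> * \<tau> / 2)) G \<le>
          ereal (C * sqrt
            (1 / weighted_measure \<mu> (cyl (x0, y0) (3 * \<tau> / 2)) *
             (LINT X:half_cyl k (x0, y0) (3 * \<tau> / 2)|lebesgue. (norm (G X))\<^sup>2 * \<mu> (snd X)))))"
proof -
  define c where "c = max 1 C1"
  have c: "1 \<le> c" "C1 \<le> c" by (auto simp: c_def)
  define N where "N = DIM((real^'n) \<times> real)"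
  define V where "V = measure lborel (cyl (0 :: (real^'n) \<times> real) 1)"
  have V: "V > 0" unfolding V_def by (rule unit_cyl_volume_pos)
  from half_cylinder_gradient_bound[OF assms(1) c(1) assms(3,4), where 'n='n] obtain C0 where C0: "C0 > 0"
    and bound: "\<And>k B \<nu> X0 R (G :: (real^'n) \<times> real \<Rightarrow> _) M.
      elliptic_sym \<Lambda> B \<Longrightarrow> \<nu> \<in> borel_measurable borel \<Longrightarrow> (\<forall>y. 1 \<le> \<nu> y \<and> \<nu> y \<le> c) \<Longrightarrow> 0 < R \<Longrightarrow>
      solution_on B \<nu> (half_cyl k X0 R) (flat_cyl k X0 R) G \<Longrightarrow> 0 \<le> M \<Longrightarrow>
      (\<integral>\<^sup>+X\<in>half_cyl k X0 R. ennreal ((norm (G X))\<^sup>2) \<partial>lborel) \<le> ennreal (M\<^sup>2) \<Longrightarrow>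
      AE X in lborel. X \<in> half_cyl k X0 (\<theta> * R) \<longrightarrow> norm (G X) \<le> C0 * M / sqrt (R ^ N)"
    unfolding N_def by blast
  define C where "C = C0 * sqrt (c * V)"
  have "C > 0" using C0 c V by (simp add: C_def)
  moreover have "Linfty_norm (half_cyl k (x0, y0) (3 * \<theta> * \<tau> / 2)) G \<le>
          ereal (C * sqrt
            (1 / weighted_measure \<mu> (cyl (x0, y0) (3 * \<tau> / 2)) *
             (LINT X:half_cyl k (x0, y0) (3 * \<tau> / 2)|lebesgue. (norm (G X))\<^sup>2 * \<mu> (snd X))))"
    if w: "weight_function \<mu>" "weight_osc_bound \<mu> C1" and A: "admissible_matrix \<mu> \<Lambda> A"
      and y0: "y0 \<in> {0<..<1}" and \<tau>: "\<tau> \<in> {0<..<1}" "y0 - 2 * \<tau> > 0"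
      and ws: "weak_solution k \<mu> A (x0, y0) (3 * \<tau> / 2) v G"
    for k :: 'n and \<mu> :: "real \<Rightarrow> real" and A :: "real \<Rightarrow> real ^ 'n option ^ 'n option"
      and x0 y0 \<tau> and v :: "(real ^ 'n) \<times> real \<Rightarrow> real" and G :: "(real ^ 'n) \<times> real \<Rightarrow> (real ^ 'n) \<times> real"
  proof -
    define R where "R = 3 * \<tau> / 2"
    define X0 where "X0 = (x0, y0)"
    have R: "R > 0" and \<tau>0: "0 < \<tau>" using \<tau> by (auto simp: R_def)
    obtain m where m: "m > 0" and \<mu>: "\<And>y. \<bar>y - y0\<bar> < R \<Longrightarrow> m \<le> \<mu> y \<and> \<mu> y \<le> C1 * m"
      using weight_comparable[OF w(2) y0 \<tau>0 \<tau>(2)] unfolding R_def by blast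
    have \<mu>c: "m \<le> \<mu> y \<and> \<mu> y \<le> c * m" if "\<bar>y - y0\<bar> < R" for y
      using \<mu>[OF that] mult_right_mono[OF c(2), of m] m by linarith
    define I where "I = {y0 - R<..<y0 + R}"
    have I: "y \<in> I \<longleftrightarrow> \<bar>y - y0\<bar> < R" for y by (auto simp: I_def)
    have I2: "I \<subseteq> {0<..<2}" using y0 \<tau> by (auto simp: I_def R_def)
    have \<mu>pos: "\<mu> y > 0" if "y \<in> {y0 - R<..<y0 + R}" for y
      using \<mu>c[of y] that m unfolding I_def[symmetric] I by linarith
    obtain B where B: "elliptic_sym \<Lambda> B" "\<And>y. y \<in> {0<..<2} \<Longrightarrow> A y = \<mu> y *\<^sub>R block_matrix B"
      by (rule admissible_imp_elliptic_sym[OF assms(1) A _ I2[unfolded I_def] \<mu>pos]) (use R in auto)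
    obtain \<nu> where \<nu>: "\<nu> \<in> borel_measurable borel" "\<And>y. 1 \<le> \<nu> y \<and> \<nu> y \<le> c"
      "AE y in lborel. y \<in> I \<longrightarrow> \<mu> y = m * \<nu> y"
      by (rule normalized_weight[OF A m c(1) I2]) (use \<mu>c I in auto)
    have ae: "AE y in lborel. \<bar>y - snd X0\<bar> < R \<longrightarrow> \<mu> y = m * \<nu> y" using \<nu>(3) unfolding I X0_def by simp
    have \<mu>m: "m \<le> \<mu> y" if "\<bar>y - snd X0\<bar> < R" for y using \<mu>c[of y] that by (simp add: X0_def)
    have AB: "A y = \<mu> y *\<^sub>R block_matrix B" if "\<bar>y - snd X0\<bar> < R" for y
      by (rule B(2)) (use I[of y] that I2 in \<open>auto simp: X0_def\<close>)
    define E where "E = half_cyl k X0 R"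
    define J where "J = (LINT X:E|lebesgue. (norm (G X))\<^sup>2 * \<mu> (snd X))"
    have J: "J \<ge> 0"
      unfolding J_def set_lebesgue_integral_def using w(1) by (intro integral_nonneg_AE) (auto simp: weight_function_def)
    obtain G' where G': "(\<lambda>X. indicator E X *\<^sub>R G X) \<in> borel_measurable lebesgue"
      "AE X in lborel. X \<in> E \<longrightarrow> G X = G' X" "solution_on B \<nu> E (flat_cyl k X0 R) G'"
      "(\<integral>\<^sup>+X\<in>E. ennreal ((norm (G' X))\<^sup>2) \<partial>lborel) \<le> ennreal (1 / m * J)"
      unfolding E_def J_def
      by (rule weak_solution_imp_solution_on[OF ws[folded R_def X0_def] m \<nu>(1,2) \<mu>m ae AB B(1)])
    define M where "M = sqrt (1 / m * J)"
    have M: "0 \<le> M" "M\<^sup>2 = 1 / m * J" using J m by (auto simp: M_def)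
    have ess: "AE X in lborel. X \<in> half_cyl k X0 (\<theta> * R) \<longrightarrow> norm (G' X) \<le> C0 * M / sqrt (R ^ N)"
      using G'(3,4) M \<nu>(2) by (intro bound[OF B(1) \<nu>(1) _ R]) (auto simp: E_def)
    have sub: "half_cyl k X0 (\<theta> * R) \<subseteq> E"
    proof -
      have "\<theta> * R \<le> R" using assms(4) R by simp
      then show ?thesis by (auto simp: E_def half_cyl_def half_ball_def)
    qed
    define W where "W = weighted_measure \<mu> (cyl X0 R)"
    have vol: "measure lborel (cyl X0 R) = R ^ N * V" unfolding N_def V_def by (rule cyl_volume[OF R])
    have "0 < m * (R ^ N * V)" using m R V by simp
    also have "\<dots> \<le> W" unfolding W_def vol[symmetric] by (rule weighted_measure_bounds(1)[OF m \<nu>(1,2) ae])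
    finally have W0: "W > 0" .
    have W1: "W \<le> c * m * (R ^ N * V)" unfolding W_def vol[symmetric] by (rule weighted_measure_bounds(2)[OF m \<nu>(1,2) ae])
    have "1 / (m * R ^ N) \<le> c * V / W" using W0 W1 m R by (simp add: field_simps)
    from mult_right_mono[OF this J] have "1 / m * J / R ^ N \<le> c * V * (1 / W * J)" by (simp add: field_simps)
    then have "sqrt (1 / m * J / R ^ N) \<le> sqrt (c * V * (1 / W * J))" by (rule real_sqrt_le_mono)
    then have "M / sqrt (R ^ N) \<le> sqrt (c * V) * sqrt (1 / W * J)"
      unfolding M_def real_sqrt_mult real_sqrt_divide .
    then have "C0 * (M / sqrt (R ^ N)) \<le> C0 * (sqrt (c * V) * sqrt (1 / W * J))" using C0 by (intro mult_left_mono) auto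
    then have final: "C0 * M / sqrt (R ^ N) \<le> C * sqrt (1 / W * J)" by (simp only: C_def mult.assoc times_divide_eq_right)
    have Hm: "half_cyl k X0 (\<theta> * R) \<in> sets lebesgue" using open_half_cyl[of k X0 "\<theta> * R"] by simp
    have "Linfty_norm (half_cyl k X0 (\<theta> * R)) G \<le> ereal (C * sqrt (1 / W * J))"
      unfolding Linfty_norm_def
    proof (rule esssup_I)
      have "(\<lambda>X. ereal (norm (indicator E X *\<^sub>R G X))) \<in> borel_measurable (lebesgue_on (half_cyl k X0 (\<theta> * R)))"
        using measurable_restrict_space1[OF G'(1)] by measurable
      moreover have "ereal (norm (indicator E X *\<^sub>R G X)) = ereal (norm (G X))"
        if "X \<in> space (lebesgue_on (half_cyl k X0 (\<theta> * R)))" for X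
        using that sub by (auto simp: space_restrict_space)
      ultimately show "(\<lambda>X. ereal (norm (G X))) \<in> borel_measurable (lebesgue_on (half_cyl k X0 (\<theta> * R)))"
        by (subst (asm) measurable_cong) auto
      have "AE X in lebesgue. X \<in> half_cyl k X0 (\<theta> * R) \<longrightarrow> ereal (norm (G X)) \<le> ereal (C * sqrt (1 / W * J))"
        using AE_completion[OF ess] AE_completion[OF G'(2)]
      proof eventually_elim
        case (elim X)
        show ?case
        proof
          assume X: "X \<in> half_cyl k X0 (\<theta> * R)"
          then have "norm (G X) \<le> C0 * M / sqrt (R ^ N)" using elim sub by auto
          then show "ereal (norm (G X)) \<le> ereal (C * sqrt (1 / W * J))" using final by simp
        qed
      qed
      then show "AE X in lebesgue_on (half_cyl k X0 (\<theta> * R)). ereal (norm (G X)) \<le> ereal (C * sqrt (1 / W * J))"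
        using Hm by (simp add: AE_restrict_space_iff)
    qed
    moreover have "3 * \<theta> * \<tau> / 2 = \<theta> * R" by (simp add: R_def)
    ultimately show ?thesis by (simp only: W_def J_def E_def X0_def R_def[symmetric])
  qed
  ultimately show ?thesis by blast
qed

end
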